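(* Let $d\ge2$ be an integer. With $\mathcal O_d^*\subset(0,d)$ and the functions $S_\infty^*(d,\cdot):\mathcal O_d^*\to\mathbb R$, $S_\infty^+(d,\cdot):(d,+\infty)\to\mathbb R$ defined in the context, the following hold. (1) For $d\ge4$ the function $\ell\mapsto S_\infty^*(d,\ell)$ extends holomorphically to a complex neighborhood of $\mathcal O_d^*$. (2) For $d\ge4$ the function $\ell\mapsto S_\infty^+(d,\ell)$ extends holomorphically to a complex neighborhood of $(d,+\infty)$. (3) For $d=2,3$ the function $\ell\mapsto S_\infty^*(d,\ell)$ extends holomorphically to a complex neighborhood of $(0,d)$. (4) For $d=2,3$ the function $\ell\mapsto S_\infty^+(d,\ell)$ extends holomorphically to an open set $\Omega_d^+$ of the complex plane with $(0,+\infty)\setminus\{d\}\subset\Omega_d^+$, and such that $(0,d)$ and $(d,+\infty)$ belong to the same connected component of $\Omega_d^+$.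
   Context: **Basic notation.** $d\ge2$ integer, $\ell>0$, $\ell\neq d$, $r>1$, $w_e=\ell(r-1)/d$ and $\Delta_1=w(w-1)(w-r)-d(w-w_e)\sigma^2$, $\Delta_2=\frac{\sigma}{\ell}\left[(\ell+d-1)w^2-(\ell+d+\ell r-r)w+\ell r-\ell\sigma^2\right]$. Critical speeds: $r^*(d,\ell)=\frac{d+\ell}{\ell+\sqrt d}$, $r_+(d,\ell)=1+\frac{d-1}{(1+\sqrt\ell)^2}$; $r_\circ=r^*$ if $0<\ell<d$, $r_\circ=r_+$ if $\ell>d$. For $1<r\le r_+$ let $w_-=\frac{1}{2(d-1)}\left(d-1+(\ell-1)(r-1)-\sqrt J\right)$ with $J=(1-\ell)^2(r-1)^2-2(d-1)(\ell+1)(r-1)+(d-1)^2\ge 0$, and $P_2=(\sigma_2,w_2)=(1-w_-,w_-)$ (points are written $(\sigma,w)$). **Linear data at $P_2$.** $c_1=\partial_w\Delta_1(P_2)$, $c_2=\partial_w\Delta_2(P_2)$, $c_3=\partial_\sigma\Delta_1(P_2)$, $c_4=\partial_\sigma\Delta_2(P_2)$, $c_\pm=\frac{c_4-c_1\pm\sqrt{(c_1-c_4)^2+4c_2c_3}}{2|c_2|}$, $\lambda_\pm=\frac{c_1+c_4\pm\sqrt{(c_1-c_4)^2+4c_2c_3}}{2}$. For $r<r_\circ$ put $b=r^*-r$ if $\ell<d$, $b=\sqrt{r_+-r}$ if $\ell>d$. **Limiting coefficients (all evaluated at $r=r_\circ$).** At $r=r_\circ$ one has $\lambda_+=0$, $\lambda_-<0$;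 let $\mu_+=\lim_{r\uparrow r_\circ}\lambda_+(r)/b<0$. Let $\tilde d_{ij}$ (resp. $\tilde e_{ij}$) be the coefficient of $\tilde W^i\tilde\Sigma^j$ in the polynomial $-\Delta_1+c_+\Delta_2$ (resp. $\Delta_1-c_-\Delta_2$) evaluated at $w=w_2+c_-\tilde W+c_+\tilde\Sigma$, $\sigma=\sigma_2+\tilde W+\tilde\Sigma$ (one has $\tilde d_{20}<0$, $\tilde e_{20}>0$). Put $$\hat w=\frac{(c_+-c_-)\mu_+}{\tilde d_{20}},\quad \hat\psi=-\frac{\tilde e_{20}\mu_+}{\tilde d_{20}\lambda_-},\quad a=\frac{|\lambda_-|}{|\mu_+|},$$ $$D_{ij}=\frac{\tilde d_{ij}\,\hat\psi^{\,j}\,\hat w^{\,i+j-1}}{|\mu_+|(c_+-c_-)},\qquad E_{ij}=\frac{\tilde e_{ij}\,\hat\psi^{\,j-1}\,\hat w^{\,i+j-1}}{|\lambda_-|(c_+-c_-)},\qquad \nu_\infty=a\,(E_{11}-D_{11}-D_{30}).$$ $\mathcal O_d^*=\{\ell\in(0,d):\nu_\infty(d,\ell)>0\}$ (for $d=2,3$ it equals $(0,d)$; for $\ell>d$ one always has $\nu_\infty>0$). **The functions $S^*_\infty,S^+_\infty$.** Define $H_1(x)=-(E_{11}+E_{30})+(E_{02}+E_{21})x-E_{12}x^2+E_{03}x^3$, $H_2(x)=(D_{11}+D_{30})x-(D_{02}+D_{21})x^2+D_{12}x^3-D_{03}x^4$, $G_1(x)=E_{11}x-(2E_{02}+E_{21})x^2+2E_{12}x^3-3E_{03}x^4$,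 $G_2(x)=-D_{11}x+(2D_{02}+D_{21})x^2-2D_{12}x^3+3D_{03}x^4$, $N_1(x,\Psi)=-xM_{11}\Psi^2+x^2M_{12}\Psi^3$ with $M_{11}=-E_{02}x+E_{12}x^2-3E_{03}x^3$, $M_{12}=-E_{03}x^2$, $N_2(x,\Psi)=-xM_{21}\Psi^2+x^2M_{22}\Psi^3$ with $M_{21}=D_{02}x-D_{12}x^2+3D_{03}x^3$, $M_{22}=D_{03}x^2$. Let $\tilde\Psi$ be the unique local $\mathcal C^\infty$ solution on some $[0,x_0]$ (its Taylor coefficients at $0$ are determined recursively, and $\tilde\Psi(0)=0$) of $$[1+H_2+G_2\tilde\Psi+N_2](-x^2)\tilde\Psi'+\left[-2x(1+H_2+G_2\tilde\Psi+N_2)-a(1+G_1)+2xG_2\right]\tilde\Psi=x\left[aH_1-2(1+H_2)+\frac{aN_1}{x}-2N_2\right].$$ Let $\xi(x)=\frac{a(1+G_1)-2xG_2}{x^2(1+H_2)}-\frac a{x^2}-\frac{\nu_\infty}{x}$ (holomorphic near $0$), $M(x)=e^{-\int_0^x\xi}$, $\Theta(x)=\frac{\tilde\Psi(x)}{xM(x)}$, and let $(g_j^\infty)_{j\ge0}$ be the Taylor coefficients at $x=0$ of $x^2\Theta'+[a+(\nu_\infty+3)x]\Theta$. Then $$S_\infty(d,\ell)=\frac1a\sum_{j=0}^{+\infty}\frac{(-1)^ja^jg_j^\infty}{\Gamma(\nu_\infty+j+3)}$$ (an absolutely convergent series for $\ell\in\mathcal O_d^*\cup(d,+\infty)$). $S^*_\infty(d,\cdot)$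 denotes $S_\infty(d,\cdot)$ restricted to $\mathcal O_d^*$ (where $r_\circ=r^*$) and $S^+_\infty(d,\cdot)$ denotes $S_\infty(d,\cdot)$ restricted to $(d,+\infty)$ (where $r_\circ=r_+$). *)

theory Defs
  imports "HOL-Analysis.Analysis" "HOL-Computational_Algebra.Polynomial"
begin

text \<open>The coefficient of \<open>X^i Y^j\<close> in the polynomial function \<open>F X Y\<close>. A polynomial in two
  variables is a polynomial in \<open>X\<close> whose coefficients are polynomials in \<open>Y\<close>.\<close>

definition coeff2 :: "(real \<Rightarrow> real \<Rightarrow> real) \<Rightarrow> nat \<Rightarrow> nat \<Rightarrow> real" where
  "coeff2 F i j =
     coeff (coeff (THE p :: real poly poly. \<forall>X Y. poly (poly p [:X:]) Y = F X Y) i) j"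

text \<open>Derivatives relative to an interval (one-sided at an end point of the interval).\<close>

definition deriv_within :: "real set \<Rightarrow> (real \<Rightarrow> real) \<Rightarrow> real \<Rightarrow> real" where
  "deriv_within I f x = vector_derivative f (at x within I)"

definition smooth_within :: "real set \<Rightarrow> (real \<Rightarrow> real) \<Rightarrow> bool" where
  "smooth_within I f \<longleftrightarrow>
     (\<forall>n. \<forall>x\<in>I. (deriv_within I ^^ n) f differentiable (at x within I))"

text \<open>The Taylor coefficients at \<open>0\<close> of a function that is smooth on some \<open>[0, x\<^sub>0]\<close>. They depend
  only on the values near \<open>0\<close>, so the same definition serves for every \<open>x\<^sub>0\<close>.\<close>

definition taylor_coeff :: "(real \<Rightarrow> real) \<Rightarrow> nat \<Rightarrow> real" where
  "taylor_coeff f j = (deriv_within {0..} ^^ j) f 0 / fact j"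

definition extends_holomorphically ::
    "(real \<Rightarrow> real) \<Rightarrow> real set \<Rightarrow> complex set \<Rightarrow> bool" where
  "extends_holomorphically f A \<Omega> \<longleftrightarrow>
     open \<Omega> \<and> of_real ` A \<subseteq> \<Omega> \<and>
     (\<exists>F. F holomorphic_on \<Omega> \<and> (\<forall>x\<in>A. F (of_real x) = of_real (f x)))"

context
  fixes d :: nat and l :: real
begin

definition w_e :: "real \<Rightarrow> real" where
  "w_e r = l * (r - 1) / real d"

definition Delta1 :: "real \<Rightarrow> real \<Rightarrow> real \<Rightarrow> real" where
  "Delta1 r \<sigma> w = w * (w - 1) * (w - r) - real d * (w - w_e r) * \<sigma>\<^sup>2"

definition Delta2 :: "real \<Rightarrow> real \<Rightarrow> real \<Rightarrow> real" where
  "Delta2 r \<sigma> w =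
     \<sigma> / l * ((l + real d - 1) * w\<^sup>2 - (l + real d + l * r - r) * w + l * r - l * \<sigma>\<^sup>2)"

definition r_star :: real where
  "r_star = (real d + l) / (l + sqrt (real d))"

definition r_plus :: real where
  "r_plus = 1 + (real d - 1) / (1 + sqrt l)\<^sup>2"

definition r_circ :: real where
  "r_circ = (if l < real d then r_star else r_plus)"

definition J_disc :: "real \<Rightarrow> real" where
  "J_disc r = (1 - l)\<^sup>2 * (r - 1)\<^sup>2 - 2 * (real d - 1) * (l + 1) * (r - 1) + (real d - 1)\<^sup>2"

definition w_minus :: "real \<Rightarrow> real" where
  "w_minus r = 1 / (2 * (real d - 1)) * (real d - 1 + (l - 1) * (r - 1) - sqrt (J_disc r))"

definition w2 :: "real \<Rightarrow> real" where
  "w2 r = w_minus r"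

definition sigma2 :: "real \<Rightarrow> real" where
  "sigma2 r = 1 - w_minus r"

definition c1 :: "real \<Rightarrow> real" where
  "c1 r = deriv (\<lambda>w. Delta1 r (sigma2 r) w) (w2 r)"

definition c2 :: "real \<Rightarrow> real" where
  "c2 r = deriv (\<lambda>w. Delta2 r (sigma2 r) w) (w2 r)"

definition c3 :: "real \<Rightarrow> real" where
  "c3 r = deriv (\<lambda>\<sigma>. Delta1 r \<sigma> (w2 r)) (sigma2 r)"

definition c4 :: "real \<Rightarrow> real" where
  "c4 r = deriv (\<lambda>\<sigma>. Delta2 r \<sigma> (w2 r)) (sigma2 r)"

definition c_plus :: "real \<Rightarrow> real" where
  "c_plus r = (c4 r - c1 r + sqrt ((c1 r - c4 r)\<^sup>2 + 4 * c2 r * c3 r)) / (2 * \<bar>c2 r\<bar>)"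

definition c_minus :: "real \<Rightarrow> real" where
  "c_minus r = (c4 r - c1 r - sqrt ((c1 r - c4 r)\<^sup>2 + 4 * c2 r * c3 r)) / (2 * \<bar>c2 r\<bar>)"

definition lambda_plus :: "real \<Rightarrow> real" where
  "lambda_plus r = (c1 r + c4 r + sqrt ((c1 r - c4 r)\<^sup>2 + 4 * c2 r * c3 r)) / 2"

definition lambda_minus :: "real \<Rightarrow> real" where
  "lambda_minus r = (c1 r + c4 r - sqrt ((c1 r - c4 r)\<^sup>2 + 4 * c2 r * c3 r)) / 2"

definition b_small :: "real \<Rightarrow> real" where
  "b_small r = (if l < real d then r_star - r else sqrt (r_plus - r))"

text \<open>From here on, every quantity is taken at \<open>r = r_circ\<close>.\<close>

definition cp :: real where "cp = c_plus r_circ"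
definition cm :: real where "cm = c_minus r_circ"
definition lam_minus :: real where "lam_minus = lambda_minus r_circ"

definition mu_plus :: real where
  "mu_plus = Lim (at_left r_circ) (\<lambda>r. lambda_plus r / b_small r)"

definition d_tilde :: "nat \<Rightarrow> nat \<Rightarrow> real" where
  "d_tilde = coeff2 (\<lambda>W \<Sigma>.
     let w = w2 r_circ + cm * W + cp * \<Sigma>; \<sigma> = sigma2 r_circ + W + \<Sigma>
     in - Delta1 r_circ \<sigma> w + cp * Delta2 r_circ \<sigma> w)"

definition e_tilde :: "nat \<Rightarrow> nat \<Rightarrow> real" where
  "e_tilde = coeff2 (\<lambda>W \<Sigma>.
     let w = w2 r_circ + cm * W + cp * \<Sigma>; \<sigma> = sigma2 r_circ + W + \<Sigma>
     in Delta1 r_circ \<sigma> w - cm * Delta2 r_circ \<sigma> w)"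

definition w_hat :: real where
  "w_hat = (cp - cm) * mu_plus / d_tilde 2 0"

definition psi_hat :: real where
  "psi_hat = - (e_tilde 2 0 * mu_plus / (d_tilde 2 0 * lam_minus))"

definition a_inf :: real where
  "a_inf = \<bar>lam_minus\<bar> / \<bar>mu_plus\<bar>"

text \<open>The exponents are integers: \<open>e_coef 3 0\<close> contains the factor \<open>psi_hat\<close> to the power \<open>-1\<close>.\<close>

definition d_coef :: "nat \<Rightarrow> nat \<Rightarrow> real" where
  "d_coef i j = d_tilde i j * psi_hat powi int j * w_hat powi (int i + int j - 1)
                  / (\<bar>mu_plus\<bar> * (cp - cm))"

definition e_coef :: "nat \<Rightarrow> nat \<Rightarrow> real" where
  "e_coef i j = e_tilde i j * psi_hat powi (int j - 1) * w_hat powi (int i + int j - 1)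
                  / (\<bar>lam_minus\<bar> * (cp - cm))"

definition nu_inf :: real where
  "nu_inf = a_inf * (e_coef 1 1 - d_coef 1 1 - d_coef 3 0)"

definition H1 :: "real \<Rightarrow> real" where
  "H1 x = - (e_coef 1 1 + e_coef 3 0) + (e_coef 0 2 + e_coef 2 1) * x
            - e_coef 1 2 * x^2 + e_coef 0 3 * x^3"

definition H2 :: "real \<Rightarrow> real" where
  "H2 x = (d_coef 1 1 + d_coef 3 0) * x - (d_coef 0 2 + d_coef 2 1) * x^2
            + d_coef 1 2 * x^3 - d_coef 0 3 * x^4"

definition G1 :: "real \<Rightarrow> real" where
  "G1 x = e_coef 1 1 * x - (2 * e_coef 0 2 + e_coef 2 1) * x^2
            + 2 * e_coef 1 2 * x^3 - 3 * e_coef 0 3 * x^4"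

definition G2 :: "real \<Rightarrow> real" where
  "G2 x = - d_coef 1 1 * x + (2 * d_coef 0 2 + d_coef 2 1) * x^2
            - 2 * d_coef 1 2 * x^3 + 3 * d_coef 0 3 * x^4"

definition M11 :: "real \<Rightarrow> real" where
  "M11 x = - e_coef 0 2 * x + e_coef 1 2 * x^2 - 3 * e_coef 0 3 * x^3"

definition M12 :: "real \<Rightarrow> real" where
  "M12 x = - e_coef 0 3 * x^2"

definition M21 :: "real \<Rightarrow> real" where
  "M21 x = d_coef 0 2 * x - d_coef 1 2 * x^2 + 3 * d_coef 0 3 * x^3"

definition M22 :: "real \<Rightarrow> real" where
  "M22 x = d_coef 0 3 * x^2"

definition N1 :: "real \<Rightarrow> real \<Rightarrow> real" where
  "N1 x \<Psi> = - x * M11 x * \<Psi>^2 + x^2 * M12 x * \<Psi>^3"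

definition N2 :: "real \<Rightarrow> real \<Rightarrow> real" where
  "N2 x \<Psi> = - x * M21 x * \<Psi>^2 + x^2 * M22 x * \<Psi>^3"

text \<open>The quotient \<open>N1 x (\<Psi> x) / x\<close> is harmless at \<open>x = 0\<close>: it is polynomial in \<open>x\<close> and
  \<open>\<Psi> x\<close>, and it is multiplied by \<open>x\<close>.\<close>

definition limit_ode :: "real set \<Rightarrow> (real \<Rightarrow> real) \<Rightarrow> real \<Rightarrow> bool" where
  "limit_ode I \<Psi> x \<longleftrightarrow>
     (1 + H2 x + G2 x * \<Psi> x + N2 x (\<Psi> x)) * (- (x^2)) * deriv_within I \<Psi> x
     + (- 2 * x * (1 + H2 x + G2 x * \<Psi> x + N2 x (\<Psi> x))
          - a_inf * (1 + G1 x) + 2 * x * G2 x) * \<Psi> x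
     = x * (a_inf * H1 x - 2 * (1 + H2 x) + a_inf * N1 x (\<Psi> x) / x - 2 * N2 x (\<Psi> x))"

definition local_solution :: "(real \<Rightarrow> real) \<Rightarrow> bool" where
  "local_solution \<Psi> \<longleftrightarrow>
     (\<exists>x0>0. smooth_within {0..x0} \<Psi> \<and> \<Psi> 0 = 0 \<and> (\<forall>x\<in>{0..x0}. limit_ode {0..x0} \<Psi> x))"

text \<open>The local solution is unique as a germ at \<open>0\<close>; only this germ is used below.\<close>

definition Psi_tilde :: "real \<Rightarrow> real" where
  "Psi_tilde = (SOME \<Psi>. local_solution \<Psi>)"

text \<open>\<open>xi\<close> has a removable singularity at \<open>0\<close>; its value there does not affect the integral.\<close>

definition xi :: "real \<Rightarrow> real" where
  "xi x = (a_inf * (1 + G1 x) - 2 * x * G2 x) / (x^2 * (1 + H2 x)) - a_inf / x^2 - nu_inf / x"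

definition M_fac :: "real \<Rightarrow> real" where
  "M_fac x = exp (- integral {0..x} xi)"

text \<open>The quotient is extended to \<open>x = 0\<close> by its limit.\<close>

definition Theta :: "real \<Rightarrow> real" where
  "Theta x = (if x = 0 then Lim (at_right 0) (\<lambda>t. Psi_tilde t / (t * M_fac t))
              else Psi_tilde x / (x * M_fac x))"

definition g_inf :: "nat \<Rightarrow> real" where
  "g_inf = taylor_coeff
     (\<lambda>x. x^2 * deriv_within {0..} Theta x + (a_inf + (nu_inf + 3) * x) * Theta x)"

definition S_infty :: real where
  "S_infty = 1 / a_inf *
     (\<Sum>j. (- 1) ^ j * a_inf ^ j * g_inf j / Gamma (nu_inf + real j + 3))"

end

definition O_star :: "nat \<Rightarrow> real set" where
  "O_star d = {l \<in> {0<..<real d}. nu_inf d l > 0}"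

end

theory Submission
  imports Defs "HOL-Complex_Analysis.Complex_Analysis"
begin

text \<open>With \<open>\<Psi> = x U\<close> the limiting equation for \<open>\<Psi>\<close> becomes \<open>a U + R(x, U, x U') = 0\<close>, where the
coefficient of \<open>x\<^sup>n\<close> in \<open>R\<close> involves only the coefficients of \<open>U\<close> before the \<open>n\<close>-th. So there is
exactly one formal power series solution \<open>U = \<Sum> u\<^sub>n x\<^sup>n\<close>, and each \<open>u\<^sub>n\<close> is a polynomial in \<open>1/a\<close>,
\<open>a\<close> and the coefficients \<open>D\<^sub>i\<^sub>j\<close>, \<open>E\<^sub>i\<^sub>j\<close>. The series usually diverges. The number \<open>S\<close> of the theorem
measures its divergence.

Put \<open>q\<^sub>0 = a u\<^sub>0\<close> and \<open>q\<^sub>n = a u\<^sub>n + (n + \<nu> + 2) u\<^sub>n\<^sub>-\<^sub>1\<close>. By the functional equation of \<open>\<Gamma>\<close> the sums of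
\<open>(-a)\<^sup>j q\<^sub>j / \<Gamma>(\<nu> + j + 3)\<close> telescope (\<open>telescope_rGamma\<close>): the sum up to \<open>N\<close> is
\<open>a (-a)\<^sup>N u\<^sub>N / \<Gamma>(\<nu> + N + 3)\<close>. The sum of the series divided by \<open>a\<close> is called \<open>stokes a D E\<close> here; it
is the limit of the normalised coefficients of \<open>U\<close>. Three facts give the theorem.

\<^item> \<open>stokes\<close> is holomorphic in the parameters as long as \<open>a \<noteq> 0\<close> (\<open>stokes_holomorphic\<close>). The equation
  expresses \<open>q\<close> by products in which every power of \<open>U\<close> comes with a power of \<open>x\<close>. Let \<open>V\<^sub>n\<close> be the
  product of the numbers \<open>max (\<mu>\<^sup>2) (\<bar>\<nu> + i + 2\<bar> / \<bar>a\<bar>)\<close>, \<open>2 \<le> i \<le> n\<close>; up to constants it is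
  \<open>\<bar>\<Gamma>(\<nu> + n + 3)\<bar> / \<bar>a\<bar>\<^sup>n\<close>. For large \<open>\<mu>\<close> an induction yields \<open>\<bar>u\<^sub>n\<bar> \<le> T V\<^sub>n\<close> and
  \<open>\<bar>q\<^sub>n\<bar> \<le> B V\<^sub>n / (\<mu> + n)\<^sup>2\<close> with locally uniform constants (\<open>formal_solution_growth\<close>), so the series
  converges locally uniformly.

\<^item> \<open>S_infty\<close> is a value of \<open>stokes\<close> (\<open>S_infty_eq_stokes\<close>). Multiplication of \<open>U\<close> by a convergent power
  series with constant term \<open>1\<close> does not change the limit of the normalised coefficients, because
  the bound for \<open>u\<^sub>N\<^sub>-\<^sub>k\<close>, \<open>k \<ge> 1\<close>, is smaller than \<open>V\<^sub>N\<close> by a factor of order \<open>1/N\<close> and a factor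
  geometric in \<open>k\<close> (\<open>stokes_invariant\<close>); this removes the factor \<open>M\<close> from the
  definition. It remains to see that the real function \<open>\<Psi>\<close>, an arbitrary local smooth solution, has
  the Taylor coefficients of \<open>x U\<close>. Solutions exist by a contraction in the variable \<open>1/x\<close>
  (\<open>singular_ode_exists\<close>). As \<open>a > 0\<close>, a barrier argument shows that any solution that tends to \<open>0\<close>
  has the asymptotic expansion \<open>x U\<close> (\<open>ode_form_solution_expands\<close>). All derivatives of the solution are
  polynomials in \<open>x\<close>, \<open>1/x\<close>, the solution and some bounded functions, hence at most of polynomial
  growth, and under this condition expansions may be differentiated term by term (\<open>expands_deriv\<close>).

\<^item> \<open>a\<close>, \<open>D\<^sub>i\<^sub>j\<close> and \<open>E\<^sub>i\<^sub>j\<close> are explicit in \<open>\<ell>\<close>. They are rational functions of \<open>\<ell>\<close> and the linear data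
  at \<open>P\<^sub>2\<close>. For \<open>\<ell> < d\<close> these data are rational in \<open>\<ell>\<close> (\<open>star_data\<close>), and the denominators that
  arise do not vanish on \<open>(0, d)\<close>. For \<open>\<ell> > d\<close> they are rational in \<open>t = \<surd>\<ell>\<close> and \<open>\<surd>t\<close>
  (\<open>plus_data\<close>), and in the half-plane \<open>Re \<ell> > 0\<close> the only singularity is at \<open>\<ell> = d\<close>, where \<open>\<mu>\<^sub>+\<close>
  vanishes. So \<open>S\<^sup>+\<close> extends to the connected set \<open>{Re \<ell> > 0} - {d}\<close>, which contains \<open>(0, d)\<close>.\<close>

no_notation vec_nth (infixl "$" 90)

section \<open>The limiting equation over an arbitrary ring\<close>

text \<open>The functions \<open>H1\<close>, \<open>H2\<close>, ... of the limiting equation for arbitrary coefficients in an arbitrary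
  commutative ring; the letter \<open>p\<close> or \<open>q\<close> in the names stands for this polymorphic version. The same
  polynomials are used for real functions, complex parameters and formal power series.\<close>

definition H1p :: "(nat \<Rightarrow> nat \<Rightarrow> 'a::comm_ring_1) \<Rightarrow> 'a \<Rightarrow> 'a" where
  "H1p E x = - (E 1 1 + E 3 0) + (E 0 2 + E 2 1) * x - E 1 2 * x^2 + E 0 3 * x^3"

definition H2p :: "(nat \<Rightarrow> nat \<Rightarrow> 'a::comm_ring_1) \<Rightarrow> 'a \<Rightarrow> 'a" where
  "H2p D x = (D 1 1 + D 3 0) * x - (D 0 2 + D 2 1) * x^2 + D 1 2 * x^3 - D 0 3 * x^4"

definition G1p :: "(nat \<Rightarrow> nat \<Rightarrow> 'a::comm_ring_1) \<Rightarrow> 'a \<Rightarrow> 'a" where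
  "G1p E x = E 1 1 * x - (2 * E 0 2 + E 2 1) * x^2 + 2 * E 1 2 * x^3 - 3 * E 0 3 * x^4"

definition G2p :: "(nat \<Rightarrow> nat \<Rightarrow> 'a::comm_ring_1) \<Rightarrow> 'a \<Rightarrow> 'a" where
  "G2p D x = - D 1 1 * x + (2 * D 0 2 + D 2 1) * x^2 - 2 * D 1 2 * x^3 + 3 * D 0 3 * x^4"

definition M11p :: "(nat \<Rightarrow> nat \<Rightarrow> 'a::comm_ring_1) \<Rightarrow> 'a \<Rightarrow> 'a" where
  "M11p E x = - E 0 2 * x + E 1 2 * x^2 - 3 * E 0 3 * x^3"

definition M12p :: "(nat \<Rightarrow> nat \<Rightarrow> 'a::comm_ring_1) \<Rightarrow> 'a \<Rightarrow> 'a" where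
  "M12p E x = - E 0 3 * x^2"

definition M21p :: "(nat \<Rightarrow> nat \<Rightarrow> 'a::comm_ring_1) \<Rightarrow> 'a \<Rightarrow> 'a" where
  "M21p D x = D 0 2 * x - D 1 2 * x^2 + 3 * D 0 3 * x^3"

definition M22p :: "(nat \<Rightarrow> nat \<Rightarrow> 'a::comm_ring_1) \<Rightarrow> 'a \<Rightarrow> 'a" where
  "M22p D x = D 0 3 * x^2"

text \<open>This is \<open>N1 / x\<close>, which is a polynomial.\<close>

definition N1q :: "(nat \<Rightarrow> nat \<Rightarrow> 'a::comm_ring_1) \<Rightarrow> 'a \<Rightarrow> 'a \<Rightarrow> 'a" where
  "N1q E x y = - M11p E x * y^2 + x * M12p E x * y^3"

definition N2p :: "(nat \<Rightarrow> nat \<Rightarrow> 'a::comm_ring_1) \<Rightarrow> 'a \<Rightarrow> 'a \<Rightarrow> 'a" where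
  "N2p D x y = - x * M21p D x * y^2 + x^2 * M22p D x * y^3"

definition Kp :: "(nat \<Rightarrow> nat \<Rightarrow> 'a::comm_ring_1) \<Rightarrow> 'a \<Rightarrow> 'a \<Rightarrow> 'a" where
  "Kp D x y = 1 + H2p D x + G2p D x * y + N2p D x y"

definition nup :: "'a::comm_ring_1 \<Rightarrow> (nat \<Rightarrow> nat \<Rightarrow> 'a) \<Rightarrow> (nat \<Rightarrow> nat \<Rightarrow> 'a) \<Rightarrow> 'a" where
  "nup a D E = a * (E 1 1 - D 1 1 - D 3 0)"

definition Rp :: "'a::comm_ring_1 \<Rightarrow> (nat \<Rightarrow> nat \<Rightarrow> 'a) \<Rightarrow> (nat \<Rightarrow> nat \<Rightarrow> 'a) \<Rightarrow> 'a \<Rightarrow> 'a \<Rightarrow> 'a" where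
  "Rp a D E x y = a * H1p E x - 2 * (1 + H2p D x) + a * N1q E x y - 2 * N2p D x y"

text \<open>The limiting equation is \<open>ode_form = 0\<close> for \<open>y = \<Psi> x\<close> and \<open>y' = \<Psi>' x\<close>, all terms being on one side
  and the sign reversed.\<close>

definition ode_form :: "'a::comm_ring_1 \<Rightarrow> (nat \<Rightarrow> nat \<Rightarrow> 'a) \<Rightarrow> (nat \<Rightarrow> nat \<Rightarrow> 'a) \<Rightarrow> 'a \<Rightarrow> 'a \<Rightarrow> 'a \<Rightarrow> 'a" where
  "ode_form a D E x y y' = Kp D x y * (x^2 * y') + (2 * x * Kp D x y + a * (1 + G1p E x) - 2 * x * G2p D x) * y
      + x * Rp a D E x y"

text \<open>What remains of \<open>ode_form\<close> after the substitution \<open>y = x u\<close>, division by \<open>x\<close> and removal of \<open>a u\<close>;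
  the argument \<open>v\<close> stands for \<open>x u'\<close>.\<close>

definition reduced_form :: "'a::comm_ring_1 \<Rightarrow> (nat \<Rightarrow> nat \<Rightarrow> 'a) \<Rightarrow> (nat \<Rightarrow> nat \<Rightarrow> 'a) \<Rightarrow> 'a \<Rightarrow> 'a \<Rightarrow> 'a \<Rightarrow> 'a" where
  "reduced_form a D E x u v = Kp D x (x * u) * (x * v + 3 * x * u) + (a * G1p E x - 2 * x * G2p D x) * u
      + Rp a D E x (x * u)"

lemma ode_form_reduced: "ode_form a D E x (x * u) (u + x * v) = x * (a * u + reduced_form a D E x u (x * v))"
  unfolding ode_form_def reduced_form_def by (simp add: algebra_simps power2_eq_square)

section \<open>The formal solution\<close>

abbreviation const_coeffs :: "(nat \<Rightarrow> nat \<Rightarrow> 'a::comm_ring_1) \<Rightarrow> nat \<Rightarrow> nat \<Rightarrow> 'a fps" where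
  "const_coeffs D \<equiv> \<lambda>i j. fps_const (D i j)"

definition reduced_op :: "'a::comm_ring_1 \<Rightarrow> (nat \<Rightarrow> nat \<Rightarrow> 'a) \<Rightarrow> (nat \<Rightarrow> nat \<Rightarrow> 'a) \<Rightarrow> 'a fps \<Rightarrow> 'a fps" where
  "reduced_op a D E U = reduced_form (fps_const a) (const_coeffs D) (const_coeffs E) fps_X U (fps_X * fps_deriv U)"

text \<open>The recursion that solves \<open>a U + reduced_op U = 0\<close> for the coefficient of \<open>x\<^sup>n\<close>, with the later
  coefficients set to \<open>0\<close>; by \<open>agree_reduced_op\<close> they do not matter.\<close>

fun formal_coeff :: "'a::field \<Rightarrow> (nat \<Rightarrow> nat \<Rightarrow> 'a) \<Rightarrow> (nat \<Rightarrow> nat \<Rightarrow> 'a) \<Rightarrow> nat \<Rightarrow> 'a" where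
  "formal_coeff a D E n = - (reduced_op a D E (Abs_fps (\<lambda>k. if k < n then formal_coeff a D E k else 0)) $ n) / a"

declare formal_coeff.simps [simp del]

definition formal_solution :: "'a::field \<Rightarrow> (nat \<Rightarrow> nat \<Rightarrow> 'a) \<Rightarrow> (nat \<Rightarrow> nat \<Rightarrow> 'a) \<Rightarrow> 'a fps" where
  "formal_solution a D E = Abs_fps (formal_coeff a D E)"

lemma G1p_factor: "G1p E x = x * (E 1 1 - (2 * E 0 2 + E 2 1) * x + 2 * E 1 2 * x^2 - 3 * E 0 3 * x^3)"
  by (simp add: G1p_def algebra_simps eval_nat_numeral)

lemma G2p_factor: "G2p D x = x * (- D 1 1 + (2 * D 0 2 + D 2 1) * x - 2 * D 1 2 * x^2 + 3 * D 0 3 * x^3)"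
  by (simp add: G2p_def algebra_simps eval_nat_numeral)

lemma H2p_factor: "H2p D x = x * ((D 1 1 + D 3 0) - (D 0 2 + D 2 1) * x + D 1 2 * x^2 - D 0 3 * x^3)"
  by (simp add: H2p_def algebra_simps eval_nat_numeral)

definition agree :: "nat \<Rightarrow> 'a::comm_ring_1 fps \<Rightarrow> 'a fps \<Rightarrow> bool" where
  "agree n A B \<longleftrightarrow> (\<forall>k<n. A $ k = B $ k)"

lemma agree_refl [simp]: "agree n A A" by (simp add: agree_def)

lemma agree_add: "agree n A B \<Longrightarrow> agree n A' B' \<Longrightarrow> agree n (A + A') (B + B')"
  by (simp add: agree_def)

lemma agree_diff: "agree n A B \<Longrightarrow> agree n A' B' \<Longrightarrow> agree n (A - A') (B - B')"
  by (simp add: agree_def)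

lemma agree_mult: "agree n A B \<Longrightarrow> agree n A' B' \<Longrightarrow> agree n (A * A') (B * B')"
  by (auto simp: agree_def fps_mult_nth intro!: sum.cong)

lemma agree_power: "agree n A B \<Longrightarrow> agree n (A ^ m) (B ^ m)"
  by (induction m) (auto intro: agree_mult)

lemma agree_X: "agree n A B \<Longrightarrow> agree (Suc n) (fps_X * A) (fps_X * B)"
  by (auto simp: agree_def)

lemma agree_Suc_le: "agree (Suc n) A B \<Longrightarrow> agree n A B"
  by (simp add: agree_def)

lemma agree_Xderiv: "agree n A B \<Longrightarrow> agree n (fps_X * fps_deriv A) (fps_X * fps_deriv B)"
  by (auto simp: agree_def)

lemma agree_mult_zero:
  assumes "agree n A B" "P $ 0 = (0::'a::comm_ring_1)"
  shows "agree (Suc n) (P * A) (P * B)"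
  unfolding agree_def fps_mult_nth
proof (intro allI impI sum.cong refl)
  fix k i assume k: "k < Suc n" "i \<in> {0..k}"
  show "P $ i * A $ (k - i) = P $ i * B $ (k - i)"
  proof (cases "i = 0")
    case False
    with k assms(1) show ?thesis by (simp add: agree_def)
  qed (simp add: assms(2))
qed

text \<open>Every occurrence of the unknown in \<open>reduced_op\<close> carries a factor \<open>x\<close>. This gain of one order is
  what makes the formal solution exist and be unique.\<close>

lemma agree_reduced_op:
  assumes "agree n A B"
  shows "agree (Suc n) (reduced_op a D E A) (reduced_op a D E B)"
proof -
  note X = agree_X [OF assms]
  have 3: "agree (Suc n) (3 * fps_X * A) (3 * fps_X * B)"
    unfolding mult.assoc by (rule agree_mult [OF agree_refl X])
  have K: "agree (Suc n) (Kp (const_coeffs D) fps_X (fps_X * A)) (Kp (const_coeffs D) fps_X (fps_X * B))"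
    unfolding Kp_def N2p_def
    by (intro agree_add [OF agree_add [OF agree_refl]] agree_add
        agree_mult [OF agree_refl] agree_power X)
  have R: "agree (Suc n) (Rp (fps_const a) (const_coeffs D) (const_coeffs E) fps_X (fps_X * A))
                 (Rp (fps_const a) (const_coeffs D) (const_coeffs E) fps_X (fps_X * B))"
    unfolding Rp_def N2p_def N1q_def
    by (intro agree_add [OF agree_diff [OF agree_refl agree_refl]] agree_add agree_diff
        agree_mult [OF agree_refl] agree_power X)
  have "(fps_const a * G1p (const_coeffs E) fps_X - 2 * fps_X * G2p (const_coeffs D) fps_X) $ 0 = 0"
    by (simp add: G1p_factor G2p_factor)
  note G = agree_mult_zero [OF assms this]
  show ?thesis
    unfolding reduced_op_def reduced_form_def
    by (rule agree_add [OF agree_add [OF agree_mult [OF K agree_add [OF agree_X [OF agree_Xderiv [OF assms]] 3]] G] R])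
qed

lemma formal_solution_solves:
  fixes a :: "'a::field"
  assumes "a \<noteq> 0"
  shows "fps_const a * formal_solution a D E + reduced_op a D E (formal_solution a D E) = 0"
proof (rule fps_ext)
  fix n
  have "agree n (formal_solution a D E) (Abs_fps (\<lambda>k. if k < n then formal_coeff a D E k else 0))"
    by (simp add: agree_def formal_solution_def)
  from agree_reduced_op [OF this, of a D E] have
    "reduced_op a D E (formal_solution a D E) $ n = reduced_op a D E (Abs_fps (\<lambda>k. if k < n then formal_coeff a D E k else 0)) $ n"
    unfolding agree_def by blast
  moreover have "formal_solution a D E $ n =
      - (reduced_op a D E (Abs_fps (\<lambda>k. if k < n then formal_coeff a D E k else 0)) $ n) / a"
    unfolding formal_solution_def fps_nth_Abs_fps by (rule formal_coeff.simps)
  ultimately have "a * formal_solution a D E $ n + reduced_op a D E (formal_solution a D E) $ n = 0"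
    using assms by simp
  then show "(fps_const a * formal_solution a D E + reduced_op a D E (formal_solution a D E)) $ n = 0 $ n"
    by simp
qed

text \<open>A partial sum of the formal solution leaves a defect of the order of its truncation; this is used
  to compare it with true solutions.\<close>

lemma formal_solution_truncated:
  fixes a :: "'a::field"
  assumes "a \<noteq> 0" "agree n W (formal_solution a D E)"
  shows "agree n (fps_const a * W + reduced_op a D E W) 0"
proof -
  have "agree n (fps_const a * W + reduced_op a D E W) (fps_const a * formal_solution a D E + reduced_op a D E (formal_solution a D E))"
    by (intro agree_add agree_mult agree_refl assms agree_Suc_le [OF agree_reduced_op [OF assms(2)]])
  then show ?thesis using formal_solution_solves [OF assms(1)] by simp
qed

section \<open>Power series with holomorphic coefficients\<close>

definition hol_fps :: "complex set \<Rightarrow> (complex \<Rightarrow> complex fps) \<Rightarrow> bool" where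
  "hol_fps S A \<longleftrightarrow> (\<forall>n. (\<lambda>z. A z $ n) holomorphic_on S)"

named_theorems hol_fps_intros

lemma hol_fps_const [hol_fps_intros]: "f holomorphic_on S \<Longrightarrow> hol_fps S (\<lambda>z. fps_const (f z))"
  unfolding hol_fps_def
proof
  fix n assume "f holomorphic_on S"
  then show "(\<lambda>z. fps_const (f z) $ n) holomorphic_on S"
    by (cases "n = 0") auto
qed

lemma hol_fps_fixed [hol_fps_intros]: "hol_fps S (\<lambda>z. A)"
  unfolding hol_fps_def by auto

lemma hol_fps_add [hol_fps_intros]: "hol_fps S A \<Longrightarrow> hol_fps S B \<Longrightarrow> hol_fps S (\<lambda>z. A z + B z)"
  unfolding hol_fps_def by (auto intro!: holomorphic_intros)

lemma hol_fps_diff [hol_fps_intros]: "hol_fps S A \<Longrightarrow> hol_fps S B \<Longrightarrow> hol_fps S (\<lambda>z. A z - B z)"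
  unfolding hol_fps_def by (auto intro!: holomorphic_intros)

lemma hol_fps_minus [hol_fps_intros]: "hol_fps S A \<Longrightarrow> hol_fps S (\<lambda>z. - A z)"
  unfolding hol_fps_def by (auto intro!: holomorphic_intros)

lemma hol_fps_mult [hol_fps_intros]: "hol_fps S A \<Longrightarrow> hol_fps S B \<Longrightarrow> hol_fps S (\<lambda>z. A z * B z)"
  unfolding hol_fps_def fps_mult_nth by (auto intro!: holomorphic_intros)

lemma hol_fps_power [hol_fps_intros]: "hol_fps S A \<Longrightarrow> hol_fps S (\<lambda>z. A z ^ n)"
  by (induction n) (auto intro!: hol_fps_intros)

lemma hol_fps_deriv [hol_fps_intros]: "hol_fps S A \<Longrightarrow> hol_fps S (\<lambda>z. fps_deriv (A z))"
  unfolding hol_fps_def by (auto intro!: holomorphic_intros)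

lemma hol_fps_reduced_op [hol_fps_intros]:
  assumes "hol_fps S A" "a holomorphic_on S" "\<And>i j. (\<lambda>z. D z i j) holomorphic_on S"
    "\<And>i j. (\<lambda>z. E z i j) holomorphic_on S"
  shows "hol_fps S (\<lambda>z. reduced_op (a z) (D z) (E z) (A z))"
  unfolding reduced_op_def reduced_form_def Kp_def Rp_def N2p_def N1q_def H1p_def H2p_def G1p_def G2p_def
    M11p_def M12p_def M21p_def M22p_def
  by (intro hol_fps_intros assms)

text \<open>The recursion divides only by \<open>a\<close>.\<close>

lemma hol_formal_solution:
  assumes "a holomorphic_on S" "\<And>i j. (\<lambda>z. D z i j) holomorphic_on S"
    "\<And>i j. (\<lambda>z. E z i j) holomorphic_on S" "\<And>z. z \<in> S \<Longrightarrow> a z \<noteq> 0"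
  shows "hol_fps S (\<lambda>z. formal_solution (a z) (D z) (E z))"
proof -
  have "(\<lambda>z. formal_coeff (a z) (D z) (E z) n) holomorphic_on S" for n
  proof (induction n rule: less_induct)
    case (less n)
    have "hol_fps S (\<lambda>z. Abs_fps (\<lambda>k. if k < n then formal_coeff (a z) (D z) (E z) k else 0))"
      unfolding hol_fps_def
    proof
      fix k show "(\<lambda>z. Abs_fps (\<lambda>k. if k < n then formal_coeff (a z) (D z) (E z) k else 0) $ k) holomorphic_on S"
        using less.IH [of k] by (cases "k < n") auto
    qed
    from hol_fps_reduced_op [OF this assms(1-3)]
    have "(\<lambda>z. - (reduced_op (a z) (D z) (E z) (Abs_fps (\<lambda>k. if k < n then formal_coeff (a z) (D z) (E z) k else 0)) $ n) / a z)
       holomorphic_on S"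
      using assms by (auto simp: hol_fps_def intro!: holomorphic_intros)
    then show ?case by (subst formal_coeff.simps)
  qed
  then show ?thesis by (simp add: hol_fps_def formal_solution_def)
qed

section \<open>Factorially growing weights\<close>

text \<open>Multiplication by \<open>p\<close> is bounded by \<open>S\<close> and lowers the indices by at least \<open>j\<close>. For a polynomial
  divisible by \<open>x\<^sup>j\<close> this holds with the sum of the moduli of its coefficients; stating it for the
  operator avoids computing these coefficients.\<close>

definition shift_bound :: "nat \<Rightarrow> real \<Rightarrow> complex fps \<Rightarrow> bool" where
  "shift_bound j S p \<longleftrightarrow> 0 \<le> S \<and>
     (\<forall>n F \<beta>. 0 \<le> \<beta> \<longrightarrow> (\<forall>k. k + j \<le> n \<longrightarrow> norm (F $ k) \<le> \<beta>) \<longrightarrow> norm ((p * F) $ n) \<le> S * \<beta>)"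

lemma shift_boundD: "shift_bound j S p \<Longrightarrow> 0 \<le> \<beta> \<Longrightarrow> (\<And>k. k + j \<le> n \<Longrightarrow> norm (F $ k) \<le> \<beta>) \<Longrightarrow> norm ((p * F) $ n) \<le> S * \<beta>"
  unfolding shift_bound_def by blast

lemma shift_bound_const: "norm c \<le> S \<Longrightarrow> shift_bound 0 S (fps_const c)"
  unfolding shift_bound_def by (auto simp: norm_mult intro!: mult_mono intro: order_trans [OF norm_ge_zero])

lemma shift_bound_X: "shift_bound 1 1 fps_X"
  unfolding shift_bound_def
proof (intro conjI allI impI)
  fix n :: nat and F :: "complex fps" and \<beta> :: real
  assume "0 \<le> \<beta>" "\<forall>k. k + 1 \<le> n \<longrightarrow> norm (F $ k) \<le> \<beta>"
  then show "norm ((fps_X * F) $ n) \<le> 1 * \<beta>"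
    by (cases n) auto
qed auto

lemma shift_bound_mult:
  assumes "shift_bound j S p" "shift_bound k T q" shows "shift_bound (j + k) (S * T) (p * q)"
  unfolding shift_bound_def
proof (intro conjI allI impI)
  fix n :: nat and F :: "complex fps" and \<beta> :: real
  assume b: "0 \<le> \<beta>" and F: "\<forall>i. i + (j + k) \<le> n \<longrightarrow> norm (F $ i) \<le> \<beta>"
  have T: "0 \<le> T" "0 \<le> S" using assms by (auto simp: shift_bound_def)
  have "norm ((p * (q * F)) $ n) \<le> S * (T * \<beta>)"
  proof (rule shift_boundD [OF assms(1)])
    fix i assume "i + j \<le> n"
    then show "norm ((q * F) $ i) \<le> T * \<beta>"
      using F by (intro shift_boundD [OF assms(2)] b) auto
  qed (use b T in auto)
  then show "norm ((p * q * F) $ n) \<le> S * T * \<beta>"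
    by (simp add: mult.assoc)
next
  show "0 \<le> S * T" using assms by (auto simp: shift_bound_def)
qed

lemma shift_bound_add:
  assumes "shift_bound j S p" "shift_bound j T q" shows "shift_bound j (S + T) (p + q)"
  unfolding shift_bound_def
proof (intro conjI allI impI)
  fix n :: nat and F :: "complex fps" and \<beta> :: real
  assume b: "0 \<le> \<beta>" and F: "\<forall>i. i + j \<le> n \<longrightarrow> norm (F $ i) \<le> \<beta>"
  have "norm ((p * F) $ n) \<le> S * \<beta>" "norm ((q * F) $ n) \<le> T * \<beta>"
    using F by (auto intro!: shift_boundD [OF assms(1)] shift_boundD [OF assms(2)] b)
  then show "norm (((p + q) * F) $ n) \<le> (S + T) * \<beta>"
    using norm_triangle_mono by (force simp: algebra_simps)
next
  show "0 \<le> S + T" using assms by (auto simp: shift_bound_def)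
qed

lemma shift_bound_minus:
  assumes "shift_bound j S p" shows "shift_bound j S (- p)"
  using assms unfolding shift_bound_def by simp

lemma shift_bound_mono:
  assumes "shift_bound j S p" "i \<le> j" "S \<le> T" shows "shift_bound i T p"
  unfolding shift_bound_def
proof (intro conjI allI impI)
  fix n :: nat and F :: "complex fps" and \<beta> :: real
  assume b: "0 \<le> \<beta>" and F: "\<forall>k. k + i \<le> n \<longrightarrow> norm (F $ k) \<le> \<beta>"
  have "norm ((p * F) $ n) \<le> S * \<beta>"
    using F assms(2) by (auto intro!: shift_boundD [OF assms(1)] b)
  also have "\<dots> \<le> T * \<beta>" using assms b by (intro mult_right_mono) auto
  finally show "norm ((p * F) $ n) \<le> T * \<beta>" .
next
  show "0 \<le> T" using assms by (auto simp: shift_bound_def)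
qed

text \<open>The constant is uniform in the parameter \<open>z\<close>.\<close>

definition shift_bounded :: "'z set \<Rightarrow> nat \<Rightarrow> ('z \<Rightarrow> complex fps) \<Rightarrow> bool" where
  "shift_bounded Z j p \<longleftrightarrow> (\<exists>S. \<forall>z\<in>Z. shift_bound j S (p z))"

lemma shift_bounded_const: "(\<And>z. z \<in> Z \<Longrightarrow> norm (c z) \<le> S) \<Longrightarrow> shift_bounded Z 0 (\<lambda>z. fps_const (c z))"
  unfolding shift_bounded_def by (blast intro: shift_bound_const)

lemma shift_bounded_numeral: "shift_bounded Z 0 (\<lambda>z. numeral k)"
  unfolding fps_numeral_fps_const by (rule shift_bounded_const) (rule order_refl)

lemma shift_bounded_X: "shift_bounded Z 1 (\<lambda>z. fps_X)"
  unfolding shift_bounded_def using shift_bound_X by blast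

lemma shift_bounded_mult: "shift_bounded Z j p \<Longrightarrow> shift_bounded Z k q \<Longrightarrow> shift_bounded Z (j + k) (\<lambda>z. p z * q z)"
  unfolding shift_bounded_def by (blast intro: shift_bound_mult)

lemma shift_bounded_add: "shift_bounded Z j p \<Longrightarrow> shift_bounded Z j q \<Longrightarrow> shift_bounded Z j (\<lambda>z. p z + q z)"
  unfolding shift_bounded_def by (blast intro: shift_bound_add)

lemma shift_bounded_minus: "shift_bounded Z j p \<Longrightarrow> shift_bounded Z j (\<lambda>z. - p z)"
  unfolding shift_bounded_def by (blast intro: shift_bound_minus)

lemma shift_bounded_diff: "shift_bounded Z j p \<Longrightarrow> shift_bounded Z j q \<Longrightarrow> shift_bounded Z j (\<lambda>z. p z - q z)"
  using shift_bounded_add [OF _ shift_bounded_minus] by fastforce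

lemma shift_bounded_mono: "shift_bounded Z j p \<Longrightarrow> i \<le> j \<Longrightarrow> shift_bounded Z i p"
  unfolding shift_bounded_def by (blast intro: shift_bound_mono)

lemma shift_bounded_power0: "shift_bounded Z 0 p \<Longrightarrow> shift_bounded Z 0 (\<lambda>z. p z ^ n)"
proof (induction n)
  case 0
  have "shift_bounded Z 0 (\<lambda>z. fps_const 1)" by (rule shift_bounded_const) auto
  then show ?case by simp
next
  case (Suc n) with shift_bounded_mult [of Z 0 p 0] show ?case by auto
qed

lemma shift_bounded_Xpower: "shift_bounded Z n (\<lambda>z. fps_X ^ n)"
proof (induction n)
  case 0
  have "shift_bounded Z 0 (\<lambda>z. fps_const 1)" by (rule shift_bounded_const) auto
  then show ?case by simp
next
  case (Suc n) with shift_bounded_mult [OF shift_bounded_X, of Z n] show ?case by auto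
qed

lemma shift_bounded_mult0: "shift_bounded Z 0 p \<Longrightarrow> shift_bounded Z 0 q \<Longrightarrow> shift_bounded Z 0 (\<lambda>z. p z * q z)"
  using shift_bounded_mult [of Z 0 p 0 q] by simp

lemma shift_bounded_X0: "shift_bounded Z 0 (\<lambda>z. fps_X)"
  by (rule shift_bounded_mono [OF shift_bounded_X]) simp

lemma shift_bounded_one0: "shift_bounded Z 0 (\<lambda>z. 1)"
  using shift_bounded_numeral [of Z num.One] by simp

lemma shift_bounded_Xmult: "shift_bounded Z 0 p \<Longrightarrow> shift_bounded Z n (\<lambda>z. fps_X ^ n * p z)"
  using shift_bounded_mult [OF shift_bounded_Xpower, of Z 0 p] by simp

lemmas shift_bounded_intros0 = shift_bounded_numeral shift_bounded_one0 shift_bounded_X0 shift_bounded_power0 shift_bounded_mult0 shift_bounded_add shift_bounded_diff shift_bounded_minus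

definition weight :: "(nat \<Rightarrow> real) \<Rightarrow> nat \<Rightarrow> real" where
  "weight r n = (\<Prod>i\<in>{2..n}. r i)"

text \<open>The properties of the ratios \<open>r i\<close> of consecutive weights that the growth estimate uses. The model
  is \<open>r i = \<bar>i + \<nu> + 2\<bar> / \<bar>a\<bar>\<close>, made large by the maximum with \<open>\<mu>\<^sup>2\<close>.\<close>

locale weights =
  fixes r :: "nat \<Rightarrow> real" and c \<mu> :: real
  assumes c: "0 < c" "c \<le> 1" and mu: "2 \<le> \<mu>"
    and r_lin: "\<And>i. 2 \<le> i \<Longrightarrow> c * (\<mu> + real i) \<le> r i"
    and r_mu: "\<And>i. 2 \<le> i \<Longrightarrow> \<mu>^2 \<le> r i"
    and r_mono: "\<And>i j. 2 \<le> i \<Longrightarrow> i \<le> j \<Longrightarrow> r i \<le> r j"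
begin

abbreviation "V \<equiv> weight r"

lemma r_ge_4: "2 \<le> i \<Longrightarrow> 4 \<le> r i"
  using r_mu [of i] power_mono [OF mu, of 2] by simp

lemma V_0 [simp]: "V 0 = 1" and V_1 [simp]: "V (Suc 0) = 1"
  by (simp_all add: weight_def)

lemma V_Suc: "1 \<le> n \<Longrightarrow> V (Suc n) = r (Suc n) * V n"
  by (simp add: weight_def mult.commute)

lemma V_ge_1: "1 \<le> V n"
  unfolding weight_def using r_ge_4 by (intro prod_ge_1) force

lemma V_pos: "0 < V n" using V_ge_1 [of n] by linarith

lemma V_mono: "m \<le> n \<Longrightarrow> V m \<le> V n"
proof (rule lift_Suc_mono_le [of V])
  fix n show "V n \<le> V (Suc n)"
  proof (cases "n = 0")
    case False
    then have "1 * V n \<le> r (Suc n) * V n"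
      using r_ge_4 [of "Suc n"] V_pos [of n] by (intro mult_right_mono) auto
    with False show ?thesis by (simp add: V_Suc)
  qed simp
qed

lemma V_mult_Suc: "1 \<le> i \<Longrightarrow> V i * V (Suc j) \<le> V (i + j)"
proof (induction i rule: nat_induct_at_least)
  case base then show ?case by simp
next
  case (Suc i)
  have "V (Suc i) * V (Suc j) = r (Suc i) * (V i * V (Suc j))"
    using Suc by (simp add: V_Suc)
  also have "\<dots> \<le> r (Suc i) * V (i + j)"
    using Suc r_ge_4 [of "Suc i"] by (intro mult_left_mono) auto
  also have "\<dots> \<le> r (Suc (i + j)) * V (i + j)"
    using Suc r_mono [of "Suc i" "Suc (i + j)"] V_pos[of "i+j"] by (intro mult_right_mono) auto
  also have "\<dots> = V (Suc i + j)" using Suc by (simp add: V_Suc)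
  finally show ?case .
qed

text \<open>The weights are superconvex because their ratios increase; products of coefficients are therefore
  dominated by their extreme terms.\<close>

lemma V_mult: "V i * V j \<le> V (i + j)"
proof (cases "i = 0 \<or> j = 0")
  case False
  then have "V i * V (Suc (j - 1)) \<le> V (i + (j - 1))" by (intro V_mult_Suc) auto
  also have "\<dots> \<le> V (i + j)" by (rule V_mono) auto
  finally show ?thesis using False by simp
qed auto

lemma le_divide_weight:
  assumes "x * (c^3 * (\<mu> + real n)^2) \<le> C * v"
  shows "x \<le> C / c^3 * (v / (\<mu> + real n)^2)"
proof -
  have "0 < c^3 * (\<mu> + real n)^2" using c mu by simp
  with assms show ?thesis by (simp add: pos_le_divide_eq)
qed

text \<open>Going back two indices gains two factors of size \<open>\<mu> + n\<close>. For small \<open>n\<close> the lower bound by \<open>\<mu>\<^sup>2\<close>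
  is used, since there are too few factors. The constants are not optimised.\<close>

lemma V_two_back:
  assumes "2 \<le> n" shows "V (n - 2) \<le> 4 / c^3 * (V n / (\<mu> + n)^2)"
proof (cases "n = 2")
  case True
  have "c^3 * (\<mu> + 2)^2 \<le> 1 * (\<mu> + 2)^2"
    using c power_le_one [of c 3] by (intro mult_right_mono) auto
  also have "\<dots> \<le> 4 * \<mu>^2" using power_mono [of "\<mu> + 2" "2 * \<mu>" 2] mu by (simp add: power_mult_distrib)
  also have "\<dots> \<le> 4 * r 2" using r_mu [of 2] by simp
  finally have *: "c^3 * (\<mu> + 2)^2 \<le> 4 * r 2" .
  have V: "V 2 = r 2" using V_Suc [of 1] by (simp add: numeral_2_eq_2)
  show ?thesis by (rule le_divide_weight) (use * V True in simp)
next
  case False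
  define m where "m = n - 2"
  have n: "n = Suc (Suc m)" "1 \<le> m" using False assms by (auto simp: m_def)
  have V: "V n = r (Suc (Suc m)) * r (Suc m) * V m"
    using n by (simp add: V_Suc)
  have "c * (\<mu> + n) * (c * ((\<mu> + n) / 2)) \<le> r (Suc (Suc m)) * r (Suc m)"
  proof (intro mult_mono)
    show "c * ((\<mu> + n) / 2) \<le> r (Suc m)"
      by (rule order_trans [OF _ r_lin]) (use n mu c in \<open>auto intro!: mult_left_mono\<close>)
  qed (use r_lin [of n] r_ge_4 [of n] n c mu in auto)
  then have "c^2 * (\<mu> + n)^2 \<le> 2 * (r (Suc (Suc m)) * r (Suc m))"
    by (simp add: power2_eq_square algebra_simps)
  then have "c^2 * (\<mu> + n)^2 * V m \<le> 2 * V n"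
    using V_pos [of m] unfolding V by (simp add: mult_right_mono mult.assoc [symmetric])
  moreover have "c^3 * (\<mu> + n)^2 * V m \<le> c^2 * (\<mu> + n)^2 * V m"
    using c V_pos [of m] by (intro mult_right_mono) (auto simp: power_decreasing)
  ultimately have "c^3 * (\<mu> + n)^2 * V m \<le> 4 * V n"
    using V_pos [of n] by linarith
  then show ?thesis by (intro le_divide_weight) (simp add: m_def mult_ac add_ac)
qed

text \<open>The third index gained pays for one factor \<open>n + 1\<close>, the number of terms of a convolution.\<close>

lemma V_three_back:
  assumes "2 \<le> n" shows "(n + 1) * V (n - 3) \<le> 12 / c^3 * (V n / (\<mu> + n)^2)"
proof (cases "n \<le> 3")
  case True
  have a: "0 \<le> V n / (\<mu> + n)^2" using V_pos [of n] by simp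
  have "V (n - 3) \<le> V (n - 2)" by (rule V_mono) auto
  show ?thesis
  proof (cases "n = 2")
    case True
    with V_two_back [of 2] show ?thesis by simp
  next
    case False
    with True assms have n: "n = 3" by auto
    have V: "V n = r 3 * r 2" using V_Suc [of 2] V_Suc [of 1] n by (simp add: eval_nat_numeral)
    have "c * (\<mu> + 3) * (c * ((\<mu> + 3) * (4/5))) \<le> r 3 * r 2"
    proof (intro mult_mono)
      show "c * ((\<mu> + 3) * (4/5)) \<le> r 2"
        by (rule order_trans [OF _ r_lin]) (use n mu c in \<open>auto intro!: mult_left_mono\<close>)
    qed (use r_lin [of 3] r_ge_4 [of 3] n c mu in auto)
    then have "4 * (c^2 * (\<mu> + 3)^2) \<le> 12 * V n"
      using V_pos [of n] V by (simp add: power2_eq_square algebra_simps)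
    moreover have "c^3 * (\<mu> + 3)^2 \<le> c^2 * (\<mu> + 3)^2"
      using c by (intro mult_right_mono) (auto simp: power_decreasing)
    ultimately have "4 * (c^3 * (\<mu> + 3)^2) \<le> 12 * V n" by linarith
    then show ?thesis by (intro le_divide_weight) (simp add: n)
  qed
next
  case False
  define m where "m = n - 3"
  have n: "n = Suc (Suc (Suc m))" "1 \<le> m" using False assms by (auto simp: m_def)
  have V: "V n = r (Suc (Suc (Suc m))) * (r (Suc (Suc m)) * r (Suc m)) * V m"
    using n by (simp add: V_Suc)
  have "c * (\<mu> + n) * (c * ((\<mu> + n) / 2) * (c * ((\<mu> + n) / 2))) \<le> r (Suc (Suc (Suc m))) * (r (Suc (Suc m)) * r (Suc m))"
  proof (intro mult_mono)
    show "c * ((\<mu> + n) / 2) \<le> r (Suc m)"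
      by (rule order_trans [OF _ r_lin]) (use n mu c in \<open>auto intro!: mult_left_mono\<close>)
    show "c * ((\<mu> + n) / 2) \<le> r (Suc (Suc m))"
      by (rule order_trans [OF _ r_lin]) (use n mu c in \<open>auto intro!: mult_left_mono\<close>)
  qed (use r_lin [of n] r_ge_4 [of n] r_ge_4 [of "Suc (Suc m)"] r_ge_4 [of "Suc m"] n c mu in auto)
  then have "c^3 * (\<mu> + n)^2 * (\<mu> + n) \<le> 4 * (r (Suc (Suc (Suc m))) * (r (Suc (Suc m)) * r (Suc m)))"
    by (simp add: power2_eq_square power3_eq_cube algebra_simps)
  then have "c^3 * (\<mu> + n)^2 * (\<mu> + n) * V m \<le> 4 * (r (Suc (Suc (Suc m))) * (r (Suc (Suc m)) * r (Suc m))) * V m"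
    using V_pos [of m] by (intro mult_right_mono) auto
  also have "\<dots> = 4 * V n" by (simp only: V mult.assoc)
  finally have "c^3 * (\<mu> + n)^2 * (\<mu> + n) * V m \<le> 4 * V n" .
  moreover have "c^3 * (\<mu> + n)^2 * ((n + 1) * V m) \<le> c^3 * (\<mu> + n)^2 * ((\<mu> + n) * V m)"
    using c mu V_pos [of m] by (intro mult_left_mono mult_right_mono) auto
  ultimately have "c^3 * (\<mu> + n)^2 * ((n + 1) * V m) \<le> 12 * V n"
    using V_pos [of n] by (simp add: mult.assoc)
  then show ?thesis by (intro le_divide_weight) (simp add: m_def mult_ac add_ac)
qed

text \<open>Each further index pays for one more factor \<open>n + 1\<close>.\<close>

lemma V_back_linear:
  "(real n + 1) * V (n - Suc j) \<le> (j + 2) / c * V (n - j)"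
proof (cases "2 \<le> n - j")
  case True
  define m where "m = n - Suc j"
  have n: "n - j = Suc m" "1 \<le> m" "n = m + Suc j" using True by (auto simp: m_def)
  have "c * (real n + 1) \<le> c * ((\<mu> + Suc m) * (j + 2))"
  proof (intro mult_left_mono)
    have "real (m + Suc j) + 1 \<le> (real m + 1) * (j + 2)"
      using n(2) by (simp add: algebra_simps)
    also have "\<dots> \<le> (\<mu> + Suc m) * (j + 2)" using mu by (intro mult_right_mono) auto
    finally show "real n + 1 \<le> (\<mu> + Suc m) * (j + 2)" using n by simp
  qed (use c in auto)
  also have "\<dots> \<le> r (Suc m) * (j + 2)"
    using r_lin [of "Suc m"] n unfolding mult.assoc [symmetric] by (intro mult_right_mono) auto
  finally have "c * (real n + 1) * V m \<le> r (Suc m) * (j + 2) * V m"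
    using V_pos [of m] by (intro mult_right_mono) auto
  also have "\<dots> = (j + 2) * V (Suc m)" using n by (simp add: V_Suc)
  finally have "c * ((real n + 1) * V m) \<le> (j + 2) * V (Suc m)" by (simp only: mult.assoc)
  then have "(real n + 1) * V m \<le> (j + 2) * V (Suc m) / c"
    using c by (subst pos_le_divide_eq) (simp_all add: mult.commute)
  also have "\<dots> = (j + 2) / c * V (n - j)" using n by simp
  finally show ?thesis by (simp add: m_def add_ac)
next
  case False
  have 1: "V (n - Suc j) = 1" "V (n - j) = 1"
    using False by (auto simp: weight_def)
  have "real n + 1 \<le> real j + 2" using False by auto
  also have "\<dots> \<le> (real j + 2) / c"
    using c mult_right_mono [of c 1 "real j + 2"] by (simp add: pos_le_divide_eq mult.commute)
  finally show ?thesis by (simp add: 1)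
qed

text \<open>All \<open>n + 1\<close> terms are estimated by the largest one. This is affordable for the higher powers of the
  unknown, whose coefficients have large shifts.\<close>

lemma conv_crude:
  fixes F G :: "complex fps"
  assumes "\<And>k. k \<le> n \<Longrightarrow> norm (F $ k) \<le> A * V k" "\<And>k. k \<le> n \<Longrightarrow> norm (G $ k) \<le> (real k + 1) ^ m * B * V k"
    "0 \<le> A" "0 \<le> B"
  shows "norm ((F * G) $ n) \<le> (real n + 1) ^ Suc m * (A * B) * V n"
proof -
  have "norm ((F * G) $ n) \<le> (\<Sum>i=0..n. (real n + 1) ^ m * (A * B) * V n)"
    unfolding fps_mult_nth
  proof (rule sum_norm_le)
    fix i assume i: "i \<in> {0..n}"
    have "norm (F $ i * G $ (n - i)) \<le> (A * V i) * ((real (n - i) + 1) ^ m * B * V (n - i))"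
      unfolding norm_mult using i assms V_pos
      by (intro mult_mono assms) (auto intro!: mult_nonneg_nonneg less_imp_le [OF V_pos])
    also have "\<dots> = (real (n - i) + 1) ^ m * ((A * B) * (V i * V (n - i)))"
      by (simp add: mult_ac)
    also have "\<dots> \<le> (real n + 1) ^ m * ((A * B) * V n)"
      using V_mult [of i "n - i"] i assms
      by (intro mult_mono power_mono mult_left_mono mult_nonneg_nonneg) (auto intro!: less_imp_le [OF V_pos])
    finally show "norm (F $ i * G $ (n - i)) \<le> (real n + 1) ^ m * (A * B) * V n"
      by (simp add: mult_ac)
  qed
  then show ?thesis by (simp add: algebra_simps)
qed

text \<open>Only the two extreme terms are of the full size \<open>V n\<close>; the others are of size \<open>V (n - 1)\<close>. The
  quadratic term with shift \<open>2\<close> needs this sharper form.\<close>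

lemma conv_fine:
  fixes F G :: "complex fps"
  assumes "\<And>k. k \<le> n \<Longrightarrow> norm (F $ k) \<le> A * V k" "\<And>k. k \<le> n \<Longrightarrow> norm (G $ k) \<le> B * V k"
    "0 \<le> A" "0 \<le> B"
  shows "norm ((F * G) $ n) \<le> A * B * (2 * V n + (real n + 1) * V (n - 1))"
proof -
  have "norm ((F * G) $ n) \<le> (\<Sum>i=0..n. A * B * ((if i = 0 then V n else 0) + (if i = n then V n else 0) + V (n - 1)))"
    unfolding fps_mult_nth
  proof (rule sum_norm_le)
    fix i assume i: "i \<in> {0..n}"
    have "norm (F $ i * G $ (n - i)) \<le> (A * V i) * (B * V (n - i))"
      unfolding norm_mult using i assms V_pos
      by (intro mult_mono assms) (auto intro!: mult_nonneg_nonneg less_imp_le [OF V_pos])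
    also have "\<dots> = A * B * (V i * V (n - i))" by simp
    also have "\<dots> \<le> A * B * ((if i = 0 then V n else 0) + (if i = n then V n else 0) + V (n - 1))"
    proof (intro mult_left_mono)
      show "V i * V (n - i) \<le> (if i = 0 then V n else 0) + (if i = n then V n else 0) + V (n - 1)"
      proof (cases "i = 0 \<or> i = n")
        case True then show ?thesis using V_pos [of n] V_pos [of "n - 1"] by auto
      next
        case False
        with i V_mult_Suc [of i "n - i - 1"] show ?thesis by (auto simp: Suc_diff_Suc)
      qed
    qed (use assms in auto)
    finally show "norm (F $ i * G $ (n - i)) \<le> A * B * ((if i = 0 then V n else 0) + (if i = n then V n else 0) + V (n - 1))" .
  qed
  also have "\<dots> = A * B * (2 * V n + (real n + 1) * V (n - 1))"
    by (simp add: sum_distrib_left [symmetric] sum.distrib)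
  finally show ?thesis .
qed

end

section \<open>Growth of the formal solution\<close>

context weights
begin

text \<open>The growth estimate, separated from the special form of the coefficients. \<open>Q\<close> collects the part of
  the equation that is linear in \<open>U\<close> and of leading order, so that \<open>U\<close> is recovered from \<open>Q\<close> by a
  first-order recursion (premise \<open>q\<close>) whose homogeneous solutions grow like \<open>V\<close>. All other terms are
  smaller by two indices, or by one index and contain \<open>Q\<close>, whence the factor \<open>1 / (\<mu> + n)\<^sup>2\<close> in the bound of \<open>Q\<close>, and such a
  perturbation changes \<open>U / V\<close> only by a summable amount. The induction closes when \<open>\<mu>\<close> is large
  compared with all constants. \<open>Y\<close> is the series \<open>x\<^sup>2 U' + 3 x U\<close>.\<close>

lemma weighted_growth_bound:
  fixes U Q Y R0 p1 p2 p3 p4 p5 p6 p7 :: "complex fps" and a \<nu> :: complex and T0 S P :: real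
  defines "T \<equiv> T0 + 1"
  defines "L \<equiv> 12 / c^3"
  defines "\<Lambda> \<equiv> L * (1 + T0 + T + 3 * (T * (3 * T / c)) + T^3 * (3/c) * (5 / c)
     + T^4 * (3/c) * (5/c) * (6/c) + T^2 + T^3 * (5/c))"
  defines "B \<equiv> 2 * S * \<Lambda>"
  assumes Q: "Q = - R0 + p1 * Q + p2 * U + p3 * (U * Y) + p4 * (U * (U * Y)) + p5 * (U * (U * (U * Y)))
       + p6 * (U * U) + p7 * (U * (U * U))"
    and p: "shift_bound 0 S R0" "shift_bound 1 S p1" "shift_bound 2 S p2" "shift_bound 2 S p3" "shift_bound 4 S p4" "shift_bound 7 S p5" "shift_bound 3 S p6" "shift_bound 6 S p7"
    and Y0: "Y $ 0 = 0" and Y: "\<And>k. Y $ Suc k = (of_nat k + 3) * U $ k"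
    and q: "\<And>n. Q $ Suc n = a * U $ Suc n + (of_nat (Suc n) + \<nu> + 2) * U $ n"
    and a: "0 < norm a" "inverse (norm a) \<le> P"
    and T0: "norm (U $ 0) \<le> T0" "norm (U $ 1) \<le> T0" "norm (Q $ 0) \<le> T0" "norm (Q $ 1) \<le> T0"
    and r: "\<And>n. 2 \<le> n \<Longrightarrow> norm (of_nat n + \<nu> + 2) \<le> norm a * r n"
    and mu_B: "P * B \<le> \<mu>" and mu_S: "2 * S * (L + 4) \<le> \<mu>^2"
  shows "norm (U $ n) \<le> T * V n \<and> (2 \<le> n \<longrightarrow> norm (Q $ n) \<le> B * (V n / (\<mu> + n)^2))"
proof -
  have S: "0 \<le> S" using p(1) by (simp add: shift_bound_def)
  have T0': "0 \<le> T0" using T0(1) norm_ge_zero order_trans by blast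
  have T: "1 \<le> T" "0 \<le> T" using T0' by (auto simp: T_def)
  have L: "0 < L" "1 \<le> L" using c power_le_one [of c 3] by (auto simp: L_def field_simps)
  have Lam: "0 \<le> \<Lambda>" unfolding \<Lambda>_def using L T T0' c by (intro mult_nonneg_nonneg add_nonneg_nonneg) auto
  have B: "0 \<le> B" using S Lam by (simp add: B_def)
  have P: "0 \<le> P" using a by (meson inverse_nonnegative_iff_nonnegative norm_ge_zero order_trans)
  have PB: "0 \<le> P * B" using P B by simp
  \<comment> \<open>The constant \<open>T\<close> is approached from below, because every step adds a multiple of \<open>1 / (\<mu> + n)\<^sup>2\<close>, which is less than a difference of consecutive \<open>1 / (\<mu> + n)\<close>.\<close>
  have main: "norm (U $ n) \<le> (T - P * B / (\<mu> + n)) * V n \<and> (2 \<le> n \<longrightarrow> norm (Q $ n) \<le> B * (V n / (\<mu> + n)^2))"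
  proof (induction n rule: less_induct)
    case (less n)
    show ?case
    proof (cases "2 \<le> n")
      case False
      then have "n = 0 \<or> n = 1" by auto
      then have "norm (U $ n) \<le> T0" "V n = 1" using T0 by auto
      moreover have "P * B / (\<mu> + n) \<le> 1" using mu_B mu PB by (simp add: pos_divide_le_eq)
      ultimately show ?thesis using False by (simp add: T_def)
    next
      case True
      define W where "W = V n / (\<mu> + n)^2"
      have W: "0 \<le> W" using V_pos [of n] by (simp add: W_def)
      have u: "norm (U $ k) \<le> T * V k" if "k < n" for k
      proof -
        have "norm (U $ k) \<le> (T - P * B / (\<mu> + k)) * V k" using less that by blast
        also have "\<dots> \<le> T * V k" using PB mu V_pos [of k] by (intro mult_right_mono) auto
        finally show ?thesis .
      qed
      have y: "norm (Y $ k) \<le> 3 * T / c * V k" if "k < n" for k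
      proof (cases k)
        case 0 then show ?thesis using T c by (simp add: Y0)
      next
        case (Suc m)
        have "norm (Y $ k) = (real m + 3) * norm (U $ m)"
          unfolding Suc Y norm_mult using norm_of_nat [of "m + 3", where 'a = complex] by (simp del: norm_of_nat)
        also have "\<dots> \<le> (real m + 3) * (T * V m)" using u [of m] Suc that by (intro mult_left_mono) auto
        also have "\<dots> \<le> 3 * T / c * V k"
        proof (cases "m = 0")
          case True then show ?thesis using Suc T c mult_left_mono [of c 1 T] by (simp add: pos_le_divide_eq mult.commute)
        next
          case False
          have "c * (real m + 3) \<le> r (Suc m)"
            by (rule order_trans [OF _ r_lin]) (use c mu False in auto)
          then have "c * (real m + 3) * V m \<le> r (Suc m) * V m" using V_pos [of m] by (intro mult_right_mono) auto
          also have "\<dots> = V k" using False Suc by (simp add: V_Suc)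
          finally have "T * (c * (real m + 3) * V m) \<le> T * V k" using T by (intro mult_left_mono) auto
          also have "\<dots> \<le> 3 * T * V k" using T V_pos [of k] by (intro mult_right_mono) auto
          finally show ?thesis using c by (simp add: pos_le_divide_eq mult_ac)
        qed
        finally show ?thesis .
      qed
      have cs: "0 \<le> 3 * T / c" using T c by simp
      have LW0: "0 \<le> L * W" using L W by simp
      note Tcs = mult_nonneg_nonneg [OF T(2) cs]
      have n3: "(real n + 1) * V (n - 3) \<le> L * W" using V_three_back [OF True] by (simp add: L_def W_def add_ac)
      have n2: "V (n - 2) \<le> L * W"
      proof -
        have "V (n - 2) \<le> 4 / c^3 * W" using V_two_back [OF True] by (simp add: W_def)
        also have "\<dots> \<le> L * W" unfolding L_def using c W by (intro mult_right_mono divide_right_mono) auto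
        finally show ?thesis .
      qed
      have n4: "(real n + 1)^2 * V (n - 4) \<le> 5 / c * (L * W)"
      proof -
        have "(real n + 1)^2 * V (n - 4) = (real n + 1) * ((real n + 1) * V (n - Suc 3))" by (simp add: power2_eq_square)
        also have "\<dots> \<le> (real n + 1) * (5 / c * V (n - 3))"
          using V_back_linear [of n 3] by (intro mult_left_mono) auto
        also have "\<dots> = 5 / c * ((real n + 1) * V (n - 3))" by simp
        also have "\<dots> \<le> 5 / c * (L * W)" using n3 c by (intro mult_left_mono) auto
        finally show ?thesis .
      qed
      have n5: "(real n + 1)^3 * V (n - 5) \<le> 6 / c * (5 / c * (L * W))"
      proof -
        have "(real n + 1)^3 * V (n - 5) = (real n + 1)^2 * ((real n + 1) * V (n - Suc 4))"
          by (simp add: power2_eq_square power3_eq_cube)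
        also have "\<dots> \<le> (real n + 1)^2 * (6 / c * V (n - 4))"
          using V_back_linear [of n 4] by (intro mult_left_mono) auto
        also have "\<dots> = 6 / c * ((real n + 1)^2 * V (n - 4))" by simp
        also have "\<dots> \<le> 6 / c * (5 / c * (L * W))" using n4 c by (intro mult_left_mono) auto
        finally show ?thesis .
      qed
      \<comment> \<open>Each term of the equation for \<open>Q\<close> is at most a constant times \<open>W\<close>: the shift of its coefficient pays for its powers of \<open>U\<close>.\<close>
      have b0: "norm (R0 $ n) \<le> S * (L * W)"
      proof -
        have "norm ((R0 * 1) $ n) \<le> S * 1" by (rule shift_boundD [OF p(1)]) (auto simp: fps_one_nth)
        also have "\<dots> \<le> S * (L * W)" using n2 V_ge_1 [of "n - 2"] S by (intro mult_left_mono) auto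
        finally show ?thesis by simp
      qed
      have b1: "norm ((p1 * Q) $ n) \<le> S * (T0 * (L * W) + B * (L + 4) / \<mu>^2 * W)"
      proof (rule shift_boundD [OF p(2)])
        show "0 \<le> T0 * (L * W) + B * (L + 4) / \<mu>^2 * W" using T0' L W B by auto
        fix k assume k: "k + 1 \<le> n"
        have mm: "0 < \<mu>^2" using mu by simp
        show "norm (Q $ k) \<le> T0 * (L * W) + B * (L + 4) / \<mu>^2 * W"
        proof (cases "2 \<le> k")
          case False
          then have "k = 0 \<or> k = 1" by auto
          then have "norm (Q $ k) \<le> T0 * 1" using T0 by auto
          also have "\<dots> \<le> T0 * (L * W)" using n2 V_ge_1 [of "n - 2"] T0' by (intro mult_left_mono) auto
          also have "\<dots> \<le> T0 * (L * W) + B * (L + 4) / \<mu>^2 * W" using L W B by auto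
          finally show ?thesis .
        next
          case k2: True
          have "norm (Q $ k) \<le> B * (V k / (\<mu> + k)^2)" using less k k2 by auto
          also have "\<dots> \<le> B * ((L + 4) / \<mu>^2 * W)"
          proof (intro mult_left_mono B)
            show "V k / (\<mu> + k)^2 \<le> (L + 4) / \<mu>^2 * W"
            proof (cases "k + 1 = n")
              case True
              have "(\<mu> + n)^2 \<le> (2 * (\<mu> + k))^2" using mu True by (intro power_mono) auto
              then have 1: "(\<mu> + n)^2 \<le> 4 * (\<mu> + k)^2" unfolding power_mult_distrib by simp
              have "\<mu>^2 * V k \<le> r n * V k" using r_mu [of n] k2 True V_pos [of k] by (intro mult_right_mono) auto
              also have "\<dots> = V n" using k2 True V_Suc [of k] by auto
              finally have "\<mu>^2 * V k * (\<mu> + n)^2 \<le> V n * (4 * (\<mu> + k)^2)"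
                using 1 V_pos [of k] V_pos [of n] by (intro mult_mono) auto
              moreover have "0 < (\<mu> + k)^2" "0 < (\<mu> + n)^2" using mu by auto
              ultimately have "V k / (\<mu> + k)^2 \<le> 4 / \<mu>^2 * W"
                using mm unfolding W_def by (simp add: divide_simps mult_ac)
              also have "\<dots> \<le> (L + 4) / \<mu>^2 * W" using L W by (intro mult_right_mono divide_right_mono) auto
              finally show ?thesis .
            next
              case False
              have "V k \<le> V (n - 2)" using k False by (intro V_mono) auto
              with n2 have "V k \<le> L * W" by simp
              moreover have "\<mu>^2 \<le> (\<mu> + k)^2" using mu by (intro power_mono) auto
              ultimately have "V k / (\<mu> + k)^2 \<le> (L * W) / \<mu>^2"
                using V_pos [of k] mm by (intro frac_le) auto
              also have "\<dots> \<le> (L + 4) / \<mu>^2 * W" using W mm by (simp add: divide_simps algebra_simps)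
              finally show ?thesis .
            qed
          qed
          also have "\<dots> = B * (L + 4) / \<mu>^2 * W" by simp
          also have "\<dots> \<le> T0 * (L * W) + B * (L + 4) / \<mu>^2 * W"
            using mult_nonneg_nonneg [OF T0' mult_nonneg_nonneg [OF less_imp_le [OF L(1)] W]] by linarith
          finally show ?thesis .
        qed
      qed
      have b2: "norm ((p2 * U) $ n) \<le> S * (T * (L * W))"
      proof (rule shift_boundD [OF p(3)])
        fix k assume k: "k + 2 \<le> n"
        have "norm (U $ k) \<le> T * V k" using u k by auto
        also have "\<dots> \<le> T * (L * W)" using k T by (intro mult_left_mono order_trans [OF V_mono n2]) auto
        finally show "norm (U $ k) \<le> T * (L * W)" .
      qed (use T L W in auto)
      have b3: "norm ((p3 * (U * Y)) $ n) \<le> S * (T * (3 * T / c) * (3 * (L * W)))"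
      proof (rule shift_boundD [OF p(4)])
        fix k assume k: "k + 2 \<le> n"
        have "norm ((U * Y) $ k) \<le> T * (3 * T / c) * (2 * V k + (real k + 1) * V (k - 1))"
          by (rule conv_fine) (use u y k T cs in auto)
        also have "\<dots> \<le> T * (3 * T / c) * (3 * (L * W))"
        proof (intro mult_left_mono)
          have "V k \<le> V (n - 2)" using k by (intro V_mono) auto
          moreover have "(real k + 1) * V (k - 1) \<le> (real n + 1) * V (n - 3)"
            using k V_pos [of "k - 1"] by (intro mult_mono V_mono) auto
          ultimately show "2 * V k + (real k + 1) * V (k - 1) \<le> 3 * (L * W)" using n2 n3 by linarith
        qed (rule Tcs)
        finally show "norm ((U * Y) $ k) \<le> T * (3 * T / c) * (3 * (L * W))" .
      qed (use Tcs LW0 in \<open>auto intro!: mult_nonneg_nonneg simp del: times_divide_eq_right\<close>)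
      have TT: "0 \<le> T * T" "0 \<le> T * (T * T)" "0 \<le> T * (T * (3 * T / c))" "0 \<le> T * (T * (T * (3 * T / c)))"
        using mult_nonneg_nonneg [OF T(2) T(2)] Tcs by (blast intro: mult_nonneg_nonneg T)+
      have u0: "norm (U $ k) \<le> (real k + 1) ^ 0 * T * V k" if "k < n" for k using u [OF that] by simp
      have y0: "norm (Y $ k) \<le> (real k + 1) ^ 0 * (3 * T / c) * V k" if "k < n" for k using y [OF that] by simp
      have UU: "norm ((U * U) $ k) \<le> (real k + 1) ^ 1 * (T * T) * V k" if "k < n" for k
      proof -
        have "norm ((U * U) $ k) \<le> (real k + 1) ^ Suc 0 * (T * T) * V k"
          by (rule conv_crude; (rule u0 u T; use that in linarith))
        then show ?thesis by (simp only: One_nat_def)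
      qed
      have UUU: "norm ((U * (U * U)) $ k) \<le> (real k + 1) ^ 2 * (T * (T * T)) * V k" if "k < n" for k
      proof -
        have "norm ((U * (U * U)) $ k) \<le> (real k + 1) ^ Suc 1 * (T * (T * T)) * V k"
          by (rule conv_crude; (rule u UU T TT(1); use that in linarith))
        then show ?thesis by (simp only: numeral_2_eq_2 numeral_3_eq_3 One_nat_def)
      qed
      have UY: "norm ((U * Y) $ k) \<le> (real k + 1) ^ 1 * (T * (3 * T / c)) * V k" if "k < n" for k
      proof -
        have "norm ((U * Y) $ k) \<le> (real k + 1) ^ Suc 0 * (T * (3 * T / c)) * V k"
          by (rule conv_crude; (rule u y0 T cs; use that in linarith))
        then show ?thesis by (simp only: One_nat_def)
      qed
      have UUY: "norm ((U * (U * Y)) $ k) \<le> (real k + 1) ^ 2 * (T * (T * (3 * T / c))) * V k" if "k < n" for k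
      proof -
        have "norm ((U * (U * Y)) $ k) \<le> (real k + 1) ^ Suc 1 * (T * (T * (3 * T / c))) * V k"
          by (rule conv_crude; (rule u UY T Tcs; use that in linarith))
        then show ?thesis by (simp only: numeral_2_eq_2 numeral_3_eq_3 One_nat_def)
      qed
      have UUUY: "norm ((U * (U * (U * Y))) $ k) \<le> (real k + 1) ^ 3 * (T * (T * (T * (3 * T / c)))) * V k" if "k < n" for k
      proof -
        have "norm ((U * (U * (U * Y))) $ k) \<le> (real k + 1) ^ Suc 2 * (T * (T * (T * (3 * T / c)))) * V k"
          by (rule conv_crude; (rule u UUY T TT(3); use that in linarith))
        then show ?thesis by (simp only: numeral_2_eq_2 numeral_3_eq_3 One_nat_def)
      qed
      have step: "(real k + 1) ^ m * A * V k \<le> A * X"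
        if "k + j \<le> n" "(real n + 1) ^ m * V (n - j) \<le> X" "0 \<le> A" for k m j A X
      proof -
        have "(real k + 1) ^ m * A * V k = A * ((real k + 1) ^ m * V k)" by simp
        also have "\<dots> \<le> A * ((real n + 1) ^ m * V (n - j))"
          using that V_pos [of k] by (intro mult_left_mono mult_mono power_mono V_mono) auto
        also have "\<dots> \<le> A * X" using that by (intro mult_left_mono) auto
        finally show ?thesis .
      qed
      have LW: "0 \<le> L * W" "0 \<le> 5 / c * (L * W)" "0 \<le> 6 / c * (5 / c * (L * W))" using LW0 c by auto
      have b4: "norm ((p4 * (U * (U * Y))) $ n) \<le> S * (T * (T * (3 * T / c)) * (5 / c * (L * W)))"
      proof (rule shift_boundD [OF p(5)])
        fix k assume k: "k + 4 \<le> n"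
        show "norm ((U * (U * Y)) $ k) \<le> T * (T * (3 * T / c)) * (5 / c * (L * W))"
          by (rule order_trans [OF UUY step [OF k n4 TT(3)]]) (use k in auto)
      qed (use TT LW in \<open>blast intro: mult_nonneg_nonneg\<close>)
      have "(real n + 1) ^ 3 * V (n - 7) \<le> (real n + 1) ^ 3 * V (n - 5)" by (intro mult_left_mono V_mono) auto
      also note n5
      finally have n7: "(real n + 1) ^ 3 * V (n - 7) \<le> 6 / c * (5 / c * (L * W))" .
      have "(real n + 1) ^ 2 * V (n - 6) \<le> (real n + 1) ^ 2 * V (n - 4)" by (intro mult_left_mono V_mono) auto
      also note n4
      finally have n6: "(real n + 1) ^ 2 * V (n - 6) \<le> 5 / c * (L * W)" .
      have b5: "norm ((p5 * (U * (U * (U * Y)))) $ n) \<le> S * (T * (T * (T * (3 * T / c))) * (6 / c * (5 / c * (L * W))))"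
      proof (rule shift_boundD [OF p(6)])
        fix k assume k: "k + 7 \<le> n"
        show "norm ((U * (U * (U * Y))) $ k) \<le> T * (T * (T * (3 * T / c))) * (6 / c * (5 / c * (L * W)))"
          by (rule order_trans [OF UUUY step [OF k n7 TT(4)]]) (use k in auto)
      qed (use TT(4) LW(3) in \<open>blast intro: mult_nonneg_nonneg\<close>)
      have b6: "norm ((p6 * (U * U)) $ n) \<le> S * (T * T * (L * W))"
      proof (rule shift_boundD [OF p(7)])
        fix k assume k: "k + 3 \<le> n"
        have "(real n + 1) ^ 1 * V (n - 3) \<le> L * W" using n3 by simp
        from step [OF k this TT(1)] show "norm ((U * U) $ k) \<le> T * T * (L * W)"
          by (rule order_trans [OF UU, rotated]) (use k in auto)
      qed (use TT LW in \<open>blast intro: mult_nonneg_nonneg\<close>)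
      have b7: "norm ((p7 * (U * (U * U))) $ n) \<le> S * (T * (T * T) * (5 / c * (L * W)))"
      proof (rule shift_boundD [OF p(8)])
        fix k assume k: "k + 6 \<le> n"
        show "norm ((U * (U * U)) $ k) \<le> T * (T * T) * (5 / c * (L * W))"
          by (rule order_trans [OF UUU step [OF k n6 TT(2)]]) (use k in auto)
      qed (use TT LW in \<open>blast intro: mult_nonneg_nonneg\<close>)
      have "Q $ n = (- R0 + p1 * Q + p2 * U + p3 * (U * Y) + p4 * (U * (U * Y)) + p5 * (U * (U * (U * Y)))
       + p6 * (U * U) + p7 * (U * (U * U))) $ n" using Q by (rule arg_cong)
      then have "Q $ n = - (R0 $ n) + (p1 * Q) $ n + (p2 * U) $ n + (p3 * (U * Y)) $ n + (p4 * (U * (U * Y))) $ n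
        + (p5 * (U * (U * (U * Y)))) $ n + (p6 * (U * U)) $ n + (p7 * (U * (U * U))) $ n"
        by (simp only: fps_add_nth fps_neg_nth)
      then have "norm (Q $ n) \<le> norm (R0 $ n) + norm ((p1 * Q) $ n) + norm ((p2 * U) $ n) + norm ((p3 * (U * Y)) $ n)
         + norm ((p4 * (U * (U * Y))) $ n) + norm ((p5 * (U * (U * (U * Y)))) $ n) + norm ((p6 * (U * U)) $ n)
         + norm ((p7 * (U * (U * U))) $ n)"
        by (simp only:) (intro order_trans [OF norm_triangle_ineq] add_mono order_refl; simp)
      also have "\<dots> \<le> S * (L * W) + S * (T0 * (L * W) + B * (L + 4) / \<mu>^2 * W) + S * (T * (L * W))
         + S * (T * (3 * T / c) * (3 * (L * W))) + S * (T * (T * (3 * T / c)) * (5 / c * (L * W)))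
         + S * (T * (T * (T * (3 * T / c))) * (6 / c * (5 / c * (L * W)))) + S * (T * T * (L * W))
         + S * (T * (T * T) * (5 / c * (L * W)))"
        by (intro add_mono b0 b1 b2 b3 b4 b5 b6 b7)
      also have "\<dots> = S * \<Lambda> * W + B * (S * (L + 4) / \<mu>^2) * W"
        unfolding \<Lambda>_def by (simp add: algebra_simps power2_eq_square power3_eq_cube power4_eq_xxxx)
      also have "\<dots> \<le> S * \<Lambda> * W + B * (1/2) * W"
        using mu_S mu B W by (intro add_left_mono mult_right_mono mult_left_mono) (auto simp: pos_divide_le_eq)
      also have "\<dots> = B * W" by (simp add: B_def)
      finally have bQ: "norm (Q $ n) \<le> B * W" .
      obtain m where m: "n = Suc m" "1 \<le> m" using True by (cases n) auto
      have "a * U $ n = Q $ n - (of_nat n + \<nu> + 2) * U $ m" using q [of m] m by simp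
      then have "norm a * norm (U $ n) \<le> norm (Q $ n) + norm (of_nat n + \<nu> + 2) * norm (U $ m)"
        by (metis norm_mult norm_triangle_ineq4)
      also have "\<dots> \<le> B * W + norm a * r n * ((T - P * B / (\<mu> + m)) * V m)"
        using bQ r [OF True] less [of m] m by (intro add_mono mult_mono) (auto intro: order_trans [OF norm_ge_zero])
      also have "\<dots> = B * W + norm a * ((T - P * B / (\<mu> + m)) * V n)"
        using m by (simp add: V_Suc)
      finally have "norm a * norm (U $ n) \<le> B * W + norm a * ((T - P * B / (\<mu> + m)) * V n)" .
      then have "norm (U $ n) \<le> inverse (norm a) * (B * W) + (T - P * B / (\<mu> + m)) * V n"
        using a(1) by (simp add: field_simps)
      also have "\<dots> \<le> P * (B * W) + (T - P * B / (\<mu> + m)) * V n"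
        using a B W by (intro add_right_mono mult_right_mono) auto
      also have "\<dots> = (P * B / (\<mu> + n)^2 + T - P * B / (\<mu> + m)) * V n"
        by (simp add: W_def algebra_simps)
      also have "\<dots> \<le> (T - P * B / (\<mu> + n)) * V n"
      proof (intro mult_right_mono)
        have pos: "0 < \<mu> + m" "0 < \<mu> + n" using mu by auto
        have "1 / (\<mu> + n)^2 \<le> 1 / ((\<mu> + m) * (\<mu> + n))"
          using pos m by (intro divide_left_mono) (auto simp: power2_eq_square)
        also have "\<dots> = 1 / (\<mu> + m) - 1 / (\<mu> + n)" using pos m by (simp add: field_simps)
        finally have "P * B * (1 / (\<mu> + n)^2) \<le> P * B * (1 / (\<mu> + m) - 1 / (\<mu> + n))"
          using PB by (intro mult_left_mono) auto
        then show "P * B / (\<mu> + n)^2 + T - P * B / (\<mu> + m) \<le> T - P * B / (\<mu> + n)"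
          by (simp add: algebra_simps)
      qed (use V_pos [of n] in auto)
      finally show ?thesis using bQ by (simp add: W_def)
    qed
  qed
  have "(T - P * B / (\<mu> + n)) * V n \<le> T * V n" using PB mu V_pos [of n] by (intro mult_right_mono) auto
  with main show ?thesis by (meson order_trans)
qed

end

definition R0p :: "'a::comm_ring_1 \<Rightarrow> (nat \<Rightarrow> nat \<Rightarrow> 'a) \<Rightarrow> (nat \<Rightarrow> nat \<Rightarrow> 'a) \<Rightarrow> 'a \<Rightarrow> 'a" where
  "R0p a D E x = a * H1p E x - 2 * (1 + H2p D x)"

text \<open>The polynomial quotient in \<open>zetap_eq\<close>. The number \<open>\<nu>\<close> is exactly the one for which the terms of
  order \<open>0\<close> and \<open>1\<close> cancel there; \<open>- zetap / (1 + H2)\<close> is the function \<open>\<xi>\<close>.\<close>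

definition zetap :: "'a::comm_ring_1 \<Rightarrow> (nat \<Rightarrow> nat \<Rightarrow> 'a) \<Rightarrow> (nat \<Rightarrow> nat \<Rightarrow> 'a) \<Rightarrow> 'a \<Rightarrow> 'a" where
  "zetap a D E x =
     (a * (2 * E 0 2 + E 2 1 - D 0 2 - D 2 1) + nup a D E * (D 1 1 + D 3 0) - 2 * D 1 1)
     + (a * (D 1 2 - 2 * E 1 2) - nup a D E * (D 0 2 + D 2 1) + 2 * (2 * D 0 2 + D 2 1)) * x
     + (a * (3 * E 0 3 - D 0 3) + nup a D E * D 1 2 - 4 * D 1 2) * x^2
     + (6 * D 0 3 - nup a D E * D 0 3) * x^3"

lemma zetap_eq:
  "(1 + H2p D x) * (a + nup a D E * x) - a * (1 + G1p E x) + 2 * x * G2p D x = x^2 * zetap a D E x"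
  unfolding zetap_def H2p_def G1p_def G2p_def nup_def
  by (simp add: algebra_simps eval_nat_numeral)

text \<open>The equation divided into its leading linear part \<open>Q = x\<^sup>2 U' + (a + (\<nu> + 3) x) U\<close> and terms that
  have a large power of \<open>x\<close> for their degree in \<open>U\<close>. The only linear term in \<open>U\<close> left beside \<open>Q\<close> has
  the factor \<open>x\<^sup>2\<close>, thanks to \<open>zetap_eq\<close>.\<close>

lemma reduced_form_balance:
  fixes a x u v :: "'a::comm_ring_1" and D E
  defines "Y \<equiv> x * v + 3 * x * u" and "Q \<equiv> x * v + (a + (nup a D E + 3) * x) * u"
  shows "a * u + reduced_form a D E x u v = Q -
    (- R0p a D E x + (- H2p D x) * Q + (x^2 * zetap a D E x) * u + (- (x * G2p D x)) * (u * Y)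
     + (x^3 * M21p D x) * (u * (u * Y)) + (- (x^5 * M22p D x)) * (u * (u * (u * Y)))
     + (a * x^2 * M11p E x - 2 * x^3 * M21p D x) * (u * u)
     + (2 * x^5 * M22p D x - a * x^4 * M12p E x) * (u * (u * u)))"
proof -
  have Q: "Q = Y + (a + nup a D E * x) * u" by (simp add: Y_def Q_def algebra_simps)
  show ?thesis
    unfolding reduced_form_def Kp_def Rp_def R0p_def N1q_def N2p_def Y_def [symmetric] zetap_eq [symmetric] Q
    by (simp add: algebra_simps eval_nat_numeral)
qed

text \<open>The series with coefficients \<open>q\<^sub>n\<close>, that is \<open>x\<^sup>2 U' + [a + (\<nu> + 3) x] U\<close>.\<close>

definition stokes_series :: "'a::field \<Rightarrow> (nat \<Rightarrow> nat \<Rightarrow> 'a) \<Rightarrow> (nat \<Rightarrow> nat \<Rightarrow> 'a) \<Rightarrow> 'a fps" where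
  "stokes_series a D E = fps_X * (fps_X * fps_deriv (formal_solution a D E))
      + (fps_const a + (fps_const (nup a D E) + 3) * fps_X) * formal_solution a D E"

lemma stokes_series_0: "stokes_series a D E $ 0 = a * formal_solution a D E $ 0"
  by (simp add: stokes_series_def)

lemma stokes_series_Suc: "stokes_series a D E $ Suc n = a * formal_solution a D E $ Suc n + (of_nat (Suc n) + nup a D E + 2) * formal_solution a D E $ n"
proof -
  have "(fps_const a + (fps_const (nup a D E) + 3) * fps_X) * formal_solution a D E
     = fps_const a * formal_solution a D E + fps_const (nup a D E + 3) * (fps_X * formal_solution a D E)"
    by (simp add: algebra_simps numeral_fps_const fps_const_add [symmetric] del: fps_const_add)
  then show ?thesis
    unfolding stokes_series_def by (cases n) (simp_all add: algebra_simps)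
qed

lemma nup_fps: "nup (fps_const a) (const_coeffs D) (const_coeffs E) = fps_const (nup a D E)"
  by (simp add: nup_def)

text \<open>The shifts of the eight coefficients in \<open>reduced_form_balance\<close>.\<close>

lemma balance_coeffs_shift_bounded:
  fixes a :: "'z \<Rightarrow> complex" and D E :: "'z \<Rightarrow> nat \<Rightarrow> nat \<Rightarrow> complex"
  assumes a: "\<And>z. z \<in> Z \<Longrightarrow> norm (a z) \<le> P" and D: "\<And>z i j. z \<in> Z \<Longrightarrow> i \<le> 3 \<Longrightarrow> j \<le> 3 \<Longrightarrow> norm (D z i j) \<le> P"
    and E: "\<And>z i j. z \<in> Z \<Longrightarrow> i \<le> 3 \<Longrightarrow> j \<le> 3 \<Longrightarrow> norm (E z i j) \<le> P"
  shows "shift_bounded Z 0 (\<lambda>z. R0p (fps_const (a z)) (const_coeffs (D z)) (const_coeffs (E z)) fps_X)"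
    and "shift_bounded Z 1 (\<lambda>z. - H2p (const_coeffs (D z)) fps_X)"
    and "shift_bounded Z 2 (\<lambda>z. fps_X^2 * zetap (fps_const (a z)) (const_coeffs (D z)) (const_coeffs (E z)) fps_X)"
    and "shift_bounded Z 2 (\<lambda>z. - (fps_X * G2p (const_coeffs (D z)) fps_X))"
    and "shift_bounded Z 4 (\<lambda>z. fps_X^3 * M21p (const_coeffs (D z)) fps_X)"
    and "shift_bounded Z 7 (\<lambda>z. - (fps_X^5 * M22p (const_coeffs (D z)) fps_X))"
    and "shift_bounded Z 3 (\<lambda>z. fps_const (a z) * fps_X^2 * M11p (const_coeffs (E z)) fps_X - 2 * fps_X^3 * M21p (const_coeffs (D z)) fps_X)"
    and "shift_bounded Z 6 (\<lambda>z. 2 * fps_X^5 * M22p (const_coeffs (D z)) fps_X - fps_const (a z) * fps_X^4 * M12p (const_coeffs (E z)) fps_X)"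
proof -
  note c = shift_bounded_const [OF a] shift_bounded_const [OF D] shift_bounded_const [OF E]
  show "shift_bounded Z 0 (\<lambda>z. R0p (fps_const (a z)) (const_coeffs (D z)) (const_coeffs (E z)) fps_X)"
    unfolding R0p_def H1p_def H2p_def by (intro shift_bounded_intros0 c; simp)
  have "shift_bounded Z 1 (\<lambda>z. fps_X ^ 1 * - ((fps_const (D z 1 1) + fps_const (D z 3 0))
      - (fps_const (D z 0 2) + fps_const (D z 2 1)) * fps_X + fps_const (D z 1 2) * fps_X^2 - fps_const (D z 0 3) * fps_X^3))"
    by (rule shift_bounded_Xmult) (intro shift_bounded_intros0 c; simp)
  then show "shift_bounded Z 1 (\<lambda>z. - H2p (const_coeffs (D z)) fps_X)"
    by (simp only: H2p_factor power_one_right mult_minus_right)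
  show "shift_bounded Z 2 (\<lambda>z. fps_X^2 * zetap (fps_const (a z)) (const_coeffs (D z)) (const_coeffs (E z)) fps_X)"
    unfolding zetap_def nup_def by (rule shift_bounded_Xmult) (intro shift_bounded_intros0 c; simp)
  have "shift_bounded Z 2 (\<lambda>z. fps_X ^ 2 * - (- fps_const (D z 1 1)
      + (2 * fps_const (D z 0 2) + fps_const (D z 2 1)) * fps_X - 2 * fps_const (D z 1 2) * fps_X^2 + 3 * fps_const (D z 0 3) * fps_X^3))"
    by (rule shift_bounded_Xmult) (intro shift_bounded_intros0 c; simp)
  then show "shift_bounded Z 2 (\<lambda>z. - (fps_X * G2p (const_coeffs (D z)) fps_X))"
    by (simp only: G2p_factor power2_eq_square [of fps_X, symmetric] mult.assoc [of fps_X fps_X, symmetric] mult_minus_right)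
  have "shift_bounded Z 4 (\<lambda>z. fps_X ^ 4 * (fps_const (D z 0 2) - fps_const (D z 1 2) * fps_X + 3 * fps_const (D z 0 3) * fps_X^2))"
    by (rule shift_bounded_Xmult) (intro shift_bounded_intros0 c; simp)
  moreover have "fps_X^3 * M21p (const_coeffs (D z)) fps_X = fps_X ^ 4 * (fps_const (D z 0 2) - fps_const (D z 1 2) * fps_X + 3 * fps_const (D z 0 3) * fps_X^2)" for z
    unfolding M21p_def by (simp add: eval_nat_numeral algebra_simps)
  ultimately show "shift_bounded Z 4 (\<lambda>z. fps_X^3 * M21p (const_coeffs (D z)) fps_X)" by simp
  have "shift_bounded Z 7 (\<lambda>z. fps_X ^ 7 * (- fps_const (D z 0 3)))"
    by (rule shift_bounded_Xmult) (intro shift_bounded_intros0 c; simp)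
  moreover have "- (fps_X^5 * M22p (const_coeffs (D z)) fps_X) = fps_X ^ 7 * (- fps_const (D z 0 3))" for z
    unfolding M22p_def by (simp add: eval_nat_numeral algebra_simps del: fps_const_neg)
  ultimately show "shift_bounded Z 7 (\<lambda>z. - (fps_X^5 * M22p (const_coeffs (D z)) fps_X))" by simp
  have "shift_bounded Z 3 (\<lambda>z. fps_X ^ 3 * (fps_const (a z) * (- fps_const (E z 0 2) + fps_const (E z 1 2) * fps_X - 3 * fps_const (E z 0 3) * fps_X^2)
       - 2 * fps_X * (fps_const (D z 0 2) - fps_const (D z 1 2) * fps_X + 3 * fps_const (D z 0 3) * fps_X^2)))"
    by (rule shift_bounded_Xmult) (intro shift_bounded_intros0 c; simp)
  moreover have "fps_const (a z) * fps_X^2 * M11p (const_coeffs (E z)) fps_X - 2 * fps_X^3 * M21p (const_coeffs (D z)) fps_X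
      = fps_X ^ 3 * (fps_const (a z) * (- fps_const (E z 0 2) + fps_const (E z 1 2) * fps_X - 3 * fps_const (E z 0 3) * fps_X^2)
       - 2 * fps_X * (fps_const (D z 0 2) - fps_const (D z 1 2) * fps_X + 3 * fps_const (D z 0 3) * fps_X^2))" for z
    unfolding M11p_def M21p_def by (simp add: eval_nat_numeral algebra_simps del: fps_const_neg fps_const_mult)
  ultimately show "shift_bounded Z 3 (\<lambda>z. fps_const (a z) * fps_X^2 * M11p (const_coeffs (E z)) fps_X - 2 * fps_X^3 * M21p (const_coeffs (D z)) fps_X)"
    by simp
  have "shift_bounded Z 6 (\<lambda>z. fps_X ^ 6 * (fps_const (a z) * fps_const (E z 0 3) + 2 * fps_X * fps_const (D z 0 3)))"
    by (rule shift_bounded_Xmult) (intro shift_bounded_intros0 c; simp)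
  moreover have "2 * fps_X^5 * M22p (const_coeffs (D z)) fps_X - fps_const (a z) * fps_X^4 * M12p (const_coeffs (E z)) fps_X
     = fps_X ^ 6 * (fps_const (a z) * fps_const (E z 0 3) + 2 * fps_X * fps_const (D z 0 3))" for z
    unfolding M12p_def M22p_def by (simp add: eval_nat_numeral algebra_simps del: fps_const_neg fps_const_mult)
  ultimately show "shift_bounded Z 6 (\<lambda>z. 2 * fps_X^5 * M22p (const_coeffs (D z)) fps_X - fps_const (a z) * fps_X^4 * M12p (const_coeffs (E z)) fps_X)"
    by simp
qed

definition weight_ratio :: "real \<Rightarrow> complex \<Rightarrow> complex \<Rightarrow> nat \<Rightarrow> real" where
  "weight_ratio \<mu> a \<nu> i = max (\<mu>^2) (norm (of_nat i + \<nu> + 2) / norm a)"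

text \<open>The lower bound for \<open>\<mu>\<close> makes the maximum take over the small indices, where \<open>\<bar>i + \<nu> + 2\<bar>\<close> may be
  small or decreasing in \<open>i\<close>.\<close>

lemma weight_ratio_weights:
  assumes P: "1 \<le> P" and a: "a \<noteq> 0" "norm a \<le> P" "inverse (norm a) \<le> P" and nu: "norm \<nu> \<le> 3 * P^2"
    and mu: "6 * P^3 + 2 \<le> \<mu>"
  shows "weights (weight_ratio \<mu> a \<nu>) (1 / (4 * P)) \<mu>"
proof
  define N where "N = 3 * P^2"
  have N: "3 \<le> N" "norm \<nu> \<le> N" using P nu power_mono [of 1 P 2] by (auto simp: N_def)
  have "P^2 \<le> P^3" using P by (intro power_increasing) auto
  moreover have "2 * N * P = 6 * P^3" by (simp add: N_def power2_eq_square power3_eq_cube)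
  moreover have "1 \<le> P^3" using P by simp
  ultimately have mN: "2 * N \<le> \<mu>" "2 * N * P \<le> \<mu>" "2 \<le> \<mu>"
    using mu unfolding N_def by linarith+
  have mu2: "2 * \<mu> \<le> \<mu>^2" using mN(3) by (simp add: power2_eq_square)
  show "0 < 1 / (4 * P)" "1 / (4 * P) \<le> 1" "2 \<le> \<mu>" using P mN by auto
  show "\<mu>^2 \<le> weight_ratio \<mu> a \<nu> i" for i by (simp add: weight_ratio_def)
  show "1 / (4 * P) * (\<mu> + real i) \<le> weight_ratio \<mu> a \<nu> i" for i
  proof (cases "real i \<le> 2 * N")
    case True
    have "1 / (4 * P) * (\<mu> + real i) \<le> 1 * (2 * \<mu>)" using True mN P by (intro mult_mono) auto
    also have "\<dots> \<le> weight_ratio \<mu> a \<nu> i" using mu2 by (simp add: weight_ratio_def)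
    finally show ?thesis .
  next
    case False
    have "norm (of_nat i + 2 :: complex) \<le> norm (of_nat i + \<nu> + 2) + norm \<nu>"
      using norm_triangle_ineq4 [of "of_nat i + \<nu> + 2" \<nu>] by simp
    moreover have "norm (of_nat i + 2 :: complex) = real i + 2"
      using norm_of_nat [of "i + 2", where 'a = complex] by (simp add: add.commute del: norm_of_nat)
    ultimately have "real i / 2 \<le> norm (of_nat i + \<nu> + 2)" using False N by linarith
    moreover have "norm (of_nat i + \<nu> + 2) / P \<le> norm (of_nat i + \<nu> + 2) / norm a"
      using a P by (intro divide_left_mono) auto
    moreover have "real i / 2 / P \<le> norm (of_nat i + \<nu> + 2) / P"
      using calculation P by (intro divide_right_mono) auto
    ultimately have 1: "real i / (2 * P) \<le> weight_ratio \<mu> a \<nu> i" by (simp add: weight_ratio_def)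
    have "\<mu> / (2 * P) \<le> \<mu> / 1" using P mN by (intro divide_left_mono) auto
    also have "\<dots> \<le> weight_ratio \<mu> a \<nu> i" using mu2 mN by (simp add: weight_ratio_def)
    finally have "\<mu> / (2 * P) + real i / (2 * P) \<le> 2 * weight_ratio \<mu> a \<nu> i" using 1 by simp
    then show ?thesis using P by (simp add: field_simps)
  qed
  show "weight_ratio \<mu> a \<nu> i \<le> weight_ratio \<mu> a \<nu> j" if "i \<le> j" for i j
  proof (cases "0 \<le> Re \<nu> + real i + 2")
    case True
    have "norm (of_nat i + \<nu> + 2) \<le> norm (of_nat j + \<nu> + 2)"
      unfolding cmod_def using True that by (auto intro!: real_sqrt_le_mono power_mono)
    then show ?thesis unfolding weight_ratio_def by (intro max.mono divide_right_mono) auto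
  next
    case False
    have "- Re \<nu> \<le> N" using N(2) abs_Re_le_cmod [of \<nu>] by linarith
    with False have "real i + 2 \<le> N" by linarith
    moreover have "norm (of_nat i + \<nu> + 2) \<le> real i + norm \<nu> + 2"
      using norm_triangle_ineq [of "of_nat i + \<nu>" 2] norm_triangle_ineq [of "of_nat i" \<nu>] by simp
    ultimately have "norm (of_nat i + \<nu> + 2) \<le> 2 * N" using N by linarith
    then have "norm (of_nat i + \<nu> + 2) * inverse (norm a) \<le> 2 * N * P" using a N by (intro mult_mono) auto
    also have "\<dots> \<le> \<mu>^2" using mN mu2 by linarith
    finally show ?thesis by (simp add: weight_ratio_def divide_inverse)
  qed
qed

text \<open>Uniform bounds on the parameters give uniform constants; this is the reason for the general set \<open>Z\<close>
  of parameter values.\<close>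

theorem formal_solution_growth:
  fixes a :: "'z \<Rightarrow> complex" and D E :: "'z \<Rightarrow> nat \<Rightarrow> nat \<Rightarrow> complex"
  assumes P: "1 \<le> P" and a: "\<And>z. z \<in> Z \<Longrightarrow> a z \<noteq> 0" "\<And>z. z \<in> Z \<Longrightarrow> norm (a z) \<le> P"
    "\<And>z. z \<in> Z \<Longrightarrow> inverse (norm (a z)) \<le> P"
    and D: "\<And>z i j. z \<in> Z \<Longrightarrow> i \<le> 3 \<Longrightarrow> j \<le> 3 \<Longrightarrow> norm (D z i j) \<le> P"
    and E: "\<And>z i j. z \<in> Z \<Longrightarrow> i \<le> 3 \<Longrightarrow> j \<le> 3 \<Longrightarrow> norm (E z i j) \<le> P"
  obtains T B \<mu>0 where "\<And>\<mu> z. \<mu>0 \<le> \<mu> \<Longrightarrow> z \<in> Z \<Longrightarrow> weights (weight_ratio \<mu> (a z) (nup (a z) (D z) (E z))) (1 / (4 * P)) \<mu>"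
    "\<And>\<mu> z n. \<mu>0 \<le> \<mu> \<Longrightarrow> z \<in> Z \<Longrightarrow> norm (formal_solution (a z) (D z) (E z) $ n) \<le> T * weight (weight_ratio \<mu> (a z) (nup (a z) (D z) (E z))) n"
    "\<And>\<mu> z n. \<mu>0 \<le> \<mu> \<Longrightarrow> z \<in> Z \<Longrightarrow> 2 \<le> n \<Longrightarrow>
        norm (stokes_series (a z) (D z) (E z) $ n) \<le> B * (weight (weight_ratio \<mu> (a z) (nup (a z) (D z) (E z))) n / (\<mu> + n)^2)"
proof -
  define u where "u z = formal_solution (a z) (D z) (E z)" for z
  define q where "q z = stokes_series (a z) (D z) (E z)" for z
  define y where "y z = fps_X * (fps_X * fps_deriv (u z)) + 3 * fps_X * u z" for z
  define \<nu> where "\<nu> z = nup (a z) (D z) (E z)" for z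
  define p0 where "p0 z = R0p (fps_const (a z)) (const_coeffs (D z)) (const_coeffs (E z)) fps_X" for z
  define p1 where "p1 z = - H2p (const_coeffs (D z)) fps_X" for z
  define p2 where "p2 z = fps_X^2 * zetap (fps_const (a z)) (const_coeffs (D z)) (const_coeffs (E z)) fps_X" for z
  define p3 where "p3 z = - (fps_X * G2p (const_coeffs (D z)) fps_X)" for z
  define p4 where "p4 z = fps_X^3 * M21p (const_coeffs (D z)) fps_X" for z
  define p5 where "p5 z = - (fps_X^5 * M22p (const_coeffs (D z)) fps_X)" for z
  define p6 where "p6 z = fps_const (a z) * fps_X^2 * M11p (const_coeffs (E z)) fps_X - 2 * fps_X^3 * M21p (const_coeffs (D z)) fps_X" for z
  define p7 where "p7 z = 2 * fps_X^5 * M22p (const_coeffs (D z)) fps_X - fps_const (a z) * fps_X^4 * M12p (const_coeffs (E z)) fps_X" for z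
  note pd = p0_def p1_def p2_def p3_def p4_def p5_def p6_def p7_def
  note pf = balance_coeffs_shift_bounded [where Z = Z and a = a and D = D and E = E, OF a(2) D E]
  have "shift_bounded Z 0 p0" unfolding p0_def [abs_def] by (rule pf(1))
  then obtain S0 where S0: "\<forall>z\<in>Z. shift_bound 0 S0 (p0 z)" unfolding shift_bounded_def by blast
  have "shift_bounded Z 1 p1" unfolding p1_def [abs_def] by (rule pf(2))
  then obtain S1 where S1: "\<forall>z\<in>Z. shift_bound 1 S1 (p1 z)" unfolding shift_bounded_def by blast
  have "shift_bounded Z 2 p2" unfolding p2_def [abs_def] by (rule pf(3))
  then obtain S2 where S2: "\<forall>z\<in>Z. shift_bound 2 S2 (p2 z)" unfolding shift_bounded_def by blast
  have "shift_bounded Z 2 p3" unfolding p3_def [abs_def] by (rule pf(4))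
  then obtain S3 where S3: "\<forall>z\<in>Z. shift_bound 2 S3 (p3 z)" unfolding shift_bounded_def by blast
  have "shift_bounded Z 4 p4" unfolding p4_def [abs_def] by (rule pf(5))
  then obtain S4 where S4: "\<forall>z\<in>Z. shift_bound 4 S4 (p4 z)" unfolding shift_bounded_def by blast
  have "shift_bounded Z 7 p5" unfolding p5_def [abs_def] by (rule pf(6))
  then obtain S5 where S5: "\<forall>z\<in>Z. shift_bound 7 S5 (p5 z)" unfolding shift_bounded_def by blast
  have "shift_bounded Z 3 p6" unfolding p6_def [abs_def] by (rule pf(7))
  then obtain S6 where S6: "\<forall>z\<in>Z. shift_bound 3 S6 (p6 z)" unfolding shift_bounded_def by blast
  have "shift_bounded Z 6 p7" unfolding p7_def [abs_def] by (rule pf(8))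
  then obtain S7 where S7: "\<forall>z\<in>Z. shift_bound 6 S7 (p7 z)" unfolding shift_bounded_def by blast
  define S where "S = Max (set [0, S0, S1, S2, S3, S4, S5, S6, S7])"
  have Sge: "0 \<le> S" "S0 \<le> S" "S1 \<le> S" "S2 \<le> S" "S3 \<le> S" "S4 \<le> S" "S5 \<le> S" "S6 \<le> S" "S7 \<le> S"
    unfolding S_def by (rule Max_ge; simp)+
  have pS: "shift_bound 0 S (p0 z)" "shift_bound 1 S (p1 z)" "shift_bound 2 S (p2 z)" "shift_bound 2 S (p3 z)" "shift_bound 4 S (p4 z)" "shift_bound 7 S (p5 z)"
    "shift_bound 3 S (p6 z)" "shift_bound 6 S (p7 z)" if "z \<in> Z" for z
    by (rule shift_bound_mono [OF bspec [OF S0 that] order_refl Sge(2)] shift_bound_mono [OF bspec [OF S1 that] order_refl Sge(3)]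
      shift_bound_mono [OF bspec [OF S2 that] order_refl Sge(4)] shift_bound_mono [OF bspec [OF S3 that] order_refl Sge(5)]
      shift_bound_mono [OF bspec [OF S4 that] order_refl Sge(6)] shift_bound_mono [OF bspec [OF S5 that] order_refl Sge(7)]
      shift_bound_mono [OF bspec [OF S6 that] order_refl Sge(8)] shift_bound_mono [OF bspec [OF S7 that] order_refl Sge(9)])+
  have eq: "q z = - p0 z + p1 z * q z + p2 z * u z + p3 z * (u z * y z) + p4 z * (u z * (u z * y z))
      + p5 z * (u z * (u z * (u z * y z))) + p6 z * (u z * u z) + p7 z * (u z * (u z * u z))" if "z \<in> Z" for z
  proof -
    have "fps_const (a z) * u z + reduced_form (fps_const (a z)) (const_coeffs (D z)) (const_coeffs (E z)) fps_X (u z) (fps_X * fps_deriv (u z)) = 0"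
      using formal_solution_solves [OF a(1) [OF that], of "D z" "E z"] by (simp add: u_def reduced_op_def)
    then show ?thesis
      unfolding reduced_form_balance nup_fps pd y_def q_def stokes_series_def u_def [symmetric] right_minus_eq .
  qed
  have y0: "y z $ 0 = 0" for z by (simp add: y_def)
  have yS: "y z $ Suc k = (of_nat k + 3) * u z $ k" for z k
    by (cases k) (simp_all add: y_def mult.assoc algebra_simps numeral_fps_const)
  have qS: "q z $ Suc n = a z * u z $ Suc n + (of_nat (Suc n) + \<nu> z + 2) * u z $ n" for z n
    unfolding q_def u_def \<nu>_def by (rule stokes_series_Suc)
  have P0: "0 \<le> P" using P by simp
  have nu: "norm (\<nu> z) \<le> 3 * P^2" if "z \<in> Z" for z
  proof -
    have "norm (E z 1 1 - D z 1 1 - D z 3 0) \<le> P + P + P"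
      using D [OF that] E [OF that] by (intro norm_triangle_le_diff add_mono) auto
    then have "norm (a z * (E z 1 1 - D z 1 1 - D z 3 0)) \<le> P * (3 * P)"
      unfolding norm_mult using a that P by (intro mult_mono) auto
    then show ?thesis by (simp add: \<nu>_def nup_def power2_eq_square)
  qed
  define T0 where "T0 = max (max S (P * S)) (max (S + S * S) (P * (S + S * S + (3 * P^2 + 3) * (P * S))))"
  have q0: "norm (q z $ 0) \<le> S" if "z \<in> Z" for z
  proof -
    have *: "norm ((p * F) $ 0) \<le> S * 0" if "shift_bound j S p" "1 \<le> j" for p F j
      by (rule shift_boundD [OF that(1)]) (use that in auto)
    have z0: "(p * F) $ 0 = 0" if "shift_bound j S p" "1 \<le> j" for p F j
      using * [OF that, of F] by (simp only: mult_zero_right norm_le_zero_iff)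
    have "q z $ 0 = (- p0 z + p1 z * q z + p2 z * u z + p3 z * (u z * y z) + p4 z * (u z * (u z * y z))
      + p5 z * (u z * (u z * (u z * y z))) + p6 z * (u z * u z) + p7 z * (u z * (u z * u z))) $ 0"
      using eq [OF that] by (rule arg_cong)
    also have "\<dots> = - (p0 z $ 0)"
      unfolding fps_add_nth fps_neg_nth using pS [OF that] by (simp only: z0) (simp add: z0 [OF pS(2) [OF that]] z0 [OF pS(3) [OF that]]
         z0 [OF pS(4) [OF that]] z0 [OF pS(5) [OF that]] z0 [OF pS(6) [OF that]] z0 [OF pS(7) [OF that]] z0 [OF pS(8) [OF that]])
    finally have "norm (q z $ 0) = norm ((p0 z * 1) $ 0)" by simp
    also have "\<dots> \<le> S * 1" by (rule shift_boundD [OF pS(1) [OF that]]) (auto simp: fps_one_nth)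
    finally show ?thesis by simp
  qed
  have q1: "norm (q z $ 1) \<le> S + S * S" if "z \<in> Z" for z
  proof -
    have *: "norm ((p * F) $ 1) \<le> S * 0" if "shift_bound j S p" "2 \<le> j" for p F j
      by (rule shift_boundD [OF that(1)]) (use that in auto)
    have z0: "(p * F) $ 1 = 0" if "shift_bound j S p" "2 \<le> j" for p F j
      using * [OF that, of F] by (simp only: mult_zero_right norm_le_zero_iff)
    have "q z $ 1 = (- p0 z + p1 z * q z + p2 z * u z + p3 z * (u z * y z) + p4 z * (u z * (u z * y z))
      + p5 z * (u z * (u z * (u z * y z))) + p6 z * (u z * u z) + p7 z * (u z * (u z * u z))) $ 1"
      using eq [OF that] by (rule arg_cong)
    also have "\<dots> = - (p0 z $ 1) + (p1 z * q z) $ 1"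
    proof -
      have "(p2 z * F) $ 1 = 0" "(p3 z * F) $ 1 = 0" "(p4 z * F) $ 1 = 0" "(p5 z * F) $ 1 = 0"
        "(p6 z * F) $ 1 = 0" "(p7 z * F) $ 1 = 0" for F
        by (rule z0 [OF pS(3) [OF that]] z0 [OF pS(4) [OF that]] z0 [OF pS(5) [OF that]]
              z0 [OF pS(6) [OF that]] z0 [OF pS(7) [OF that]] z0 [OF pS(8) [OF that]]; simp)+
      then show ?thesis by (simp only: fps_add_nth fps_neg_nth add_0_right)
    qed
    finally have "norm (q z $ 1) \<le> norm ((p0 z * 1) $ 1) + norm ((p1 z * q z) $ 1)"
      using norm_triangle_ineq [of "- (p0 z $ 1)" "(p1 z * q z) $ 1"] by simp
    also have "\<dots> \<le> S * 1 + S * S"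
    proof (intro add_mono)
      show "norm ((p0 z * 1) $ 1) \<le> S * 1" by (rule shift_boundD [OF pS(1) [OF that]]) (auto simp: fps_one_nth)
      show "norm ((p1 z * q z) $ 1) \<le> S * S" by (rule shift_boundD [OF pS(2) [OF that]]) (use q0 [OF that] Sge in auto)
    qed
    finally show ?thesis by simp
  qed
  have u0: "norm (u z $ 0) \<le> P * S" if "z \<in> Z" for z
  proof -
    have "u z $ 0 = inverse (a z) * q z $ 0" using a(1) [OF that] by (simp add: q_def u_def stokes_series_0)
    then have "norm (u z $ 0) = inverse (norm (a z)) * norm (q z $ 0)" by (simp add: norm_mult norm_inverse)
    also have "\<dots> \<le> P * S" using a(3) [OF that] q0 [OF that] P0 by (intro mult_mono) auto
    finally show ?thesis .
  qed
  have u1: "norm (u z $ 1) \<le> P * (S + S * S + (3 * P^2 + 3) * (P * S))" if "z \<in> Z" for z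
  proof -
    have "u z $ 1 = inverse (a z) * (q z $ 1 - (\<nu> z + 3) * u z $ 0)"
      using a(1) [OF that] qS [of z 0] by (simp add: field_simps)
    then have "norm (u z $ 1) = inverse (norm (a z)) * norm (q z $ 1 - (\<nu> z + 3) * u z $ 0)" by (simp add: norm_mult norm_inverse)
    also have "\<dots> \<le> P * (S + S * S + (3 * P^2 + 3) * (P * S))"
    proof (intro mult_mono)
      have "norm ((\<nu> z + 3) * u z $ 0) \<le> (3 * P^2 + 3) * (P * S)"
        unfolding norm_mult using u0 [OF that] nu [OF that] norm_triangle_ineq [of "\<nu> z" 3] by (intro mult_mono) auto
      then show "norm (q z $ 1 - (\<nu> z + 3) * u z $ 0) \<le> S + S * S + (3 * P^2 + 3) * (P * S)"
        using q1 [OF that] by (intro norm_triangle_le_diff add_mono)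
    qed (use a(3) that P0 in auto)
    finally show ?thesis .
  qed
  define c where "c = 1 / (4 * P)"
  define T where "T = T0 + 1"
  define L where "L = 12 / c^3"
  define \<Lambda> where "\<Lambda> = L * (1 + T0 + T + 3 * (T * (3 * T / c)) + T^3 * (3/c) * (5 / c)
     + T^4 * (3/c) * (5/c) * (6/c) + T^2 + T^3 * (5/c))"
  define B where "B = 2 * S * \<Lambda>"
  define \<mu>0 where "\<mu>0 = max (6 * P^3 + 2) (max (P * B) (2 * S * (L + 4)))"
  have w: "weights (weight_ratio \<mu> (a z) (\<nu> z)) c \<mu>" if "\<mu>0 \<le> \<mu>" "z \<in> Z" for \<mu> z
    unfolding c_def using that a nu P by (intro weight_ratio_weights) (auto simp: \<mu>0_def)
  have main: "norm (u z $ n) \<le> T * weight (weight_ratio \<mu> (a z) (\<nu> z)) n \<and>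
      (2 \<le> n \<longrightarrow> norm (q z $ n) \<le> B * (weight (weight_ratio \<mu> (a z) (\<nu> z)) n / (\<mu> + n)^2))" if mz: "\<mu>0 \<le> \<mu>" "z \<in> Z" for \<mu> z n
  proof -
    interpret weights "weight_ratio \<mu> (a z) (\<nu> z)" c \<mu> by (rule w [OF mz])
    have "\<mu> * 1 \<le> \<mu> * \<mu>" using mu by (intro mult_left_mono) auto
    then have mu': "2 * S * (12 / c^3 + 4) \<le> \<mu>^2" using mz by (auto simp: \<mu>0_def L_def power2_eq_square)
    show ?thesis
      unfolding B_def \<Lambda>_def T_def L_def
    proof (rule weighted_growth_bound [OF eq [OF mz(2)] pS [OF mz(2)] y0 yS qS])
      show "0 < norm (a z)" "inverse (norm (a z)) \<le> P" using a mz by auto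
      show "norm (u z $ 0) \<le> T0" "norm (u z $ 1) \<le> T0" "norm (q z $ 0) \<le> T0" "norm (q z $ 1) \<le> T0"
        using u0 u1 q0 q1 mz unfolding T0_def by (auto simp: le_max_iff_disj)
      show "norm (of_nat n + \<nu> z + 2) \<le> norm (a z) * weight_ratio \<mu> (a z) (\<nu> z) n" for n
        using a(1) [OF mz(2)] by (auto simp: weight_ratio_def max_def field_simps)
      show "P * (2 * S * (12 / c ^ 3 * (1 + T0 + (T0 + 1) + 3 * ((T0 + 1) * (3 * (T0 + 1) / c)) + (T0 + 1) ^ 3 * (3 / c) * (5 / c)
         + (T0 + 1) ^ 4 * (3 / c) * (5 / c) * (6 / c) + (T0 + 1)\<^sup>2 + (T0 + 1) ^ 3 * (5 / c)))) \<le> \<mu>"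
        using mz unfolding \<mu>0_def B_def \<Lambda>_def L_def T_def by simp
      show "2 * S * (12 / c^3 + 4) \<le> \<mu>^2" by (rule mu')
    qed
  qed
  show ?thesis
    by (rule that [of \<mu>0 T B]) (use w main in \<open>auto simp: c_def u_def q_def \<nu>_def\<close>)
qed

section \<open>The Stokes constant of the formal solution\<close>

text \<open>Since \<open>1/\<Gamma>(z) = z/\<Gamma>(z + 1)\<close>, the second summand of \<open>g (Suc n)\<close> cancels the previous partial sum.\<close>

lemma telescope_rGamma:
  fixes a \<nu> :: complex and \<theta> g :: "nat \<Rightarrow> complex"
  assumes "g 0 = a * \<theta> 0" "\<And>n. g (Suc n) = a * \<theta> (Suc n) + (of_nat (Suc n) + \<nu> + 2) * \<theta> n"
  shows "(\<Sum>j\<le>N. (-a) ^ j * g j * rGamma (\<nu> + of_nat j + 3)) = a * ((-a) ^ N * \<theta> N * rGamma (\<nu> + of_nat N + 3))"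
proof (induction N)
  case 0 then show ?case by (simp add: assms)
next
  case (Suc N)
  have "rGamma (\<nu> + of_nat N + 3) = (\<nu> + of_nat N + 3) * rGamma (\<nu> + of_nat (Suc N) + 3)"
    using rGamma_plus1 [of "\<nu> + of_nat N + 3"] by (simp add: add_ac)
  then have r: "a * ((-a) ^ N * \<theta> N * rGamma (\<nu> + of_nat N + 3))
     = a * (-a) ^ N * \<theta> N * ((\<nu> + of_nat N + 3) * rGamma (\<nu> + of_nat (Suc N) + 3))" by simp
  show ?case
    unfolding sum.atMost_Suc Suc r assms by (simp add: algebra_simps)
qed

lemma (in weights) V_geometric: "1 \<le> m \<Longrightarrow> V m * (\<mu>^2) ^ j \<le> V (m + j)"
proof (induction j)
  case (Suc j)
  have "V m * (\<mu>^2) ^ Suc j = \<mu>^2 * (V m * (\<mu>^2) ^ j)" by simp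
  also have "\<dots> \<le> r (Suc (m + j)) * V (m + j)"
    using Suc r_mu [of "Suc (m + j)"] V_pos [of m] r_ge_4 [of "Suc (m + j)"] by (intro mult_mono) auto
  also have "\<dots> = V (m + Suc j)" using Suc by (simp add: V_Suc)
  finally show ?case .
qed simp

text \<open>Every ratio is at least \<open>\<mu>\<^sup>2\<close>. The factor \<open>\<mu>\<^sup>4\<close> makes room for the trivial ratios of the first two
  weights.\<close>

lemma (in weights) V_geometric_drop:
  assumes "1 \<le> k" "k \<le> N" shows "V (N - k) * (\<mu>^2) ^ k \<le> \<mu>^4 * V (N - 1)"
proof -
  have m1: "1 \<le> \<mu>^2" using mu by simp
  consider "k < N" | "k = N" "2 \<le> N" | "k = 1" "N = 1" using assms by fastforce
  then show ?thesis
  proof cases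
    case 1
    have "V (N - k) * (\<mu>^2) ^ k = \<mu>^2 * (V (N - k) * (\<mu>^2) ^ (k - 1))"
      using assms by (simp add: power_eq_if)
    also have "\<dots> \<le> \<mu>^2 * V (N - 1)" using V_geometric [of "N - k" "k - 1"] 1 assms by (intro mult_left_mono) auto
    also have "\<dots> \<le> \<mu>^4 * V (N - 1)"
      using V_pos [of "N - 1"] mu power_increasing [of 2 4 \<mu>] by (intro mult_right_mono) auto
    finally show ?thesis .
  next
    case 2
    then obtain M where M: "N = Suc (Suc M)" by (metis add_2_eq_Suc le_Suc_ex)
    have "(\<mu>^2) ^ N = \<mu>^4 * (\<mu>^2) ^ M"
      unfolding M by (simp add: power2_eq_square power4_eq_xxxx mult.assoc)
    then have "V (N - k) * (\<mu>^2) ^ k = \<mu>^4 * (V 1 * (\<mu>^2) ^ M)"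
      using 2 by simp
    also have "\<dots> \<le> \<mu>^4 * V (N - 1)" using V_geometric [of 1 M] M by (intro mult_left_mono) auto
    finally show ?thesis .
  next
    case 3 then show ?thesis using mu power_increasing [of 2 4 \<mu>] by simp
  qed
qed

text \<open>For large \<open>n\<close> the ratio of the weights equals \<open>\<bar>n + \<nu> + 2\<bar> / \<bar>a\<bar>\<close>, so that the product is constant
  in \<open>n\<close>.\<close>

lemma weight_rGamma_bounded:
  fixes a \<nu> :: "'z \<Rightarrow> complex"
  assumes P: "1 \<le> P" and a: "\<And>z. z \<in> Z \<Longrightarrow> a z \<noteq> 0" "\<And>z. z \<in> Z \<Longrightarrow> norm (a z) \<le> P"
    "\<And>z. z \<in> Z \<Longrightarrow> inverse (norm (a z)) \<le> P"
    and nu: "\<And>z. z \<in> Z \<Longrightarrow> norm (\<nu> z) \<le> N"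
  obtains C n0 where "\<And>z n. z \<in> Z \<Longrightarrow> n0 \<le> n \<Longrightarrow>
     weight (weight_ratio \<mu> (a z) (\<nu> z)) n * norm (a z) ^ n * norm (rGamma (\<nu> z + of_nat n + 3)) \<le> C"
proof -
  obtain n0 :: nat where n0: "P * \<mu>^2 + N + 2 \<le> real n0" using real_arch_simple by blast
  have P0: "0 \<le> P" using P by simp
  define n1 where "n1 = max 2 n0"
  have n1: "P * \<mu>^2 + N + 2 \<le> real n1" "2 \<le> n1" using n0 by (auto simp: n1_def)
  have ex: "norm (a z) * weight_ratio \<mu> (a z) (\<nu> z) n = norm (of_nat n + \<nu> z + 2)" if "z \<in> Z" "n1 \<le> n" for z n
  proof -
    have "norm (of_nat n + 2 :: complex) \<le> norm (of_nat n + \<nu> z + 2) + norm (\<nu> z)"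
      using norm_triangle_ineq4 [of "of_nat n + \<nu> z + 2" "\<nu> z"] by simp
    moreover have "norm (of_nat n + 2 :: complex) = real n + 2"
      using norm_of_nat [of "n + 2", where 'a = complex] by (simp add: add.commute del: norm_of_nat)
    ultimately have "P * \<mu>^2 \<le> norm (of_nat n + \<nu> z + 2)" using n1 that nu [OF that(1)] by linarith
    moreover have "norm (a z) * \<mu>^2 \<le> P * \<mu>^2" using a that by (intro mult_right_mono) auto
    ultimately have "\<mu>^2 \<le> norm (of_nat n + \<nu> z + 2) / norm (a z)"
      using a(1) [OF that(1)] by (simp add: pos_le_divide_eq mult.commute)
    then show ?thesis using a(1) [OF that(1)] by (simp add: weight_ratio_def)
  qed
  define W where "W z n = weight (weight_ratio \<mu> (a z) (\<nu> z)) n * norm (a z) ^ n * norm (rGamma (\<nu> z + of_nat n + 3))" for z n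
  have WS: "W z (Suc n) = W z n" if "z \<in> Z" "n1 \<le> n" for z n
  proof -
    have V: "weight (weight_ratio \<mu> (a z) (\<nu> z)) (Suc n) = weight_ratio \<mu> (a z) (\<nu> z) (Suc n) * weight (weight_ratio \<mu> (a z) (\<nu> z)) n"
      using n1 that by (simp add: weight_def mult.commute)
    have r: "rGamma (\<nu> z + of_nat n + 3) = (of_nat (Suc n) + \<nu> z + 2) * rGamma (\<nu> z + of_nat (Suc n) + 3)"
      using rGamma_plus1 [of "\<nu> z + of_nat n + 3"] by (simp add: add_ac)
    have "W z (Suc n) = (norm (a z) * weight_ratio \<mu> (a z) (\<nu> z) (Suc n)) * weight (weight_ratio \<mu> (a z) (\<nu> z)) n * norm (a z) ^ n
        * norm (rGamma (\<nu> z + of_nat (Suc n) + 3))"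
      unfolding W_def V by simp
    also have "norm (a z) * weight_ratio \<mu> (a z) (\<nu> z) (Suc n) = norm (of_nat (Suc n) + \<nu> z + 2)"
      using that by (intro ex) auto
    finally show ?thesis unfolding W_def r norm_mult by (simp only: mult_ac)
  qed
  have W: "W z n = W z n1" if "z \<in> Z" "n1 \<le> n" for z n
    using that(2) by (induction n rule: dec_induct) (auto simp: WS that(1))
  have "compact ((\<lambda>s. norm (rGamma (s + of_nat n1 + 3 :: complex))) ` cball 0 N)"
    by (intro compact_continuous_image continuous_on_norm compact_cball
        holomorphic_on_imp_continuous_on holomorphic_rGamma' holomorphic_intros)
  then have "bounded ((\<lambda>s. norm (rGamma (s + of_nat n1 + 3 :: complex))) ` cball 0 N)"
    by (rule compact_imp_bounded)
  then obtain G where G': "\<forall>x\<in>(\<lambda>s. norm (rGamma (s + of_nat n1 + 3 :: complex))) ` cball 0 N. norm x \<le> G"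
    unfolding bounded_iff by blast
  have G: "norm (rGamma (s + of_nat n1 + 3)) \<le> G" if "norm s \<le> N" for s :: complex
    using bspec [OF G' imageI [of s]] that by simp
  define K where "K = max (\<mu>^2) ((real n1 + N + 2) * P)"
  have K: "weight_ratio \<mu> (a z) (\<nu> z) i \<le> K" if "z \<in> Z" "i \<le> n1" for z i
  proof -
    have "norm (of_nat i + \<nu> z + 2) \<le> real n1 + N + 2"
      using norm_triangle_ineq [of "of_nat i + \<nu> z" 2] norm_triangle_ineq [of "of_nat i" "\<nu> z"] nu [OF that(1)] that by simp
    then have "norm (of_nat i + \<nu> z + 2) * inverse (norm (a z)) \<le> (real n1 + N + 2) * P"
      using a(3) [OF that(1)] P0 by (intro mult_mono) (auto intro: order_trans [OF norm_ge_zero])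
    then show ?thesis unfolding weight_ratio_def K_def by (intro max.mono) (auto simp: divide_inverse)
  qed
  have rw0: "0 \<le> weight_ratio \<mu> (a z) (\<nu> z) i" for z i by (simp add: weight_ratio_def le_max_iff_disj)
  have "W z n \<le> (\<Prod>i\<in>{2..n1}. K) * P ^ n1 * G" if "z \<in> Z" "n1 \<le> n" for z n
    unfolding W [OF that] unfolding W_def weight_def
    using K that rw0 a P0 G [OF nu [OF that(1)]]
    by (intro mult_mono prod_mono power_mono mult_nonneg_nonneg prod_nonneg) (auto intro: order_trans [OF rw0])
  then show ?thesis by (intro that [of n1]) (auto simp: W_def)
qed

definition stokes :: "complex \<Rightarrow> (nat \<Rightarrow> nat \<Rightarrow> complex) \<Rightarrow> (nat \<Rightarrow> nat \<Rightarrow> complex) \<Rightarrow> complex" where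
  "stokes a D E = (\<Sum>j. (-a) ^ j * stokes_series a D E $ j * rGamma (nup a D E + of_nat j + 3)) / a"

lemma stokes_terms_bound:
  fixes a :: "'z \<Rightarrow> complex" and D E :: "'z \<Rightarrow> nat \<Rightarrow> nat \<Rightarrow> complex"
  assumes P: "1 \<le> P" and a: "\<And>z. z \<in> Z \<Longrightarrow> a z \<noteq> 0" "\<And>z. z \<in> Z \<Longrightarrow> norm (a z) \<le> P"
    "\<And>z. z \<in> Z \<Longrightarrow> inverse (norm (a z)) \<le> P"
    and D: "\<And>z i j. z \<in> Z \<Longrightarrow> i \<le> 3 \<Longrightarrow> j \<le> 3 \<Longrightarrow> norm (D z i j) \<le> P"
    and E: "\<And>z i j. z \<in> Z \<Longrightarrow> i \<le> 3 \<Longrightarrow> j \<le> 3 \<Longrightarrow> norm (E z i j) \<le> P"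
  obtains C n0 where "\<And>z n. z \<in> Z \<Longrightarrow> n0 \<le> n \<Longrightarrow>
     norm ((-a z) ^ n * stokes_series (a z) (D z) (E z) $ n * rGamma (nup (a z) (D z) (E z) + of_nat n + 3)) \<le> C * (1 / real n ^ 2)"
proof -
  obtain T B \<mu>0 where g: "\<And>\<mu> z. \<mu>0 \<le> \<mu> \<Longrightarrow> z \<in> Z \<Longrightarrow> weights (weight_ratio \<mu> (a z) (nup (a z) (D z) (E z))) (1 / (4 * P)) \<mu>"
    "\<And>\<mu> z n. \<mu>0 \<le> \<mu> \<Longrightarrow> z \<in> Z \<Longrightarrow> norm (formal_solution (a z) (D z) (E z) $ n) \<le> T * weight (weight_ratio \<mu> (a z) (nup (a z) (D z) (E z))) n"
    "\<And>\<mu> z n. \<mu>0 \<le> \<mu> \<Longrightarrow> z \<in> Z \<Longrightarrow> 2 \<le> n \<Longrightarrow>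
        norm (stokes_series (a z) (D z) (E z) $ n) \<le> B * (weight (weight_ratio \<mu> (a z) (nup (a z) (D z) (E z))) n / (\<mu> + n)^2)"
    by (rule formal_solution_growth [of P Z a D E]; (rule P a D E | rule that); blast)
  have nu: "norm (nup (a z) (D z) (E z)) \<le> 3 * P^2" if "z \<in> Z" for z
  proof -
    have "norm (E z 1 1 - D z 1 1 - D z 3 0) \<le> P + P + P"
      using D [OF that] E [OF that] by (intro norm_triangle_le_diff add_mono) auto
    then have "norm (a z * (E z 1 1 - D z 1 1 - D z 3 0)) \<le> P * (3 * P)"
      unfolding norm_mult using a that P by (intro mult_mono) auto
    then show ?thesis by (simp add: nup_def power2_eq_square)
  qed
  obtain C n0 where C: "\<And>z n. z \<in> Z \<Longrightarrow> n0 \<le> n \<Longrightarrow>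
     weight (weight_ratio \<mu>0 (a z) (nup (a z) (D z) (E z))) n * norm (a z) ^ n * norm (rGamma (nup (a z) (D z) (E z) + of_nat n + 3)) \<le> C"
    by (rule weight_rGamma_bounded [where Z = Z and a = a and P = P and \<nu> = "\<lambda>z. nup (a z) (D z) (E z)" and N = "3 * P^2"]; (rule P a nu | rule that); blast)
  have "norm ((-a z) ^ n * stokes_series (a z) (D z) (E z) $ n * rGamma (nup (a z) (D z) (E z) + of_nat n + 3)) \<le> (\<bar>B\<bar> * C) * (1 / real n ^ 2)"
    if z: "z \<in> Z" and n: "max 2 n0 \<le> n" for z n
  proof -
    interpret weights "weight_ratio \<mu>0 (a z) (nup (a z) (D z) (E z))" "1 / (4 * P)" \<mu>0 by (rule g [OF order_refl z])
    have "norm ((-a z) ^ n * stokes_series (a z) (D z) (E z) $ n * rGamma (nup (a z) (D z) (E z) + of_nat n + 3)) =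
       norm (stokes_series (a z) (D z) (E z) $ n) * (norm (a z) ^ n * norm (rGamma (nup (a z) (D z) (E z) + of_nat n + 3)))"
      by (simp add: norm_mult norm_power)
    also have "\<dots> \<le> (\<bar>B\<bar> * (V n / (\<mu>0 + n)^2)) * (norm (a z) ^ n * norm (rGamma (nup (a z) (D z) (E z) + of_nat n + 3)))"
    proof (intro mult_right_mono)
      have "norm (stokes_series (a z) (D z) (E z) $ n) \<le> B * (V n / (\<mu>0 + n)^2)" using n by (intro g z order_refl) auto
      also have "\<dots> \<le> \<bar>B\<bar> * (V n / (\<mu>0 + n)^2)" using V_pos [of n] by (intro mult_right_mono) auto
      finally show "norm (stokes_series (a z) (D z) (E z) $ n) \<le> \<bar>B\<bar> * (V n / (\<mu>0 + n)^2)" .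
    qed auto
    also have "\<dots> = \<bar>B\<bar> * (V n * norm (a z) ^ n * norm (rGamma (nup (a z) (D z) (E z) + of_nat n + 3))) * (1 / (\<mu>0 + n)^2)"
      by simp
    also have "\<dots> \<le> \<bar>B\<bar> * C * (1 / real n ^ 2)"
    proof (intro mult_mono mult_left_mono)
      show VC: "V n * norm (a z) ^ n * norm (rGamma (nup (a z) (D z) (E z) + of_nat n + 3)) \<le> C" using n by (intro C z) auto
      then have "0 \<le> C" using V_pos [of n] by (intro order_trans [OF _ VC] mult_nonneg_nonneg) auto
      then show "0 \<le> \<bar>B\<bar> * C" by simp
      show "1 / (\<mu>0 + n)^2 \<le> 1 / real n ^ 2"
        using n mu by (intro divide_left_mono power_mono mult_pos_pos) auto
    qed (auto intro!: mult_nonneg_nonneg less_imp_le [OF V_pos])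
    finally show ?thesis .
  qed
  then show ?thesis by (rule that)
qed

lemma const_bounds:
  fixes a :: complex and D E :: "nat \<Rightarrow> nat \<Rightarrow> complex"
  obtains P where "1 \<le> P" "norm a \<le> P" "inverse (norm a) \<le> P"
    "\<And>i j. i \<le> 3 \<Longrightarrow> j \<le> 3 \<Longrightarrow> norm (D i j) \<le> P" "\<And>i j. i \<le> 3 \<Longrightarrow> j \<le> 3 \<Longrightarrow> norm (E i j) \<le> P"
proof -
  define P where "P = 1 + norm a + inverse (norm a) + (\<Sum>(i,j)\<in>{..3}\<times>{..3}. norm (D i j)) + (\<Sum>(i,j)\<in>{..3}\<times>{..3}. norm (E i j))"
  have F: "norm (F i j) \<le> (\<Sum>(i,j)\<in>{..3}\<times>{..3}. norm (F i j))" if "i \<le> 3" "j \<le> 3" for F :: "nat \<Rightarrow> nat \<Rightarrow> complex" and i j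
    using member_le_sum [of "(i,j)" "{..3}\<times>{..3}" "\<lambda>(i,j). norm (F i j)"] that by auto
  have F0: "0 \<le> (\<Sum>(i,j)\<in>{..3}\<times>{..3}. norm (F i j))" for F :: "nat \<Rightarrow> nat \<Rightarrow> complex"
    by (intro sum_nonneg) auto
  have i0: "0 \<le> inverse (norm a)" by simp
  note z = F0 [of D] F0 [of E] i0 norm_ge_zero [of a]
  show ?thesis
  proof (rule that [of P])
    show "norm (D i j) \<le> P" if "i \<le> 3" "j \<le> 3" for i j using F [OF that, of D] z unfolding P_def by linarith
    show "norm (E i j) \<le> P" if "i \<le> 3" "j \<le> 3" for i j using F [OF that, of E] z unfolding P_def by linarith
  qed (use z in \<open>unfold P_def, linarith+\<close>)
qed

lemma stokes_sums:
  assumes "a \<noteq> 0"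
  shows "(\<lambda>j. (-a) ^ j * stokes_series a D E $ j * rGamma (nup a D E + of_nat j + 3)) sums (a * stokes a D E)"
proof -
  obtain P where P: "1 \<le> P" "norm a \<le> P" "inverse (norm a) \<le> P"
    "\<And>i j. i \<le> 3 \<Longrightarrow> j \<le> 3 \<Longrightarrow> norm (D i j) \<le> P" "\<And>i j. i \<le> 3 \<Longrightarrow> j \<le> 3 \<Longrightarrow> norm (E i j) \<le> P"
    by (rule const_bounds [of a D E]) (rule that; blast)
  obtain C n0 where C: "\<And>z n. z \<in> {()} \<Longrightarrow> n0 \<le> n \<Longrightarrow>
     norm ((-a) ^ n * stokes_series a D E $ n * rGamma (nup a D E + of_nat n + 3)) \<le> C * (1 / real n ^ 2)"
    by (rule stokes_terms_bound [of P "{()}" "\<lambda>_. a" "\<lambda>_. D" "\<lambda>_. E"]; (rule P assms | rule that); blast)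
  have "summable (\<lambda>n. C * (1 / real n ^ 2))"
    using inverse_power_summable [of 2, where 'a = real] by (intro summable_mult) (simp add: divide_inverse)
  then have "summable (\<lambda>j. (-a) ^ j * stokes_series a D E $ j * rGamma (nup a D E + of_nat j + 3))"
    by (rule summable_comparison_test') (rule C, rule singletonI)
  moreover have "a * stokes a D E = (\<Sum>j. (-a) ^ j * stokes_series a D E $ j * rGamma (nup a D E + of_nat j + 3))"
    using assms by (simp add: stokes_def)
  ultimately show ?thesis by (simp only: summable_sums)
qed

lemma compact_bounds:
  fixes a :: "complex \<Rightarrow> complex" and D E :: "complex \<Rightarrow> nat \<Rightarrow> nat \<Rightarrow> complex"
  assumes K: "compact K" and a: "continuous_on K a" "\<And>z. z \<in> K \<Longrightarrow> a z \<noteq> 0"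
    and D: "\<And>i j. continuous_on K (\<lambda>z. D z i j)" and E: "\<And>i j. continuous_on K (\<lambda>z. E z i j)"
  obtains P where "1 \<le> P" "\<And>z. z \<in> K \<Longrightarrow> norm (a z) \<le> P" "\<And>z. z \<in> K \<Longrightarrow> inverse (norm (a z)) \<le> P"
    "\<And>z i j. z \<in> K \<Longrightarrow> i \<le> 3 \<Longrightarrow> j \<le> 3 \<Longrightarrow> norm (D z i j) \<le> P"
    "\<And>z i j. z \<in> K \<Longrightarrow> i \<le> 3 \<Longrightarrow> j \<le> 3 \<Longrightarrow> norm (E z i j) \<le> P"
proof -
  define p where "p z = 1 + norm (a z) + inverse (norm (a z)) + (\<Sum>i\<le>3. \<Sum>j\<le>3. norm (D z i j)) + (\<Sum>i\<le>3. \<Sum>j\<le>3. norm (E z i j))" for z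
  have "continuous_on K p"
    unfolding p_def using a by (intro continuous_intros D E) auto
  then have "bounded (p ` K)" by (intro compact_imp_bounded compact_continuous_image K)
  then obtain Q where Q: "\<And>z. z \<in> K \<Longrightarrow> \<bar>p z\<bar> \<le> Q" unfolding bounded_iff by auto
  have F: "norm (F z i j) \<le> (\<Sum>i\<le>3. \<Sum>j\<le>3. norm (F z i j))" if "i \<le> 3" "j \<le> 3"
    for F :: "complex \<Rightarrow> nat \<Rightarrow> nat \<Rightarrow> complex" and z i j
  proof -
    have "norm (F z i j) \<le> (\<Sum>j\<le>3. norm (F z i j))" using that by (intro member_le_sum) auto
    also have "\<dots> \<le> (\<Sum>i\<le>3. \<Sum>j\<le>3. norm (F z i j))"
      using that by (intro member_le_sum [of i "{..3}" "\<lambda>i. \<Sum>j\<le>3. norm (F z i j)"]) (auto intro: sum_nonneg)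
    finally show ?thesis .
  qed
  have F0: "0 \<le> (\<Sum>i\<le>3. \<Sum>j\<le>3. norm (F z i j))" for F :: "complex \<Rightarrow> nat \<Rightarrow> nat \<Rightarrow> complex" and z
    by (intro sum_nonneg) auto
  have i0: "0 \<le> inverse (norm (a z))" for z by simp
  show ?thesis
  proof (rule that [of "max 1 Q"])
    fix z assume z: "z \<in> K"
    note zz = Q [OF z] F0 [of D z] F0 [of E z] i0 [of z] norm_ge_zero [of "a z"]
    show "norm (a z) \<le> max 1 Q" using zz unfolding p_def by linarith
    show "inverse (norm (a z)) \<le> max 1 Q" using zz unfolding p_def by linarith
    fix i j :: nat assume ij: "i \<le> 3" "j \<le> 3"
    show "norm (D z i j) \<le> max 1 Q" using F [OF ij, of D z] zz unfolding p_def by linarith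
    show "norm (E z i j) \<le> max 1 Q" using F [OF ij, of E z] zz unfolding p_def by linarith
  qed auto
qed

theorem stokes_holomorphic:
  fixes a :: "complex \<Rightarrow> complex" and D E :: "complex \<Rightarrow> nat \<Rightarrow> nat \<Rightarrow> complex"
  assumes "open \<Omega>" and a: "a holomorphic_on \<Omega>" "\<And>z. z \<in> \<Omega> \<Longrightarrow> a z \<noteq> 0"
    and D: "\<And>i j. (\<lambda>z. D z i j) holomorphic_on \<Omega>" and E: "\<And>i j. (\<lambda>z. E z i j) holomorphic_on \<Omega>"
  shows "(\<lambda>z. stokes (a z) (D z) (E z)) holomorphic_on \<Omega>"
proof -
  define t where "t z j = (-a z) ^ j * stokes_series (a z) (D z) (E z) $ j * rGamma (nup (a z) (D z) (E z) + of_nat j + 3)" for z j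
  have hu: "hol_fps \<Omega> (\<lambda>z. formal_solution (a z) (D z) (E z))" by (rule hol_formal_solution [OF a(1) D E a(2)])
  have hq: "(\<lambda>z. stokes_series (a z) (D z) (E z) $ j) holomorphic_on \<Omega>" for j
  proof -
    have "hol_fps \<Omega> (\<lambda>z. stokes_series (a z) (D z) (E z))"
      unfolding stokes_series_def by (intro hol_fps_intros hu a) (auto simp: nup_def intro!: holomorphic_intros a D E)
    then show ?thesis by (simp add: hol_fps_def)
  qed
  have ht: "(\<lambda>z. t z j) holomorphic_on \<Omega>" for j
    unfolding t_def nup_def by (intro holomorphic_intros a D E hq)
  have "(\<lambda>z. \<Sum>j. t z j) holomorphic_on \<Omega>"
  proof (rule holomorphic_uniform_sequence [OF \<open>open \<Omega>\<close>])
    show "(\<lambda>z. \<Sum>j<n. t z j) holomorphic_on \<Omega>" for n by (intro holomorphic_on_sum ht)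
    fix z0 assume "z0 \<in> \<Omega>"
    with \<open>open \<Omega>\<close> obtain e where e: "0 < e" "cball z0 e \<subseteq> \<Omega>" using open_contains_cball by blast
    have c: "continuous_on (cball z0 e) f" if "f holomorphic_on \<Omega>" for f
      using that e holomorphic_on_imp_continuous_on holomorphic_on_subset by blast
    have a2: "a z \<noteq> 0" if "z \<in> cball z0 e" for z using a(2) e that by blast
    obtain P where P: "1 \<le> P" "\<And>z. z \<in> cball z0 e \<Longrightarrow> norm (a z) \<le> P" "\<And>z. z \<in> cball z0 e \<Longrightarrow> inverse (norm (a z)) \<le> P"
      "\<And>z i j. z \<in> cball z0 e \<Longrightarrow> i \<le> 3 \<Longrightarrow> j \<le> 3 \<Longrightarrow> norm (D z i j) \<le> P"
      "\<And>z i j. z \<in> cball z0 e \<Longrightarrow> i \<le> 3 \<Longrightarrow> j \<le> 3 \<Longrightarrow> norm (E z i j) \<le> P"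
      by (rule compact_bounds [of "cball z0 e" a D E]; (rule compact_cball c [OF a(1)] a2 c [OF D] c [OF E] | rule that); blast)
    obtain C n0 where C: "\<And>z n. z \<in> cball z0 e \<Longrightarrow> n0 \<le> n \<Longrightarrow>
        norm ((-a z) ^ n * stokes_series (a z) (D z) (E z) $ n * rGamma (nup (a z) (D z) (E z) + of_nat n + 3)) \<le> C * (1 / real n ^ 2)"
      by (rule stokes_terms_bound [of P "cball z0 e" a D E]; (rule P a2 | rule that); blast)
    have "summable (\<lambda>n. C * (1 / real n ^ 2))"
      using inverse_power_summable [of 2, where 'a = real] by (intro summable_mult) (simp add: divide_inverse)
    then have "uniform_limit (cball z0 e) (\<lambda>n z. \<Sum>j<n. t z j) (\<lambda>z. \<Sum>j. t z j) sequentially"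
    proof (rule Weierstrass_m_test_ev [rotated])
      show "\<forall>\<^sub>F n in sequentially. \<forall>x\<in>cball z0 e. norm (t x n) \<le> C * (1 / real n ^ 2)"
        using C unfolding t_def by (intro eventually_mono [OF eventually_ge_at_top [of n0]]) blast
    qed
    then show "\<exists>d>0. cball z0 d \<subseteq> \<Omega> \<and> uniform_limit (cball z0 d) (\<lambda>n z. \<Sum>j<n. t z j) (\<lambda>z. \<Sum>j. t z j) sequentially"
      using e by blast
  qed
  then have "(\<lambda>z. (\<Sum>j. t z j) / a z) holomorphic_on \<Omega>" by (intro holomorphic_intros a)
  then show ?thesis unfolding stokes_def t_def .
qed

text \<open>In the convolution of \<open>m\<close> with \<open>U\<close> the terms with \<open>k \<ge> 1\<close> are bounded by a geometric series times
  \<open>V (N - 1)\<close>, provided that \<open>\<mu>\<^sup>2\<close> exceeds twice the exponential rate \<open>R\<close>, and \<open>V (N - 1) / V N\<close> is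
  of order \<open>1 / N\<close>. So \<open>m U\<close> and \<open>U\<close> have the same normalised limit, and by telescoping so do the
  series.\<close>

theorem stokes_invariant:
  fixes m :: "complex fps"
  assumes a: "a \<noteq> 0" and AR: "0 < R" "0 \<le> A" "\<And>n. norm (m $ n) \<le> A * R ^ n" and m: "m $ 0 = 1"
    and g: "g 0 = a * (m * formal_solution a D E) $ 0"
      "\<And>n. g (Suc n) = a * (m * formal_solution a D E) $ Suc n + (of_nat (Suc n) + nup a D E + 2) * (m * formal_solution a D E) $ n"
  shows "(\<lambda>j. (-a) ^ j * g j * rGamma (nup a D E + of_nat j + 3)) sums (a * stokes a D E)"
proof -
  define \<nu> where "\<nu> = nup a D E"
  define u where "u = formal_solution a D E"
  define G where "G N = (-a) ^ N * rGamma (\<nu> + of_nat N + 3)" for N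
  obtain P where P: "1 \<le> P" "norm a \<le> P" "inverse (norm a) \<le> P"
    "\<And>i j. i \<le> 3 \<Longrightarrow> j \<le> 3 \<Longrightarrow> norm (D i j) \<le> P" "\<And>i j. i \<le> 3 \<Longrightarrow> j \<le> 3 \<Longrightarrow> norm (E i j) \<le> P"
    by (rule const_bounds [of a D E]) (rule that; blast)
  have "\<exists>T \<mu>0. \<forall>\<mu>\<ge>\<mu>0. weights (weight_ratio \<mu> a \<nu>) (1 / (4 * P)) \<mu> \<and> (\<forall>n. norm (u $ n) \<le> T * weight (weight_ratio \<mu> a \<nu>) n)"
  proof (rule formal_solution_growth [of P "{()}" "\<lambda>_. a" "\<lambda>_. D" "\<lambda>_. E"])
    fix T B \<mu>0
    assume W: "\<And>\<mu> z. \<mu>0 \<le> \<mu> \<Longrightarrow> z \<in> {()} \<Longrightarrow> weights (weight_ratio \<mu> a (nup a D E)) (1 / (4 * P)) \<mu>"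
      and U: "\<And>\<mu> z n. \<mu>0 \<le> \<mu> \<Longrightarrow> z \<in> {()} \<Longrightarrow> norm (formal_solution a D E $ n) \<le> T * weight (weight_ratio \<mu> a (nup a D E)) n"
    show ?thesis
      unfolding u_def \<nu>_def using W [OF _ singletonI] U [OF _ singletonI] by (intro exI [of _ T] exI [of _ \<mu>0]) simp
  qed (rule P a; assumption)+
  then obtain T \<mu>0 where W: "\<And>\<mu>. \<mu>0 \<le> \<mu> \<Longrightarrow> weights (weight_ratio \<mu> a \<nu>) (1 / (4 * P)) \<mu>"
    and U: "\<And>\<mu> n. \<mu>0 \<le> \<mu> \<Longrightarrow> norm (u $ n) \<le> T * weight (weight_ratio \<mu> a \<nu>) n" by blast
  define \<mu> where "\<mu> = max \<mu>0 (2 * R + 1)"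
  interpret weights "weight_ratio \<mu> a \<nu>" "1 / (4 * P)" \<mu> by (rule W) (auto simp: \<mu>_def)
  have u: "norm (u $ n) \<le> T * V n" for n by (rule U) (auto simp: \<mu>_def)
  have T: "0 \<le> T" using order_trans [OF norm_ge_zero u [of 0]] by simp
  have R2: "2 * R \<le> \<mu>^2"
  proof -
    have "2 * R \<le> \<mu> * 1" by (simp add: \<mu>_def)
    also have "\<dots> \<le> \<mu> * \<mu>" using mu by (intro mult_left_mono) auto
    finally show ?thesis by (simp add: power2_eq_square)
  qed
  obtain C n0 where C: "\<And>z n. z \<in> {()} \<Longrightarrow> n0 \<le> n \<Longrightarrow> V n * norm a ^ n * norm (rGamma (\<nu> + of_nat n + 3)) \<le> C"
    by (rule weight_rGamma_bounded [of P "{()}" "\<lambda>_. a" "\<lambda>_. \<nu>" "norm \<nu>" \<mu>]; (rule P a order_refl | rule that); blast)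
  have C': "V n * norm (G n) \<le> C" if "n0 \<le> n" for n
    using C [of "()" n] that by (simp add: G_def norm_mult norm_power mult.assoc)
  have lim: "(\<lambda>N. G N * u $ N) \<longlonglongrightarrow> stokes a D E"
  proof -
    have "(\<lambda>N. \<Sum>j\<le>N. (-a) ^ j * stokes_series a D E $ j * rGamma (\<nu> + of_nat j + 3)) \<longlonglongrightarrow> a * stokes a D E"
      using stokes_sums [OF a, of D E] by (simp add: sums_def_le \<nu>_def)
    also have "(\<lambda>N. \<Sum>j\<le>N. (-a) ^ j * stokes_series a D E $ j * rGamma (\<nu> + of_nat j + 3)) = (\<lambda>N. a * (G N * u $ N))"
      unfolding \<nu>_def u_def G_def by (subst telescope_rGamma [OF stokes_series_0 stokes_series_Suc]) (simp add: mult_ac)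
    finally show ?thesis by (simp only: tendsto_mult_left_iff [OF a])
  qed
  have diff: "norm ((m * u) $ N - u $ N) \<le> 2 * A * T * \<mu>^4 * V (N - 1)" if "1 \<le> N" for N
  proof -
    have "(m * u) $ N - u $ N = (\<Sum>k=1..N. m $ k * u $ (N - k))"
      unfolding fps_mult_nth using m by (simp add: sum.atLeast_Suc_atMost)
    also have "norm \<dots> \<le> (\<Sum>k=1..N. A * T * \<mu>^4 * V (N - 1) * (1/2) ^ k)"
    proof (rule sum_norm_le)
      fix k assume k: "k \<in> {1..N}"
      have m0: "0 < \<mu>^2" using mu by simp
      have "norm (m $ k * u $ (N - k)) \<le> (A * R ^ k) * (T * V (N - k))"
        unfolding norm_mult using AR u T by (intro mult_mono) auto
      also have "\<dots> = A * T * (R ^ k * V (N - k))" by simp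
      also have "\<dots> \<le> A * T * ((\<mu>^2 / 2) ^ k * V (N - k))"
        using AR T R2 V_pos [of "N - k"] by (intro mult_left_mono mult_right_mono power_mono) auto
      also have "\<dots> = A * T * (1/2) ^ k * (V (N - k) * (\<mu>^2) ^ k)"
        by (simp add: power_divide)
      also have "\<dots> \<le> A * T * (1/2) ^ k * (\<mu>^4 * V (N - 1))"
        using AR T k V_geometric_drop [of k N] by (intro mult_left_mono) auto
      finally show "norm (m $ k * u $ (N - k)) \<le> A * T * \<mu>^4 * V (N - 1) * (1/2) ^ k"
        by (simp add: mult_ac)
    qed
    also have "\<dots> = A * T * \<mu>^4 * V (N - 1) * (\<Sum>k=1..N. (1/2) ^ k)" by (simp add: sum_distrib_left)
    also have "\<dots> \<le> A * T * \<mu>^4 * V (N - 1) * 2"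
    proof (intro mult_left_mono)
      have "(\<Sum>k=1..N. (1/2::real) ^ k) \<le> (\<Sum>k. (1/2) ^ k)"
        by (intro sum_le_suminf) auto
      then show "(\<Sum>k=1..N. (1/2::real) ^ k) \<le> 2" by (simp add: suminf_geometric)
    qed (use AR T V_pos [of "N - 1"] in auto)
    finally show ?thesis by simp
  qed
  have "(\<lambda>N. G N * ((m * u) $ N - u $ N)) \<longlonglongrightarrow> 0"
  proof (rule Lim_null_comparison)
    show "\<forall>\<^sub>F N in sequentially. norm (G N * ((m * u) $ N - u $ N)) \<le> 2 * A * T * \<mu>^4 * C * (4 * P) * inverse (real N)"
    proof (rule eventually_mono [OF eventually_ge_at_top [of "max 2 n0"]])
      fix N assume N: "max 2 n0 \<le> N"
      have "1 \<le> N - 1" "Suc (N - 1) = N" using N by auto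
      then have V: "V N = weight_ratio \<mu> a \<nu> N * V (N - 1)" using V_Suc [of "N - 1"] by simp
      have r: "real N / (4 * P) \<le> weight_ratio \<mu> a \<nu> N"
        by (rule order_trans [OF _ r_lin]) (use N P mu in \<open>auto simp: field_simps\<close>)
      have N0: "0 < real N / (4 * P)" using N P by auto
            have "real N / (4 * P) * V (N - 1) * norm (G N) \<le> V N * norm (G N)"
        unfolding V using r V_pos [of "N - 1"] by (intro mult_right_mono) auto
      also have "\<dots> \<le> C" using C' [of N] N by simp
      finally have *: "V (N - 1) * norm (G N) \<le> C * (4 * P) * inverse (real N)"
        using N P by (simp add: divide_simps mult_ac)
      have "norm (G N * ((m * u) $ N - u $ N)) \<le> norm (G N) * (2 * A * T * \<mu>^4 * V (N - 1))"
        unfolding norm_mult using diff [of N] N by (intro mult_left_mono) auto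
      also have "\<dots> = 2 * A * T * \<mu>^4 * (V (N - 1) * norm (G N))" by simp
      also have "\<dots> \<le> 2 * A * T * \<mu>^4 * (C * (4 * P) * inverse (real N))"
        using * AR T by (intro mult_left_mono) auto
      finally show "norm (G N * ((m * u) $ N - u $ N)) \<le> 2 * A * T * \<mu>^4 * C * (4 * P) * inverse (real N)"
        by (simp only: mult_ac)
    qed
    show "(\<lambda>N. 2 * A * T * \<mu>^4 * C * (4 * P) * inverse (real N)) \<longlonglongrightarrow> 0"
      by (intro tendsto_mult_right_zero lim_inverse_n)
  qed
  then have "(\<lambda>N. G N * u $ N + G N * ((m * u) $ N - u $ N)) \<longlonglongrightarrow> stokes a D E + 0"
    by (intro tendsto_add lim)
  then have "(\<lambda>N. a * (G N * (m * u) $ N)) \<longlonglongrightarrow> a * stokes a D E"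
    by (intro tendsto_mult_left) (simp add: algebra_simps)
  also have "(\<lambda>N. a * (G N * (m * u) $ N)) = (\<lambda>N. \<Sum>j\<le>N. (-a) ^ j * g j * rGamma (\<nu> + of_nat j + 3))"
    unfolding \<nu>_def u_def G_def by (subst telescope_rGamma [OF g]) (simp add: mult_ac)
  finally show ?thesis by (simp add: sums_def_le \<nu>_def)
qed

section \<open>Asymptotic expansions at a one-sided limit\<close>

definition partial_sum :: "real fps \<Rightarrow> nat \<Rightarrow> real \<Rightarrow> real" where
  "partial_sum A N x = (\<Sum>n<N. A $ n * x ^ n)"

text \<open>Asymptotic expansion at \<open>0\<close> from the right, up to an error of order \<open>x\<^sup>N\<close>.\<close>

definition expands_upto :: "nat \<Rightarrow> (real \<Rightarrow> real) \<Rightarrow> real fps \<Rightarrow> bool" where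
  "expands_upto N f A \<longleftrightarrow> (\<exists>C. \<forall>\<^sub>F x in at_right 0. \<bar>f x - partial_sum A N x\<bar> \<le> C * x ^ N)"

definition expands :: "(real \<Rightarrow> real) \<Rightarrow> real fps \<Rightarrow> bool" where
  "expands f A \<longleftrightarrow> (\<forall>N. expands_upto N f A)"

lemma partial_sum_0 [simp]: "partial_sum A 0 x = 0" by (simp add: partial_sum_def)

lemma partial_sum_Suc: "partial_sum A (Suc N) x = A $ 0 + x * partial_sum (fps_shift 1 A) N x"
  unfolding partial_sum_def by (subst sum.lessThan_Suc_shift) (simp add: sum_distrib_left mult_ac)

lemma eventually_right_pos: "\<forall>\<^sub>F x in at_right (0::real). 0 < x"
  by (simp add: eventually_at_right_less)

lemma eventually_right_less: "0 < (d::real) \<Longrightarrow> \<forall>\<^sub>F x in at_right (0::real). x < d"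
  by (simp add: eventually_at_right_field) (auto intro: exI [of _ d])

lemma expands_upto_cong:
  assumes "\<forall>\<^sub>F x in at_right 0. f x = g x" "expands_upto N f A" shows "expands_upto N g A"
proof -
  obtain C where "\<forall>\<^sub>F x in at_right 0. \<bar>f x - partial_sum A N x\<bar> \<le> C * x ^ N" using assms(2) by (auto simp: expands_upto_def)
  with assms(1) have "\<forall>\<^sub>F x in at_right 0. \<bar>g x - partial_sum A N x\<bar> \<le> C * x ^ N"
    by eventually_elim simp
  then show ?thesis by (auto simp: expands_upto_def)
qed

lemma expands_cong: "expands f A \<Longrightarrow> \<forall>\<^sub>F x in at_right 0. f x = g x \<Longrightarrow> expands g A"
  unfolding expands_def using expands_upto_cong by blast

lemma expands_upto_add:
  assumes "expands_upto N f A" "expands_upto N g B" shows "expands_upto N (\<lambda>x. f x + g x) (A + B)"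
proof -
  obtain C where 1: "\<forall>\<^sub>F x in at_right 0. \<bar>f x - partial_sum A N x\<bar> \<le> C * x ^ N" using assms(1) by (auto simp: expands_upto_def)
  obtain C' where 2: "\<forall>\<^sub>F x in at_right 0. \<bar>g x - partial_sum B N x\<bar> \<le> C' * x ^ N" using assms(2) by (auto simp: expands_upto_def)
  have p: "partial_sum (A + B) N x = partial_sum A N x + partial_sum B N x" for x
    by (simp add: partial_sum_def sum.distrib algebra_simps)
  from 1 2 have "\<forall>\<^sub>F x in at_right 0. \<bar>f x + g x - partial_sum (A + B) N x\<bar> \<le> (C + C') * x ^ N"
    by eventually_elim (auto simp: p algebra_simps)
  then show ?thesis unfolding expands_upto_def by blast
qed

lemma expands_upto_cmult:
  assumes "expands_upto N f A" shows "expands_upto N (\<lambda>x. c * f x) (fps_const c * A)"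
proof -
  obtain C where 1: "\<forall>\<^sub>F x in at_right 0. \<bar>f x - partial_sum A N x\<bar> \<le> C * x ^ N" using assms(1) by (auto simp: expands_upto_def)
  have p: "partial_sum (fps_const c * A) N x = c * partial_sum A N x" for x
    by (simp add: partial_sum_def sum_distrib_left mult_ac)
  from 1 have "\<forall>\<^sub>F x in at_right 0. \<bar>c * f x - partial_sum (fps_const c * A) N x\<bar> \<le> (\<bar>c\<bar> * C) * x ^ N"
  proof eventually_elim
    case (elim x)
    have "\<bar>c * f x - partial_sum (fps_const c * A) N x\<bar> = \<bar>c\<bar> * \<bar>f x - partial_sum A N x\<bar>"
      by (simp add: p abs_mult [symmetric] right_diff_distrib)
    also have "\<dots> \<le> \<bar>c\<bar> * (C * x ^ N)" using elim by (intro mult_left_mono) auto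
    finally show ?case by simp
  qed
  then show ?thesis unfolding expands_upto_def by blast
qed

text \<open>Division by \<open>x\<close> lowers the order by one; products are treated by induction along
  this equivalence.\<close>

lemma expands_upto_shift:
  "expands_upto (Suc N) f A \<longleftrightarrow> expands_upto N (\<lambda>x. (f x - A $ 0) / x) (fps_shift 1 A)"
proof -
  have "(\<forall>\<^sub>F x in at_right 0. \<bar>f x - partial_sum A (Suc N) x\<bar> \<le> C * x ^ Suc N) \<longleftrightarrow>
        (\<forall>\<^sub>F x in at_right 0. \<bar>(f x - A $ 0) / x - partial_sum (fps_shift 1 A) N x\<bar> \<le> C * x ^ N)" for C
  proof (rule eventually_cong [OF eventually_right_pos])
    fix x :: real assume x: "0 < x"
    have "f x - partial_sum A (Suc N) x = x * ((f x - A $ 0) / x - partial_sum (fps_shift 1 A) N x)"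
      using x by (simp add: partial_sum_Suc field_simps)
    then have "\<bar>f x - partial_sum A (Suc N) x\<bar> = x * \<bar>(f x - A $ 0) / x - partial_sum (fps_shift 1 A) N x\<bar>"
      using x by (simp add: abs_mult)
    then show "(\<bar>f x - partial_sum A (Suc N) x\<bar> \<le> C * x ^ Suc N) = (\<bar>(f x - A $ 0) / x - partial_sum (fps_shift 1 A) N x\<bar> \<le> C * x ^ N)"
      using x by (simp add: mult.left_commute [of C])
  qed
  then show ?thesis unfolding expands_upto_def by simp
qed

lemma expands_upto_less: "expands_upto (Suc N) f A \<Longrightarrow> expands_upto N f A"
proof -
  assume "expands_upto (Suc N) f A"
  then obtain C where 1: "\<forall>\<^sub>F x in at_right 0. \<bar>f x - partial_sum A (Suc N) x\<bar> \<le> C * x ^ Suc N" by (auto simp: expands_upto_def)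
  have "\<forall>\<^sub>F x in at_right 0. \<bar>f x - partial_sum A N x\<bar> \<le> (\<bar>C\<bar> + \<bar>A $ N\<bar>) * x ^ N"
    using 1 eventually_right_pos eventually_right_less [OF zero_less_one]
  proof eventually_elim
    case (elim x)
    have "x ^ Suc N \<le> 1 * x ^ N" using elim by (simp del: mult_1_left add: mult_right_mono)
    then have "C * x ^ Suc N \<le> \<bar>C\<bar> * x ^ N"
      using elim by (intro mult_mono) auto
    moreover have "partial_sum A (Suc N) x = partial_sum A N x + A $ N * x ^ N" by (simp add: partial_sum_def)
    moreover have "\<bar>A $ N * x ^ N\<bar> = \<bar>A $ N\<bar> * x ^ N" using elim by (simp add: abs_mult)
    ultimately show ?case using elim(1) unfolding distrib_right by linarith
  qed
  then show ?thesis unfolding expands_upto_def by blast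
qed

lemma expands_upto_mult:
  "expands_upto N f A \<Longrightarrow> expands_upto N g B \<Longrightarrow> expands_upto N (\<lambda>x. f x * g x) (A * B)"
proof (induction N arbitrary: f A)
  case 0
  then obtain C C' where 1: "\<forall>\<^sub>F x in at_right 0. \<bar>f x\<bar> \<le> C" and 2: "\<forall>\<^sub>F x in at_right 0. \<bar>g x\<bar> \<le> C'" by (auto simp: expands_upto_def)
  from 1 2 have "\<forall>\<^sub>F x in at_right 0. \<bar>f x * g x\<bar> \<le> C * C'"
    by eventually_elim (auto simp: abs_mult intro!: mult_mono)
  then show ?case by (auto simp: expands_upto_def)
next
  case (Suc N)
  have 1: "expands_upto N (\<lambda>x. (f x - A $ 0) / x) (fps_shift 1 A)" using Suc.prems(1) by (simp add: expands_upto_shift)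
  have 2: "expands_upto N g B" using Suc.prems(2) by (rule expands_upto_less)
  have 3: "expands_upto N (\<lambda>x. A $ 0 * ((g x - B $ 0) / x)) (fps_const (A $ 0) * fps_shift 1 B)"
    using Suc.prems(2) by (intro expands_upto_cmult) (simp add: expands_upto_shift)
  have 4: "expands_upto N (\<lambda>x. (f x - A $ 0) / x * g x + A $ 0 * ((g x - B $ 0) / x))
       (fps_shift 1 A * B + fps_const (A $ 0) * fps_shift 1 B)"
    by (intro expands_upto_add Suc.IH 1 2 3)
  have "fps_shift 1 A * B + fps_const (A $ 0) * fps_shift 1 B = fps_shift 1 (A * B)"
  proof (rule fps_ext)
    fix n
    have "(\<Sum>i=0..Suc n. A $ i * B $ (Suc n - i)) = A $ 0 * B $ Suc n + (\<Sum>i=0..n. A $ Suc i * B $ (n - i))"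
      by (subst sum.atLeast0_atMost_Suc_shift) simp
    then show "(fps_shift 1 A * B + fps_const (A $ 0) * fps_shift 1 B) $ n = fps_shift 1 (A * B) $ n"
      unfolding fps_add_nth fps_mult_left_const_nth fps_shift_nth by (simp add: fps_mult_nth del: sum.atLeast0_atMost_Suc)
  qed
  with 4 have 5: "expands_upto N (\<lambda>x. (f x - A $ 0) / x * g x + A $ 0 * ((g x - B $ 0) / x)) (fps_shift 1 (A * B))" by simp
  have 6: "\<forall>\<^sub>F x in at_right 0. (f x - A $ 0) / x * g x + A $ 0 * ((g x - B $ 0) / x) = (f x * g x - (A * B) $ 0) / x"
    using eventually_right_pos by eventually_elim (simp add: field_simps)
  show ?case unfolding expands_upto_shift by (rule expands_upto_cong [OF 6 5])
qed

named_theorems expands_intros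

lemma expands_add [expands_intros]: "expands f A \<Longrightarrow> expands g B \<Longrightarrow> expands (\<lambda>x. f x + g x) (A + B)"
  by (simp add: expands_def expands_upto_add)

lemma expands_mult [expands_intros]: "expands f A \<Longrightarrow> expands g B \<Longrightarrow> expands (\<lambda>x. f x * g x) (A * B)"
  by (simp add: expands_def expands_upto_mult)

lemma expands_const [expands_intros]: "expands (\<lambda>x. c) (fps_const c)"
  unfolding expands_def
proof
  fix N
  have "partial_sum (fps_const c) N x = (if N = 0 then 0 else c)" for x
    by (cases N) (simp_all add: partial_sum_Suc, simp add: partial_sum_def)
  then show "expands_upto N (\<lambda>x. c) (fps_const c)"
    unfolding expands_upto_def by (intro exI [of _ "\<bar>c\<bar>"] eventually_mono [OF eventually_right_pos]) auto
qed

lemma expands_minus [expands_intros]: "expands f A \<Longrightarrow> expands (\<lambda>x. - f x) (- A)"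
  using expands_mult [OF expands_const [of "-1"]] by (simp add: fps_const_neg [symmetric] del: fps_const_neg)

lemma expands_diff [expands_intros]: "expands f A \<Longrightarrow> expands g B \<Longrightarrow> expands (\<lambda>x. f x - g x) (A - B)"
  using expands_add [OF _ expands_minus, of f A g B] by simp

lemma expands_0 [expands_intros]: "expands (\<lambda>x. 0) 0" using expands_const [of 0] by simp
lemma expands_1 [expands_intros]: "expands (\<lambda>x. 1) 1" using expands_const [of 1] by simp
lemma expands_numeral [expands_intros]: "expands (\<lambda>x. numeral k) (numeral k)"
  using expands_const [of "numeral k"] by (simp add: numeral_fps_const)

lemma expands_X [expands_intros]: "expands (\<lambda>x. x) fps_X"
  unfolding expands_def
proof
  fix N
  show "expands_upto N (\<lambda>x. x) fps_X"
  proof (cases N)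
    case 0
    have "\<forall>\<^sub>F x in at_right 0. \<bar>x\<bar> \<le> (1::real)" using eventually_right_pos eventually_right_less [OF zero_less_one] by eventually_elim auto
    then show ?thesis unfolding 0 expands_upto_def by (intro exI [of _ 1]) auto
  next
    case (Suc M)
    have "fps_shift 1 (fps_X :: real fps) = 1" by (rule fps_ext) (simp add: fps_X_def)
    moreover have "expands_upto M (\<lambda>x. (x - fps_X $ 0) / x) 1"
      by (rule expands_upto_cong [of "\<lambda>x. 1"]) (use expands_1 eventually_right_pos in \<open>auto simp: expands_def elim: eventually_mono\<close>)
    ultimately show ?thesis unfolding Suc expands_upto_shift by simp
  qed
qed

lemma expands_power [expands_intros]: "expands f A \<Longrightarrow> expands (\<lambda>x. f x ^ n) (A ^ n)"
  by (induction n) (auto intro: expands_intros)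

lemma expands_tendsto:
  assumes "expands f A" shows "(f \<longlongrightarrow> A $ 0) (at_right 0)"
proof -
  obtain C where "\<forall>\<^sub>F x in at_right 0. \<bar>f x - partial_sum A 1 x\<bar> \<le> C * x ^ 1" using assms unfolding expands_def expands_upto_def by blast
  then have 1: "\<forall>\<^sub>F x in at_right 0. norm (f x - A $ 0) \<le> C * x" by (simp add: partial_sum_def)
  have 2: "((\<lambda>x. C * x) \<longlongrightarrow> 0) (at_right (0::real))"
    by (rule tendsto_mult_right_zero) (rule tendsto_ident_at)
  have "((\<lambda>x. f x - A $ 0) \<longlongrightarrow> 0) (at_right 0)" by (rule Lim_null_comparison [OF 1 2])
  then show ?thesis by (rule Lim_null [THEN iffD2])
qed

lemma has_derivative_partial_sum: "(partial_sum A (Suc N) has_real_derivative partial_sum (fps_deriv A) N x) (at x)"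
proof -
  have "((\<lambda>x. \<Sum>n<Suc N. A $ n * x ^ n) has_real_derivative (\<Sum>n<Suc N. A $ n * (real n * x ^ (n - 1)))) (at x)"
    by (auto intro!: derivative_eq_intros sum.cong)
  also have "(\<Sum>n<Suc N. A $ n * (real n * x ^ (n - 1))) = partial_sum (fps_deriv A) N x"
    unfolding partial_sum_def by (subst sum.lessThan_Suc_shift) (simp add: mult_ac)
  finally show ?thesis unfolding partial_sum_def [abs_def] .
qed

lemma partial_sum_bounded: "\<exists>B\<ge>0. \<forall>x. 0 \<le> x \<and> x \<le> 1 \<longrightarrow> \<bar>partial_sum A N x\<bar> \<le> B"
proof -
  have "\<bar>partial_sum A N x\<bar> \<le> (\<Sum>n<N. \<bar>A $ n\<bar>)" if "0 \<le> x" "x \<le> 1" for x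
    unfolding partial_sum_def using that
    by (intro order_trans [OF sum_abs] sum_mono) (auto simp: abs_mult intro!: mult_left_le power_le_one)
  then show ?thesis by (intro exI [of _ "\<Sum>n<N. \<bar>A $ n\<bar>"]) (auto intro: sum_nonneg)
qed

text \<open>Asymptotic expansions cannot be differentiated in general. They can when the second derivative
  grows at most polynomially at \<open>0\<close>: a Taylor step whose length is a high power of \<open>x\<close> expresses the
  derivative by two values of the function.\<close>

lemma expands_deriv:
  fixes f f' f'' :: "real \<Rightarrow> real"
  assumes f: "expands f A" and x0: "0 < x0"
    and f1: "\<And>x. 0 < x \<Longrightarrow> x < x0 \<Longrightarrow> (f has_real_derivative f' x) (at x)"
    and f2: "\<And>x. 0 < x \<Longrightarrow> x < x0 \<Longrightarrow> (f' has_real_derivative f'' x) (at x)"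
    and pb: "\<And>x. 0 < x \<Longrightarrow> x < x0 \<Longrightarrow> \<bar>f'' x\<bar> \<le> C / x ^ m"
  shows "expands f' (fps_deriv A)"
  unfolding expands_def
proof
  fix N
  \<comment> \<open>A Taylor step of length \<open>h = x ^ M\<close> from \<open>x\<close>: with this \<open>M\<close> the second-order term, of size \<open>h / x ^ m\<close> after division by \<open>h\<close>, is small enough, and the order \<open>K\<close> makes the remainder of \<open>f\<close> small after division by \<open>h\<close>.\<close>
  define M where "M = Suc (m + N)"
  define K where "K = Suc (N + M)"
  obtain C1 where "\<forall>\<^sub>F x in at_right 0. \<bar>f x - partial_sum A (Suc (Suc K)) x\<bar> \<le> C1 * x ^ Suc (Suc K)"
    using f unfolding expands_def expands_upto_def by blast
  then obtain \<delta> where \<delta>: "0 < \<delta>" "\<And>x. 0 < x \<Longrightarrow> x < \<delta> \<Longrightarrow> \<bar>f x - partial_sum A (Suc (Suc K)) x\<bar> \<le> C1 * x ^ Suc (Suc K)"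
    unfolding eventually_at_right_field by auto
  define g where "g x = f x - partial_sum A (Suc (Suc K)) x" for x
  define g' where "g' x = f' x - partial_sum (fps_deriv A) (Suc K) x" for x
  define g'' where "g'' x = f'' x - partial_sum (fps_deriv (fps_deriv A)) K x" for x
  obtain B where B: "0 \<le> B" "\<And>x. 0 \<le> x \<Longrightarrow> x \<le> 1 \<Longrightarrow> \<bar>partial_sum (fps_deriv (fps_deriv A)) K x\<bar> \<le> B"
    using partial_sum_bounded by blast
  define B' where "B' = \<bar>C\<bar> + B"
  have e0: "0 < min (min 1 x0) \<delta> / 2" using x0 \<delta> by auto
  have "\<forall>\<^sub>F x in at_right 0. \<bar>f' x - partial_sum (fps_deriv A) (Suc K) x\<bar> \<le> (\<bar>C1\<bar> * 2 ^ Suc (Suc K) + \<bar>C1\<bar> + B') * x ^ N"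
    using eventually_right_pos eventually_right_less [OF e0]
  proof eventually_elim
    case (elim x)
    then have x: "0 < x" "2 * x < 1" "2 * x < x0" "2 * x < \<delta>" using x0 \<delta> by auto
    define h where "h = x ^ M"
    have h: "0 < h" "h \<le> x" using x power_decreasing [of 1 M x] by (auto simp: h_def M_def)
    define diff where "diff = (\<lambda>n::nat. if n = 0 then g else if n = 1 then g' else g'')"
    have "\<exists>t>x. t < x + h \<and> g (x + h) = (\<Sum>n<2. diff n x / fact n * (x + h - x) ^ n) + diff 2 t / fact 2 * (x + h - x) ^ 2"
    proof (rule Taylor_up [of 2 diff g x "x + h" x])
      have "(g has_real_derivative g' t) (at t)" if "x \<le> t" "t \<le> x + h" for t
        unfolding g_def [abs_def] g'_def using that x h by (intro DERIV_diff f1 has_derivative_partial_sum) auto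
      moreover have "(g' has_real_derivative g'' t) (at t)" if "x \<le> t" "t \<le> x + h" for t
        unfolding g'_def [abs_def] g''_def using that x h by (intro DERIV_diff f2 has_derivative_partial_sum) auto
      ultimately show "\<forall>n t. n < 2 \<and> x \<le> t \<and> t \<le> x + h \<longrightarrow> (diff n has_real_derivative diff (Suc n) t) (at t)"
        by (auto simp: diff_def less_2_cases_iff)
    qed (use h in \<open>auto simp: diff_def\<close>)
    then obtain t where t: "x < t" "t < x + h" and e: "g (x + h) = g x + g' x * h + g'' t / 2 * h^2"
      by (auto simp: diff_def eval_nat_numeral)
    have gb: "\<bar>g s\<bar> \<le> C1 * s ^ Suc (Suc K)" if "0 < s" "s \<le> 2 * x" for s
      using \<delta>(2) [of s] that x by (simp add: g_def)
    have "g' x * h = g (x + h) - g x - g'' t / 2 * h^2" using e by simp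
    then have "\<bar>g' x * h\<bar> \<le> \<bar>g (x + h)\<bar> + \<bar>g x\<bar> + \<bar>g'' t / 2 * h^2\<bar>" by linarith
    moreover have "\<bar>g' x * h\<bar> = \<bar>g' x\<bar> * h" using h by (simp add: abs_mult)
    moreover have "\<bar>g'' t / 2 * h^2\<bar> = \<bar>g'' t\<bar> / 2 * h^2" by (simp add: abs_mult)
    moreover have "\<bar>g'' t\<bar> / 2 * h^2 \<le> \<bar>g'' t\<bar> * h^2" by (intro mult_right_mono) auto
    ultimately have "\<bar>g' x\<bar> * h \<le> \<bar>g (x + h)\<bar> + \<bar>g x\<bar> + \<bar>g'' t\<bar> * h^2" by linarith
    also have "\<bar>g (x + h)\<bar> \<le> \<bar>C1\<bar> * (2 * x) ^ Suc (Suc K)"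
      using x h by (intro order_trans [OF gb] mult_mono power_mono) auto
    also have "\<bar>g x\<bar> \<le> \<bar>C1\<bar> * x ^ Suc (Suc K)"
      using x h by (intro order_trans [OF gb] mult_mono power_mono) auto
    also have "\<bar>g'' t\<bar> \<le> B' / x ^ m"
    proof -
      have "\<bar>f'' t\<bar> \<le> C / t ^ m" using t x h by (intro pb) auto
      also have "\<dots> \<le> \<bar>C\<bar> / x ^ m" using t x by (intro frac_le power_mono) auto
      finally have 1: "\<bar>f'' t\<bar> \<le> \<bar>C\<bar> / x ^ m" .
      have "B * 1 \<le> B * (1 / x ^ m)" using x B power_le_one [of x m] by (intro mult_left_mono) auto
      then have "\<bar>partial_sum (fps_deriv (fps_deriv A)) K t\<bar> \<le> B / x ^ m" using B(2) [of t] t x h by auto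
      with 1 show ?thesis unfolding g''_def B'_def add_divide_distrib by linarith
    qed
    finally have "\<bar>g' x\<bar> * h \<le> \<bar>C1\<bar> * (2 * x) ^ Suc (Suc K) + \<bar>C1\<bar> * x ^ Suc (Suc K) + B' / x ^ m * h^2"
      by (simp add: mult_right_mono)
    also have "\<dots> = ((\<bar>C1\<bar> * 2 ^ Suc (Suc K) + \<bar>C1\<bar>) * x ^ (3 + N) + B' * x ^ Suc N) * h"
    proof -
      have "x ^ Suc (Suc K) = x ^ (3 + N) * h" by (simp add: h_def K_def power_add [symmetric] del: power_Suc) (simp add: eval_nat_numeral add_ac)
      moreover have "h / x ^ m = x ^ Suc N" using x by (simp add: h_def M_def power_add)
      then have "B' * (h / x ^ m) * h = B' * x ^ Suc N * h" by (simp only:)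
      then have "B' / x ^ m * h^2 = B' * x ^ Suc N * h" by (simp add: power2_eq_square mult_ac)
      ultimately show ?thesis by (simp only: power_mult_distrib distrib_right mult.assoc)
    qed
    finally have "\<bar>g' x\<bar> \<le> (\<bar>C1\<bar> * 2 ^ Suc (Suc K) + \<bar>C1\<bar>) * x ^ (3 + N) + B' * x ^ Suc N" using h by simp
    also have "\<dots> \<le> (\<bar>C1\<bar> * 2 ^ Suc (Suc K) + \<bar>C1\<bar>) * x ^ N + B' * x ^ N"
      using x B by (intro add_mono mult_left_mono power_decreasing) (auto simp: B'_def)
    finally show ?case unfolding g'_def by (simp only: distrib_right)
  qed
  then obtain C3 where 1: "\<forall>\<^sub>F x in at_right 0. \<bar>f' x - partial_sum (fps_deriv A) (Suc K) x\<bar> \<le> C3 * x ^ N" by blast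
  have "expands_upto N (partial_sum (fps_deriv A) (Suc K)) (fps_deriv A)"
  proof -
    have "\<forall>\<^sub>F x in at_right 0. \<bar>partial_sum (fps_deriv A) (Suc K) x - partial_sum (fps_deriv A) N x\<bar> \<le> (\<Sum>n\<in>{N..<Suc K}. \<bar>fps_deriv A $ n\<bar>) * x ^ N"
      using eventually_right_pos eventually_right_less [OF zero_less_one]
    proof eventually_elim
      case (elim x)
      have "partial_sum (fps_deriv A) (Suc K) x = partial_sum (fps_deriv A) N x + (\<Sum>n\<in>{N..<Suc K}. fps_deriv A $ n * x ^ n)"
        unfolding partial_sum_def lessThan_atLeast0 by (subst sum.atLeastLessThan_concat) (auto simp: K_def)
      then have "\<bar>partial_sum (fps_deriv A) (Suc K) x - partial_sum (fps_deriv A) N x\<bar> = \<bar>\<Sum>n\<in>{N..<Suc K}. fps_deriv A $ n * x ^ n\<bar>" by simp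
      also have "\<dots> \<le> (\<Sum>n\<in>{N..<Suc K}. \<bar>fps_deriv A $ n\<bar> * x ^ N)"
      proof (intro order_trans [OF sum_abs] sum_mono)
        fix n assume "n \<in> {N..<Suc K}"
        then show "\<bar>fps_deriv A $ n * x ^ n\<bar> \<le> \<bar>fps_deriv A $ n\<bar> * x ^ N"
          unfolding abs_mult using elim by (intro mult_left_mono) (auto intro: power_decreasing)
      qed
      finally show ?case by (simp only: sum_distrib_right)
    qed
    then show ?thesis unfolding expands_upto_def by blast
  qed
  then obtain C2 where 2: "\<forall>\<^sub>F x in at_right 0. \<bar>partial_sum (fps_deriv A) (Suc K) x - partial_sum (fps_deriv A) N x\<bar> \<le> C2 * x ^ N"
    unfolding expands_upto_def by blast
  from 1 2 have "\<forall>\<^sub>F x in at_right 0. \<bar>f' x - partial_sum (fps_deriv A) N x\<bar> \<le> (C3 + C2) * x ^ N"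
    unfolding distrib_right by eventually_elim linarith
  then show "expands_upto N f' (fps_deriv A)" unfolding expands_upto_def by blast
qed

section \<open>Derivatives of expandable functions\<close>

text \<open>The algebra of functions generated by \<open>G\<close>. If all functions in \<open>G\<close> are polynomially bounded and
  have derivatives in the algebra, then the same holds for the algebra, and hence for all higher
  derivatives.\<close>

inductive_set fun_algebra :: "(real \<Rightarrow> real) set \<Rightarrow> (real \<Rightarrow> real) set" for G where
  gen: "g \<in> G \<Longrightarrow> g \<in> fun_algebra G"
| const: "(\<lambda>x. c) \<in> fun_algebra G"
| add: "f \<in> fun_algebra G \<Longrightarrow> g \<in> fun_algebra G \<Longrightarrow> (\<lambda>x. f x + g x) \<in> fun_algebra G"
| mult: "f \<in> fun_algebra G \<Longrightarrow> g \<in> fun_algebra G \<Longrightarrow> (\<lambda>x. f x * g x) \<in> fun_algebra G"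

lemma fun_algebra_minus: "f \<in> fun_algebra G \<Longrightarrow> (\<lambda>x. - f x) \<in> fun_algebra G"
  using fun_algebra.mult [OF fun_algebra.const [of "-1"]] by fastforce

lemma fun_algebra_diff: "f \<in> fun_algebra G \<Longrightarrow> g \<in> fun_algebra G \<Longrightarrow> (\<lambda>x. f x - g x) \<in> fun_algebra G"
  using fun_algebra.add [OF _ fun_algebra_minus, of f G g] by simp

lemma fun_algebra_power: "f \<in> fun_algebra G \<Longrightarrow> (\<lambda>x. f x ^ n) \<in> fun_algebra G"
  by (induction n) (auto intro: fun_algebra.const fun_algebra.mult)

definition poly_bounded :: "real \<Rightarrow> (real \<Rightarrow> real) \<Rightarrow> bool" where
  "poly_bounded x0 f \<longleftrightarrow> (\<exists>C m. \<forall>x. 0 < x \<and> x < x0 \<longrightarrow> \<bar>f x\<bar> \<le> C / x ^ m)"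

lemma poly_bounded_add:
  assumes "poly_bounded x0 f" "poly_bounded x0 g" "x0 \<le> 1" shows "poly_bounded x0 (\<lambda>x. f x + g x)"
proof -
  obtain C m where 1: "\<And>x. 0 < x \<Longrightarrow> x < x0 \<Longrightarrow> \<bar>f x\<bar> \<le> C / x ^ m" using assms(1) unfolding poly_bounded_def by blast
  obtain D n where 2: "\<And>x. 0 < x \<Longrightarrow> x < x0 \<Longrightarrow> \<bar>g x\<bar> \<le> D / x ^ n" using assms(2) unfolding poly_bounded_def by blast
  have "\<bar>f x + g x\<bar> \<le> (\<bar>C\<bar> + \<bar>D\<bar>) / x ^ (m + n)" if x: "0 < x" "x < x0" for x
  proof -
    have *: "K / x ^ k \<le> \<bar>K\<bar> / x ^ (m + n)" if "k \<le> m + n" for K k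
      using x that assms by (intro frac_le) (auto intro!: power_decreasing)
    have "\<bar>f x\<bar> \<le> \<bar>C\<bar> / x ^ (m + n)" using 1 [OF x] * [of m C] by simp
    moreover have "\<bar>g x\<bar> \<le> \<bar>D\<bar> / x ^ (m + n)" using 2 [OF x] * [of n D] by simp
    ultimately show ?thesis unfolding add_divide_distrib by linarith
  qed
  then show ?thesis unfolding poly_bounded_def by blast
qed

lemma poly_bounded_mult:
  assumes "poly_bounded x0 f" "poly_bounded x0 g" shows "poly_bounded x0 (\<lambda>x. f x * g x)"
proof -
  obtain C m where 1: "\<And>x. 0 < x \<Longrightarrow> x < x0 \<Longrightarrow> \<bar>f x\<bar> \<le> C / x ^ m" using assms(1) unfolding poly_bounded_def by blast
  obtain D n where 2: "\<And>x. 0 < x \<Longrightarrow> x < x0 \<Longrightarrow> \<bar>g x\<bar> \<le> D / x ^ n" using assms(2) unfolding poly_bounded_def by blast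
  have "\<bar>f x * g x\<bar> \<le> (C * D) / x ^ (m + n)" if x: "0 < x" "x < x0" for x
  proof -
    have "\<bar>f x * g x\<bar> \<le> (C / x ^ m) * (D / x ^ n)"
      unfolding abs_mult using 1 [OF x] 2 [OF x] by (intro mult_mono) (auto intro: order_trans [OF abs_ge_zero])
    then show ?thesis by (simp add: power_add)
  qed
  then show ?thesis unfolding poly_bounded_def by blast
qed

lemma fun_algebra_closed:
  assumes x0: "x0 \<le> 1"
    and G: "\<And>g. g \<in> G \<Longrightarrow> poly_bounded x0 g \<and> (\<exists>g'\<in>fun_algebra G. \<forall>x. 0 < x \<and> x < x0 \<longrightarrow> (g has_real_derivative g' x) (at x))"
    and f: "f \<in> fun_algebra G"
  shows "poly_bounded x0 f \<and> (\<exists>f'\<in>fun_algebra G. \<forall>x. 0 < x \<and> x < x0 \<longrightarrow> (f has_real_derivative f' x) (at x))"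
  using f
proof induction
  case (gen g) then show ?case by (rule G)
next
  case (const c)
  have "poly_bounded x0 (\<lambda>x. c)" unfolding poly_bounded_def by (intro exI [of _ "\<bar>c\<bar>"] exI [of _ 0]) auto
  moreover have "(\<lambda>x. 0) \<in> fun_algebra G" by (rule fun_algebra.const)
  ultimately show ?case by (auto intro!: bexI [of _ "\<lambda>x. 0"])
next
  case (add f g)
  then obtain f' g' where "f' \<in> fun_algebra G" "g' \<in> fun_algebra G" "\<forall>x. 0 < x \<and> x < x0 \<longrightarrow> (f has_real_derivative f' x) (at x)"
    "\<forall>x. 0 < x \<and> x < x0 \<longrightarrow> (g has_real_derivative g' x) (at x)" by blast
  then have "\<exists>h\<in>fun_algebra G. \<forall>x. 0 < x \<and> x < x0 \<longrightarrow> ((\<lambda>x. f x + g x) has_real_derivative h x) (at x)"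
    by (intro bexI [of _ "\<lambda>x. f' x + g' x"]) (auto intro: DERIV_add fun_algebra.add)
  with add show ?case using poly_bounded_add [OF _ _ x0] by blast
next
  case (mult f g)
  then obtain f' g' where fg: "f' \<in> fun_algebra G" "g' \<in> fun_algebra G" "\<forall>x. 0 < x \<and> x < x0 \<longrightarrow> (f has_real_derivative f' x) (at x)"
    "\<forall>x. 0 < x \<and> x < x0 \<longrightarrow> (g has_real_derivative g' x) (at x)" by blast
  have "(\<lambda>x. f' x * g x + g' x * f x) \<in> fun_algebra G"
    using fg mult by (intro fun_algebra.add fun_algebra.mult) auto
  with fg have "\<exists>h\<in>fun_algebra G. \<forall>x. 0 < x \<and> x < x0 \<longrightarrow> ((\<lambda>x. f x * g x) has_real_derivative h x) (at x)"
    by (intro bexI [of _ "\<lambda>x. f' x * g x + g' x * f x"]) (auto intro: DERIV_mult)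
  with mult show ?case using poly_bounded_mult by blast
qed

text \<open>Repeated application of \<open>expands_deriv\<close>; the polynomial bound for the second derivative comes from
  the algebra.\<close>

lemma fun_algebra_derivative_sequence:
  assumes x0: "0 < x0" "x0 \<le> 1"
    and G: "\<And>g. g \<in> G \<Longrightarrow> poly_bounded x0 g \<and> (\<exists>g'\<in>fun_algebra G. \<forall>x. 0 < x \<and> x < x0 \<longrightarrow> (g has_real_derivative g' x) (at x))"
    and f: "f \<in> fun_algebra G" "expands f A"
  obtains F where "F 0 = f" "\<And>n x. 0 < x \<Longrightarrow> x < x0 \<Longrightarrow> (F n has_real_derivative F (Suc n) x) (at x)"
    "\<And>n. expands (F n) ((fps_deriv ^^ n) A)" "\<And>n. F n \<in> fun_algebra G"
proof -
  have cl: "poly_bounded x0 f \<and> (\<exists>f'\<in>fun_algebra G. \<forall>x. 0 < x \<and> x < x0 \<longrightarrow> (f has_real_derivative f' x) (at x))" if "f \<in> fun_algebra G" for f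
    by (rule fun_algebra_closed [OF x0(2) _ that]) (rule G)
  define D where "D f = (SOME f'. f' \<in> fun_algebra G \<and> (\<forall>x. 0 < x \<and> x < x0 \<longrightarrow> (f has_real_derivative f' x) (at x)))" for f :: "real \<Rightarrow> real"
  have D: "D f \<in> fun_algebra G \<and> (\<forall>x. 0 < x \<and> x < x0 \<longrightarrow> (f has_real_derivative D f x) (at x))" if "f \<in> fun_algebra G" for f
  proof -
    have "\<exists>f'. f' \<in> fun_algebra G \<and> (\<forall>x. 0 < x \<and> x < x0 \<longrightarrow> (f has_real_derivative f' x) (at x))"
      using cl [OF that] by blast
    from someI_ex [OF this] show ?thesis unfolding D_def .
  qed
  define F where "F n = (D ^^ n) f" for n
  have F: "F n \<in> fun_algebra G" for n
  proof (induction n)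
    case 0 then show ?case using f(1) by (simp add: F_def)
  next
    case (Suc n)
    from D [OF this] have "D (F n) \<in> fun_algebra G" by (rule conjunct1)
    then show ?case by (simp add: F_def)
  qed
  have der: "(F n has_real_derivative F (Suc n) x) (at x)" if "0 < x" "x < x0" for n x
    using D [OF F [of n]] that by (auto simp: F_def)
  have "expands (F n) ((fps_deriv ^^ n) A)" for n
  proof (induction n)
    case 0 then show ?case using f by (simp add: F_def)
  next
    case (Suc n)
    obtain C m where "\<forall>x. 0 < x \<and> x < x0 \<longrightarrow> \<bar>F (Suc (Suc n)) x\<bar> \<le> C / x ^ m"
      using cl [OF F [of "Suc (Suc n)"]] unfolding poly_bounded_def by blast
    then have "expands (F (Suc n)) (fps_deriv ((fps_deriv ^^ n) A))"
      by (intro expands_deriv [OF Suc x0(1) der der]) auto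
    then show ?case by simp
  qed
  then show ?thesis using der F by (intro that [of F]) (auto simp: F_def)
qed

text \<open>At the end point \<open>0\<close> the expansion itself gives the derivative.\<close>

lemma expands_has_derivative_0:
  assumes "expands f A" "h 0 = A $ 0" "\<forall>\<^sub>F x in at_right 0. h x = f x" "S \<subseteq> {0..}"
  shows "(h has_vector_derivative A $ 1) (at 0 within S)"
proof -
  have e: "expands h A" by (rule expands_cong [OF assms(1)]) (use assms(3) in \<open>auto elim: eventually_mono\<close>)
  have "expands_upto 1 (\<lambda>x. (h x - A $ 0) / x) (fps_shift 1 A)"
    using e unfolding expands_upto_shift [symmetric] by (simp add: expands_def)
  then obtain C where "\<forall>\<^sub>F x in at_right 0. \<bar>(h x - A $ 0) / x - partial_sum (fps_shift 1 A) 1 x\<bar> \<le> C * x ^ 1"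
    unfolding expands_upto_def by blast
  then have 1: "\<forall>\<^sub>F x in at_right 0. norm ((h x - h 0) / (x - 0) - A $ 1) \<le> C * x"
    by (simp add: partial_sum_def assms)
  have 2: "((\<lambda>x. C * x) \<longlongrightarrow> 0) (at_right (0::real))"
    by (rule tendsto_mult_right_zero) (rule tendsto_ident_at)
  have "((\<lambda>x. (h x - h 0) / (x - 0) - A $ 1) \<longlongrightarrow> 0) (at_right 0)" by (rule Lim_null_comparison [OF 1 2])
  then have "((\<lambda>x. (h x - h 0) / (x - 0)) \<longlongrightarrow> A $ 1) (at_right 0)" by (rule Lim_null [THEN iffD2])
  then have "(h has_field_derivative A $ 1) (at_right 0)" by (simp add: has_field_derivative_iff)
  then have "(h has_field_derivative A $ 1) (at 0 within {0..})"
    by (simp add: has_field_derivative_iff at_within_Ici_at_right)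
  then have "(h has_field_derivative A $ 1) (at 0 within S)"
    using assms(4) by (rule DERIV_subset)
  then show ?thesis by (simp add: has_real_derivative_iff_has_vector_derivative)
qed

lemma one_sided_derivative:
  fixes H :: "real \<Rightarrow> real"
  assumes x0: "0 < x0" and S: "S = {0..} \<or> (\<exists>c>0. c < x0 \<and> S = {0..c})"
    and F: "\<And>x. 0 < x \<Longrightarrow> x < x0 \<Longrightarrow> (F has_real_derivative F' x) (at x)"
    and B: "expands F B"
    and H: "\<And>x. x \<in> S \<Longrightarrow> x < x0 \<Longrightarrow> H x = (if x = 0 then B $ 0 else F x)"
    and x: "x \<in> S" "x < x0"
  shows "(H has_vector_derivative (if x = 0 then B $ 1 else F' x)) (at x within S)"
proof (cases "x = 0")
  case True
  obtain c where c: "0 < c" "c < x0" "{0..c} \<subseteq> S"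
  proof -
    have "{0..x0/2} \<subseteq> {0..}" by auto
    then show ?thesis using S that [of "x0/2"] that x0 by auto
  qed
  have 0: "0 \<in> S" "S \<subseteq> {0..}" using S by auto
  have "\<forall>\<^sub>F x in at_right 0. H x = F x"
    using eventually_right_pos eventually_right_less [OF c(1)]
  proof eventually_elim
    case (elim x)
    with c have "x \<in> S" "x < x0" by auto
    with H [of x] elim show ?case by simp
  qed
  from expands_has_derivative_0 [OF B _ this 0(2)] H [OF 0(1)] x0 True show ?thesis by simp
next
  case False
  with x S have x': "0 < x" by auto
  have "(F has_vector_derivative F' x) (at x within S)"
    using F [OF x' x(2)] by (simp add: has_real_derivative_iff_has_vector_derivative has_vector_derivative_at_within)
  moreover have "0 < min x (x0 - x)" using x' x by auto
  moreover have "F y = H y" if "y \<in> S" "dist y x < min x (x0 - x)" for y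
  proof -
    have "0 < y" "y < x0" using that(2) by (auto simp: dist_real_def abs_less_iff)
    then show ?thesis using H [OF that(1)] by simp
  qed
  ultimately have "(H has_vector_derivative F' x) (at x within S)"
    using x by (intro has_vector_derivative_transform_within [of F "F' x" x S "min x (x0 - x)" H]) auto
  then show ?thesis using False by simp
qed

text \<open>A function with expandable derivatives is smooth up to the end point \<open>0\<close>, and its Taylor
  coefficients are those of the expansion. The set \<open>S\<close> is \<open>{0..}\<close> in the definition of Taylor
  coefficients and a compact interval in the definition of local solutions.\<close>

lemma derivatives_within:
  fixes h :: "real \<Rightarrow> real"
  assumes x0: "0 < x0" and S: "S = {0..} \<or> (\<exists>c>0. c < x0 \<and> S = {0..c})"
    and F: "\<And>n x. 0 < x \<Longrightarrow> x < x0 \<Longrightarrow> (F n has_real_derivative F (Suc n) x) (at x)"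
    and A: "\<And>n. expands (F n) ((fps_deriv ^^ n) A)"
    and h: "\<And>x. 0 < x \<Longrightarrow> x < x0 \<Longrightarrow> x \<in> S \<Longrightarrow> h x = F 0 x" "h 0 = A $ 0"
  shows "\<And>x. x \<in> S \<Longrightarrow> x < x0 \<Longrightarrow> (deriv_within S ^^ n) h x = (if x = 0 then fact n * A $ n else F n x)"
    and "\<And>x. x \<in> S \<Longrightarrow> x < x0 \<Longrightarrow> (deriv_within S ^^ n) h differentiable (at x within S)"
proof -
  have nb: "at x within S \<noteq> bot" if "x \<in> S" for x
  proof -
    have "convex S" using S by auto
    then have "connected S" by (rule convex_connected)
    have "\<exists>y\<in>S. 0 < y"
    proof (cases "S = {0..}")
      case True then show ?thesis by (intro bexI [of _ 1]) auto
    next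
      case False
      with S obtain c where "0 < c" "S = {0..c}" by blast
      then show ?thesis by (intro bexI [of _ c]) auto
    qed
    moreover have "0 \<in> S" using S by auto
    ultimately have "S \<noteq> {x}" by auto
    with \<open>connected S\<close> have "x islimpt S" using that by (intro connected_imp_perfect) auto
    then show ?thesis by (simp add: trivial_limit_within)
  qed
  have B0: "((fps_deriv ^^ n) A) $ 0 = fact n * A $ n" for n by (simp add: fps_0th_higher_deriv)
  have B1: "((fps_deriv ^^ n) A) $ 1 = fact (Suc n) * A $ Suc n" for n
    using B0 [of "Suc n"] by simp
  have main: "\<forall>x. x \<in> S \<longrightarrow> x < x0 \<longrightarrow> (deriv_within S ^^ n) h x = (if x = 0 then fact n * A $ n else F n x)" for n
  proof (induction n)
    case 0
    show ?case using h S by auto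
  next
    case (Suc n)
    show ?case
    proof (intro allI impI)
      fix x assume x: "x \<in> S" "x < x0"
      have "((deriv_within S ^^ n) h has_vector_derivative (if x = 0 then ((fps_deriv ^^ n) A) $ 1 else F (Suc n) x)) (at x within S)"
        by (rule one_sided_derivative [OF x0 S F A _ x]) (use Suc B0 in auto)
      from vector_derivative_within [OF nb [OF x(1)] this]
      show "(deriv_within S ^^ Suc n) h x = (if x = 0 then fact (Suc n) * A $ Suc n else F (Suc n) x)"
        unfolding B1 by (simp add: deriv_within_def)
    qed
  qed
  fix x assume x: "x \<in> S" "x < x0"
  show "(deriv_within S ^^ n) h x = (if x = 0 then fact n * A $ n else F n x)" using main x by blast
  have "((deriv_within S ^^ n) h has_vector_derivative (if x = 0 then ((fps_deriv ^^ n) A) $ 1 else F (Suc n) x)) (at x within S)"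
    by (rule one_sided_derivative [OF x0 S F A _ x]) (use main B0 in auto)
  then show "(deriv_within S ^^ n) h differentiable (at x within S)"
    by (rule differentiableI_vector)
qed

text \<open>If \<open>\<phi>\<close> were positive at \<open>x\<close>, then a maximum of \<open>\<phi>\<close> on an interval that ends at \<open>x\<close> would be a
  positive value at which \<open>\<phi>\<close> decreases, and \<open>\<phi>\<close> would be larger just before it. The maximum is
  not at the left end of the interval, for near \<open>0\<close> the values of \<open>\<phi>\<close> are below \<open>\<phi> x\<close>.\<close>

lemma barrier:
  fixes \<phi> :: "real \<Rightarrow> real"
  assumes x1: "0 < x1"
    and d: "\<And>x. 0 < x \<Longrightarrow> x \<le> x1 \<Longrightarrow> (\<phi> has_real_derivative \<phi>' x) (at x)"
    and neg: "\<And>x. 0 < x \<Longrightarrow> x \<le> x1 \<Longrightarrow> 0 < \<phi> x \<Longrightarrow> \<phi>' x < 0"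
    and lim: "(\<phi> \<longlongrightarrow> 0) (at_right 0)"
    and x: "0 < x" "x \<le> x1"
  shows "\<phi> x \<le> 0"
proof (rule ccontr)
  assume "\<not> \<phi> x \<le> 0"
  then have pos: "0 < \<phi> x" by simp
  have "\<forall>\<^sub>F y in at_right 0. \<phi> y < \<phi> x" using lim pos by (rule order_tendstoD)
  then obtain b where b: "0 < b" "\<And>y. 0 < y \<Longrightarrow> y < b \<Longrightarrow> \<phi> y < \<phi> x"
    unfolding eventually_at_right_field by auto
  have bx: "b \<le> x" using b(2) [of x] x by force
  have "continuous_on {b/2..x} \<phi>"
    using d b x by (intro continuous_at_imp_continuous_on ballI DERIV_isCont [OF d]) auto
  moreover have ne: "{b/2..x} \<noteq> {}" using b bx by auto
  ultimately obtain m where m: "m \<in> {b/2..x}" "\<And>y. y \<in> {b/2..x} \<Longrightarrow> \<phi> y \<le> \<phi> m"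
    using continuous_attains_sup [of "{b/2..x}" \<phi>] ne by auto
  have mx: "\<phi> x \<le> \<phi> m" using m(2) [of x] b bx by auto
  have m0: "0 < m" "m \<le> x1" using m(1) b x by auto
  have "\<phi>' m < 0" using neg [OF m0] mx pos by linarith
  with d [OF m0] obtain e where e: "0 < e" "\<And>h. 0 < h \<Longrightarrow> h < e \<Longrightarrow> \<phi> m < \<phi> (m - h)"
    using DERIV_neg_dec_left by blast
  define h where "h = min e (b/2) / 2"
  have h: "0 < h" "h < e" "h < b/2" using e b by (auto simp: h_def min_def)
  have "m - b / 2 \<ge> 0" using m by auto
  have "\<phi> m < \<phi> (m - h)" using e h by blast
  moreover have "\<phi> (m - h) \<le> \<phi> m"
  proof (cases "b / 2 \<le> m - h")
    case True with m h show ?thesis by (intro m) auto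
  next
    case False
    have "0 < m - h" using m h by auto
    moreover have "m - h < b" using False b by auto
    ultimately show ?thesis using b(2) [of "m - h"] mx by linarith
  qed
  ultimately show False by simp
qed

section \<open>Singular equations on an interval\<close>

text \<open>The bounded solution of \<open>y' = a y - g\<close> on the half-line.\<close>

definition decay_int :: "real \<Rightarrow> (real \<Rightarrow> real) \<Rightarrow> real \<Rightarrow> real" where
  "decay_int a g s = exp (a * s) * integral {s..} (\<lambda>u. exp (-a * u) * g u)"

lemma decay_integrable:
  fixes g :: "real \<Rightarrow> real" and a s M :: real
  assumes a: "0 < a" and g: "continuous_on UNIV g" "\<And>u. s \<le> u \<Longrightarrow> \<bar>g u\<bar> \<le> M"
  shows "(\<lambda>u. exp (-a * u) * g u) integrable_on {s..}"
proof (rule measurable_bounded_by_integrable_imp_integrable)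
  show "(\<lambda>u. exp (-a * u) * g u) \<in> borel_measurable (lebesgue_on {s..})"
  proof (rule continuous_imp_measurable_on_sets_lebesgue)
    have "continuous_on UNIV (\<lambda>u. exp (-a * u))" by (intro continuous_intros)
    then have "continuous_on {s..} (\<lambda>u. exp (-a * u))" by (rule continuous_on_subset) simp
    then show "continuous_on {s..} (\<lambda>u. exp (-a * u) * g u)"
      by (rule continuous_on_mult) (rule continuous_on_subset [OF g(1)], simp)
  qed simp
  show "(\<lambda>u. M * exp (-a * u)) integrable_on {s..}"
    using has_integral_exp_minus_to_infinity [OF a, of s] by (intro integrable_on_mult_right) (auto simp: integrable_on_def)
  show "norm (exp (-a * u) * g u) \<le> M * exp (-a * u)" if "u \<in> {s..}" for u
    using g(2) [of u] that by (simp add: abs_mult mult.commute [of M])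
qed auto

lemma decay_int_bound:
  assumes a: "0 < a" and g: "continuous_on UNIV g" "\<And>u. s \<le> u \<Longrightarrow> \<bar>g u\<bar> \<le> M"
  shows "\<bar>decay_int a g s\<bar> \<le> M / a"
proof -
  have i: "((\<lambda>u. M * exp (-a * u)) has_integral M * (exp (-a * s) / a)) {s..}"
    by (intro has_integral_mult_right has_integral_exp_minus_to_infinity a)
  have "norm (integral {s..} (\<lambda>u. exp (-a * u) * g u)) \<le> integral {s..} (\<lambda>u. M * exp (-a * u))"
  proof (rule integral_norm_bound_integral [OF decay_integrable [OF a g]])
    show "(\<lambda>u. M * exp (-a * u)) integrable_on {s..}" using i by blast
    show "norm (exp (-a * u) * g u) \<le> M * exp (-a * u)" if "u \<in> {s..}" for u
      using g(2) [of u] that by (simp add: abs_mult mult.commute [of M])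
  qed auto
  also have "\<dots> = M * (exp (-a * s) / a)" using i by (rule integral_unique)
  finally have "\<bar>decay_int a g s\<bar> \<le> exp (a * s) * (M * (exp (-a * s) / a))"
    unfolding decay_int_def abs_mult by (simp del: times_divide_eq_right)
  also have "\<dots> = M / a" by (simp add: exp_minus field_simps)
  finally show ?thesis .
qed

lemma decay_int_diff:
  assumes a: "0 < a" and g: "continuous_on UNIV g" "\<And>u. s \<le> u \<Longrightarrow> \<bar>g u\<bar> \<le> M"
    and h: "continuous_on UNIV h" "\<And>u. s \<le> u \<Longrightarrow> \<bar>h u\<bar> \<le> M"
  shows "decay_int a g s - decay_int a h s = decay_int a (\<lambda>u. g u - h u) s"
  unfolding decay_int_def right_diff_distrib
  by (subst integral_diff [OF decay_integrable [OF a g] decay_integrable [OF a h]]) (simp_all add: right_diff_distrib)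

lemma decay_int_derivative:
  assumes a: "0 < a" and g: "continuous_on UNIV g" "\<And>u. \<bar>g u\<bar> \<le> M"
  shows "(decay_int a g has_real_derivative a * decay_int a g s - g s) (at s)"
proof -
  define h where "h u = exp (-a * u) * g u" for u
  have dh: "decay_int a g t = exp (a * t) * integral {t..} h" for t
    by (simp add: decay_int_def h_def [abs_def])
  have h: "h integrable_on {t..}" for t unfolding h_def [abs_def] using decay_integrable [OF a g] by blast
  have hc: "continuous_on A h" for A
    unfolding h_def [abs_def] by (intro continuous_intros continuous_on_subset [OF g(1)]) auto
  have split: "integral {t..} h = integral {s - 1..} h - integral {s - 1..t} h" if "s - 1 < t" for t
  proof -
    have "((h) has_integral (integral {s - 1..t} h + integral {t..} h)) ({s - 1..t} \<union> {t..})"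
    proof (rule has_integral_Un)
      show "(h has_integral integral {s - 1..t} h) {s - 1..t}"
        using hc by (intro integrable_integral integrable_continuous_interval)
      show "(h has_integral integral {t..} h) {t..}" using h by (rule integrable_integral)
      have "{s - 1..t} \<inter> {t..} \<subseteq> {t}" by auto
      then show "negligible ({s - 1..t} \<inter> {t..})" by (rule negligible_subset [rotated]) simp
    qed
    moreover have "{s - 1..t} \<union> {t..} = {s - 1..}" using that by auto
    ultimately have "(h has_integral (integral {s - 1..t} h + integral {t..} h)) {s - 1..}" by simp
    then show ?thesis by (simp add: integral_unique)
  qed
  have "((\<lambda>t. integral {s - 1..t} h) has_real_derivative h s) (at s within {s - 1..s + 1})"
    by (rule integral_has_real_derivative [OF hc]) auto
  then have d: "((\<lambda>t. integral {s - 1..t} h) has_real_derivative h s) (at s)"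
    by (simp add: at_within_Icc_at)
  have "((\<lambda>t. exp (a * t) * (integral {s - 1..} h - integral {s - 1..t} h)) has_real_derivative
      a * (exp (a * s) * (integral {s - 1..} h - integral {s - 1..s} h)) - g s) (at s)"
  proof -
    have "exp (a * s) * h s = g s" by (simp add: h_def exp_minus)
    then show ?thesis
      by (auto intro!: derivative_eq_intros d simp: algebra_simps)
  qed
  then have "((\<lambda>t. exp (a * t) * (integral {s - 1..} h - integral {s - 1..t} h)) has_real_derivative
      a * decay_int a g s - g s) (at s)"
    using split [of s] by (simp add: dh)
  moreover have "\<forall>\<^sub>F t in nhds s. exp (a * t) * (integral {s - 1..} h - integral {s - 1..t} h) = decay_int a g t"
  proof -
    have "\<forall>\<^sub>F t in nhds s. t \<in> {s - 1<..}" by (rule eventually_nhds_in_open) auto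
    then show ?thesis
      by eventually_elim (simp add: split dh)
  qed
  ultimately show ?thesis by (simp add: DERIV_cong_ev)
qed

text \<open>The equation \<open>x\<^sup>2 y' = - a y + x f(x, y)\<close> turns into \<open>dy/ds = a y - f(1/s, y) / s\<close> for \<open>s = 1/x\<close>.
  Its solutions that stay bounded as \<open>s \<rightarrow> \<infinity>\<close> are fixed points of an integral operator, which
  contracts for large \<open>s\<close> because of the factor \<open>1/s\<close>.\<close>

theorem singular_ode_exists:
  fixes f :: "real \<Rightarrow> real \<Rightarrow> real"
  assumes a: "0 < a" and x1: "0 < x1"
    and cont: "continuous_on ({0..x1} \<times> {-1..1}) (\<lambda>(x, y). f x y)"
    and bd: "\<And>x y. 0 \<le> x \<Longrightarrow> x \<le> x1 \<Longrightarrow> \<bar>y\<bar> \<le> 1 \<Longrightarrow> \<bar>f x y\<bar> \<le> B"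
    and lip: "\<And>x y z. 0 \<le> x \<Longrightarrow> x \<le> x1 \<Longrightarrow> \<bar>y\<bar> \<le> 1 \<Longrightarrow> \<bar>z\<bar> \<le> 1 \<Longrightarrow> \<bar>f x y - f x z\<bar> \<le> B * \<bar>y - z\<bar>"
  obtains x0 y where "0 < x0" "x0 \<le> x1" "\<And>x. 0 < x \<Longrightarrow> x < x0 \<Longrightarrow> \<bar>y x\<bar> \<le> 1"
    "\<And>x. 0 < x \<Longrightarrow> x < x0 \<Longrightarrow> \<bar>y x\<bar> \<le> B / a * x"
    "\<And>x. 0 < x \<Longrightarrow> x < x0 \<Longrightarrow> (y has_real_derivative (- a * y x + x * f x (y x)) / x^2) (at x)"
proof -
  have B: "0 \<le> B" using bd [of 0 0] x1 by simp
  \<comment> \<open>In the variable \<open>u = 1 / x\<close> the solution is the fixed point of the decaying integral of \<open>G\<close>. Beyond \<open>s0\<close> this map is a contraction with factor \<open>1/2\<close>; the equation is frozen below \<open>s0\<close> and restrict_relevant off at \<open>\<bar>y\<bar> = 1\<close>, so that the map acts on all bounded continuous functions.\<close>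
  define s0 where "s0 = 1 / x1 + 2 * B / a"
  have s0: "0 < s0" "1 / x1 \<le> s0" "2 * B / a \<le> s0" using x1 B a by (auto simp: s0_def add_pos_nonneg)
  define p where "p u = 1 / max u s0" for u :: real
  have p: "0 < p u" "p u \<le> x1" "p u \<le> 1 / s0" for u
  proof -
    show "0 < p u" using s0 by (simp add: p_def)
    show *: "p u \<le> 1 / s0" unfolding p_def using s0 by (intro divide_left_mono) auto
    have "1 / s0 \<le> 1 / (1 / x1)" using s0 x1 by (intro divide_left_mono) auto
    with * show "p u \<le> x1" by simp
  qed
  define cl where "cl y = max (-1) (min 1 y)" for y :: real
  have cl: "\<bar>cl y\<bar> \<le> 1" "\<bar>cl y - cl z\<bar> \<le> \<bar>y - z\<bar>" for y z by (auto simp: cl_def max_def min_def)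
  define G where "G Y u = p u * f (p u) (cl (Y u))" for Y :: "real \<Rightarrow> real" and u
  have Gc: "continuous_on UNIV (G Y)" if "continuous_on UNIV Y" for Y
  proof -
    have pc: "continuous_on UNIV p" unfolding p_def [abs_def] using s0 by (intro continuous_intros) auto
    have "continuous_on UNIV (\<lambda>u. (p u, cl (Y u)))" unfolding cl_def by (intro continuous_intros pc that)
    then have "continuous_on UNIV (\<lambda>u. (\<lambda>(x, y). f x y) (p u, cl (Y u)))"
    proof (rule continuous_on_compose2 [OF cont])
      show "(\<lambda>u. (p u, cl (Y u))) ` UNIV \<subseteq> {0..x1} \<times> {- 1..1}"
      proof (rule image_subsetI)
        fix u show "(p u, cl (Y u)) \<in> {0..x1} \<times> {- 1..1}" using p [of u] cl(1) [of "Y u"] by (auto simp: abs_le_iff)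
      qed
    qed
    then show ?thesis unfolding G_def [abs_def] by (intro continuous_intros pc) simp
  qed
  have Gb: "\<bar>G Y u\<bar> \<le> B / max u s0" for Y u
  proof -
    have "\<bar>G Y u\<bar> \<le> p u * B" unfolding G_def abs_mult using p [of u] cl(1) by (intro mult_mono bd) auto
    then show ?thesis by (simp add: p_def)
  qed
  have Gb': "\<bar>G Y u\<bar> \<le> B / s0" for Y u
    using s0 B by (intro order_trans [OF Gb] divide_left_mono) auto
  have Gl: "\<bar>G Y u - G Z u\<bar> \<le> B / s0 * \<bar>Y u - Z u\<bar>" for Y Z u
  proof -
    have "\<bar>G Y u - G Z u\<bar> = p u * \<bar>f (p u) (cl (Y u)) - f (p u) (cl (Z u))\<bar>"
      using p(1) [of u] by (simp add: G_def abs_mult right_diff_distrib [symmetric])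
    also have "\<dots> \<le> 1 / s0 * (B * \<bar>Y u - Z u\<bar>)"
    proof (intro mult_mono p)
      have "\<bar>f (p u) (cl (Y u)) - f (p u) (cl (Z u))\<bar> \<le> B * \<bar>cl (Y u) - cl (Z u)\<bar>"
        using p [of u] cl(1) by (intro lip) auto
      also have "\<dots> \<le> B * \<bar>Y u - Z u\<bar>" using B cl(2) by (intro mult_left_mono) auto
      finally show "\<bar>f (p u) (cl (Y u)) - f (p u) (cl (Z u))\<bar> \<le> B * \<bar>Y u - Z u\<bar>" .
    qed (use s0 in auto)
    finally show ?thesis by simp
  qed
  define T where "T Y = Bcontfun (decay_int a (G (apply_bcontfun Y)))" for Y :: "real \<Rightarrow>\<^sub>C real"
  note GY = Gc [OF continuous_on_apply_bcontfun]
  have T: "apply_bcontfun (T Y) = decay_int a (G (apply_bcontfun Y))" for Y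
  proof -
    have "decay_int a (G (apply_bcontfun Y)) \<in> bcontfun"
    proof (rule bcontfun_normI)
      show "continuous_on UNIV (decay_int a (G (apply_bcontfun Y)))"
        using decay_int_derivative [OF a GY Gb'] by (intro continuous_at_imp_continuous_on ballI DERIV_isCont) blast
      show "norm (decay_int a (G (apply_bcontfun Y)) s) \<le> B / s0 / a" for s
        using decay_int_bound [OF a GY Gb'] by simp
    qed
    then show ?thesis unfolding T_def by (rule Bcontfun_inverse)
  qed
  have "\<exists>!Y. T Y = Y"
  proof (rule banach_fix_type)
    show "\<forall>Y Z. dist (T Y) (T Z) \<le> 1/2 * dist Y Z"
    proof (intro allI dist_bound)
      fix Y Z :: "real \<Rightarrow>\<^sub>C real" and s
      have cd: "continuous_on UNIV (\<lambda>u. G (apply_bcontfun Y) u - G (apply_bcontfun Z) u)"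
        by (intro continuous_intros GY)
      have "dist (apply_bcontfun (T Y) s) (apply_bcontfun (T Z) s) = \<bar>decay_int a (\<lambda>u. G (apply_bcontfun Y) u - G (apply_bcontfun Z) u) s\<bar>"
        unfolding T dist_real_def by (subst decay_int_diff [OF a GY Gb' GY Gb']) simp
      also have "\<dots> \<le> (B / s0 * dist Y Z) / a"
      proof (rule decay_int_bound [OF a cd])
        fix u
        have "\<bar>G (apply_bcontfun Y) u - G (apply_bcontfun Z) u\<bar> \<le> B / s0 * \<bar>apply_bcontfun Y u - apply_bcontfun Z u\<bar>" by (rule Gl)
        also have "\<dots> \<le> B / s0 * dist Y Z"
          using dist_bounded [of Y u Z] B s0 by (intro mult_left_mono) (auto simp: dist_real_def)
        finally show "\<bar>G (apply_bcontfun Y) u - G (apply_bcontfun Z) u\<bar> \<le> B / s0 * dist Y Z" .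
      qed
      also have "\<dots> = (B / s0 / a) * dist Y Z" by simp
      also have "\<dots> \<le> 1/2 * dist Y Z" using s0 a by (intro mult_right_mono) (auto simp: field_simps)
      finally show "dist (apply_bcontfun (T Y) s) (apply_bcontfun (T Z) s) \<le> 1/2 * dist Y Z" .
    qed
  qed auto
  then obtain Y0 where Y0: "T Y0 = Y0" by blast
  define Y where "Y = apply_bcontfun Y0"
  have Y: "Y = decay_int a (G Y)" unfolding Y_def using T [of Y0] Y0 by simp
  have Yc: "continuous_on UNIV Y" unfolding Y_def by simp
  have Yd: "(Y has_real_derivative a * Y s - G Y s) (at s)" for s
    using decay_int_derivative [OF a Gc [OF Yc] Gb'] Y by metis
  have Yb: "\<bar>Y s\<bar> \<le> B / max s s0 / a" for s
  proof -
    have "\<bar>decay_int a (G Y) s\<bar> \<le> B / max s s0 / a"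
    proof (rule decay_int_bound [OF a Gc [OF Yc]])
      fix u assume "s \<le> u"
      then show "\<bar>G Y u\<bar> \<le> B / max s s0"
        using s0 B by (intro order_trans [OF Gb] divide_left_mono) auto
    qed
    then show ?thesis using Y by metis
  qed
  have Y1: "\<bar>Y s\<bar> \<le> 1" for s
  proof -
    have "B / max s s0 / a \<le> B / s0 / a" using s0 B a by (intro divide_right_mono divide_left_mono) auto
    also have "\<dots> \<le> 1" using s0 a B by (simp add: field_simps)
    finally show ?thesis using Yb [of s] by linarith
  qed
  show ?thesis
  proof (rule that [of "1 / s0" "\<lambda>x. Y (1 / x)"])
    show "0 < 1 / s0" using s0 by simp
    show "1 / s0 \<le> x1" using s0 x1 by (simp add: field_simps)
    fix x :: real assume x: "0 < x" "x < 1 / s0"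
    have xs: "s0 < 1 / x" using x s0 by (simp add: field_simps)
    have m: "max (1 / x) s0 = 1 / x" using xs by simp
    show "\<bar>Y (1 / x)\<bar> \<le> 1" by (rule Y1)
    show "\<bar>Y (1 / x)\<bar> \<le> B / a * x" using Yb [of "1 / x"] m by (simp add: mult.commute)
    have "G Y (1 / x) = x * f x (Y (1 / x))"
    proof -
      have "cl (Y (1 / x)) = Y (1 / x)" using Y1 [of "1 / x"] by (auto simp: cl_def max_def min_def)
      then show ?thesis unfolding G_def p_def m by simp
    qed
    then have "(Y has_real_derivative a * Y (1 / x) - x * f x (Y (1 / x))) (at (1 / x))"
      using Yd [of "1 / x"] by simp
    moreover have "((\<lambda>x. 1 / x) has_real_derivative - 1 / x^2) (at x)"
      using x by (auto intro!: derivative_eq_intros simp: power2_eq_square)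
    ultimately have "((\<lambda>x. Y (1 / x)) has_real_derivative (a * Y (1 / x) - x * f x (Y (1 / x))) * (- 1 / x^2)) (at x)"
      by (rule DERIV_chain2)
    then show "((\<lambda>x. Y (1 / x)) has_real_derivative (- a * Y (1 / x) + x * f x (Y (1 / x))) / x^2) (at x)"
      by (simp add: algebra_simps diff_divide_distrib)
  qed
qed

section \<open>The real solution and its expansion\<close>

definition K_quotient :: "(nat \<Rightarrow> nat \<Rightarrow> 'a::comm_ring_1) \<Rightarrow> 'a \<Rightarrow> 'a \<Rightarrow> 'a" where
  "K_quotient D x y = ((D 1 1 + D 3 0) - (D 0 2 + D 2 1) * x + D 1 2 * x^2 - D 0 3 * x^3)
     + (- D 1 1 + (2 * D 0 2 + D 2 1) * x - 2 * D 1 2 * x^2 + 3 * D 0 3 * x^3) * y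
     + (- M21p D x * y^2 + x * M22p D x * y^3)"

definition ode_remainder :: "'a::comm_ring_1 \<Rightarrow> (nat \<Rightarrow> nat \<Rightarrow> 'a) \<Rightarrow> (nat \<Rightarrow> nat \<Rightarrow> 'a) \<Rightarrow> 'a \<Rightarrow> 'a \<Rightarrow> 'a" where
  "ode_remainder a D E x y = (2 * Kp D x y + a * ((E 1 1 - (2 * E 0 2 + E 2 1) * x + 2 * E 1 2 * x^2 - 3 * E 0 3 * x^3)
      - K_quotient D x y) - 2 * G2p D x) * y + Rp a D E x y"

lemma Kp_eq_quotient: "Kp D x y = 1 + x * K_quotient D x y"
  unfolding Kp_def N2p_def K_quotient_def H2p_factor G2p_factor by (simp add: algebra_simps power2_eq_square)

text \<open>The leading part is collected in such a way that division by \<open>Kp\<close> gives \<open>x\<^sup>2 y' + a y\<close> plus a multiple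
  of \<open>x\<close>, the form required by \<open>singular_ode_exists\<close>.\<close>

lemma ode_form_split: "ode_form a D E x y y' = Kp D x y * (x^2 * y' + a * y) + x * ode_remainder a D E x y"
proof -
  define T where "T = (E 1 1 - (2 * E 0 2 + E 2 1) * x + 2 * E 1 2 * x^2 - 3 * E 0 3 * x^3) - K_quotient D x y"
  have "a * (1 + G1p E x) = a * Kp D x y + x * (a * T)"
    unfolding Kp_eq_quotient G1p_factor T_def by (simp add: algebra_simps)
  then show ?thesis
    unfolding ode_form_def ode_remainder_def T_def [symmetric] by (simp add: algebra_simps)
qed

text \<open>Bounded by a constant and Lipschitz in \<open>y\<close> with the same constant, for \<open>0 \<le> x \<le> x1\<close> and \<open>\<bar>y\<bar> \<le> 1\<close>;
  this property passes through the algebraic operations that build the equation.\<close>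

definition bounded_lipschitz :: "real \<Rightarrow> (real \<Rightarrow> real \<Rightarrow> real) \<Rightarrow> bool" where
  "bounded_lipschitz x1 g \<longleftrightarrow> (\<exists>B. \<forall>x y z. 0 \<le> x \<and> x \<le> x1 \<and> \<bar>y\<bar> \<le> 1 \<and> \<bar>z\<bar> \<le> 1 \<longrightarrow>
      \<bar>g x y\<bar> \<le> B \<and> \<bar>g x y - g x z\<bar> \<le> B * \<bar>y - z\<bar>)"

lemma bounded_lipschitzE:
  assumes "bounded_lipschitz x1 g"
  obtains B where "0 \<le> B" "\<And>x y. 0 \<le> x \<Longrightarrow> x \<le> x1 \<Longrightarrow> \<bar>y\<bar> \<le> 1 \<Longrightarrow> \<bar>g x y\<bar> \<le> B"
    "\<And>x y z. 0 \<le> x \<Longrightarrow> x \<le> x1 \<Longrightarrow> \<bar>y\<bar> \<le> 1 \<Longrightarrow> \<bar>z\<bar> \<le> 1 \<Longrightarrow> \<bar>g x y - g x z\<bar> \<le> B * \<bar>y - z\<bar>"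
proof -
  obtain B where B: "\<forall>x y z. 0 \<le> x \<and> x \<le> x1 \<and> \<bar>y\<bar> \<le> 1 \<and> \<bar>z\<bar> \<le> 1 \<longrightarrow>
      \<bar>g x y\<bar> \<le> B \<and> \<bar>g x y - g x z\<bar> \<le> B * \<bar>y - z\<bar>" using assms unfolding bounded_lipschitz_def by blast
  show ?thesis
  proof (rule that [of "max 0 B"])
    fix x y z :: real assume *: "0 \<le> x" "x \<le> x1" "\<bar>y\<bar> \<le> 1"
    then show "\<bar>g x y\<bar> \<le> max 0 B" using B by (auto simp: le_max_iff_disj)
    assume "\<bar>z\<bar> \<le> 1"
    with * B have "\<bar>g x y - g x z\<bar> \<le> B * \<bar>y - z\<bar>" by blast
    also have "\<dots> \<le> max 0 B * \<bar>y - z\<bar>" by (intro mult_right_mono) auto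
    finally show "\<bar>g x y - g x z\<bar> \<le> max 0 B * \<bar>y - z\<bar>" .
  qed auto
qed

lemma bounded_lipschitz_fst: "bounded_lipschitz x1 (\<lambda>x y. x)"
  unfolding bounded_lipschitz_def by (intro exI [of _ "max 0 x1"]) (auto simp: le_max_iff_disj)

lemma bounded_lipschitz_snd: "bounded_lipschitz x1 (\<lambda>x y. y)"
  unfolding bounded_lipschitz_def by (intro exI [of _ 1]) auto

lemma bounded_lipschitz_const: "bounded_lipschitz x1 (\<lambda>x y. c)"
  unfolding bounded_lipschitz_def by (intro exI [of _ "\<bar>c\<bar>"]) auto

lemma bounded_lipschitz_add:
  assumes "bounded_lipschitz x1 g" "bounded_lipschitz x1 h" shows "bounded_lipschitz x1 (\<lambda>x y. g x y + h x y)"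
proof -
  obtain B where B: "0 \<le> B" "\<And>x y. 0 \<le> x \<Longrightarrow> x \<le> x1 \<Longrightarrow> \<bar>y\<bar> \<le> 1 \<Longrightarrow> \<bar>g x y\<bar> \<le> B"
    "\<And>x y z. 0 \<le> x \<Longrightarrow> x \<le> x1 \<Longrightarrow> \<bar>y\<bar> \<le> 1 \<Longrightarrow> \<bar>z\<bar> \<le> 1 \<Longrightarrow> \<bar>g x y - g x z\<bar> \<le> B * \<bar>y - z\<bar>"
    using assms(1) by (rule bounded_lipschitzE) (rule that; blast)
  obtain C where C: "0 \<le> C" "\<And>x y. 0 \<le> x \<Longrightarrow> x \<le> x1 \<Longrightarrow> \<bar>y\<bar> \<le> 1 \<Longrightarrow> \<bar>h x y\<bar> \<le> C"
    "\<And>x y z. 0 \<le> x \<Longrightarrow> x \<le> x1 \<Longrightarrow> \<bar>y\<bar> \<le> 1 \<Longrightarrow> \<bar>z\<bar> \<le> 1 \<Longrightarrow> \<bar>h x y - h x z\<bar> \<le> C * \<bar>y - z\<bar>"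
    using assms(2) by (rule bounded_lipschitzE) (rule that; blast)
  show ?thesis unfolding bounded_lipschitz_def
  proof (intro exI [of _ "B + C"] allI impI)
    fix x y z :: real assume *: "0 \<le> x \<and> x \<le> x1 \<and> \<bar>y\<bar> \<le> 1 \<and> \<bar>z\<bar> \<le> (1::real)"
    with B(2) [of x y] C(2) [of x y] B(3) [of x y z] C(3) [of x y z]
    show "\<bar>g x y + h x y\<bar> \<le> B + C \<and> \<bar>g x y + h x y - (g x z + h x z)\<bar> \<le> (B + C) * \<bar>y - z\<bar>"
      unfolding distrib_right by linarith
  qed
qed

lemma bounded_lipschitz_mult:
  assumes "bounded_lipschitz x1 g" "bounded_lipschitz x1 h" shows "bounded_lipschitz x1 (\<lambda>x y. g x y * h x y)"
proof -
  obtain B where B: "0 \<le> B" "\<And>x y. 0 \<le> x \<Longrightarrow> x \<le> x1 \<Longrightarrow> \<bar>y\<bar> \<le> 1 \<Longrightarrow> \<bar>g x y\<bar> \<le> B"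
    "\<And>x y z. 0 \<le> x \<Longrightarrow> x \<le> x1 \<Longrightarrow> \<bar>y\<bar> \<le> 1 \<Longrightarrow> \<bar>z\<bar> \<le> 1 \<Longrightarrow> \<bar>g x y - g x z\<bar> \<le> B * \<bar>y - z\<bar>"
    using assms(1) by (rule bounded_lipschitzE) (rule that; blast)
  obtain C where C: "0 \<le> C" "\<And>x y. 0 \<le> x \<Longrightarrow> x \<le> x1 \<Longrightarrow> \<bar>y\<bar> \<le> 1 \<Longrightarrow> \<bar>h x y\<bar> \<le> C"
    "\<And>x y z. 0 \<le> x \<Longrightarrow> x \<le> x1 \<Longrightarrow> \<bar>y\<bar> \<le> 1 \<Longrightarrow> \<bar>z\<bar> \<le> 1 \<Longrightarrow> \<bar>h x y - h x z\<bar> \<le> C * \<bar>y - z\<bar>"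
    using assms(2) by (rule bounded_lipschitzE) (rule that; blast)
  show ?thesis unfolding bounded_lipschitz_def
  proof (intro exI [of _ "2 * B * C"] allI impI conjI)
    fix x y z :: real assume *: "0 \<le> x \<and> x \<le> x1 \<and> \<bar>y\<bar> \<le> 1 \<and> \<bar>z\<bar> \<le> (1::real)"
    have gh: "\<bar>g x y\<bar> \<le> B" "\<bar>h x z\<bar> \<le> C" "\<bar>h x y\<bar> \<le> C" using B C * by auto
    have "\<bar>g x y * h x y\<bar> \<le> B * C" unfolding abs_mult using gh B C by (intro mult_mono) auto
    also have "\<dots> \<le> 2 * B * C" using B C by simp
    finally show "\<bar>g x y * h x y\<bar> \<le> 2 * B * C" .
    have "g x y * h x y - g x z * h x z = g x y * (h x y - h x z) + h x z * (g x y - g x z)" by (simp add: algebra_simps)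
    then have "\<bar>g x y * h x y - g x z * h x z\<bar> \<le> \<bar>g x y\<bar> * \<bar>h x y - h x z\<bar> + \<bar>h x z\<bar> * \<bar>g x y - g x z\<bar>"
      by (metis abs_mult abs_triangle_ineq)
    also have "\<dots> \<le> B * (C * \<bar>y - z\<bar>) + C * (B * \<bar>y - z\<bar>)"
      using * gh B C by (intro add_mono mult_mono) auto
    finally show "\<bar>g x y * h x y - g x z * h x z\<bar> \<le> 2 * B * C * \<bar>y - z\<bar>" by (simp add: algebra_simps)
  qed
qed

lemma bounded_lipschitz_minus: "bounded_lipschitz x1 g \<Longrightarrow> bounded_lipschitz x1 (\<lambda>x y. - g x y)"
  using bounded_lipschitz_mult [OF bounded_lipschitz_const [of x1 "-1"]] by fastforce

lemma bounded_lipschitz_diff: "bounded_lipschitz x1 g \<Longrightarrow> bounded_lipschitz x1 h \<Longrightarrow> bounded_lipschitz x1 (\<lambda>x y. g x y - h x y)"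
  using bounded_lipschitz_add [OF _ bounded_lipschitz_minus, of x1 g h] by simp

lemma bounded_lipschitz_power: "bounded_lipschitz x1 g \<Longrightarrow> bounded_lipschitz x1 (\<lambda>x y. g x y ^ n)"
  by (induction n) (auto intro: bounded_lipschitz_const bounded_lipschitz_mult)

lemma bounded_lipschitz_inverse:
  assumes "bounded_lipschitz x1 g" and g: "\<And>x y. 0 \<le> x \<Longrightarrow> x \<le> x1 \<Longrightarrow> \<bar>y\<bar> \<le> 1 \<Longrightarrow> 1/2 \<le> g x y"
  shows "bounded_lipschitz x1 (\<lambda>x y. inverse (g x y))"
proof -
  obtain B where B: "0 \<le> B" "\<And>x y. 0 \<le> x \<Longrightarrow> x \<le> x1 \<Longrightarrow> \<bar>y\<bar> \<le> 1 \<Longrightarrow> \<bar>g x y\<bar> \<le> B"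
    "\<And>x y z. 0 \<le> x \<Longrightarrow> x \<le> x1 \<Longrightarrow> \<bar>y\<bar> \<le> 1 \<Longrightarrow> \<bar>z\<bar> \<le> 1 \<Longrightarrow> \<bar>g x y - g x z\<bar> \<le> B * \<bar>y - z\<bar>"
    using assms(1) by (rule bounded_lipschitzE) (rule that; blast)
  show ?thesis unfolding bounded_lipschitz_def
  proof (intro exI [of _ "2 + 4 * B"] allI impI conjI)
    fix x y z :: real assume *: "0 \<le> x \<and> x \<le> x1 \<and> \<bar>y\<bar> \<le> 1 \<and> \<bar>z\<bar> \<le> (1::real)"
    have i: "0 < inverse (g x y)" "inverse (g x y) \<le> 2" "0 < inverse (g x z)" "inverse (g x z) \<le> 2"
      using g [of x y] g [of x z] * le_imp_inverse_le [of "1/2" "g x y"] le_imp_inverse_le [of "1/2" "g x z"] by auto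
    then show "\<bar>inverse (g x y)\<bar> \<le> 2 + 4 * B" using B by simp
    have "inverse (g x y) - inverse (g x z) = inverse (g x y) * inverse (g x z) * (g x z - g x y)"
      using g [of x y] g [of x z] * by (simp add: field_simps)
    then have "\<bar>inverse (g x y) - inverse (g x z)\<bar> = inverse (g x y) * inverse (g x z) * \<bar>g x y - g x z\<bar>"
      using i by (simp add: abs_mult abs_minus_commute)
    also have "\<dots> \<le> 2 * 2 * (B * \<bar>y - z\<bar>)" using i B(3) * by (intro mult_mono) auto
    also have "\<dots> \<le> (2 + 4 * B) * \<bar>y - z\<bar>" by (simp add: algebra_simps)
    finally show "\<bar>inverse (g x y) - inverse (g x z)\<bar> \<le> (2 + 4 * B) * \<bar>y - z\<bar>" .
  qed
qed

lemmas bounded_lipschitz_intros = bounded_lipschitz_fst bounded_lipschitz_snd bounded_lipschitz_const bounded_lipschitz_power bounded_lipschitz_mult bounded_lipschitz_add bounded_lipschitz_diff bounded_lipschitz_minus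

lemma bounded_lipschitz_K_quotient: "bounded_lipschitz x1 (K_quotient D)"
proof -
  have "bounded_lipschitz x1 (\<lambda>x y. K_quotient D x y)" unfolding K_quotient_def M21p_def M22p_def by (intro bounded_lipschitz_intros)
  then show ?thesis .
qed

lemma bounded_lipschitz_ode_remainder: "bounded_lipschitz x1 (ode_remainder a D E)"
proof -
  have k: "bounded_lipschitz x1 (\<lambda>x y. K_quotient D x y)" using bounded_lipschitz_K_quotient by simp
  have "bounded_lipschitz x1 (\<lambda>x y. ode_remainder a D E x y)" unfolding ode_remainder_def Kp_eq_quotient Rp_def N1q_def N2p_def M11p_def M12p_def M21p_def M22p_def
      H1p_def H2p_def G2p_def by (intro bounded_lipschitz_intros k)
  then show ?thesis .
qed

definition ode_field :: "real \<Rightarrow> (nat \<Rightarrow> nat \<Rightarrow> real) \<Rightarrow> (nat \<Rightarrow> nat \<Rightarrow> real) \<Rightarrow> real \<Rightarrow> real \<Rightarrow> real" where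
  "ode_field a D E x y = - (ode_remainder a D E x y * inverse (Kp D x y))"

lemma ode_field_lipschitz:
  obtains x1 B where "0 < x1" "x1 \<le> 1" "0 \<le> B" "\<And>x y. 0 \<le> x \<Longrightarrow> x \<le> x1 \<Longrightarrow> \<bar>y\<bar> \<le> 1 \<Longrightarrow> 1/2 \<le> Kp D x y"
    "\<And>x y. 0 \<le> x \<Longrightarrow> x \<le> x1 \<Longrightarrow> \<bar>y\<bar> \<le> 1 \<Longrightarrow> \<bar>ode_field a D E x y\<bar> \<le> B"
    "\<And>x y z. 0 \<le> x \<Longrightarrow> x \<le> x1 \<Longrightarrow> \<bar>y\<bar> \<le> 1 \<Longrightarrow> \<bar>z\<bar> \<le> 1 \<Longrightarrow> \<bar>ode_field a D E x y - ode_field a D E x z\<bar> \<le> B * \<bar>y - z\<bar>"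
proof -
  obtain C where C: "0 \<le> C" "\<And>x y. 0 \<le> x \<Longrightarrow> x \<le> 1 \<Longrightarrow> \<bar>y\<bar> \<le> 1 \<Longrightarrow> \<bar>K_quotient D x y\<bar> \<le> C"
    using bounded_lipschitz_K_quotient by (rule bounded_lipschitzE) (rule that; blast)
  define x1 where "x1 = min 1 (1 / (2 * (C + 1)))"
  have x1: "0 < x1" "x1 \<le> 1" "x1 * C \<le> 1/2"
  proof -
    show "0 < x1" "x1 \<le> 1" using C by (auto simp: x1_def)
    have "x1 * C \<le> 1 / (2 * (C + 1)) * (C + 1)" using C by (intro mult_mono) (auto simp: x1_def)
    also have "\<dots> = 1 / 2" using C by (simp add: field_simps)
    finally show "x1 * C \<le> 1/2" .
  qed
  have K: "1/2 \<le> Kp D x y" if "0 \<le> x" "x \<le> x1" "\<bar>y\<bar> \<le> 1" for x y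
  proof -
    have "\<bar>x * K_quotient D x y\<bar> \<le> x1 * C" unfolding abs_mult using C(2) [of x y] that x1 by (intro mult_mono) auto
    then show ?thesis using x1 unfolding Kp_eq_quotient by linarith
  qed
  have "bounded_lipschitz x1 (\<lambda>x y. Kp D x y)" unfolding Kp_eq_quotient using bounded_lipschitz_K_quotient [of x1 D] by (intro bounded_lipschitz_intros) auto
  then have "bounded_lipschitz x1 (\<lambda>x y. inverse (Kp D x y))" using K by (intro bounded_lipschitz_inverse) auto
  then have "bounded_lipschitz x1 (\<lambda>x y. ode_field a D E x y)"
    unfolding ode_field_def using bounded_lipschitz_ode_remainder [of x1 a D E] by (intro bounded_lipschitz_minus bounded_lipschitz_mult) auto
  then show ?thesis using x1 K that by (elim bounded_lipschitzE) blast
qed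

lemma ode_form_eq_iff:
  assumes "Kp D x y \<noteq> 0" "x \<noteq> 0"
  shows "ode_form a D E x y y' = e \<longleftrightarrow> y' = (- a * y + x * ode_field a D E x y + e * inverse (Kp D x y)) / x^2"
proof -
  have "ode_form a D E x y y' = Kp D x y * (x^2 * y' + a * y - x * ode_field a D E x y)"
    using assms unfolding ode_form_split ode_field_def by (simp add: field_simps)
  then have "ode_form a D E x y y' = e \<longleftrightarrow> x^2 * y' + a * y - x * ode_field a D E x y = e * inverse (Kp D x y)"
    using assms by (auto simp: field_simps)
  also have "\<dots> \<longleftrightarrow> x^2 * y' = - a * y + x * ode_field a D E x y + e * inverse (Kp D x y)" by (auto simp: algebra_simps)
  also have "\<dots> \<longleftrightarrow> y' = (- a * y + x * ode_field a D E x y + e * inverse (Kp D x y)) / x^2"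
    using assms by (auto simp: eq_divide_eq mult.commute)
  finally show ?thesis .
qed

theorem ode_form_solution_exists:
  assumes a: "0 < a"
  obtains x0 y y' where "0 < x0" "x0 \<le> 1" "\<And>x. 0 < x \<Longrightarrow> x < x0 \<Longrightarrow> (y has_real_derivative y' x) (at x)"
    "\<And>x. 0 < x \<Longrightarrow> x < x0 \<Longrightarrow> ode_form a D E x (y x) (y' x) = 0" "(y \<longlongrightarrow> 0) (at_right 0)"
proof -
  obtain x1 B where x1: "0 < x1" "x1 \<le> 1" "0 \<le> B" and K: "\<And>x y. 0 \<le> x \<Longrightarrow> x \<le> x1 \<Longrightarrow> \<bar>y\<bar> \<le> 1 \<Longrightarrow> 1/2 \<le> Kp D x y"
    and f: "\<And>x y. 0 \<le> x \<Longrightarrow> x \<le> x1 \<Longrightarrow> \<bar>y\<bar> \<le> 1 \<Longrightarrow> \<bar>ode_field a D E x y\<bar> \<le> B"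
    "\<And>x y z. 0 \<le> x \<Longrightarrow> x \<le> x1 \<Longrightarrow> \<bar>y\<bar> \<le> 1 \<Longrightarrow> \<bar>z\<bar> \<le> 1 \<Longrightarrow> \<bar>ode_field a D E x y - ode_field a D E x z\<bar> \<le> B * \<bar>y - z\<bar>"
    by (rule ode_field_lipschitz [of D a E]) (rule that; blast)
  have cont: "continuous_on ({0..x1} \<times> {-1..1}) (\<lambda>(x, y). ode_field a D E x y)"
  proof -
    have "Kp D (fst p) (snd p) \<noteq> 0" if "p \<in> {0..x1} \<times> {-1..1}" for p
      using K [of "fst p" "snd p"] that by (force simp: abs_le_iff)
    moreover have "continuous_on ({0..x1} \<times> {-1..1}) (\<lambda>p. Kp D (fst p) (snd p))"
      unfolding Kp_def N2p_def M21p_def M22p_def H2p_def G2p_def by (intro continuous_intros)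
    moreover have "continuous_on ({0..x1} \<times> {-1..1}) (\<lambda>p. ode_remainder a D E (fst p) (snd p))"
      unfolding ode_remainder_def K_quotient_def Kp_def Rp_def N1q_def N2p_def M11p_def M12p_def M21p_def M22p_def
      H1p_def H2p_def G2p_def by (intro continuous_intros)
    ultimately have "continuous_on ({0..x1} \<times> {-1..1}) (\<lambda>p. ode_field a D E (fst p) (snd p))"
      unfolding ode_field_def by (intro continuous_on_minus continuous_on_mult continuous_on_inverse) auto
    then show ?thesis by (simp add: case_prod_unfold)
  qed
  show ?thesis
  proof (rule singular_ode_exists [where a = a and ?x1.0 = x1 and f = "ode_field a D E" and B = B])
    fix x0 y
    assume y: "0 < x0" "x0 \<le> x1" "\<And>x. 0 < x \<Longrightarrow> x < x0 \<Longrightarrow> \<bar>y x\<bar> \<le> 1"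
      "\<And>x. 0 < x \<Longrightarrow> x < x0 \<Longrightarrow> \<bar>y x\<bar> \<le> B / a * x"
      "\<And>x. 0 < x \<Longrightarrow> x < x0 \<Longrightarrow> (y has_real_derivative (- a * y x + x * ode_field a D E x (y x)) / x^2) (at x)"
  show ?thesis
  proof (rule that [OF y(1) _ y(5)])
    show "x0 \<le> 1" using y x1 by simp
    show "ode_form a D E x (y x) ((- a * y x + x * ode_field a D E x (y x)) / x^2) = 0" if x: "0 < x" "x < x0" for x
    proof -
      have "Kp D x (y x) \<noteq> 0" using K [of x "y x"] y(3) [OF x] y(2) x by force
      then show ?thesis using x by (subst ode_form_eq_iff) auto
    qed
    have 1: "\<forall>\<^sub>F x in at_right 0. norm (y x) \<le> B / a * x"
      using eventually_right_pos eventually_right_less [OF y(1)] by eventually_elim (use y(4) in auto)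
    have 2: "((\<lambda>x. B / a * x) \<longlongrightarrow> 0) (at_right (0::real))"
      by (rule tendsto_mult_right_zero) (rule tendsto_ident_at)
    show "(y \<longlongrightarrow> 0) (at_right 0)" by (rule Lim_null_comparison [OF 1 2])
  qed
  qed (use a x1 cont f in auto)
qed

lemma expands_partial_sum: "expands (partial_sum A n) (Abs_fps (\<lambda>k. if k < n then A $ k else 0))"
proof (induction n)
  case 0
  have "Abs_fps (\<lambda>k. if k < 0 then A $ k else 0) = 0" by (rule fps_ext) simp
  then show ?case using expands_0 by (simp add: partial_sum_def [abs_def])
next
  case (Suc n)
  have "partial_sum A (Suc n) = (\<lambda>x. partial_sum A n x + A $ n * x ^ n)" by (simp add: partial_sum_def [abs_def])
  moreover have "Abs_fps (\<lambda>k. if k < Suc n then A $ k else 0) = Abs_fps (\<lambda>k. if k < n then A $ k else 0) + fps_const (A $ n) * fps_X ^ n"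
    by (rule fps_ext) (auto simp: fps_X_power_nth less_Suc_eq)
  ultimately show ?case using Suc by (auto intro!: expands_intros)
qed

lemma expands_reduced_op:
  assumes "expands w W" "expands w' (fps_deriv W)"
  shows "expands (\<lambda>x. a * w x + reduced_form a D E x (w x) (x * w' x)) (fps_const a * W + reduced_op a D E W)"
  unfolding reduced_op_def reduced_form_def Kp_def Rp_def N1q_def N2p_def M11p_def M12p_def M21p_def M22p_def H1p_def H2p_def G1p_def G2p_def
  by (intro expands_intros assms)

text \<open>Let \<open>x w\<close> be a partial sum of the formal solution and \<open>R = y - x w\<close>. By the equation \<open>x\<^sup>2 R'\<close> is
  \<open>- a R\<close> up to a small multiple of \<open>R\<close> and the defect of the partial sum, of order \<open>x\<^sup>n\<^sup>+\<^sup>2\<close>. Hence \<open>\<plusminus>R\<close>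
  decreases wherever it exceeds a large multiple of \<open>x\<^sup>n\<^sup>+\<^sup>2\<close>, and since \<open>R\<close> tends to \<open>0\<close>, the
  barrier argument excludes this.\<close>

theorem ode_form_solution_expands:
  fixes a :: real
  assumes a: "0 < a" and x1: "0 < x1" and y: "\<And>x. 0 < x \<Longrightarrow> x < x1 \<Longrightarrow> (y has_real_derivative y' x) (at x)"
    and ode: "\<And>x. 0 < x \<Longrightarrow> x < x1 \<Longrightarrow> ode_form a D E x (y x) (y' x) = 0" and lim: "(y \<longlongrightarrow> 0) (at_right 0)"
  shows "expands y (fps_X * formal_solution a D E)"
proof -
  define U where "U = formal_solution a D E"
  have main: "expands_upto (Suc (Suc n)) y (fps_X * U)" for n
  proof -
    define w where "w = partial_sum U (Suc n)"
    define w' where "w' = partial_sum (fps_deriv U) n"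
    define W where "W = Abs_fps (\<lambda>k. if k < Suc n then U $ k else 0)"
    have w: "expands w W" "expands w' (fps_deriv W)" and wd: "(w has_real_derivative w' x) (at x)" for x
    proof -
      show "expands w W" unfolding w_def W_def by (rule expands_partial_sum)
      have "fps_deriv W = Abs_fps (\<lambda>k. if k < n then fps_deriv U $ k else 0)"
        by (rule fps_ext) (auto simp: W_def)
      then show "expands w' (fps_deriv W)" unfolding w'_def using expands_partial_sum [of "fps_deriv U" n] by simp
      show "(w has_real_derivative w' x) (at x)" unfolding w_def w'_def by (rule has_derivative_partial_sum)
    qed
    define e where "e x = x * (a * w x + reduced_form a D E x (w x) (x * w' x))" for x
    have e: "e x = ode_form a D E x (x * w x) (w x + x * w' x)" for x by (simp add: e_def ode_form_reduced)
    have "agree (Suc n) W (formal_solution a D E)" by (simp add: agree_def W_def U_def)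
    then have "agree (Suc n) (fps_const a * W + reduced_op a D E W) 0" using a by (intro formal_solution_truncated) auto
    then have p0: "partial_sum (fps_const a * W + reduced_op a D E W) (Suc n) x = 0" for x
      unfolding partial_sum_def by (intro sum.neutral) (auto simp: agree_def)
    have "expands_upto (Suc n) (\<lambda>x. a * w x + reduced_form a D E x (w x) (x * w' x)) (fps_const a * W + reduced_op a D E W)"
      using expands_reduced_op [OF w, of a D E] unfolding expands_def by blast
    then obtain C where "\<forall>\<^sub>F x in at_right 0. \<bar>a * w x + reduced_form a D E x (w x) (x * w' x)
        - partial_sum (fps_const a * W + reduced_op a D E W) (Suc n) x\<bar> \<le> C * x ^ Suc n"
      unfolding expands_upto_def by blast
    then have C: "\<forall>\<^sub>F x in at_right 0. \<bar>a * w x + reduced_form a D E x (w x) (x * w' x)\<bar> \<le> C * x ^ Suc n"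
      unfolding p0 diff_zero .
    obtain x2 B where x2: "0 < x2" "x2 \<le> 1" "0 \<le> B" and K: "\<And>x y. 0 \<le> x \<Longrightarrow> x \<le> x2 \<Longrightarrow> \<bar>y\<bar> \<le> 1 \<Longrightarrow> 1/2 \<le> Kp D x y"
      and "\<And>x y. 0 \<le> x \<Longrightarrow> x \<le> x2 \<Longrightarrow> \<bar>y\<bar> \<le> 1 \<Longrightarrow> \<bar>ode_field a D E x y\<bar> \<le> B"
      and lip: "\<And>x y z. 0 \<le> x \<Longrightarrow> x \<le> x2 \<Longrightarrow> \<bar>y\<bar> \<le> 1 \<Longrightarrow> \<bar>z\<bar> \<le> 1 \<Longrightarrow> \<bar>ode_field a D E x y - ode_field a D E x z\<bar> \<le> B * \<bar>y - z\<bar>"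
      by (rule ode_field_lipschitz [of D a E]) (rule that; blast)
    have limP: "((\<lambda>x. x * w x) \<longlongrightarrow> 0) (at_right 0)"
      using tendsto_mult [OF tendsto_ident_at expands_tendsto [OF w(1)]] by simp
    have ey: "\<forall>\<^sub>F x in at_right 0. \<bar>y x\<bar> < 1"
      using tendstoD [OF lim zero_less_one] by (simp add: dist_real_def)
    have eP: "\<forall>\<^sub>F x in at_right 0. \<bar>x * w x\<bar> < 1"
      using tendstoD [OF limP zero_less_one] by (simp add: dist_real_def)
    have dB: "0 < a / (2 * (B + 1))" using a x2 by simp
    have "\<forall>\<^sub>F x in at_right 0. \<bar>a * w x + reduced_form a D E x (w x) (x * w' x)\<bar> \<le> C * x ^ Suc n \<and> \<bar>y x\<bar> < 1 \<and> \<bar>x * w x\<bar> < 1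
        \<and> x < a / (2 * (B + 1)) \<and> x < x2 \<and> x < x1"
      using C ey eP eventually_right_less [OF dB] eventually_right_less [OF x2(1)] eventually_right_less [OF x1] by eventually_elim blast
    then obtain b where b: "0 < b" and bb: "\<And>x. 0 < x \<Longrightarrow> x < b \<Longrightarrow> \<bar>a * w x + reduced_form a D E x (w x) (x * w' x)\<bar> \<le> C * x ^ Suc n \<and> \<bar>y x\<bar> < 1 \<and> \<bar>x * w x\<bar> < 1
        \<and> x < a / (2 * (B + 1)) \<and> x < x2 \<and> x < x1"
      unfolding eventually_at_right_field by auto
    \<comment> \<open>The defect enters with the factor \<open>inverse (Kp D x y) \<le> 2\<close>, and half of the damping \<open>a\<close> is spent on the Lipschitz bound.\<close>
    define k where "k = 4 * \<bar>C\<bar> / a + 1"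
    define R where "R x = y x - x * w x" for x
    define R' where "R' x = y' x - (w x + x * w' x)" for x
    have Rd: "(R has_real_derivative R' x) (at x)" if "0 < x" "x < b" for x
      unfolding R_def [abs_def] R'_def using that bb [OF that] by (auto intro!: derivative_eq_intros y wd)
    have key: "x^2 * (s * R' x) < 0" if x: "0 < x" "x < b" and s: "s = 1 \<or> s = -1" and pos: "k * x ^ Suc (Suc n) < s * R x" for x s
    proof -
      note b = bb [OF x]
      have K1: "1/2 \<le> Kp D x (y x)" "1/2 \<le> Kp D x (x * w x)" using K b x by auto
      then have K2: "Kp D x (y x) \<noteq> 0" "Kp D x (x * w x) \<noteq> 0" by auto
      have "y' x = (- a * y x + x * ode_field a D E x (y x) + 0 * inverse (Kp D x (y x))) / x^2"
        using ode [of x] b x ode_form_eq_iff [OF K2(1)] by blast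
      then have 1: "x^2 * y' x = - a * y x + x * ode_field a D E x (y x)" using x by simp
      have "w x + x * w' x = (- a * (x * w x) + x * ode_field a D E x (x * w x) + e x * inverse (Kp D x (x * w x))) / x^2"
        using e [of x] ode_form_eq_iff [OF K2(2)] x by (metis less_irrefl)
      then have 2: "x^2 * (w x + x * w' x) = - a * (x * w x) + x * ode_field a D E x (x * w x) + e x * inverse (Kp D x (x * w x))" using x by simp
      have 3: "x^2 * R' x = - a * R x + x * (ode_field a D E x (y x) - ode_field a D E x (x * w x)) - e x * inverse (Kp D x (x * w x))"
        using 1 2 by (simp add: R'_def R_def algebra_simps)
      have sR: "s * R x = \<bar>R x\<bar>"
      proof -
        have "0 \<le> k * x ^ Suc (Suc n)" using x a by (auto simp: k_def)
        with pos have "0 < s * R x" by linarith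
        with s show ?thesis by auto
      qed
      have s1: "\<bar>s\<bar> = 1" using s by auto
      have "\<bar>x * (ode_field a D E x (y x) - ode_field a D E x (x * w x))\<bar> \<le> x * (B * \<bar>R x\<bar>)"
        using lip [of x "y x" "x * w x"] b x by (simp add: abs_mult R_def)
      also have "\<dots> \<le> a / 2 * \<bar>R x\<bar>"
      proof -
        have "x * B \<le> a / (2 * (B + 1)) * (B + 1)" using b x x2 a by (intro mult_mono) auto
        also have "\<dots> = a / 2" using x2 by (simp add: field_simps)
        finally have "x * B * \<bar>R x\<bar> \<le> a / 2 * \<bar>R x\<bar>" by (rule mult_right_mono) simp
        then show ?thesis by (simp only: mult.assoc)
      qed
      finally have 4: "\<bar>s * (x * (ode_field a D E x (y x) - ode_field a D E x (x * w x)))\<bar> \<le> a / 2 * \<bar>R x\<bar>"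
        unfolding abs_mult s1 by simp
      have "\<bar>e x * inverse (Kp D x (x * w x))\<bar> \<le> (x * (\<bar>C\<bar> * x ^ Suc n)) * 2"
        unfolding abs_mult
      proof (intro mult_mono)
        have "\<bar>a * w x + reduced_form a D E x (w x) (x * w' x)\<bar> \<le> \<bar>C\<bar> * x ^ Suc n"
          using b x by (intro order_trans [OF conjunct1 [OF b]] mult_right_mono) auto
        then show "\<bar>e x\<bar> \<le> x * (\<bar>C\<bar> * x ^ Suc n)"
          unfolding e_def abs_mult using x by (intro mult_mono) auto
        show "\<bar>inverse (Kp D x (x * w x))\<bar> \<le> 2" using K1 le_imp_inverse_le [of "1/2" "Kp D x (x * w x)"] by auto
      qed (use x in auto)
      then have 5: "\<bar>s * (e x * inverse (Kp D x (x * w x)))\<bar> \<le> 2 * \<bar>C\<bar> * x ^ Suc (Suc n)"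
        unfolding abs_mult [of s] s1 by (simp add: mult_ac)
      have "x^2 * (s * R' x) = s * (x^2 * R' x)" by simp
      also have "\<dots> = - a * (s * R x) + s * (x * (ode_field a D E x (y x) - ode_field a D E x (x * w x))) - s * (e x * inverse (Kp D x (x * w x)))"
        unfolding 3 by (simp add: algebra_simps)
      also have "\<dots> \<le> - a / 2 * \<bar>R x\<bar> + 2 * \<bar>C\<bar> * x ^ Suc (Suc n)"
      proof -
        have "- a * \<bar>R x\<bar> = - a / 2 * \<bar>R x\<bar> - a / 2 * \<bar>R x\<bar>" by (simp add: field_simps)
        then show ?thesis using abs_le_D1 [OF 4] abs_le_D2 [OF 5] unfolding sR by linarith
      qed
      also have "\<dots> < - a / 2 * (k * x ^ Suc (Suc n)) + 2 * \<bar>C\<bar> * x ^ Suc (Suc n)"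
        using pos a unfolding sR by simp
      also have "\<dots> = - (a / 2) * x ^ Suc (Suc n)" using a by (simp add: k_def field_simps)
      also have "\<dots> < 0" using a x by simp
      finally show ?thesis .
    qed
    have bound: "s * R x \<le> k * x ^ Suc (Suc n)" if x: "0 < x" "x < b" and s: "s = 1 \<or> s = -1" for x s
    proof -
      have "s * R x - k * x ^ Suc (Suc n) \<le> 0"
      proof (rule barrier [of "b / 2 + x / 2" "\<lambda>x. s * R x - k * x ^ Suc (Suc n)" "\<lambda>x. s * R' x - k * (real (Suc (Suc n)) * x ^ Suc n)" x])
        show "0 < b / 2 + x / 2" using b x by simp
        fix z assume z: "0 < z" "z \<le> b / 2 + x / 2"
        then have zb: "z < b" using x by simp
        show "((\<lambda>x. s * R x - k * x ^ Suc (Suc n)) has_real_derivative s * R' z - k * (real (Suc (Suc n)) * z ^ Suc n)) (at z)"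
          using Rd [OF z(1) zb] by (auto intro!: derivative_eq_intros simp del: power_Suc)
        assume "0 < s * R z - k * z ^ Suc (Suc n)"
        then have "z^2 * (s * R' z) < 0" using key [OF z(1) zb s] by simp
        then have "s * R' z < 0" using z by (simp add: mult_less_0_iff)
        moreover have "0 \<le> k * (real (Suc (Suc n)) * z ^ Suc n)" using a z by (simp add: k_def)
        ultimately show "s * R' z - k * (real (Suc (Suc n)) * z ^ Suc n) < 0" by linarith
      next
        have "((\<lambda>x. s * R x - k * x ^ Suc (Suc n)) \<longlongrightarrow> s * (0 - 0) - k * 0 ^ Suc (Suc n)) (at_right 0)"
          unfolding R_def by (intro tendsto_intros lim limP)
        then show "((\<lambda>x. s * R x - k * x ^ Suc (Suc n)) \<longlongrightarrow> 0) (at_right 0)" by simp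
      qed (use x in auto)
      then show ?thesis by simp
    qed
    have p: "partial_sum (fps_X * U) (Suc (Suc n)) x = x * w x" for x
    proof -
      have "fps_shift 1 (fps_X * U) = U" by (rule fps_ext) simp
      then show ?thesis by (subst partial_sum_Suc) (simp add: w_def)
    qed
    have "\<forall>\<^sub>F x in at_right 0. \<bar>y x - partial_sum (fps_X * U) (Suc (Suc n)) x\<bar> \<le> k * x ^ Suc (Suc n)"
      using eventually_right_pos eventually_right_less [OF b]
    proof eventually_elim
      case (elim x)
      then show ?case using bound [of x 1] bound [of x "-1"] unfolding p R_def by (simp add: abs_le_iff)
    qed
    then show ?thesis unfolding expands_upto_def by blast
  qed
  have "expands_upto N y (fps_X * U)" for N
    using expands_upto_less [OF expands_upto_less [OF main]] by blast
  then show ?thesis unfolding expands_def U_def by blast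
qed

section \<open>The integrating factor\<close>

lemma poly_boundedI: "(\<And>x. 0 < x \<Longrightarrow> x < x0 \<Longrightarrow> \<bar>f x\<bar> \<le> C / x ^ m) \<Longrightarrow> poly_bounded x0 f"
  unfolding poly_bounded_def by blast

text \<open>Generators of an algebra of functions near \<open>0\<close> that contains the derivatives of the solution \<open>y\<close>
  and of the integrating factor \<open>m\<close>.\<close>

definition solution_functions :: "(nat \<Rightarrow> nat \<Rightarrow> real) \<Rightarrow> (real \<Rightarrow> real) \<Rightarrow> (real \<Rightarrow> real) \<Rightarrow> (real \<Rightarrow> real) set" where
  "solution_functions D y m = {\<lambda>x. x, inverse, y, \<lambda>x. inverse (Kp D x (y x)), \<lambda>x. inverse (1 + H2p D x), m}"

lemma fun_algebra_mono: "G \<subseteq> H \<Longrightarrow> f \<in> fun_algebra G \<Longrightarrow> f \<in> fun_algebra H"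
  by (erule fun_algebra.induct) (auto intro: fun_algebra.intros)

lemma fun_algebra_derivative_in_larger:
  assumes "G0 \<subseteq> G" and G0: "\<And>g. g \<in> G0 \<Longrightarrow> \<exists>g'\<in>fun_algebra G. \<forall>x. 0 < x \<and> x < x0 \<longrightarrow> (g has_real_derivative g' x) (at x)"
    and "f \<in> fun_algebra G0"
  shows "\<exists>f'\<in>fun_algebra G. \<forall>x. 0 < x \<and> x < x0 \<longrightarrow> (f has_real_derivative f' x) (at x)"
  using assms(3)
proof induction
  case (gen g) then show ?case by (rule G0)
next
  case (const c) then show ?case by (intro bexI [of _ "\<lambda>x. 0"]) (auto intro: fun_algebra.const)
next
  case (add f g)
  then obtain f' g' where "f' \<in> fun_algebra G" "g' \<in> fun_algebra G" "\<forall>x. 0 < x \<and> x < x0 \<longrightarrow> (f has_real_derivative f' x) (at x)"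
    "\<forall>x. 0 < x \<and> x < x0 \<longrightarrow> (g has_real_derivative g' x) (at x)" by blast
  then show ?case by (intro bexI [of _ "\<lambda>x. f' x + g' x"]) (auto intro: DERIV_add fun_algebra.add)
next
  case (mult f g)
  then obtain f' g' where fg: "f' \<in> fun_algebra G" "g' \<in> fun_algebra G" "\<forall>x. 0 < x \<and> x < x0 \<longrightarrow> (f has_real_derivative f' x) (at x)"
    "\<forall>x. 0 < x \<and> x < x0 \<longrightarrow> (g has_real_derivative g' x) (at x)" by blast
  have "(\<lambda>x. f' x * g x + g' x * f x) \<in> fun_algebra G"
    using fg mult fun_algebra_mono [OF assms(1)] by (intro fun_algebra.add fun_algebra.mult) auto
  with fg show ?case
    by (intro bexI [of _ "\<lambda>x. f' x * g x + g' x * f x"]) (auto intro: DERIV_mult)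
qed

lemmas fun_algebra_intros = fun_algebra.const fun_algebra_power fun_algebra.mult fun_algebra.add fun_algebra_minus fun_algebra_diff

lemma solution_functions_closed:
  fixes a :: real
  assumes a: "0 < a" and x1: "0 < x1" and y: "\<And>x. 0 < x \<Longrightarrow> x < x1 \<Longrightarrow> (y has_real_derivative y' x) (at x)"
    and ode: "\<And>x. 0 < x \<Longrightarrow> x < x1 \<Longrightarrow> ode_form a D E x (y x) (y' x) = 0" and lim: "(y \<longlongrightarrow> 0) (at_right 0)"
    and m: "\<And>x. 0 < x \<Longrightarrow> x < x1 \<Longrightarrow> (m has_real_derivative - zetap a D E x * inverse (1 + H2p D x) * m x) (at x)"
    and mb: "\<And>x. 0 < x \<Longrightarrow> x < x1 \<Longrightarrow> \<bar>m x\<bar> \<le> C"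
  obtains x2 where "0 < x2" "x2 \<le> 1" "x2 \<le> x1"
    "\<And>g. g \<in> solution_functions D y m \<Longrightarrow> poly_bounded x2 g \<and> (\<exists>g'\<in>fun_algebra (solution_functions D y m). \<forall>x. 0 < x \<and> x < x2 \<longrightarrow> (g has_real_derivative g' x) (at x))"
proof -
  define G where "G = solution_functions D y m"
  obtain x3 B where x3: "0 < x3" "x3 \<le> 1" "0 \<le> B" and K0: "\<And>x y. 0 \<le> x \<Longrightarrow> x \<le> x3 \<Longrightarrow> \<bar>y\<bar> \<le> 1 \<Longrightarrow> 1/2 \<le> Kp D x y"
    and "\<And>x y. 0 \<le> x \<Longrightarrow> x \<le> x3 \<Longrightarrow> \<bar>y\<bar> \<le> 1 \<Longrightarrow> \<bar>ode_field a D E x y\<bar> \<le> B"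
    and "\<And>x y z. 0 \<le> x \<Longrightarrow> x \<le> x3 \<Longrightarrow> \<bar>y\<bar> \<le> 1 \<Longrightarrow> \<bar>z\<bar> \<le> 1 \<Longrightarrow> \<bar>ode_field a D E x y - ode_field a D E x z\<bar> \<le> B * \<bar>y - z\<bar>"
    by (rule ode_field_lipschitz [of D a E]) (rule that; blast)
  have ey: "\<forall>\<^sub>F x in at_right 0. \<bar>y x\<bar> < 1"
    using tendstoD [OF lim zero_less_one] by (simp add: dist_real_def)
  then obtain b where b: "0 < b" "\<And>x. 0 < x \<Longrightarrow> x < b \<Longrightarrow> \<bar>y x\<bar> < 1"
    unfolding eventually_at_right_field by auto
  define x2 where "x2 = min (min x1 x3) b"
  have x2: "0 < x2" "x2 \<le> 1" "x2 \<le> x1" "x2 \<le> x3" "x2 \<le> b" using x1 x3 b by (auto simp: x2_def)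
  have K: "1/2 \<le> Kp D x (y x)" "1/2 \<le> 1 + H2p D x" "\<bar>y x\<bar> \<le> 1" if "0 < x" "x < x2" for x
  proof -
    show y1: "\<bar>y x\<bar> \<le> 1" using b(2) [of x] that x2 by simp
    show "1/2 \<le> Kp D x (y x)" using K0 [of x "y x"] y1 that x2 by simp
    have "Kp D x 0 = 1 + H2p D x" by (simp add: Kp_def N2p_def)
    then show "1/2 \<le> 1 + H2p D x" using K0 [of x 0] that x2 by simp
  qed
  have g: "(\<lambda>x. x) \<in> fun_algebra G" "inverse \<in> fun_algebra G" "y \<in> fun_algebra G" "(\<lambda>x. inverse (Kp D x (y x))) \<in> fun_algebra G"
    "(\<lambda>x. inverse (1 + H2p D x)) \<in> fun_algebra G" "m \<in> fun_algebra G"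
    by (auto intro!: fun_algebra.gen simp: G_def solution_functions_def)
  note pd = Kp_def ode_remainder_def K_quotient_def Rp_def N1q_def N2p_def M11p_def M12p_def M21p_def M22p_def H1p_def H2p_def G1p_def G2p_def zetap_def
  define G0 where "G0 = {\<lambda>x. x, y}"
  have g0: "(\<lambda>x. x) \<in> fun_algebra G0" "y \<in> fun_algebra G0" by (auto intro!: fun_algebra.gen simp: G0_def)
  have K_fun_algebra: "(\<lambda>x. Kp D x (y x)) \<in> fun_algebra G0" unfolding pd by (intro fun_algebra_intros g0)
  have H_fun_algebra: "(\<lambda>x. 1 + H2p D x) \<in> fun_algebra G0" unfolding pd by (intro fun_algebra_intros g0)
  have p_fun_algebra: "(\<lambda>x. ode_remainder a D E x (y x)) \<in> fun_algebra G" unfolding pd by (intro fun_algebra_intros g)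
  have z_fun_algebra: "(\<lambda>x. zetap a D E x) \<in> fun_algebra G" unfolding pd by (intro fun_algebra_intros g)
  define yd where "yd x = (- a * y x + x * - (ode_remainder a D E x (y x) * inverse (Kp D x (y x)))) * inverse x ^ 2" for x
  have yd: "yd \<in> fun_algebra G" unfolding yd_def [abs_def] by (intro fun_algebra_intros g p_fun_algebra)
  have ydd: "(y has_real_derivative yd x) (at x)" if "0 < x" "x < x2" for x
  proof -
    have "Kp D x (y x) \<noteq> 0" using K(1) [OF that] by auto
    then have "y' x = (- a * y x + x * ode_field a D E x (y x) + 0 * inverse (Kp D x (y x))) / x^2"
      using ode [of x] that x2 ode_form_eq_iff [of D x "y x" a E "y' x" 0] by auto
    then have "y' x = yd x" by (simp add: yd_def ode_field_def divide_inverse power_inverse)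
    then show ?thesis using y [of x] that x2 by simp
  qed
  have sub: "G0 \<subseteq> G" by (auto simp: G0_def G_def solution_functions_def)
  have der0: "\<exists>g'\<in>fun_algebra G. \<forall>x. 0 < x \<and> x < x2 \<longrightarrow> (g has_real_derivative g' x) (at x)" if "g \<in> G0" for g
  proof -
    have "g = (\<lambda>x. x) \<or> g = y" using that by (simp add: G0_def)
    then show ?thesis
  proof (elim disjE)
    assume "g = (\<lambda>x. x)"
    then show ?thesis by (intro bexI [of _ "\<lambda>x. 1"]) (auto intro: fun_algebra.const)
  next
    assume "g = y"
    then show ?thesis using yd ydd by (intro bexI [of _ yd]) auto
  qed
  qed
  have inv: "\<exists>g'\<in>fun_algebra G. \<forall>x. 0 < x \<and> x < x2 \<longrightarrow> ((\<lambda>x. inverse (f x)) has_real_derivative g' x) (at x)"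
    if f: "f \<in> fun_algebra G0" "(\<lambda>x. inverse (f x)) \<in> fun_algebra G" "\<And>x. 0 < x \<Longrightarrow> x < x2 \<Longrightarrow> 1/2 \<le> f x" for f
  proof -
    obtain f' where f': "f' \<in> fun_algebra G" "\<forall>x. 0 < x \<and> x < x2 \<longrightarrow> (f has_real_derivative f' x) (at x)"
      using fun_algebra_derivative_in_larger [OF sub der0 f(1)] by blast
    have "((\<lambda>x. inverse (f x)) has_real_derivative - (inverse (f x) * f' x * inverse (f x))) (at x)" if "0 < x" "x < x2" for x
      using f'(2) f(3) [OF that] that by (intro DERIV_inverse') auto
    moreover have "(\<lambda>x. - (inverse (f x) * f' x * inverse (f x))) \<in> fun_algebra G" by (intro fun_algebra_intros f f')
    ultimately show ?thesis by (intro bexI [of _ "\<lambda>x. - (inverse (f x) * f' x * inverse (f x))"]) simp_all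
  qed
  have pinv: "poly_bounded x2 (\<lambda>x. inverse (f x))" if "\<And>x. 0 < x \<Longrightarrow> x < x2 \<Longrightarrow> 1/2 \<le> f x" for f :: "real \<Rightarrow> real"
  proof (rule poly_boundedI [of x2 _ 2 0])
    fix x assume "0 < x" "x < x2"
    then show "\<bar>inverse (f x)\<bar> \<le> 2 / x ^ 0"
      using that [of x] le_imp_inverse_le [of "1/2" "f x"] by auto
  qed
  have "poly_bounded x2 g \<and> (\<exists>g'\<in>fun_algebra G. \<forall>x. 0 < x \<and> x < x2 \<longrightarrow> (g has_real_derivative g' x) (at x))" if "g \<in> G" for g
  proof -
    have "g = (\<lambda>x. x) \<or> g = inverse \<or> g = y \<or> g = (\<lambda>x. inverse (Kp D x (y x)))
        \<or> g = (\<lambda>x. inverse (1 + H2p D x)) \<or> g = m"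
      using that by (simp add: G_def solution_functions_def)
    then show ?thesis
  proof (elim disjE)
    assume e: "g = (\<lambda>x. x)"
    have "poly_bounded x2 g" unfolding e by (rule poly_boundedI [of x2 _ 1 0]) (use x2 in auto)
    then show ?thesis using der0 [of g] by (auto simp: e G0_def)
  next
    assume e: "g = inverse"
    have "poly_bounded x2 g" unfolding e by (rule poly_boundedI [of x2 _ 1 1]) (auto simp: divide_inverse)
    moreover have "(\<lambda>x. - (inverse x ^ Suc (Suc 0))) \<in> fun_algebra G" by (intro fun_algebra_intros g)
    moreover have "(inverse has_real_derivative - (inverse x ^ Suc (Suc 0))) (at x)" if "0 < x" for x :: real
      using that by (intro DERIV_inverse) auto
    ultimately show ?thesis unfolding e by (intro conjI bexI [of _ "\<lambda>x. - (inverse x ^ Suc (Suc 0))"]) simp_all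
  next
    assume e: "g = y"
    have "poly_bounded x2 g" unfolding e by (rule poly_boundedI [of x2 _ 1 0]) (use K(3) in auto)
    then show ?thesis using der0 [of g] by (auto simp: e G0_def)
  next
    assume e: "g = (\<lambda>x. inverse (Kp D x (y x)))"
    show ?thesis unfolding e using inv [OF K_fun_algebra g(4) K(1)] pinv [OF K(1)] by simp
  next
    assume e: "g = (\<lambda>x. inverse (1 + H2p D x))"
    show ?thesis unfolding e using inv [OF H_fun_algebra g(5) K(2)] pinv [OF K(2)] by simp
  next
    assume e: "g = m"
    have "poly_bounded x2 g" unfolding e by (rule poly_boundedI [of x2 _ C 0]) (use mb x2 in auto)
    moreover have "(\<lambda>x. - zetap a D E x * inverse (1 + H2p D x) * m x) \<in> fun_algebra G" by (intro fun_algebra_intros g z_fun_algebra)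
    ultimately show ?thesis unfolding e using m x2 by (intro conjI bexI [of _ "\<lambda>x. - zetap a D E x * inverse (1 + H2p D x) * m x"]) auto
  qed
  qed
  then show ?thesis using x2 by (intro that [of x2]) (auto simp: G_def)
qed

text \<open>A convergent power series is its own asymptotic expansion.\<close>

lemma expands_power_series:
  assumes s: "0 < r" "\<And>x. 0 < x \<Longrightarrow> x < r \<Longrightarrow> (\<lambda>n. A $ n * x ^ n) sums f x"
    and AR: "0 < R" "\<And>n. \<bar>A $ n\<bar> \<le> C * R ^ n"
  shows "expands f A"
  unfolding expands_def
proof
  fix N
  have C: "0 \<le> C" using AR(2) [of 0] by simp
  have r: "0 < min r (1 / (2 * R))" using s AR by simp
  have "\<forall>\<^sub>F x in at_right 0. \<bar>f x - partial_sum A N x\<bar> \<le> 2 * C * R ^ N * x ^ N"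
    using eventually_right_pos eventually_right_less [OF r]
  proof eventually_elim
    case (elim x)
    then have x: "0 < x" "x < r" "R * x \<le> 1/2" using AR by (auto simp: field_simps)
    have "(\<lambda>n. A $ (n + N) * x ^ (n + N)) sums (f x - partial_sum A N x)"
      using sums_split_initial_segment [OF s(2) [OF x(1,2)], of N] by (simp add: partial_sum_def)
    moreover have "(\<lambda>n. C * R ^ N * x ^ N * (1/2) ^ n) sums (C * R ^ N * x ^ N * (1 / (1 - 1/2)))"
      by (intro sums_mult geometric_sums) auto
    moreover have "norm (A $ (n + N) * x ^ (n + N)) \<le> C * R ^ N * x ^ N * (1/2) ^ n" for n
    proof -
      have "norm (A $ (n + N) * x ^ (n + N)) \<le> C * R ^ (n + N) * x ^ (n + N)"
        using AR(2) [of "n + N"] x by (simp add: abs_mult mult_right_mono)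
      also have "\<dots> = C * R ^ N * x ^ N * (R * x) ^ n" by (simp add: power_add power_mult_distrib)
      also have "\<dots> \<le> C * R ^ N * x ^ N * (1/2) ^ n"
        using x AR C by (intro mult_left_mono power_mono) auto
      finally show ?thesis .
    qed
    ultimately have "norm (f x - partial_sum A N x) \<le> C * R ^ N * x ^ N * (1 / (1 - 1/2))"
      by (metis (no_types, lifting) norm_suminf_le sums_iff)
    then show ?case by simp
  qed
  then show "expands_upto N f A" unfolding expands_upto_def by blast
qed

text \<open>The factor \<open>m = 1/M\<close> is the exponential of the integral of a function that is holomorphic near \<open>0\<close>.
  It is the restriction of a holomorphic function, built from a complex primitive, whose power
  series converges; so its coefficients grow at most geometrically.\<close>

lemma integrating_factor:
  fixes a :: real
  obtains x3 m A C R where "0 < x3" "\<And>x. 0 < x \<Longrightarrow> x < x3 \<Longrightarrow> 1 + H2p D x \<noteq> 0"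
    "\<And>x. 0 < x \<Longrightarrow> x < x3 \<Longrightarrow> (m has_real_derivative - zetap a D E x * inverse (1 + H2p D x) * m x) (at x)"
    "\<And>x. 0 < x \<Longrightarrow> x < x3 \<Longrightarrow> m x = exp (integral {0..x} (\<lambda>x. - zetap a D E x * inverse (1 + H2p D x)))"
    "\<And>x. 0 < x \<Longrightarrow> x < x3 \<Longrightarrow> \<bar>m x\<bar> \<le> C" "expands m A" "A $ 0 = 1" "0 < R" "0 \<le> C" "\<And>n. \<bar>A $ n\<bar> \<le> C * R ^ n"
proof -
  define xc where "xc z = - zetap (of_real a) (\<lambda>i j. of_real (D i j)) (\<lambda>i j. of_real (E i j)) z *
     inverse (1 + H2p (\<lambda>i j. of_real (D i j)) z)" for z :: complex
  define xr where "xr x = - zetap a D E x * inverse (1 + H2p D x)" for x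
  have xcr: "xc (of_real x) = of_real (xr x)" for x
    by (simp add: xc_def xr_def zetap_def H2p_def nup_def)
  have "continuous (at 0) (\<lambda>z::complex. 1 + H2p (\<lambda>i j. of_real (D i j)) z)"
    unfolding H2p_def by (intro continuous_intros)
  then have "\<forall>\<^sub>F z in nhds (0::complex). 1 + H2p (\<lambda>i j. of_real (D i j)) z \<noteq> 0"
    by (intro tendsto_imp_eventually_ne [of _ 1]) (auto simp: isCont_def H2p_def tendsto_nhds_iff)
  then obtain \<rho> where \<rho>: "0 < \<rho>" "\<And>z::complex. z \<in> ball 0 \<rho> \<Longrightarrow> 1 + H2p (\<lambda>i j. of_real (D i j)) z \<noteq> 0"
    unfolding eventually_nhds_metric by (auto simp: dist_commute)
  have hol: "xc holomorphic_on ball 0 \<rho>"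
    unfolding xc_def [abs_def] zetap_def using \<rho>(2) by (intro holomorphic_intros) (auto simp: H2p_def intro!: holomorphic_intros)
  obtain L0 where L0: "\<And>z. z \<in> ball 0 \<rho> \<Longrightarrow> (L0 has_field_derivative xc z) (at z within ball 0 \<rho>)"
    by (rule holomorphic_convex_primitive' [OF convex_ball open_ball hol]) (rule that; blast)
  define mc where "mc z = exp (L0 z - L0 0)" for z
  have mcd: "(mc has_field_derivative xc z * mc z) (at z)" if "z \<in> ball 0 \<rho>" for z
  proof -
    have "(L0 has_field_derivative xc z) (at z)" using L0 [OF that] that by (simp add: at_within_open [OF _ open_ball])
    then show ?thesis unfolding mc_def [abs_def] by (auto intro!: derivative_eq_intros simp: mult.commute)
  qed
  have mch: "mc holomorphic_on ball 0 \<rho>"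
    using mcd unfolding holomorphic_on_open [OF open_ball] by blast
  define c where "c n = (deriv ^^ n) mc 0 / fact n" for n
  have ser: "(\<lambda>n. c n * z ^ n) sums mc z" if "z \<in> ball 0 \<rho>" for z
    using holomorphic_power_series [OF mch that] by (simp add: c_def)
  define A where "A = Abs_fps (\<lambda>n. Re (c n))"
  define R where "R = 2 / \<rho>"
  have R: "0 < R" using \<rho> by (simp add: R_def)
  have "of_real (\<rho> / 2) \<in> ball (0::complex) \<rho>" using \<rho> by simp
  then have "(\<lambda>n. c n * of_real (\<rho> / 2) ^ n) \<longlonglongrightarrow> 0" by (intro summable_LIMSEQ_zero sums_summable [OF ser])
  then have "Bseq (\<lambda>n. c n * of_real (\<rho> / 2) ^ n)" by (intro convergent_imp_Bseq convergentI)
  then obtain C0 where C0: "0 < C0" "\<And>n. norm (c n * of_real (\<rho> / 2) ^ n) \<le> C0" by (auto elim!: BseqE)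
  have cb: "norm (c n) \<le> C0 * R ^ n" for n
  proof -
    have "norm (c n) * (\<rho> / 2) ^ n \<le> C0" using C0(2) [of n] \<rho> by (simp add: norm_mult norm_power norm_divide)
    then have "norm (c n) * (\<rho> / 2) ^ n * R ^ n \<le> C0 * R ^ n" using R by (intro mult_right_mono) auto
    moreover have "(\<rho> / 2) ^ n * R ^ n = 1" using \<rho> by (simp add: R_def power_mult_distrib [symmetric])
    ultimately show ?thesis by (simp add: mult.assoc)
  qed
  have Ab: "\<bar>A $ n\<bar> \<le> C0 * R ^ n" for n using cb [of n] abs_Re_le_cmod [of "c n"] by (simp add: A_def)
  define m where "m x = exp (integral {0..x} xr)" for x
  have ballx: "of_real x \<in> ball (0::complex) \<rho>" if "0 \<le> x" "x < \<rho>" for x using that by simp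
  have H: "1 + H2p D x \<noteq> 0" if "0 \<le> x" "x < \<rho>" for x
  proof
    assume "1 + H2p D x = 0"
    then have "of_real (1 + H2p D x) = (0::complex)" by simp
    then show False using \<rho>(2) [OF ballx [OF that]] by (simp add: H2p_def)
  qed
  have xrc: "continuous_on {0..x} xr" if "x < \<rho>" for x
    unfolding xr_def [abs_def] zetap_def using H that by (intro continuous_intros) (auto simp: H2p_def intro!: continuous_intros)
  have md: "(m has_real_derivative xr x * m x) (at x)" if x: "0 < x" "x < \<rho>" for x
  proof -
    obtain x' where x': "x < x'" "x' < \<rho>" using dense [OF x(2)] by auto
    have "((\<lambda>u. integral {0..u} xr) has_real_derivative xr x) (at x within {0..x'})"
      using xrc x' that by (intro integral_has_real_derivative) auto
    then have "((\<lambda>u. integral {0..u} xr) has_real_derivative xr x) (at x)" using that x' by (simp add: at_within_Icc_at)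
    then show ?thesis unfolding m_def [abs_def] by (auto intro!: derivative_eq_intros simp: mult.commute)
  qed
  have mm: "mc (of_real x) = of_real (m x)" if x: "0 < x" "x < \<rho>" for x
  proof -
    define q where "q t = mc (of_real t) * of_real (exp (- integral {0..t} xr))" for t
    have "q x = q 0"
    proof (rule has_derivative_zero_unique_strong_interval [where k = "{}" and a = 0 and b = x and f = q and y = "q 0" and x = x])
      show "continuous_on {0..x} q"
      proof -
        have "continuous_on {0..x} (\<lambda>t. mc (of_real t))"
        proof (rule continuous_on_compose2 [OF holomorphic_on_imp_continuous_on [OF mch]])
          show "continuous_on {0..x} (\<lambda>t. of_real t :: complex)" by (intro continuous_on_of_real continuous_on_id)
          show "(\<lambda>t. of_real t) ` {0..x} \<subseteq> ball (0::complex) \<rho>" using x by auto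
        qed
        moreover have "continuous_on {0..x} (\<lambda>t. integral {0..t} xr)"
          using xrc [OF x(2)] by (intro indefinite_integral_continuous_1 integrable_continuous_interval)
        ultimately show ?thesis unfolding q_def [abs_def]
          by (intro continuous_on_mult continuous_on_of_real continuous_on_exp continuous_on_minus)
      qed
      fix t assume t: "t \<in> {0..x} - {}"
      have "((\<lambda>u. integral {0..u} xr) has_vector_derivative xr t) (at t within {0..x})"
        using xrc [OF x(2)] t by (intro integral_has_vector_derivative) auto
      then have "((\<lambda>u. integral {0..u} xr) has_real_derivative xr t) (at t within {0..x})"
        by (simp add: has_real_derivative_iff_has_vector_derivative)
      then have "((\<lambda>u. exp (- integral {0..u} xr)) has_real_derivative - xr t * exp (- integral {0..t} xr)) (at t within {0..x})"
        by (auto intro!: derivative_eq_intros)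
      then have 1: "((\<lambda>u. of_real (exp (- integral {0..u} xr)) :: complex) has_vector_derivative of_real (- xr t * exp (- integral {0..t} xr))) (at t within {0..x})"
        by (intro has_vector_derivative_of_real) (simp add: has_real_derivative_iff_has_vector_derivative)
      have 2: "((\<lambda>u. mc (of_real u)) has_vector_derivative xc (of_real t) * mc (of_real t)) (at t within {0..x})"
        using mcd [OF ballx, of t] t x by (intro has_vector_derivative_real_field) auto
      have "(q has_vector_derivative mc (of_real t) * of_real (- xr t * exp (- integral {0..t} xr)) +
           xc (of_real t) * mc (of_real t) * of_real (exp (- integral {0..t} xr))) (at t within {0..x})"
        unfolding q_def [abs_def] by (rule has_vector_derivative_mult [OF 2 1])
      then have "(q has_vector_derivative 0) (at t within {0..x})" by (simp add: xcr mult_ac)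
      then show "(q has_derivative (\<lambda>h. 0)) (at t within {0..x})" by (simp add: has_vector_derivative_def)
    qed (use x in auto)
    moreover have "q 0 = 1" by (simp add: q_def mc_def)
    ultimately have "mc (of_real x) * of_real (exp (- integral {0..x} xr)) = 1" by (simp add: q_def)
    then show ?thesis by (simp add: m_def exp_minus field_simps of_real_inverse)
  qed
  have ms: "(\<lambda>n. A $ n * x ^ n) sums m x" if x: "0 < x" "x < \<rho>" for x
  proof -
    have "(\<lambda>n. Re (c n * of_real x ^ n)) sums Re (mc (of_real x))"
      using ser [OF ballx] x by (intro sums_Re) auto
    moreover have "Re (c n * of_real x ^ n) = A $ n * x ^ n" for n
      by (simp add: A_def of_real_power [symmetric] del: of_real_power)
    ultimately have "(\<lambda>n. A $ n * x ^ n) sums Re (mc (of_real x))" by (simp only:)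
    then show ?thesis using mm [OF x] by (simp only: Re_complex_of_real)
  qed
  have em: "expands m A" by (rule expands_power_series [OF \<rho>(1) ms R Ab])
  have A0: "A $ 0 = 1"
  proof -
    have "mc 0 = 1" by (simp add: mc_def)
    then show ?thesis by (simp add: A_def c_def)
  qed
  have "\<forall>\<^sub>F x in at_right 0. dist (m x) (A $ 0) < 1" using expands_tendsto [OF em] by (rule tendstoD) simp
  then obtain b where b: "0 < b" "\<And>x. 0 < x \<Longrightarrow> x < b \<Longrightarrow> dist (m x) (A $ 0) < 1"
    unfolding eventually_at_right_field by auto
  show ?thesis
  proof (rule that [of "min \<rho> b" m "max C0 2" A R])
    show "0 < min \<rho> b" using b \<rho> by simp
    show "expands m A" "A $ 0 = 1" "0 < R" "0 \<le> max C0 2" using em A0 R by auto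
    show "\<bar>A $ n\<bar> \<le> max C0 2 * R ^ n" for n
    proof (rule order_trans [OF Ab])
      show "C0 * R ^ n \<le> max C0 2 * R ^ n" using R by (intro mult_right_mono) auto
    qed
    fix x assume x: "0 < x" "x < min \<rho> b"
    then show "1 + H2p D x \<noteq> 0" using H [of x] by simp
    show "(m has_real_derivative - zetap a D E x * inverse (1 + H2p D x) * m x) (at x)"
      using md [of x] x by (simp add: xr_def)
    show "m x = exp (integral {0..x} (\<lambda>x. - zetap a D E x * inverse (1 + H2p D x)))"
      by (simp add: m_def xr_def [abs_def])
    show "\<bar>m x\<bar> \<le> max C0 2" using b(2) [of x] x by (auto simp: A0 dist_real_def)
  qed
qed

section \<open>The limiting constant as a Stokes constant\<close>

definition complex_fps :: "real fps \<Rightarrow> complex fps" where "complex_fps A = Abs_fps (\<lambda>n. of_real (A $ n))"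

lemma complex_fps_nth [simp]: "complex_fps A $ n = of_real (A $ n)" by (simp add: complex_fps_def)
lemma complex_fps_add: "complex_fps (A + B) = complex_fps A + complex_fps B" by (rule fps_ext) simp
lemma complex_fps_diff: "complex_fps (A - B) = complex_fps A - complex_fps B" by (rule fps_ext) simp
lemma complex_fps_minus: "complex_fps (- A) = - complex_fps A" by (rule fps_ext) simp
lemma complex_fps_mult: "complex_fps (A * B) = complex_fps A * complex_fps B" by (rule fps_ext) (simp add: fps_mult_nth)
lemma complex_fps_const: "complex_fps (fps_const c) = fps_const (of_real c)" by (rule fps_ext) simp
lemma complex_fps_1: "complex_fps 1 = 1" by (rule fps_ext) simp
lemma complex_fps_numeral: "complex_fps (numeral k) = numeral k" by (rule fps_ext) (simp add: fps_numeral_nth)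
lemma complex_fps_X: "complex_fps fps_X = fps_X" by (rule fps_ext) (simp add: fps_X_def)
lemma complex_fps_power: "complex_fps (A ^ n) = complex_fps A ^ n" by (induction n) (simp_all add: complex_fps_1 complex_fps_mult)
lemma complex_fps_deriv: "complex_fps (fps_deriv A) = fps_deriv (complex_fps A)" by (rule fps_ext) simp

lemmas complex_fps_simps = complex_fps_add complex_fps_diff complex_fps_minus complex_fps_mult complex_fps_const complex_fps_1 complex_fps_numeral complex_fps_X complex_fps_power complex_fps_deriv

abbreviation complex_coeffs :: "(nat \<Rightarrow> nat \<Rightarrow> real) \<Rightarrow> nat \<Rightarrow> nat \<Rightarrow> complex" where
  "complex_coeffs D \<equiv> \<lambda>i j. of_real (D i j)"

lemma reduced_op_complex_fps: "reduced_op (of_real a) (complex_coeffs D) (complex_coeffs E) (complex_fps A) = complex_fps (reduced_op a D E A)"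
  unfolding reduced_op_def reduced_form_def Kp_def Rp_def N1q_def N2p_def M11p_def M12p_def M21p_def M22p_def H1p_def H2p_def G1p_def G2p_def
  by (simp only: complex_fps_simps)

lemma formal_solution_of_real: "formal_solution (of_real a) (complex_coeffs D) (complex_coeffs E) = complex_fps (formal_solution a D E)"
proof -
  have "formal_coeff (of_real a) (complex_coeffs D) (complex_coeffs E) n = of_real (formal_coeff a D E n)" for n
  proof (induction n rule: less_induct)
    case (less n)
    have "Abs_fps (\<lambda>k. if k < n then formal_coeff (of_real a) (complex_coeffs D) (complex_coeffs E) k else 0) =
       complex_fps (Abs_fps (\<lambda>k. if k < n then formal_coeff a D E k else 0))"
      by (rule fps_ext) (simp add: less)
    then have "formal_coeff (of_real a) (complex_coeffs D) (complex_coeffs E) n = - (reduced_op (of_real a) (complex_coeffs D) (complex_coeffs E)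
       (complex_fps (Abs_fps (\<lambda>k. if k < n then formal_coeff a D E k else 0))) $ n) / of_real a"
      by (subst formal_coeff.simps) (simp only:)
    also have "\<dots> = of_real (- (reduced_op a D E (Abs_fps (\<lambda>k. if k < n then formal_coeff a D E k else 0)) $ n) / a)"
      unfolding reduced_op_complex_fps by simp
    also have "\<dots> = of_real (formal_coeff a D E n)" by (subst (2) formal_coeff.simps) (rule refl)
    finally show ?case .
  qed
  then show ?thesis by (intro fps_ext) (simp add: formal_solution_def)
qed

lemma nup_of_real: "nup (of_real a) (complex_coeffs D) (complex_coeffs E) = of_real (nup a D E)"
  by (simp add: nup_def)

lemma limit_ode_iff:
  assumes "x \<noteq> 0"
  shows "limit_ode d l I \<Psi> x \<longleftrightarrow> ode_form (a_inf d l) (d_coef d l) (e_coef d l) x (\<Psi> x) (deriv_within I \<Psi> x) = 0"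
proof -
  have h: "H1 d l x = H1p (e_coef d l) x" "H2 d l x = H2p (d_coef d l) x" "G1 d l x = G1p (e_coef d l) x"
    "G2 d l x = G2p (d_coef d l) x" "N2 d l x y = N2p (d_coef d l) x y" for y
    by (simp_all add: H1_def H1p_def H2_def H2p_def G1_def G1p_def G2_def G2p_def N2_def N2p_def M21_def M21p_def M22_def M22p_def)
  have n: "N1 d l x y / x = N1q (e_coef d l) x y" for y
    using assms by (simp add: N1_def N1q_def M11_def M11p_def M12_def M12p_def field_simps power2_eq_square)
  have e: "a_inf d l * N1 d l x y / x = a_inf d l * N1q (e_coef d l) x y" for y
    using n [of y] by (metis times_divide_eq_right)
  have k: "1 + H2p (d_coef d l) x + G2p (d_coef d l) x * y + N2p (d_coef d l) x y = Kp (d_coef d l) x y" for y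
    by (simp add: Kp_def)
  have r: "a_inf d l * H1p (e_coef d l) x - 2 * (1 + H2p (d_coef d l) x) + a_inf d l * N1q (e_coef d l) x y - 2 * N2p (d_coef d l) x y
     = Rp (a_inf d l) (d_coef d l) (e_coef d l) x y" for y by (simp add: Rp_def)
  show ?thesis
    unfolding limit_ode_def h e k r ode_form_def by (auto simp: algebra_simps)
qed

lemma limit_ode_0: "\<Psi> 0 = 0 \<Longrightarrow> limit_ode d l I \<Psi> 0"
  by (simp add: limit_ode_def)

text \<open>\<open>Psi_tilde\<close> is chosen among the smooth solutions, so that their existence has to be known before
  anything can be said about it. The factor \<open>M\<close> is absent here: the algebra is taken with \<open>m = 0\<close>.\<close>

lemma local_solution_exists:
  assumes a: "0 < a_inf d l"
  shows "\<exists>\<Psi>. local_solution d l \<Psi>"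
proof -
  define a D E where "a = a_inf d l" and "D = d_coef d l" and "E = e_coef d l"
  have a0: "0 < a" using assms by (simp add: a_def)
  show ?thesis
  proof (rule ode_form_solution_exists [OF a0, of D E])
    fix x0 y y'
    assume x0: "0 < x0" "x0 \<le> 1" and y: "\<And>x. 0 < x \<Longrightarrow> x < x0 \<Longrightarrow> (y has_real_derivative y' x) (at x)"
      and ode: "\<And>x. 0 < x \<Longrightarrow> x < x0 \<Longrightarrow> ode_form a D E x (y x) (y' x) = 0" and lim: "(y \<longlongrightarrow> 0) (at_right 0)"
    have ex: "expands y (fps_X * formal_solution a D E)" by (rule ode_form_solution_expands [OF a0 x0(1) y ode lim])
    show ?thesis
    proof (rule solution_functions_closed [OF a0 x0(1) y ode lim, where m = "\<lambda>x. 0" and C = 0])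
      show "((\<lambda>x. 0) has_real_derivative - zetap a D E x * inverse (1 + H2p D x) * 0) (at x)" for x by simp
      fix x2 assume x2: "0 < x2" "x2 \<le> 1" "x2 \<le> x0"
        and cl: "\<And>g. g \<in> solution_functions D y (\<lambda>x. 0) \<Longrightarrow> poly_bounded x2 g \<and> (\<exists>g'\<in>fun_algebra (solution_functions D y (\<lambda>x. 0)). \<forall>x. 0 < x \<and> x < x2 \<longrightarrow> (g has_real_derivative g' x) (at x))"
      have mem: "y \<in> fun_algebra (solution_functions D y (\<lambda>x. 0))" by (auto intro!: fun_algebra.gen simp: solution_functions_def)
      show ?thesis
      proof (rule fun_algebra_derivative_sequence [of x2 "solution_functions D y (\<lambda>x. 0)" y "fps_X * formal_solution a D E"])
        fix F
        assume F0: "F 0 = y" and F: "\<And>n x. 0 < x \<Longrightarrow> x < x2 \<Longrightarrow> (F n has_real_derivative F (Suc n) x) (at x)"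
          and FA: "\<And>n. expands (F n) ((fps_deriv ^^ n) (fps_X * formal_solution a D E))"
        define \<Psi> where "\<Psi> x = (if x = 0 then 0 else y x)" for x
        define c where "c = x2 / 2"
        have c: "0 < c" "c < x2" using x2 by (auto simp: c_def)
        have S: "{0..c} = {0..} \<or> (\<exists>c'>0. c' < x2 \<and> {0..c} = {0..c'})" using c by blast
        note dw = derivatives_within [OF x2(1) S F FA, of \<Psi>]
        have 0: "\<Psi> x = F 0 x" if "0 < x" for x using that by (simp add: \<Psi>_def F0)
        have 1: "\<Psi> 0 = (fps_X * formal_solution a D E) $ 0" by (simp add: \<Psi>_def)
        have sm: "smooth_within {0..c} \<Psi>"
          unfolding smooth_within_def
        proof (intro allI ballI)
          fix n x assume "x \<in> {0..c}"
          then show "(deriv_within {0..c} ^^ n) \<Psi> differentiable at x within {0..c}"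
            using c by (intro dw(2) 0 1) auto
        qed
        have "limit_ode d l {0..c} \<Psi> x" if x: "x \<in> {0..c}" for x
        proof (cases "x = 0")
          case True then show ?thesis using limit_ode_0 [of \<Psi>] by (simp add: \<Psi>_def)
        next
          case False
          have x': "0 < x" "x < x2" using x False c by auto
          have "(deriv_within {0..c} ^^ 1) \<Psi> x = (if x = 0 then fact 1 * (fps_X * formal_solution a D E) $ 1 else F 1 x)"
            using x x' by (intro dw(1) 0 1) auto
          then have "deriv_within {0..c} \<Psi> x = F 1 x" using False by simp
          moreover have "F 1 x = y' x" using F [OF x', of 0] y [of x] x' x2 by (auto simp: F0 intro: DERIV_unique)
          ultimately show ?thesis
            unfolding limit_ode_iff [OF False] using ode [of x] x' x2 False by (simp add: \<Psi>_def a_def D_def E_def)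
        qed
        then show "\<exists>\<Psi>. local_solution d l \<Psi>"
          using sm c unfolding local_solution_def by (intro exI [of _ \<Psi>] exI [of _ c]) (simp add: \<Psi>_def)
      qed (rule x2 mem ex cl; assumption)+
    qed auto
  qed
qed

lemma Psi_tilde_solution:
  assumes a: "0 < a_inf d l"
  obtains x0 y' where "0 < x0" "\<And>x. 0 < x \<Longrightarrow> x < x0 \<Longrightarrow> (Psi_tilde d l has_real_derivative y' x) (at x)"
    "\<And>x. 0 < x \<Longrightarrow> x < x0 \<Longrightarrow> ode_form (a_inf d l) (d_coef d l) (e_coef d l) x (Psi_tilde d l x) (y' x) = 0"
    "(Psi_tilde d l \<longlongrightarrow> 0) (at_right 0)"
proof -
  define \<Psi> where "\<Psi> = Psi_tilde d l"
  have "local_solution d l \<Psi>" unfolding \<Psi>_def Psi_tilde_def by (rule someI_ex [OF local_solution_exists [OF a]])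
  then obtain x0 where x0: "0 < x0" and sm: "smooth_within {0..x0} \<Psi>" and P0: "\<Psi> 0 = 0"
    and ode: "\<And>x. x \<in> {0..x0} \<Longrightarrow> limit_ode d l {0..x0} \<Psi> x"
    unfolding local_solution_def by blast
  have df: "\<Psi> differentiable (at x within {0..x0})" if "x \<in> {0..x0}" for x
    using sm that unfolding smooth_within_def by (metis funpow_0)
  show ?thesis
  proof (rule that [of x0 "deriv_within {0..x0} \<Psi>"], unfold \<Psi>_def [symmetric])
    show "0 < x0" by (rule x0)
    show "(\<Psi> has_real_derivative deriv_within {0..x0} \<Psi> x) (at x)" if "0 < x" "x < x0" for x
    proof -
      have "(\<Psi> has_vector_derivative deriv_within {0..x0} \<Psi> x) (at x within {0..x0})"
        unfolding deriv_within_def using df [of x] that by (subst vector_derivative_works [symmetric]) auto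
      then show ?thesis using that by (simp add: at_within_Icc_at has_real_derivative_iff_has_vector_derivative)
    qed
    show "ode_form (a_inf d l) (d_coef d l) (e_coef d l) x (\<Psi> x) (deriv_within {0..x0} \<Psi> x) = 0" if "0 < x" "x < x0" for x
      using ode [of x] that limit_ode_iff [of x d l "{0..x0}" \<Psi>] by auto
    have "continuous (at 0 within {0..x0}) \<Psi>" using df [of 0] x0 by (intro differentiable_imp_continuous_within) auto
    then show "(\<Psi> \<longlongrightarrow> 0) (at_right 0)" using P0 x0 by (simp add: continuous_within at_within_Icc_at_right)
  qed
qed

text \<open>The definition of \<open>\<xi>\<close> divides by \<open>x\<^sup>2\<close> and takes a default value at \<open>x = 0\<close>; a single point does
  not affect the integral.\<close>

lemma integral_xi:
  assumes "\<And>t. 0 < t \<Longrightarrow> t \<le> x \<Longrightarrow> 1 + H2p (d_coef d l) t \<noteq> 0"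
  shows "integral {0..x} (xi d l) = integral {0..x} (\<lambda>t. - zetap (a_inf d l) (d_coef d l) (e_coef d l) t * inverse (1 + H2p (d_coef d l) t))"
proof (rule integral_spike [of "{0}"])
  fix t assume t: "t \<in> {0..x} - {0}"
  define a D E where "a = a_inf d l" and "D = d_coef d l" and "E = e_coef d l"
  have t0: "t \<noteq> 0" "1 + H2p D t \<noteq> 0" using t assms [of t] by (auto simp: D_def)
  have nu: "nu_inf d l = nup a D E" by (simp add: nu_inf_def nup_def a_def D_def E_def)
  have "xi d l t = (a * (1 + G1p E t) - 2 * t * G2p D t) / (t^2 * (1 + H2p D t)) - a / t^2 - nup a D E / t"
    unfolding xi_def nu by (simp add: G1_def G1p_def G2_def G2p_def H2_def H2p_def a_def D_def E_def)
  also have "\<dots> = (a * (1 + G1p E t) - 2 * t * G2p D t - (1 + H2p D t) * (a + nup a D E * t)) / (t^2 * (1 + H2p D t))"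
  proof -
    have "p / (t^2 * h) - a / t^2 - n / t = (p - h * (a + n * t)) / (t^2 * h)" if "h \<noteq> 0" for p h n :: real
      using t0(1) that by (simp add: field_simps power2_eq_square)
    from this [OF t0(2)] show ?thesis .
  qed
  also have "a * (1 + G1p E t) - 2 * t * G2p D t - (1 + H2p D t) * (a + nup a D E * t) = - (t^2 * zetap a D E t)"
    unfolding zetap_eq [symmetric] by simp
  also have "- (t^2 * zetap a D E t) / (t^2 * (1 + H2p D t)) = - zetap a D E t * inverse (1 + H2p D t)"
  proof -
    have "- (t^2 * z) / (t^2 * h) = - z * inverse h" if "h \<noteq> 0" for z h :: real
      using t0(1) that by (simp add: field_simps)
    from this [OF t0(2)] show ?thesis .
  qed
  finally show "- zetap (a_inf d l) (d_coef d l) (e_coef d l) t * inverse (1 + H2p (d_coef d l) t) = xi d l t"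
    by (simp add: a_def D_def E_def)
qed simp

text \<open>\<open>\<Theta> = \<Psi> / (x M)\<close> has the expansion \<open>m U\<close>, where \<open>m\<close> now denotes the power series of \<open>1/M\<close>, and it
  belongs to the algebra of functions with polynomially bounded derivatives. So \<open>x\<^sup>2 \<Theta>' + ...\<close> is
  smooth up to \<open>0\<close> and its Taylor coefficients are the formal ones.\<close>

theorem g_inf_coeffs:
  assumes a: "0 < a_inf d l"
  obtains m C R where "m $ 0 = 1" "0 < R" "0 \<le> C" "\<And>n. \<bar>m $ n\<bar> \<le> C * R ^ n"
    "\<And>j. g_inf d l j = (fps_X^2 * fps_deriv (m * formal_solution (a_inf d l) (d_coef d l) (e_coef d l))
       + (fps_const (a_inf d l) + fps_const (nu_inf d l + 3) * fps_X) * (m * formal_solution (a_inf d l) (d_coef d l) (e_coef d l))) $ j"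
proof -
  define a D E \<Psi> where "a = a_inf d l" and "D = d_coef d l" and "E = e_coef d l" and "\<Psi> = Psi_tilde d l"
  have a0: "0 < a" using assms by (simp add: a_def)
  have nu: "nu_inf d l = nup a D E" by (simp add: nu_inf_def nup_def a_def D_def E_def)
  obtain x0 y' where x0: "0 < x0" and y: "\<And>x. 0 < x \<Longrightarrow> x < x0 \<Longrightarrow> (\<Psi> has_real_derivative y' x) (at x)"
    and ode: "\<And>x. 0 < x \<Longrightarrow> x < x0 \<Longrightarrow> ode_form a D E x (\<Psi> x) (y' x) = 0" and lim: "(\<Psi> \<longlongrightarrow> 0) (at_right 0)"
    by (rule Psi_tilde_solution [OF a, folded a_def D_def E_def \<Psi>_def]) (rule that; blast)
  have ex: "expands \<Psi> (fps_X * formal_solution a D E)" by (rule ode_form_solution_expands [OF a0 x0 y ode lim])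
  show ?thesis
  proof (rule integrating_factor [of D a E])
  fix x3 m A C R
  assume x3: "0 < x3" and H: "\<And>x. 0 < x \<Longrightarrow> x < x3 \<Longrightarrow> 1 + H2p D x \<noteq> 0"
    and md: "\<And>x. 0 < x \<Longrightarrow> x < x3 \<Longrightarrow> (m has_real_derivative - zetap a D E x * inverse (1 + H2p D x) * m x) (at x)"
    and me: "\<And>x. 0 < x \<Longrightarrow> x < x3 \<Longrightarrow> m x = exp (integral {0..x} (\<lambda>x. - zetap a D E x * inverse (1 + H2p D x)))"
    and mb: "\<And>x. 0 < x \<Longrightarrow> x < x3 \<Longrightarrow> \<bar>m x\<bar> \<le> C" and mA: "expands m A" "A $ 0 = 1" "0 < R" "0 \<le> C" "\<And>n. \<bar>A $ n\<bar> \<le> C * R ^ n"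
  define x4 where "x4 = min x0 x3"
  have x4: "0 < x4" "x4 \<le> x0" "x4 \<le> x3" using x0 x3 by (auto simp: x4_def)
  have Mm: "inverse (M_fac d l x) = m x" if "0 < x" "x < x3" for x
  proof -
    have "integral {0..x} (xi d l) = integral {0..x} (\<lambda>t. - zetap a D E t * inverse (1 + H2p D t))"
      unfolding a_def D_def E_def using H that by (intro integral_xi) (auto simp: D_def)
    then show ?thesis using me [OF that] by (simp add: M_fac_def exp_minus)
  qed
  define \<theta> where "\<theta> x = \<Psi> x * inverse x * m x" for x
  define \<Theta> where "\<Theta> = A * formal_solution a D E"
  have Th: "Theta d l x = \<theta> x" if "0 < x" "x < x3" for x
    using that Mm [OF that] by (simp add: Theta_def \<theta>_def \<Psi>_def divide_inverse)
  have e1: "expands (\<lambda>x. \<Psi> x * inverse x) (formal_solution a D E)"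
    unfolding expands_def
  proof
    fix N
    have "expands_upto (Suc N) \<Psi> (fps_X * formal_solution a D E)" using ex by (simp add: expands_def)
    moreover have "fps_shift 1 (fps_X * formal_solution a D E) = formal_solution a D E" by (rule fps_ext) simp
    ultimately show "expands_upto N (\<lambda>x. \<Psi> x * inverse x) (formal_solution a D E)" unfolding expands_upto_shift by (simp add: divide_inverse)
  qed
  have eth: "expands \<theta> \<Theta>" unfolding \<theta>_def \<Theta>_def mult.commute [of A] by (intro expands_mult e1 mA)
  have Th0: "Theta d l 0 = \<Theta> $ 0"
  proof -
    have "\<forall>\<^sub>F x in at_right 0. \<theta> x = Psi_tilde d l x / (x * M_fac d l x)"
      using eventually_right_pos eventually_right_less [OF x3] by eventually_elim (use Mm in \<open>simp add: \<theta>_def \<Psi>_def divide_inverse\<close>)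
    then have "((\<lambda>t. Psi_tilde d l t / (t * M_fac d l t)) \<longlongrightarrow> \<Theta> $ 0) (at_right 0)"
      using expands_tendsto [OF eth] by (rule Lim_transform_eventually [rotated])
    then show ?thesis by (simp add: Theta_def tendsto_Lim)
  qed
  have y4: "(\<Psi> has_real_derivative y' x) (at x)" if "0 < x" "x < x4" for x using y that x4 by simp
  have o4: "ode_form a D E x (\<Psi> x) (y' x) = 0" if "0 < x" "x < x4" for x using ode that x4 by simp
  have m4: "(m has_real_derivative - zetap a D E x * inverse (1 + H2p D x) * m x) (at x)" if "0 < x" "x < x4" for x
    using md [of x] that x4 by simp
  have b4: "\<bar>m x\<bar> \<le> C" if "0 < x" "x < x4" for x using mb [of x] that x4 by simp
  obtain x2 where x2: "0 < x2" "x2 \<le> 1" "x2 \<le> x4" and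
    cl0: "\<And>g. g \<in> solution_functions D \<Psi> m \<Longrightarrow> poly_bounded x2 g \<and> (\<exists>g'\<in>fun_algebra (solution_functions D \<Psi> m). \<forall>x. 0 < x \<and> x < x2 \<longrightarrow> (g has_real_derivative g' x) (at x))"
    by (rule solution_functions_closed [of a x4 \<Psi> y' D E m C]; (rule a0 x4(1) y4 o4 lim m4 b4 | rule that); blast)
  define G where "G = solution_functions D \<Psi> m"
  note cl = cl0 [folded G_def]
  have gG: "(\<lambda>x. x) \<in> fun_algebra G" "inverse \<in> fun_algebra G" "\<Psi> \<in> fun_algebra G" "m \<in> fun_algebra G"
    by (auto intro!: fun_algebra.gen simp: G_def solution_functions_def)
  have tG: "\<theta> \<in> fun_algebra G" unfolding \<theta>_def [abs_def] by (intro fun_algebra_intros gG)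
  obtain F where F0: "F 0 = \<theta>" and F: "\<And>n x. 0 < x \<Longrightarrow> x < x2 \<Longrightarrow> (F n has_real_derivative F (Suc n) x) (at x)"
    and FA: "\<And>n. expands (F n) ((fps_deriv ^^ n) \<Theta>)" and FG: "\<And>n. F n \<in> fun_algebra G"
    by (rule fun_algebra_derivative_sequence [of x2 G \<theta> \<Theta>]; (rule x2(1) x2(2) cl tG eth | rule that); blast)
  have S: "{0..} = {0..} \<or> (\<exists>c>0. c < x2 \<and> {0::real..} = {0..c})" by blast
  have dTh: "deriv_within {0..} (Theta d l) x = (if x = 0 then \<Theta> $ 1 else F 1 x)" if "0 \<le> x" "x < x2" for x
  proof -
    have "(deriv_within {0..} ^^ 1) (Theta d l) x = (if x = 0 then fact 1 * \<Theta> $ 1 else F 1 x)"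
      by (rule derivatives_within(1) [OF x2(1) S F FA]) (use that Th Th0 x2 x4 F0 in auto)
    then show ?thesis by simp
  qed
  define f where "f x = x^2 * F 1 x + (a + (nup a D E + 3) * x) * \<theta> x" for x
  define B where "B = fps_X^2 * fps_deriv \<Theta> + (fps_const a + fps_const (nup a D E + 3) * fps_X) * \<Theta>"
  have fG: "f \<in> fun_algebra G" unfolding f_def [abs_def] by (intro fun_algebra_intros gG tG FG)
  have ef: "expands f B" unfolding f_def B_def using FA [of 1] by (intro expands_intros eth) simp
  obtain F' where F'0: "F' 0 = f" and F': "\<And>n x. 0 < x \<Longrightarrow> x < x2 \<Longrightarrow> (F' n has_real_derivative F' (Suc n) x) (at x)"
    and F'A: "\<And>n. expands (F' n) ((fps_deriv ^^ n) B)" and "\<And>n. F' n \<in> fun_algebra G"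
    by (rule fun_algebra_derivative_sequence [of x2 G f B]; (rule x2(1) x2(2) cl fG ef | rule that); blast)
  define h where "h x = x^2 * deriv_within {0..} (Theta d l) x + (a + (nup a D E + 3) * x) * Theta d l x" for x
  have g: "g_inf d l j = B $ j" for j
  proof -
    have "(deriv_within {0..} ^^ j) h 0 = (if (0::real) = 0 then fact j * B $ j else F' j 0)"
    proof (rule derivatives_within(1) [OF x2(1) S F' F'A])
      show "h x = F' 0 x" if "0 < x" "x < x2" for x
        using dTh [of x] Th [of x] that x2 x4 by (simp add: h_def F'0 f_def)
      show "h 0 = B $ 0" by (simp add: h_def B_def Th0)
    qed (use x2 in auto)
    then show ?thesis unfolding g_inf_def taylor_coeff_def h_def nu a_def by simp
  qed
  show ?thesis
    by (rule that [of A R C]) (use mA g in \<open>auto simp: B_def \<Theta>_def a_def D_def E_def nu\<close>)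
  qed
qed

theorem S_infty_eq_stokes:
  assumes a: "0 < a_inf d l"
  shows "of_real (S_infty d l) = stokes (of_real (a_inf d l)) (complex_coeffs (d_coef d l)) (complex_coeffs (e_coef d l))"
proof -
  define a D E where "a = a_inf d l" and "D = d_coef d l" and "E = e_coef d l"
  define \<nu> where "\<nu> = nup a D E"
  have nu: "nu_inf d l = \<nu>" by (simp add: nu_inf_def nup_def a_def D_def E_def \<nu>_def)
  have a0: "a \<noteq> 0" using a by (simp add: a_def)
  obtain m C R where m: "m $ 0 = 1" "0 < R" "0 \<le> C" "\<And>n. \<bar>m $ n\<bar> \<le> C * R ^ n"
    and g: "\<And>j. g_inf d l j = (fps_X^2 * fps_deriv (m * formal_solution a D E)
       + (fps_const a + fps_const (\<nu> + 3) * fps_X) * (m * formal_solution a D E)) $ j"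
    by (rule g_inf_coeffs [OF a, folded a_def D_def E_def, unfolded nu]) (rule that; blast)
  define \<theta> where "\<theta> = m * formal_solution a D E"
  have cth: "complex_fps m * formal_solution (of_real a) (complex_coeffs D) (complex_coeffs E) = complex_fps \<theta>"
    by (simp add: \<theta>_def formal_solution_of_real complex_fps_mult)
  have expd: "(fps_const a + fps_const (\<nu> + 3) * fps_X) * \<theta> = fps_const a * \<theta> + fps_const (\<nu> + 3) * (fps_X * \<theta>)"
    by (simp add: algebra_simps)
  have g0: "g_inf d l 0 = a * \<theta> $ 0" unfolding g \<theta>_def [symmetric] expd by simp
  have gS: "g_inf d l (Suc n) = a * \<theta> $ Suc n + (real (Suc n) + \<nu> + 2) * \<theta> $ n" for n
    unfolding g \<theta>_def [symmetric] expd power2_eq_square mult.assoc by (cases n) (simp_all add: algebra_simps)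
  have "(\<lambda>j. (- of_real a) ^ j * of_real (g_inf d l j) * rGamma (nup (of_real a) (complex_coeffs D) (complex_coeffs E) + of_nat j + 3))
      sums (of_real a * stokes (of_real a) (complex_coeffs D) (complex_coeffs E))"
  proof (rule stokes_invariant [where m = "complex_fps m" and R = R and A = C])
    show "norm (complex_fps m $ n) \<le> C * R ^ n" for n using m(4) [of n] by simp
    show "of_real (g_inf d l 0) = of_real a * (complex_fps m * formal_solution (of_real a) (complex_coeffs D) (complex_coeffs E)) $ 0"
      unfolding cth g0 by simp
    show "of_real (g_inf d l (Suc n)) = of_real a * (complex_fps m * formal_solution (of_real a) (complex_coeffs D) (complex_coeffs E)) $ Suc n +
         (of_nat (Suc n) + nup (of_real a) (complex_coeffs D) (complex_coeffs E) + 2) * (complex_fps m * formal_solution (of_real a) (complex_coeffs D) (complex_coeffs E)) $ n" for n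
      unfolding cth gS nup_of_real \<nu>_def [symmetric] by simp
  qed (use m a0 in auto)
  moreover have "(- of_real a) ^ j * of_real (g_inf d l j) * rGamma (nup (of_real a) (complex_coeffs D) (complex_coeffs E) + of_nat j + 3)
     = complex_of_real ((- 1) ^ j * a ^ j * g_inf d l j / Gamma (\<nu> + real j + 3))" for j
  proof -
    have "rGamma (nup (of_real a) (complex_coeffs D) (complex_coeffs E) + of_nat j + 3) = inverse (Gamma (complex_of_real (\<nu> + real j + 3)))"
      by (simp add: nup_of_real \<nu>_def rGamma_inverse_Gamma)
    also have "\<dots> = of_real (inverse (Gamma (\<nu> + real j + 3)))"
      unfolding Gamma_complex_of_real by (rule of_real_inverse [symmetric])
    finally have r: "rGamma (nup (of_real a) (complex_coeffs D) (complex_coeffs E) + of_nat j + 3) = of_real (inverse (Gamma (\<nu> + real j + 3)))" .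
    have "(- of_real a :: complex) ^ j = of_real ((-1) ^ j * a ^ j)" by (simp add: power_minus [of "of_real a"])
    then show ?thesis unfolding r by (simp add: divide_inverse)
  qed
  ultimately have s: "(\<lambda>j. complex_of_real ((- 1) ^ j * a ^ j * g_inf d l j / Gamma (\<nu> + real j + 3)))
      sums (of_real a * stokes (of_real a) (complex_coeffs D) (complex_coeffs E))" by simp
  then have "(\<lambda>j. (- 1) ^ j * a ^ j * g_inf d l j / Gamma (\<nu> + real j + 3)) sums Re (of_real a * stokes (of_real a) (complex_coeffs D) (complex_coeffs E))"
    using sums_Re [OF s] by simp
  then have s1: "(\<lambda>j. (- 1) ^ j * a ^ j * g_inf d l j / Gamma (\<nu> + real j + 3)) sums (a * S_infty d l)"
    using a0 unfolding S_infty_def a_def [symmetric] nu by (simp add: sums_iff)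
  then have "(\<lambda>j. complex_of_real ((- 1) ^ j * a ^ j * g_inf d l j / Gamma (\<nu> + real j + 3))) sums of_real (a * S_infty d l)"
    by (rule sums_of_real)
  from sums_unique2 [OF s this] have "of_real a * stokes (of_real a) (complex_coeffs D) (complex_coeffs E) = of_real a * of_real (S_infty d l)"
    by simp
  then show ?thesis using a0 by (simp add: a_def D_def E_def)
qed

section \<open>Dependence of the coefficients on the parameter\<close>

text \<open>This justifies the definite description in \<open>coeff2\<close>.\<close>

lemma poly2_eqI:
  fixes p q :: "real poly poly"
  assumes "\<And>X Y. poly (poly p [:X:]) Y = poly (poly q [:X:]) Y"
  shows "p = q"
proof -
  have 1: "poly (p - q) [:X:] = 0" for X
    using assms by (intro poly_ext) simp
  have "p - q = 0"
  proof (rule ccontr)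
    assume "p - q \<noteq> 0"
    then have "finite {x. poly (p - q) x = 0}" by (rule poly_roots_finite)
    moreover have "range (\<lambda>X::real. [:X:]) \<subseteq> {x. poly (p - q) x = 0}" using 1 by blast
    ultimately have "finite (range (\<lambda>X::real. [:X:]))" by (rule rev_finite_subset)
    moreover have "inj (\<lambda>X::real. [:X:])" by (auto simp: inj_def)
    ultimately show False using finite_imageD infinite_UNIV_char_0 by blast
  qed
  then show ?thesis by simp
qed

lemma coeff2_cubic:
  fixes F :: "real \<Rightarrow> real \<Rightarrow> real"
  assumes F: "\<And>X Y. F X Y = k00 + k10 * X + k01 * Y + k20 * X^2 + k11 * X * Y + k02 * Y^2
      + k30 * X^3 + k21 * X^2 * Y + k12 * X * Y^2 + k03 * Y^3"
  shows "coeff2 F 2 0 = k20" "coeff2 F 1 1 = k11" "coeff2 F 0 2 = k02" "coeff2 F 3 0 = k30"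
    "coeff2 F 2 1 = k21" "coeff2 F 1 2 = k12" "coeff2 F 0 3 = k03"
proof -
  define p :: "real poly poly" where "p = [: [:k00, k01, k02, k03:], [:k10, k11, k12:], [:k20, k21:], [:k30:] :]"
  have p: "poly (poly p [:X:]) Y = F X Y" for X Y
    unfolding F p_def by (simp add: algebra_simps power2_eq_square power3_eq_cube)
  have "(THE p :: real poly poly. \<forall>X Y. poly (poly p [:X:]) Y = F X Y) = p"
    using p by (intro the_equality poly2_eqI) auto
  then have c: "coeff2 F i j = coeff (coeff p i) j" for i j by (simp add: coeff2_def)
  show "coeff2 F 2 0 = k20" "coeff2 F 1 1 = k11" "coeff2 F 0 2 = k02" "coeff2 F 3 0 = k30"
    "coeff2 F 2 1 = k21" "coeff2 F 1 2 = k12" "coeff2 F 0 3 = k03"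
    unfolding c p_def by (simp_all add: eval_nat_numeral)
qed

text \<open>The coefficients of \<open>W\<^sup>i \<Sigma>\<^sup>j\<close>, \<open>2 \<le> i + j \<le> 3\<close>, in \<open>x \<Delta>\<^sub>1 + y \<Delta>\<^sub>2\<close> at \<open>(\<sigma> + W + \<Sigma>, w + m W + p \<Sigma>)\<close>. Up to
  constant factors \<open>A\<close>, \<open>B\<close>, \<open>C\<close> are the second derivatives with respect to \<open>w\<close> and \<open>\<sigma>\<close>, and \<open>x\<close>, \<open>G\<close>, \<open>H\<close>,
  \<open>I\<close> the third ones. A formula over any field serves for both the real values and their extension.\<close>

definition Delta_coeff :: "'a::field \<Rightarrow> 'a \<Rightarrow> 'a \<Rightarrow> 'a \<Rightarrow> 'a \<Rightarrow> 'a \<Rightarrow> 'a \<Rightarrow> 'a \<Rightarrow> 'a \<Rightarrow> nat \<Rightarrow> nat \<Rightarrow> 'a" where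
  "Delta_coeff x y d l r w \<sigma> m p i j =
    (let A = x * (3 * w - 1 - r) + y * (\<sigma> * (l + d - 1) / l);
         B = x * (- 2 * d * \<sigma>) + y * ((2 * (l + d - 1) * w - (l + d + l * r - r)) / l);
         C = - x * (d * w - l * (r - 1)) - y * 3 * \<sigma>;
         G = y * ((l + d - 1) / l); H = - x * d; I = - y in
     if (i, j) = (2, 0) then A * m^2 + B * m + C
     else if (i, j) = (1, 1) then 2 * A * m * p + B * (m + p) + 2 * C
     else if (i, j) = (0, 2) then A * p^2 + B * p + C
     else if (i, j) = (3, 0) then x * m^3 + G * m^2 + H * m + I
     else if (i, j) = (2, 1) then 3 * x * m^2 * p + G * (m^2 + 2 * m * p) + H * (2 * m + p) + 3 * I
     else if (i, j) = (1, 2) then 3 * x * m * p^2 + G * (p^2 + 2 * m * p) + H * (2 * p + m) + 3 * I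
     else if (i, j) = (0, 3) then x * p^3 + G * p^2 + H * p + I
     else 0)"

text \<open>The indices that occur in the limiting equation. Only for these and for \<open>(2, 0)\<close> is \<open>Delta_coeff\<close>
  the true Taylor coefficient.\<close>

definition relevant :: "(nat \<times> nat) set" where "relevant = {(1,1), (3,0), (0,2), (2,1), (1,2), (0,3)}"

text \<open>In the variables \<open>\<delta> = m W + p \<Sigma>\<close> and \<open>\<eta> = W + \<Sigma>\<close> this is the Taylor expansion of two cubic
  polynomials.\<close>

lemma Delta_expand:
  fixes d :: nat and l :: real
  assumes "l \<noteq> 0" "d > 0"
  shows "x * Delta1 d l r (\<sigma> + W + S) (w + m * W + p * S) + y * Delta2 d l r (\<sigma> + W + S) (w + m * W + p * S) =
    (x * Delta1 d l r \<sigma> w + y * Delta2 d l r \<sigma> w)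
    + ((x * (3 * w^2 - 2 * (1 + r) * w + r - real d * \<sigma>^2) + y * (\<sigma> * ((2 * (l + real d - 1) * w - (l + real d + l * r - r)) / l))) * m
       + (x * (- 2 * (real d * w - l * (r - 1)) * \<sigma>) + y * (((l + real d - 1) * w^2 - (l + real d + l * r - r) * w + l * r) / l - 3 * \<sigma>^2))) * W
    + ((x * (3 * w^2 - 2 * (1 + r) * w + r - real d * \<sigma>^2) + y * (\<sigma> * ((2 * (l + real d - 1) * w - (l + real d + l * r - r)) / l))) * p
       + (x * (- 2 * (real d * w - l * (r - 1)) * \<sigma>) + y * (((l + real d - 1) * w^2 - (l + real d + l * r - r) * w + l * r) / l - 3 * \<sigma>^2))) * S
    + Delta_coeff x y (real d) l r w \<sigma> m p 2 0 * W^2 + Delta_coeff x y (real d) l r w \<sigma> m p 1 1 * W * S + Delta_coeff x y (real d) l r w \<sigma> m p 0 2 * S^2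
    + Delta_coeff x y (real d) l r w \<sigma> m p 3 0 * W^3 + Delta_coeff x y (real d) l r w \<sigma> m p 2 1 * W^2 * S
    + Delta_coeff x y (real d) l r w \<sigma> m p 1 2 * W * S^2 + Delta_coeff x y (real d) l r w \<sigma> m p 0 3 * S^3"
proof -
  define \<delta> \<eta> where "\<delta> = m * W + p * S" and "\<eta> = W + S"
  define k where "k = l + real d - 1"
  define k' where "k' = l + real d + l * r - r"
  have 1: "Delta1 d l r (\<sigma> + \<eta>) (w + \<delta>) = Delta1 d l r \<sigma> w + (3 * w^2 - 2 * (1 + r) * w + r - real d * \<sigma>^2) * \<delta>
     - 2 * (real d * w - l * (r - 1)) * \<sigma> * \<eta> + (3 * w - 1 - r) * \<delta>^2 - 2 * real d * \<sigma> * \<delta> * \<eta>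
     - (real d * w - l * (r - 1)) * \<eta>^2 + \<delta>^3 - real d * \<delta> * \<eta>^2"
  proof -
    have e: "real d * (v - w_e d l r) = real d * v - l * (r - 1)" for v
    proof -
      have "real d * w_e d l r = l * (r - 1)" using assms by (simp add: w_e_def)
      then show ?thesis by (simp add: right_diff_distrib)
    qed
    show ?thesis unfolding Delta1_def e by (simp add: algebra_simps power2_eq_square power3_eq_cube)
  qed
  have 2: "Delta2 d l r (\<sigma> + \<eta>) (w + \<delta>) = Delta2 d l r \<sigma> w + \<sigma> * ((2 * k * w - k') / l) * \<delta>
     + ((k * w^2 - k' * w + l * r) / l - 3 * \<sigma>^2) * \<eta> + \<sigma> * k / l * \<delta>^2 + (2 * k * w - k') / l * \<delta> * \<eta>
     - 3 * \<sigma> * \<eta>^2 + k / l * \<delta>^2 * \<eta> - \<eta>^3"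
    unfolding Delta2_def k_def [symmetric] k'_def [symmetric] using assms
    by (simp add: field_simps power2_eq_square power3_eq_cube)
  have 3: "\<sigma> + W + S = \<sigma> + \<eta>" "w + m * W + p * S = w + \<delta>" by (simp_all add: \<delta>_def \<eta>_def)
  show ?thesis
    unfolding 3 1 2 Delta_coeff_def Let_def k_def [symmetric] k'_def [symmetric]
    unfolding \<delta>_def \<eta>_def divide_inverse by (simp add: algebra_simps power2_eq_square power3_eq_cube)
qed

lemma tilde_eq:
  assumes "l \<noteq> 0" "d > 0" "(i, j) \<in> insert (2, 0) relevant"
  shows "d_tilde d l i j = Delta_coeff (-1) (cp d l) (real d) l (r_circ d l) (w2 d l (r_circ d l)) (sigma2 d l (r_circ d l)) (cm d l) (cp d l) i j"
    and "e_tilde d l i j = Delta_coeff 1 (- cm d l) (real d) l (r_circ d l) (w2 d l (r_circ d l)) (sigma2 d l (r_circ d l)) (cm d l) (cp d l) i j"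
proof -
  note D = coeff2_cubic [OF Delta_expand [OF assms(1,2), where x = "-1" and y = "cp d l" and r = "r_circ d l"
    and w = "w2 d l (r_circ d l)" and \<sigma> = "sigma2 d l (r_circ d l)" and m = "cm d l" and p = "cp d l"]]
  note E = coeff2_cubic [OF Delta_expand [OF assms(1,2), where x = 1 and y = "- cm d l" and r = "r_circ d l"
    and w = "w2 d l (r_circ d l)" and \<sigma> = "sigma2 d l (r_circ d l)" and m = "cm d l" and p = "cp d l"]]
  have d: "d_tilde d l = coeff2 (\<lambda>W S. (-1) * Delta1 d l (r_circ d l) (sigma2 d l (r_circ d l) + W + S) (w2 d l (r_circ d l) + cm d l * W + cp d l * S)
     + cp d l * Delta2 d l (r_circ d l) (sigma2 d l (r_circ d l) + W + S) (w2 d l (r_circ d l) + cm d l * W + cp d l * S))"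
    unfolding d_tilde_def Let_def by simp
  have e: "e_tilde d l = coeff2 (\<lambda>W S. 1 * Delta1 d l (r_circ d l) (sigma2 d l (r_circ d l) + W + S) (w2 d l (r_circ d l) + cm d l * W + cp d l * S)
     + - cm d l * Delta2 d l (r_circ d l) (sigma2 d l (r_circ d l) + W + S) (w2 d l (r_circ d l) + cm d l * W + cp d l * S))"
    unfolding e_tilde_def Let_def by simp
  show "d_tilde d l i j = Delta_coeff (-1) (cp d l) (real d) l (r_circ d l) (w2 d l (r_circ d l)) (sigma2 d l (r_circ d l)) (cm d l) (cp d l) i j"
    using assms(3) unfolding d relevant_def by (elim insertE emptyE; simp only: prod.inject; elim conjE; simp only: D)
  show "e_tilde d l i j = Delta_coeff 1 (- cm d l) (real d) l (r_circ d l) (w2 d l (r_circ d l)) (sigma2 d l (r_circ d l)) (cm d l) (cp d l) i j"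
    using assms(3) unfolding e relevant_def by (elim insertE emptyE; simp only: prod.inject; elim conjE; simp only: E)
qed

definition restrict_relevant :: "(nat \<Rightarrow> nat \<Rightarrow> 'a::zero) \<Rightarrow> nat \<Rightarrow> nat \<Rightarrow> 'a" where
  "restrict_relevant D i j = (if (i, j) \<in> relevant then D i j else 0)"

lemma restrict_relevant_simps: "restrict_relevant D 1 1 = D 1 1" "restrict_relevant D 3 0 = D 3 0" "restrict_relevant D 0 2 = D 0 2" "restrict_relevant D 2 1 = D 2 1" "restrict_relevant D 1 2 = D 1 2" "restrict_relevant D 0 3 = D 0 3"
  by (simp_all add: restrict_relevant_def relevant_def)

lemma reduced_op_restrict_relevant: "reduced_op a (restrict_relevant D) (restrict_relevant E) U = reduced_op a D E U"
  unfolding reduced_op_def reduced_form_def Kp_def Rp_def N1q_def N2p_def M11p_def M12p_def M21p_def M22p_def H1p_def H2p_def G1p_def G2p_def restrict_relevant_simps ..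

lemma nup_restrict_relevant: "nup a (restrict_relevant D) (restrict_relevant E) = nup a D E"
  unfolding nup_def restrict_relevant_simps ..

lemma formal_solution_restrict_relevant: "formal_solution a (restrict_relevant D) (restrict_relevant E) = formal_solution a D E"
proof -
  have "formal_coeff a (restrict_relevant D) (restrict_relevant E) n = formal_coeff a D E n" for n
  proof (induction n rule: less_induct)
    case (less n)
    have "(\<lambda>k. if k < n then formal_coeff a (restrict_relevant D) (restrict_relevant E) k else 0) = (\<lambda>k. if k < n then formal_coeff a D E k else 0)"
      using less by auto
    then have "formal_coeff a (restrict_relevant D) (restrict_relevant E) n = - (reduced_op a D E (Abs_fps (\<lambda>k. if k < n then formal_coeff a D E k else 0)) $ n) / a"
      by (subst formal_coeff.simps) (simp only: reduced_op_restrict_relevant)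
    then show ?case by (subst (2) formal_coeff.simps)
  qed
  then show ?thesis by (simp add: formal_solution_def fps_eq_iff)
qed

lemma stokes_restrict_relevant: "stokes a (restrict_relevant D) (restrict_relevant E) = stokes a D E"
  unfolding stokes_def stokes_series_def nup_restrict_relevant formal_solution_restrict_relevant ..

text \<open>The coefficient \<open>D\<^sub>i\<^sub>j\<close> as a function of the linear data. For \<open>\<mu>\<^sub>+ < 0\<close> the factor \<open>\<bar>\<mu>\<^sub>+\<bar>\<close> is
  \<open>- \<mu>\<^sub>+\<close>, which is holomorphic in the data.\<close>

definition D_formula :: "'a::field \<Rightarrow> 'a \<Rightarrow> 'a \<Rightarrow> 'a \<Rightarrow> 'a \<Rightarrow> 'a \<Rightarrow> 'a \<Rightarrow> 'a \<Rightarrow> 'a \<Rightarrow> nat \<Rightarrow> nat \<Rightarrow> 'a" where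
  "D_formula d l r w \<sigma> m p lam mu i j =
    (let d20 = Delta_coeff (-1) p d l r w \<sigma> m p 2 0; e20 = Delta_coeff 1 (-m) d l r w \<sigma> m p 2 0 in
      Delta_coeff (-1) p d l r w \<sigma> m p i j * (- (e20 * mu / (d20 * lam))) powi int j * ((p - m) * mu / d20) powi (int i + int j - 1)
        / (- mu * (p - m)))"

definition E_formula :: "'a::field \<Rightarrow> 'a \<Rightarrow> 'a \<Rightarrow> 'a \<Rightarrow> 'a \<Rightarrow> 'a \<Rightarrow> 'a \<Rightarrow> 'a \<Rightarrow> 'a \<Rightarrow> nat \<Rightarrow> nat \<Rightarrow> 'a" where
  "E_formula d l r w \<sigma> m p lam mu i j =
    (let d20 = Delta_coeff (-1) p d l r w \<sigma> m p 2 0; e20 = Delta_coeff 1 (-m) d l r w \<sigma> m p 2 0 in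
      Delta_coeff 1 (-m) d l r w \<sigma> m p i j * (- (e20 * mu / (d20 * lam))) powi (int j - 1) * ((p - m) * mu / d20) powi (int i + int j - 1)
        / (- lam * (p - m)))"

lemma Delta_coeff_of_real:
  "Delta_coeff (of_real x) (of_real y) (of_real d) (of_real l) (of_real r) (of_real w) (of_real \<sigma>) (of_real m) (of_real p) i j
    = (of_real (Delta_coeff x y d l r w \<sigma> m p i j) :: complex)"
  unfolding Delta_coeff_def Let_def by (simp split: if_splits)

lemma D_formula_of_real:
  "D_formula (of_real d) (of_real l) (of_real r) (of_real w) (of_real \<sigma>) (of_real m) (of_real p) (of_real lam) (of_real mu) i j
    = (of_real (D_formula d l r w \<sigma> m p lam mu i j) :: complex)"
  unfolding D_formula_def Let_def using Delta_coeff_of_real [of "-1" p d l r w \<sigma> m p] Delta_coeff_of_real [of 1 "-m" d l r w \<sigma> m p] by simp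

lemma E_formula_of_real:
  "E_formula (of_real d) (of_real l) (of_real r) (of_real w) (of_real \<sigma>) (of_real m) (of_real p) (of_real lam) (of_real mu) i j
    = (of_real (E_formula d l r w \<sigma> m p lam mu i j) :: complex)"
  unfolding E_formula_def Let_def using Delta_coeff_of_real [of "-1" p d l r w \<sigma> m p] Delta_coeff_of_real [of 1 "-m" d l r w \<sigma> m p] by simp

lemma Delta_coeff_holomorphic:
  assumes "x holomorphic_on S" "y holomorphic_on S" "l holomorphic_on S" "r holomorphic_on S" "w holomorphic_on S"
    "\<sigma> holomorphic_on S" "m holomorphic_on S" "p holomorphic_on S" "\<And>z. z \<in> S \<Longrightarrow> l z \<noteq> 0"
  shows "(\<lambda>z. Delta_coeff (x z) (y z) d (l z) (r z) (w z) (\<sigma> z) (m z) (p z) i j) holomorphic_on S"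
proof -
  consider "(i,j) = (2,0)" | "(i,j) = (1,1)" | "(i,j) = (0,2)" | "(i,j) = (3,0)" | "(i,j) = (2,1)" | "(i,j) = (1,2)"
    | "(i,j) = (0,3)" | "(i,j) \<notin> insert (2,0) relevant" unfolding relevant_def by blast
  then show ?thesis
    by cases (use assms in \<open>auto simp: Delta_coeff_def Let_def relevant_def intro!: holomorphic_intros\<close>)
qed

text \<open>An extension of the critical speed and of the linear data to \<open>\<Omega>\<close> extends \<open>S_infty\<close>, provided that
  the divisors \<open>\<lambda>\<^sub>-\<close>, \<open>\<mu>\<^sub>+\<close>, \<open>c\<^sub>+ - c\<^sub>-\<close> and the coefficients with index \<open>(2, 0)\<close> do not vanish. At
  the real points the signs of \<open>\<lambda>\<^sub>-\<close> and \<open>\<mu>\<^sub>+\<close> turn their moduli into holomorphic expressions.\<close>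

theorem S_infty_extends:
  fixes d :: nat and r w \<sigma> m p lam mu :: "complex \<Rightarrow> complex"
  assumes "open \<Omega>" "of_real ` A \<subseteq> \<Omega>" "0 < d"
    and hol: "r holomorphic_on \<Omega>" "w holomorphic_on \<Omega>" "\<sigma> holomorphic_on \<Omega>" "m holomorphic_on \<Omega>" "p holomorphic_on \<Omega>"
      "lam holomorphic_on \<Omega>" "mu holomorphic_on \<Omega>"
    and nz: "\<And>z. z \<in> \<Omega> \<Longrightarrow> z \<noteq> 0" "\<And>z. z \<in> \<Omega> \<Longrightarrow> lam z \<noteq> 0" "\<And>z. z \<in> \<Omega> \<Longrightarrow> mu z \<noteq> 0" "\<And>z. z \<in> \<Omega> \<Longrightarrow> p z \<noteq> m z"
      "\<And>z. z \<in> \<Omega> \<Longrightarrow> Delta_coeff (-1) (p z) (of_nat d) z (r z) (w z) (\<sigma> z) (m z) (p z) 2 0 \<noteq> 0"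
      "\<And>z. z \<in> \<Omega> \<Longrightarrow> Delta_coeff 1 (- m z) (of_nat d) z (r z) (w z) (\<sigma> z) (m z) (p z) 2 0 \<noteq> 0"
    and real: "\<And>l. l \<in> A \<Longrightarrow> r (of_real l) = of_real (r_circ d l)" "\<And>l. l \<in> A \<Longrightarrow> w (of_real l) = of_real (w2 d l (r_circ d l))"
      "\<And>l. l \<in> A \<Longrightarrow> \<sigma> (of_real l) = of_real (sigma2 d l (r_circ d l))" "\<And>l. l \<in> A \<Longrightarrow> m (of_real l) = of_real (cm d l)"
      "\<And>l. l \<in> A \<Longrightarrow> p (of_real l) = of_real (cp d l)" "\<And>l. l \<in> A \<Longrightarrow> lam (of_real l) = of_real (lam_minus d l)"
      "\<And>l. l \<in> A \<Longrightarrow> mu (of_real l) = of_real (mu_plus d l)"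
    and neg: "\<And>l. l \<in> A \<Longrightarrow> lam_minus d l < 0" "\<And>l. l \<in> A \<Longrightarrow> mu_plus d l < 0"
  shows "extends_holomorphically (S_infty d) A \<Omega>"
proof -
  define a where "a z = lam z / mu z" for z
  define D where "D z = restrict_relevant (D_formula (of_nat d) z (r z) (w z) (\<sigma> z) (m z) (p z) (lam z) (mu z))" for z
  define E where "E z = restrict_relevant (E_formula (of_nat d) z (r z) (w z) (\<sigma> z) (m z) (p z) (lam z) (mu z))" for z
  have idh: "(\<lambda>z. z) holomorphic_on \<Omega>" by (rule holomorphic_on_ident)
  have t1: "(\<lambda>z. Delta_coeff (-1) (p z) (of_nat d) z (r z) (w z) (\<sigma> z) (m z) (p z) i j) holomorphic_on \<Omega>" for i j
    by (intro Delta_coeff_holomorphic hol idh nz holomorphic_on_const)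
  have t2: "(\<lambda>z. Delta_coeff 1 (- m z) (of_nat d) z (r z) (w z) (\<sigma> z) (m z) (p z) i j) holomorphic_on \<Omega>" for i j
    by (intro Delta_coeff_holomorphic hol idh nz holomorphic_on_const holomorphic_on_minus)
  have aD: "a holomorphic_on \<Omega>" unfolding a_def [abs_def] using nz by (intro holomorphic_intros hol)
  have DD: "(\<lambda>z. D z i j) holomorphic_on \<Omega>" for i j
  proof (cases "(i, j) \<in> relevant")
    case True
    show ?thesis unfolding D_def restrict_relevant_def D_formula_def Let_def using True nz
      by (simp only: if_True) (intro holomorphic_intros t1 t2 hol; simp)
  qed (simp add: D_def restrict_relevant_def)
  have EE: "(\<lambda>z. E z i j) holomorphic_on \<Omega>" for i j
  proof (cases "(i, j) \<in> relevant")
    case True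
    show ?thesis unfolding E_def restrict_relevant_def E_formula_def Let_def using True nz
      by (simp only: if_True) (intro holomorphic_intros t1 t2 hol; simp)
  qed (simp add: E_def restrict_relevant_def)
  have "(\<lambda>z. stokes (a z) (D z) (E z)) holomorphic_on \<Omega>"
    using nz by (intro stokes_holomorphic \<open>open \<Omega>\<close> aD DD EE) (simp add: a_def)
  moreover have "stokes (a (of_real l)) (D (of_real l)) (E (of_real l)) = of_real (S_infty d l)" if l: "l \<in> A" for l
  proof -
    have "complex_of_real l \<in> \<Omega>" using assms(2) l by blast
    then have l0: "l \<noteq> 0" using nz(1) by force
    note neg = neg [OF l]
    have ai: "a_inf d l = lam_minus d l / mu_plus d l" using neg by (simp add: a_inf_def)
    have a0: "0 < a_inf d l" using neg by (simp add: ai divide_neg_neg)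
    have at: "a (of_real l) = of_real (a_inf d l)" by (simp add: a_def ai real [OF l])
    note tl = tilde_eq [OF l0 \<open>0 < d\<close>]
    have d20: "d_tilde d l 2 0 = Delta_coeff (-1) (cp d l) (real d) l (r_circ d l) (w2 d l (r_circ d l)) (sigma2 d l (r_circ d l)) (cm d l) (cp d l) 2 0"
      and e20: "e_tilde d l 2 0 = Delta_coeff 1 (- cm d l) (real d) l (r_circ d l) (w2 d l (r_circ d l)) (sigma2 d l (r_circ d l)) (cm d l) (cp d l) 2 0"
      by (rule tl; simp)+
    have dc: "d_coef d l i j = D_formula (real d) l (r_circ d l) (w2 d l (r_circ d l)) (sigma2 d l (r_circ d l)) (cm d l) (cp d l) (lam_minus d l) (mu_plus d l) i j"
      if "(i, j) \<in> relevant" for i j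
      unfolding d_coef_def D_formula_def Let_def psi_hat_def w_hat_def d20 e20 using tl(1) [of i j] that neg by simp
    have ec: "e_coef d l i j = E_formula (real d) l (r_circ d l) (w2 d l (r_circ d l)) (sigma2 d l (r_circ d l)) (cm d l) (cp d l) (lam_minus d l) (mu_plus d l) i j"
      if "(i, j) \<in> relevant" for i j
      unfolding e_coef_def E_formula_def Let_def psi_hat_def w_hat_def d20 e20 using tl(2) [of i j] that neg by simp
    have rd: "of_nat d = complex_of_real (real d)" by simp
    have Dt: "D (of_real l) = restrict_relevant (complex_coeffs (d_coef d l))"
      unfolding D_def real [OF l] rd D_formula_of_real by (intro ext) (simp add: restrict_relevant_def dc)
    have Et: "E (of_real l) = restrict_relevant (complex_coeffs (e_coef d l))"
      unfolding E_def real [OF l] rd E_formula_of_real by (intro ext) (simp add: restrict_relevant_def ec)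
    show ?thesis unfolding at Dt Et stokes_restrict_relevant by (rule S_infty_eq_stokes [OF a0, symmetric])
  qed
  ultimately show ?thesis unfolding extends_holomorphically_def using assms(1,2) by blast
qed

section \<open>Linear data at the critical speed\<close>

lemma c_values:
  fixes d :: nat and l r :: real
  assumes l: "0 < l" and d: "0 < d"
  defines "w \<equiv> w_minus d l r"
  defines "\<sigma> \<equiv> 1 - w"
  shows "c1 d l r = 3 * w^2 - 2 * (1 + r) * w + r - real d * \<sigma>^2"
    and "c2 d l r = \<sigma> * (2 * (l + real d - 1) * w - (l + real d + l * r - r)) / l"
    and "c3 d l r = - 2 * (real d * w - l * (r - 1)) * \<sigma>"
    and "c4 d l r = ((l + real d - 1) * w^2 - (l + real d + l * r - r) * w + l * r) / l - 3 * \<sigma>^2"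
proof -
  have s: "sigma2 d l r = \<sigma>" "w2 d l r = w" by (simp_all add: sigma2_def w2_def \<sigma>_def w_def)
  have "((\<lambda>v. Delta1 d l r \<sigma> v) has_real_derivative 3 * w^2 - 2 * (1 + r) * w + r - real d * \<sigma>^2) (at w)"
    unfolding Delta1_def by (auto intro!: derivative_eq_intros simp: algebra_simps power2_eq_square)
  then show "c1 d l r = 3 * w^2 - 2 * (1 + r) * w + r - real d * \<sigma>^2"
    unfolding c1_def s by (rule DERIV_imp_deriv)
  have "((\<lambda>v. Delta2 d l r \<sigma> v) has_real_derivative \<sigma> / l * (2 * (l + real d - 1) * w - (l + real d + l * r - r))) (at w)"
    unfolding Delta2_def by (auto intro!: derivative_eq_intros simp: algebra_simps power2_eq_square)
  then show "c2 d l r = \<sigma> * (2 * (l + real d - 1) * w - (l + real d + l * r - r)) / l"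
    unfolding c2_def s by (simp add: DERIV_imp_deriv)
  have e: "real d * (w - w_e d l r) = real d * w - l * (r - 1)"
  proof -
    have "real d * w_e d l r = l * (r - 1)" using d by (simp add: w_e_def)
    then show ?thesis by (simp add: right_diff_distrib)
  qed
  have "((\<lambda>v. Delta1 d l r v w) has_real_derivative - (real d * (w - w_e d l r)) * (2 * \<sigma>)) (at \<sigma>)"
    unfolding Delta1_def by (auto intro!: derivative_eq_intros)
  then show "c3 d l r = - 2 * (real d * w - l * (r - 1)) * \<sigma>"
    unfolding c3_def s e by (simp add: DERIV_imp_deriv)
  have "((\<lambda>v. Delta2 d l r v w) has_real_derivative
     1 / l * ((l + real d - 1) * w\<^sup>2 - (l + real d + l * r - r) * w + l * r - l * \<sigma>\<^sup>2) + \<sigma> / l * (- l * (2 * \<sigma>))) (at \<sigma>)"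
    unfolding Delta2_def using l by (auto intro!: derivative_eq_intros simp: diff_divide_distrib add_divide_distrib)
  moreover have "1 / l * ((l + real d - 1) * w\<^sup>2 - (l + real d + l * r - r) * w + l * r - l * \<sigma>\<^sup>2) + \<sigma> / l * (- l * (2 * \<sigma>))
     = ((l + real d - 1) * w^2 - (l + real d + l * r - r) * w + l * r) / l - 3 * \<sigma>^2"
    using l by (simp add: field_simps power2_eq_square)
  ultimately show "c4 d l r = ((l + real d - 1) * w^2 - (l + real d + l * r - r) * w + l * r) / l - 3 * \<sigma>^2"
    unfolding c4_def s by (simp only: DERIV_imp_deriv)
qed

text \<open>By the equation for \<open>w\<^sub>-\<close>, the determinant of the linear part has the factor \<open>\<surd>J\<close>. It vanishes at
  \<open>r\<^sub>+\<close> through \<open>J\<close> and at \<open>r\<^sup>*\<close> through the other factor.\<close>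

lemma determinant_formula:
  fixes d :: nat and l r :: real
  assumes l: "0 < l" and d: "2 \<le> d" and J: "0 \<le> J_disc d l r"
  defines "w \<equiv> w_minus d l r"
  shows "c1 d l r * c4 d l r - c2 d l r * c3 d l r = 2 * (1 - w)^2 * sqrt (J_disc d l r) * (r - w * (l + real d) / l)"
    and "c4 d l r = - 2 * (1 - w)^2"
    and "c1 d l r = c3 d l r - (1 - w) * sqrt (J_disc d l r)"
    and "l * c2 d l r = l * c4 d l r - (1 - w) * sqrt (J_disc d l r)"
proof -
  define T where "T = sqrt (J_disc d l r)"
  define n where "n = real d"
  have n: "2 \<le> n" using d by (simp add: n_def)
  have T2: "T^2 = (1 - l)^2 * (r - 1)^2 - 2 * (n - 1) * (l + 1) * (r - 1) + (n - 1)^2"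
    using J by (simp add: T_def J_disc_def n_def)
  have "w = (n - 1 + (l - 1) * (r - 1) - T) / (2 * (n - 1))" by (simp add: w_def w_minus_def T_def n_def)
  then have Tw: "T = n - 1 + (l - 1) * (r - 1) - 2 * (n - 1) * w" using n by (simp add: field_simps)
  define B where "B = (n - 1) * w^2 - (n - 1 + (l - 1) * (r - 1)) * w + l * (r - 1)"
  have "4 * (n - 1) * B = T^2 - ((1 - l)^2 * (r - 1)^2 - 2 * (n - 1) * (l + 1) * (r - 1) + (n - 1)^2)"
    unfolding B_def Tw by (simp add: algebra_simps power2_eq_square)
  then have B0: "B = 0" using T2 n by simp
  note c = c_values [OF l, of d r, folded w_def n_def]
  have c4l: "l * c4 d l r = - 2 * l * (1 - w)^2"
  proof -
    have "l * c4 d l r = (l + n - 1) * w^2 - (l + n + l * r - r) * w + l * r - l * (3 * (1 - w)^2)"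
      using l d by (simp add: c right_diff_distrib)
    also have "\<dots> = B - 2 * l * (1 - w)^2" unfolding B_def by (simp add: algebra_simps power2_eq_square)
    finally show ?thesis using B0 by simp
  qed
  then have "l * c4 d l r = l * (- 2 * (1 - w)^2)" by simp
  then show c4: "c4 d l r = - 2 * (1 - w)^2" unfolding mult_cancel_left using l by simp
  have "c1 d l r = c3 d l r - (1 - w) * T - B"
    using d unfolding Tw B_def by (simp add: c algebra_simps power2_eq_square)
  then show c1: "c1 d l r = c3 d l r - (1 - w) * sqrt (J_disc d l r)" using B0 by (simp add: T_def)
  have "l * c2 d l r = (1 - w) * (2 * (l + n - 1) * w - (l + n + l * r - r))" using l d by (simp add: c)
  also have "\<dots> = - 2 * l * (1 - w)^2 - (1 - w) * T" unfolding Tw by (simp add: algebra_simps power2_eq_square)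
  finally have c2: "l * c2 d l r = l * c4 d l r - (1 - w) * T" using c4l by simp
  then show "l * c2 d l r = l * c4 d l r - (1 - w) * sqrt (J_disc d l r)" by (simp add: T_def)
  have "l * (c1 d l r * c4 d l r - c2 d l r * c3 d l r) = l * c4 d l r * c1 d l r - (l * c2 d l r) * c3 d l r" by (simp add: algebra_simps)
  also have "\<dots> = (1 - w) * T * (c3 d l r - l * c4 d l r)" unfolding c2 c1 T_def [symmetric] by (simp add: algebra_simps)
  also have "\<dots> = (1 - w) * T * (- 2 * (n * w - l * (r - 1)) * (1 - w) + 2 * l * (1 - w)^2)"
    unfolding c4l using d by (simp add: c(3))
  also have "\<dots> = l * (2 * (1 - w)^2 * T * (r - w * (l + n) / l))" using l by (simp add: field_simps power2_eq_square)
  finally show "c1 d l r * c4 d l r - c2 d l r * c3 d l r = 2 * (1 - w)^2 * sqrt (J_disc d l r) * (r - w * (l + real d) / l)"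
    using l unfolding T_def n_def by simp
qed

text \<open>A singular matrix with negative trace has the eigenvalues \<open>0\<close> and its trace.\<close>

lemma eigen_data:
  assumes det: "c1 d l r * c4 d l r = c2 d l r * c3 d l r" and tr: "c1 d l r + c4 d l r < 0" and c2: "c2 d l r < 0"
  shows "c_plus d l r = c1 d l r / c2 d l r" "c_minus d l r = - c4 d l r / c2 d l r"
    "lambda_minus d l r = c1 d l r + c4 d l r" "0 < (c1 d l r - c4 d l r)^2 + 4 * c2 d l r * c3 d l r"
proof -
  have disc: "(c1 d l r - c4 d l r)^2 + 4 * c2 d l r * c3 d l r = (c1 d l r + c4 d l r)^2"
    using det by (simp add: power2_eq_square algebra_simps)
  have sq: "sqrt ((c1 d l r - c4 d l r)^2 + 4 * c2 d l r * c3 d l r) = - (c1 d l r + c4 d l r)"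
    unfolding disc using tr by simp
  show "c_plus d l r = c1 d l r / c2 d l r" "c_minus d l r = - c4 d l r / c2 d l r"
    "lambda_minus d l r = c1 d l r + c4 d l r"
    unfolding c_plus_def c_minus_def lambda_minus_def sq using c2 by (simp_all add: abs_of_neg field_simps)
  show "0 < (c1 d l r - c4 d l r)^2 + 4 * c2 d l r * c3 d l r" unfolding disc using tr by simp
qed

lemma continuous_c:
  assumes l: "0 < l" and d: "2 \<le> d"
  shows "isCont (w_minus d l) r" "isCont (c1 d l) r" "isCont (c2 d l) r" "isCont (c3 d l) r" "isCont (c4 d l) r"
proof -
  show w: "isCont (w_minus d l) r" for r
    unfolding w_minus_def [abs_def] J_disc_def by (intro continuous_intros)
  have d0: "0 < d" using d by simp
  have e: "c1 d l = (\<lambda>r. 3 * (w_minus d l r)^2 - 2 * (1 + r) * w_minus d l r + r - real d * (1 - w_minus d l r)^2)"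
    "c2 d l = (\<lambda>r. (1 - w_minus d l r) * (2 * (l + real d - 1) * w_minus d l r - (l + real d + l * r - r)) / l)"
    "c3 d l = (\<lambda>r. - 2 * (real d * w_minus d l r - l * (r - 1)) * (1 - w_minus d l r))"
    "c4 d l = (\<lambda>r. ((l + real d - 1) * (w_minus d l r)^2 - (l + real d + l * r - r) * w_minus d l r + l * r) / l - 3 * (1 - w_minus d l r)^2)"
    using c_values [OF l d0] by (auto intro!: ext)
  show "isCont (c1 d l) r" "isCont (c2 d l) r" "isCont (c3 d l) r" "isCont (c4 d l) r"
    unfolding e using l by (auto intro!: continuous_intros w)
qed

text \<open>The product of the eigenvalues is the determinant, and \<open>\<lambda>\<^sub>-\<close> stays away from \<open>0\<close>.\<close>

lemma mu_plus_limit: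
  assumes l: "0 < l" and d: "2 \<le> d" and r0: "r0 = r_circ d l"
    and det: "c1 d l r0 * c4 d l r0 = c2 d l r0 * c3 d l r0" and tr: "c1 d l r0 + c4 d l r0 < 0" and c2: "c2 d l r0 < 0"
    and lim: "((\<lambda>r. (c1 d l r * c4 d l r - c2 d l r * c3 d l r) / b_small d l r) \<longlongrightarrow> \<delta>) (at_left r0)"
  shows "mu_plus d l = \<delta> / (c1 d l r0 + c4 d l r0)"
proof -
  note c = continuous_c [OF l d, of r0]
  have D: "isCont (\<lambda>r. (c1 d l r - c4 d l r)^2 + 4 * c2 d l r * c3 d l r) r0" by (intro continuous_intros c)
  have "isCont (lambda_minus d l) r0"
    unfolding lambda_minus_def [abs_def] by (intro continuous_intros c) auto
  then have lm: "(lambda_minus d l \<longlongrightarrow> lambda_minus d l r0) (at_left r0)"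
    unfolding isCont_def by (rule filterlim_mono [OF _ order_refl at_le]) simp
  have lm0: "lambda_minus d l r0 = c1 d l r0 + c4 d l r0" by (rule eigen_data(3) [OF det tr c2])
  have "((\<lambda>r. (c1 d l r - c4 d l r)^2 + 4 * c2 d l r * c3 d l r) \<longlongrightarrow> (c1 d l r0 - c4 d l r0)^2 + 4 * c2 d l r0 * c3 d l r0) (at_left r0)"
    using D unfolding isCont_def by (rule filterlim_mono [OF _ order_refl at_le]) simp
  then have e1: "\<forall>\<^sub>F r in at_left r0. 0 < (c1 d l r - c4 d l r)^2 + 4 * c2 d l r * c3 d l r"
    by (rule order_tendstoD(1)) (rule eigen_data(4) [OF det tr c2])
  have e2: "\<forall>\<^sub>F r in at_left r0. lambda_minus d l r < 0"
    by (rule order_tendstoD(2) [OF lm]) (use lm0 tr in simp)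
  have "\<forall>\<^sub>F r in at_left r0. (c1 d l r * c4 d l r - c2 d l r * c3 d l r) / b_small d l r / lambda_minus d l r = lambda_plus d l r / b_small d l r"
    using e1 e2
  proof eventually_elim
    case (elim r)
    have "lambda_plus d l r * lambda_minus d l r = c1 d l r * c4 d l r - c2 d l r * c3 d l r"
    proof -
      define q where "q = sqrt ((c1 d l r - c4 d l r)^2 + 4 * c2 d l r * c3 d l r)"
      have "q^2 = (c1 d l r - c4 d l r)^2 + 4 * c2 d l r * c3 d l r" using elim(1) by (simp add: q_def)
      moreover have "4 * (lambda_plus d l r * lambda_minus d l r) = (c1 d l r + c4 d l r)^2 - q^2"
        unfolding lambda_plus_def lambda_minus_def q_def [symmetric] by (simp add: field_simps power2_eq_square)
      ultimately have "4 * (lambda_plus d l r * lambda_minus d l r) = 4 * (c1 d l r * c4 d l r - c2 d l r * c3 d l r)"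
        by (simp add: algebra_simps power2_eq_square)
      then show ?thesis by simp
    qed
    then show ?case using elim(2) by (metis divide_divide_eq_left' less_irrefl nonzero_mult_div_cancel_right times_divide_eq_left mult.commute)
  qed
  moreover have "((\<lambda>r. (c1 d l r * c4 d l r - c2 d l r * c3 d l r) / b_small d l r / lambda_minus d l r) \<longlongrightarrow> \<delta> / lambda_minus d l r0) (at_left r0)"
    using lm0 tr by (intro tendsto_divide lim lm) auto
  ultimately have "((\<lambda>r. lambda_plus d l r / b_small d l r) \<longlongrightarrow> \<delta> / lambda_minus d l r0) (at_left r0)"
    by (rule Lim_transform_eventually [rotated])
  then show ?thesis unfolding mu_plus_def r0 [symmetric] lm0 by (intro tendsto_Lim) auto
qed

text \<open>At \<open>r\<^sub>+\<close> the discriminant \<open>J\<close> vanishes, so everything is rational in \<open>t = \<surd>\<ell>\<close>, except that \<open>\<mu>\<^sub>+\<close>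
  contains the derivative of \<open>\<surd>J\<close> with respect to \<open>b\<close>, hence \<open>\<surd>t\<close>.\<close>

lemma plus_data:
  fixes d :: nat and l :: real
  assumes d: "2 \<le> d" and l: "real d < l"
  defines "t \<equiv> sqrt l"
  defines "T \<equiv> t^2 + (real d + 1) * t + 1"
  shows "r_circ d l = 1 + (real d - 1) / (1 + t)^2" "w2 d l (r_circ d l) = t / (1 + t)" "sigma2 d l (r_circ d l) = 1 / (1 + t)"
    "cm d l = -1" "cp d l = t * (t + real d) / (1 + t)" "lam_minus d l = - 2 * T / (1 + t)^3"
    "mu_plus d l = - 2 * sqrt (real d - 1) * sqrt t * (t^2 - real d) / (t * (1 + t) * T)"
    "lam_minus d l < 0" "mu_plus d l < 0"
proof -
  define n where "n = real d"
  have n: "2 \<le> n" "n < l" using d l by (auto simp: n_def)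
  have t2: "t^2 = l" using n by (simp add: t_def)
  have t1: "1 < t" unfolding t_def using n by simp
  have t0: "0 < t" "1 + t \<noteq> 0" "0 < 1 + t" using t1 by auto
  have T0: "0 < T" unfolding T_def using t0 by (simp add: add_pos_pos)
  define r0 where "r0 = 1 + (n - 1) / (1 + t)^2"
  have rc: "r_circ d l = r0" using l by (simp add: r_circ_def r_plus_def r0_def t_def n_def)
  then show "r_circ d l = 1 + (real d - 1) / (1 + t)^2" by (simp add: r0_def n_def)
  \<comment> \<open>The other root of the discriminant \<open>J\<close>.\<close>
  define \<rho> where "\<rho> = 1 + (n - 1) / (t - 1)^2"
  have Jf: "J_disc d l r = (l - 1)^2 * (\<rho> - r) * (r0 - r)" for r
  proof -
    define k where "k = n - 1"
    define u v where "u = t - 1" and "v = 1 + t"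
    have uv: "u \<noteq> 0" "v \<noteq> 0" "l - 1 = u * v" "u^2 + v^2 = 2 * (l + 1)"
      using t1 by (auto simp: u_def v_def t2 [symmetric] algebra_simps power2_eq_square)
    have 1: "(l - 1) * (\<rho> - r) = k * v / u - (l - 1) * (r - 1)"
      using uv(1,2) unfolding \<rho>_def k_def [symmetric] uv(3) u_def [symmetric] by (simp add: field_simps power2_eq_square)
    have 2: "(l - 1) * (r0 - r) = k * u / v - (l - 1) * (r - 1)"
      using uv(1,2) unfolding r0_def k_def [symmetric] uv(3) v_def [symmetric] by (simp add: field_simps power2_eq_square)
    have "(l - 1)^2 * (\<rho> - r) * (r0 - r) = ((l - 1) * (\<rho> - r)) * ((l - 1) * (r0 - r))" by (simp add: power2_eq_square)
    also have "\<dots> = k^2 - (k * v / u + k * u / v) * ((l - 1) * (r - 1)) + (l - 1)^2 * (r - 1)^2"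
      unfolding 1 2 using uv(1,2) by (simp add: field_simps power2_eq_square)
    also have "(k * v / u + k * u / v) * ((l - 1) * (r - 1)) = 2 * k * (l + 1) * (r - 1)"
    proof -
      have "(k * v / u + k * u / v) * (l - 1) = k * (u^2 + v^2)"
        using uv(1,2) unfolding uv(3) by (simp add: field_simps power2_eq_square)
      then have "(k * v / u + k * u / v) * (l - 1) * (r - 1) = k * (2 * (l + 1)) * (r - 1)" unfolding uv(4) by simp
      then show ?thesis by (simp add: mult_ac)
    qed
    finally show ?thesis unfolding J_disc_def k_def n_def by (simp add: power2_commute [of 1 l] algebra_simps)
  qed
  have J0: "J_disc d l r0 = 0" unfolding Jf by simp
  have w0: "w_minus d l r0 = t / (1 + t)"
  proof -
    have "w_minus d l r0 = 1 / (2 * (n - 1)) * (n - 1 + (l - 1) * ((n - 1) / (1 + t)^2))"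
      unfolding w_minus_def J0 by (simp add: n_def r0_def)
    also have "\<dots> = 1/2 + (l - 1) / (2 * (1 + t)^2)"
    proof -
      have "1 / (2 * k) * (k + x * (k / y)) = 1/2 + x / (2 * y)" if "k \<noteq> 0" for k x y :: real
        using that by (simp add: distrib_left)
      from this [of "n - 1"] show ?thesis using n by auto
    qed
    also have "(l - 1) / (2 * (1 + t)^2) = (t - 1) / (2 * (1 + t))"
    proof -
      have "l - 1 = (t - 1) * (1 + t)" by (simp add: t2 [symmetric] algebra_simps power2_eq_square)
      then show ?thesis using t0 by (simp add: power2_eq_square)
    qed
    also have "1/2 + (t - 1) / (2 * (1 + t)) = t / (1 + t)" using t0 by (simp add: field_simps)
    finally show ?thesis .
  qed
  then show "w2 d l (r_circ d l) = t / (1 + t)" by (simp add: rc w2_def)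
  have s0: "1 - t / (1 + t) = 1 / (1 + t)" using t0 by (simp add: field_simps)
  then show "sigma2 d l (r_circ d l) = 1 / (1 + t)" by (simp add: rc sigma2_def w0)
  have l0: "0 < l" using n by simp
  have J0': "0 \<le> J_disc d l r0" using J0 by simp
  note df = determinant_formula [OF l0 d J0', unfolded w0 s0 J0]
  have c4: "c4 d l r0 = - 2 / (1 + t)^2" using df(2) by (simp add: power_divide)
  have c3: "c3 d l r0 = - 2 * t * (t + n) / (1 + t)^3"
  proof -
    have "c3 d l r0 = - 2 * (n * (t / (1 + t)) - l * ((n - 1) / (1 + t)^2)) * (1 / (1 + t))"
    proof -
      have "r0 - 1 = (n - 1) / (1 + t)^2" by (simp add: r0_def)
      then show ?thesis using c_values(3) [OF l0, of d r0] d unfolding w0 s0 n_def by simp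
    qed
    also have "n * (t / (1 + t)) - l * ((n - 1) / (1 + t)^2) = t * (t + n) / (1 + t)^2"
    proof -
      have "n * (t / v) = n * t * v / v^2" if "v \<noteq> 0" for v using that by (simp add: power2_eq_square)
      from this [OF t0(2)] show ?thesis
        unfolding t2 [symmetric] by (simp add: algebra_simps power2_eq_square flip: diff_divide_distrib)
    qed
    finally show ?thesis using t0 by (simp add: field_simps power2_eq_square power3_eq_cube)
  qed
  have c1: "c1 d l r0 = c3 d l r0" using df(3) by simp
  have c2: "c2 d l r0 = c4 d l r0" using df(4) l0 by simp
  have trv: "c1 d l r0 + c4 d l r0 = - 2 * T / (1 + t)^3"
  proof -
    have "- 2 / v^2 = - 2 * v / v^3" if "v \<noteq> 0" for v :: real
      using that by (simp add: power2_eq_square power3_eq_cube)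
    from this [OF t0(2)] have "c1 d l r0 + c4 d l r0 = (- 2 * t * (t + n) + - 2 * (1 + t)) / (1 + t)^3"
      unfolding c1 c3 c4 by (simp only: add_divide_distrib)
    also have "- 2 * t * (t + n) + - 2 * (1 + t) = - 2 * T" by (simp add: T_def n_def algebra_simps power2_eq_square)
    finally show ?thesis .
  qed
  have tr: "c1 d l r0 + c4 d l r0 < 0" unfolding trv using T0 t0 by simp
  have c2n: "c2 d l r0 < 0" unfolding c2 c4 using t0 by simp
  have det: "c1 d l r0 * c4 d l r0 = c2 d l r0 * c3 d l r0" unfolding c1 c2 by simp
  note eig = eigen_data [OF det tr c2n]
  show "cm d l = -1" unfolding cm_def rc eig(2) c2 using c2n c2 by simp
  show "cp d l = t * (t + real d) / (1 + t)"
  proof -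
    define v where "v = 1 + t"
    have "v \<noteq> 0" "0 < v" using t0 by (auto simp: v_def)
    then show ?thesis unfolding cp_def rc eig(1) c1 c2 c3 c4 n_def v_def [symmetric]
      by (simp add: field_simps power2_eq_square power3_eq_cube)
  qed
  show lamv: "lam_minus d l = - 2 * T / (1 + t)^3" unfolding lam_minus_def rc eig(3) trv ..
  then show "lam_minus d l < 0" using T0 t0 by simp
  have lim: "((\<lambda>r. (c1 d l r * c4 d l r - c2 d l r * c3 d l r) / b_small d l r) \<longlongrightarrow>
      2 * (1 / (1 + t))^2 * ((l - 1) * sqrt (\<rho> - r0)) * (r0 - t / (1 + t) * (l + n) / l)) (at_left r0)"
  proof -
    have rr: "r0 < \<rho>"
    proof -
      have "(t - 1)^2 < (1 + t)^2" using t1 by (intro power_strict_mono) auto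
      then show ?thesis unfolding r0_def \<rho>_def using n t1 by (auto intro!: divide_strict_left_mono mult_pos_pos)
    qed
    have "isCont (\<lambda>r. 2 * (1 - w_minus d l r)^2 * ((l - 1) * sqrt (\<rho> - r)) * (r - w_minus d l r * (l + n) / l)) r0"
      using l0 by (intro continuous_intros continuous_c [OF l0 d]) auto
    then have "((\<lambda>r. 2 * (1 - w_minus d l r)^2 * ((l - 1) * sqrt (\<rho> - r)) * (r - w_minus d l r * (l + n) / l)) \<longlongrightarrow>
      2 * (1 / (1 + t))^2 * ((l - 1) * sqrt (\<rho> - r0)) * (r0 - t / (1 + t) * (l + n) / l)) (at_left r0)"
      unfolding isCont_def w0 s0 by (rule filterlim_mono [OF _ order_refl at_le]) simp
    moreover have "\<forall>\<^sub>F r in at_left r0. 2 * (1 - w_minus d l r)^2 * ((l - 1) * sqrt (\<rho> - r)) * (r - w_minus d l r * (l + n) / l)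
       = (c1 d l r * c4 d l r - c2 d l r * c3 d l r) / b_small d l r"
    proof -
      have "\<forall>\<^sub>F r in at_left r0. r < r0" by (simp add: eventually_at_filter)
      then show ?thesis
      proof eventually_elim
        case (elim r)
        have J: "0 \<le> J_disc d l r" unfolding Jf using elim rr by simp
        have "sqrt (J_disc d l r) = (l - 1) * sqrt (\<rho> - r) * sqrt (r0 - r)"
          unfolding Jf using n by (simp add: real_sqrt_mult)
        moreover have "b_small d l r = sqrt (r0 - r)"
          using l rc by (simp add: b_small_def r_circ_def)
        ultimately show ?case
          unfolding determinant_formula(1) [OF l0 d J] n_def [symmetric] using elim by simp
      qed
    qed
    ultimately show ?thesis by (rule Lim_transform_eventually)
  qed
  have gv: "r0 - t / (1 + t) * (l + n) / l = (t^2 - n) / (t * (1 + t)^2)"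
  proof -
    have "t / v * (t^2 + n) / t^2 = (t^2 + n) * v / (t * v^2)" "1 + (n - 1) / v^2 = t * (v^2 + n - 1) / (t * v^2)" if "v \<noteq> 0" for v
      using that t0(1) by (simp_all add: field_simps power2_eq_square)
    from this [OF t0(2)] show ?thesis unfolding r0_def t2 [symmetric]
      by (simp add: algebra_simps power2_eq_square flip: diff_divide_distrib)
  qed
  have rv: "(l - 1) * sqrt (\<rho> - r0) = 2 * sqrt (n - 1) * sqrt t"
  proof -
    have "(l - 1)^2 * (\<rho> - r0) = 4 * (n - 1) * t"
    proof -
      have l1: "(l - 1)^2 = (t - 1)^2 * (1 + t)^2"
        by (simp add: t2 [symmetric] algebra_simps power2_eq_square)
      have "(l - 1)^2 * ((n - 1) / (t - 1)^2) = (n - 1) * (t + 1)^2" using t1 unfolding l1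
        by (simp add: add.commute)
      moreover have "(l - 1)^2 * ((n - 1) / (1 + t)^2) = (n - 1) * (t - 1)^2" using t0 unfolding l1
        by simp
      moreover have "(l - 1)^2 * (\<rho> - r0) = (l - 1)^2 * ((n - 1) / (t - 1)^2) - (l - 1)^2 * ((n - 1) / (1 + t)^2)"
        by (simp add: \<rho>_def r0_def right_diff_distrib)
      ultimately show ?thesis by (simp add: algebra_simps power2_eq_square)
    qed
    then have "sqrt ((l - 1)^2 * (\<rho> - r0)) = sqrt (2^2 * ((n - 1) * t))" by simp
    then show ?thesis using n by (simp add: real_sqrt_mult)
  qed
  have "mu_plus d l = 2 * (1 / (1 + t))^2 * ((l - 1) * sqrt (\<rho> - r0)) * (r0 - t / (1 + t) * (l + n) / l) / (c1 d l r0 + c4 d l r0)"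
    by (rule mu_plus_limit [OF l0 d rc [symmetric] det tr c2n lim])
  also have "\<dots> = - 2 * sqrt (real d - 1) * sqrt t * (t^2 - real d) / (t * (1 + t) * T)"
  proof -
    have "2 * (1 / v)^2 * (2 * A * B) * (C / (t * v^2)) / (- 2 * T / v^3) = - 2 * A * B * C / (t * v * T)" if "v \<noteq> 0" for A B C v
      using that t0(1) T0 by (simp add: field_simps power2_eq_square power3_eq_cube)
    from this [OF t0(2)] show ?thesis unfolding gv rv trv unfolding n_def .
  qed
  finally show muv: "mu_plus d l = - 2 * sqrt (real d - 1) * sqrt t * (t^2 - real d) / (t * (1 + t) * T)" .
  have "0 < sqrt (real d - 1) * sqrt t * (t^2 - real d) / (t * (1 + t) * T)"
    using n t0 T0 t2 by (intro divide_pos_pos mult_pos_pos) (auto simp: n_def)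
  then show "mu_plus d l < 0" unfolding muv by simp
qed

text \<open>The two coefficients by which one divides. Their zeros are at \<open>t\<^sup>2 = d\<close> and \<open>t\<^sup>2 = - 1\<close>; the second
  is outside the half-plane.\<close>

lemma plus_Delta_coeff:
  fixes t d :: complex
  assumes "t \<noteq> 0" "1 + t \<noteq> 0"
  shows "Delta_coeff (-1) (t * (t + d) / (1 + t)) d (t^2) (1 + (d - 1) / (1 + t)^2) (t / (1 + t)) (1 / (1 + t)) (-1) p 2 0
      = (d - 1) * (d - t^2) / (t * (1 + t)^2)"
    and "Delta_coeff 1 1 d (t^2) (1 + (d - 1) / (1 + t)^2) (t / (1 + t)) (1 / (1 + t)) (-1) p 2 0
      = (d - 1) * (1 + t^2) / (t^2 * (1 + t))"
proof -
  define r w \<sigma> where "r = 1 + (d - 1) / (1 + t)^2" and "w = t / (1 + t)" and "\<sigma> = 1 / (1 + t)"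
  define v where "v = 1 + t"
  have v: "v \<noteq> 0" "t = v - 1" using assms by (auto simp: v_def)
  have q1: "(3 * w - 1 - r) + 2 * d * \<sigma> - (d * w - t^2 * (r - 1)) = (d - 1) / v"
    using v(1) unfolding r_def w_def \<sigma>_def v_def [symmetric] unfolding v(2) by (simp add: field_simps power2_eq_square)
  have "\<sigma> * (t^2 + d - 1) - (2 * (t^2 + d - 1) * w - (t^2 + d + t^2 * r - r)) - 3 * \<sigma> * t^2 = (d - 1) / v"
    using v(1) unfolding r_def w_def \<sigma>_def v_def [symmetric] unfolding v(2) by (simp add: field_simps power2_eq_square)
  then have "(\<sigma> * (t^2 + d - 1) - (2 * (t^2 + d - 1) * w - (t^2 + d + t^2 * r - r)) - 3 * \<sigma> * t^2) / t^2 = (d - 1) / v / t^2"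
    by simp
  then have q2: "\<sigma> * (t^2 + d - 1) / t^2 - (2 * (t^2 + d - 1) * w - (t^2 + d + t^2 * r - r)) / t^2 - 3 * \<sigma> = (d - 1) / (t^2 * v)"
    using assms by (simp add: diff_divide_distrib mult.commute)
  have g: "Delta_coeff x y d (t^2) r w \<sigma> (-1) p 2 0 = x * ((3 * w - 1 - r) + 2 * d * \<sigma> - (d * w - t^2 * (r - 1)))
     + y * (\<sigma> * (t^2 + d - 1) / t^2 - (2 * (t^2 + d - 1) * w - (t^2 + d + t^2 * r - r)) / t^2 - 3 * \<sigma>)" for x y
    unfolding Delta_coeff_def Let_def divide_inverse by (simp add: algebra_simps)
  have "(-1) * ((d - 1) / v) + t * (t + d) / v * ((d - 1) / (t^2 * v)) = (d - 1) * (t + d - t * v) / (t * v^2)"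
    using assms v(1) by (simp add: field_simps power2_eq_square)
  also have "t + d - t * v = d - t^2" by (simp add: v_def algebra_simps power2_eq_square)
  finally have "Delta_coeff (-1) (t * (t + d) / v) d (t^2) r w \<sigma> (-1) p 2 0 = (d - 1) * (d - t^2) / (t * v^2)"
    unfolding g q1 q2 .
  then show "Delta_coeff (-1) (t * (t + d) / (1 + t)) d (t^2) (1 + (d - 1) / (1 + t)^2) (t / (1 + t)) (1 / (1 + t)) (-1) p 2 0
      = (d - 1) * (d - t^2) / (t * (1 + t)^2)"
    unfolding r_def w_def \<sigma>_def v_def .
  have "1 * ((d - 1) / v) + 1 * ((d - 1) / (t^2 * v)) = (d - 1) * (1 + t^2) / (t^2 * v)"
    using assms v(1) by (simp add: field_simps power2_eq_square)
  then have "Delta_coeff 1 1 d (t^2) r w \<sigma> (-1) p 2 0 = (d - 1) * (1 + t^2) / (t^2 * v)"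
    unfolding g q1 q2 .
  then show "Delta_coeff 1 1 d (t^2) (1 + (d - 1) / (1 + t)^2) (t / (1 + t)) (1 / (1 + t)) (-1) p 2 0
      = (d - 1) * (1 + t^2) / (t^2 * (1 + t))"
    unfolding r_def w_def \<sigma>_def v_def .
qed

text \<open>In the half-plane the principal square roots \<open>t\<close> of \<open>\<ell>\<close> and \<open>\<surd>t\<close> are holomorphic with positive real
  part.\<close>

theorem plus_extension:
  assumes d: "2 \<le> d"
  shows "extends_holomorphically (S_infty d) {real d<..} ({z. 0 < Re z} - {of_nat d})"
proof -
  define \<Omega> where "\<Omega> = {z::complex. 0 < Re z} - {of_nat d}"
  define n :: complex where "n = of_nat d"
  define t where "t z = csqrt z" for z
  define T where "T z = z + (n + 1) * t z + 1" for z
  have t2: "t z ^ 2 = z" for z by (simp add: t_def)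
  have tR: "0 < Re (t z)" if "0 < Re z" for z
  proof -
    have "Re z = Re (t z) ^ 2 - Im (t z) ^ 2" using t2 [of z] by (metis Re_power2)
    then have "Re (t z) \<noteq> 0" using that by auto
    moreover have "0 \<le> Re (t z)" unfolding t_def using csqrt_principal [of z] by auto
    ultimately show ?thesis by linarith
  qed
  have nzs: "t z \<noteq> 0" "1 + t z \<noteq> 0" "T z \<noteq> 0" "t z ^ 2 \<noteq> n" "1 + t z ^ 2 \<noteq> 0" "csqrt (t z) \<noteq> 0" "z \<noteq> 0" if z: "z \<in> \<Omega>" for z
  proof -
    have R: "0 < Re z" "0 < Re (t z)" using z tR by (auto simp: \<Omega>_def)
    show "t z \<noteq> 0" "z \<noteq> 0" using R by auto
    then show "csqrt (t z) \<noteq> 0" by simp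
    have "0 < Re (1 + t z)" "0 < Re (1 + t z ^ 2)" using R unfolding t2 by simp_all
    then show "1 + t z \<noteq> 0" "1 + t z ^ 2 \<noteq> 0" by force+
    have "0 < Re (T z)" using R by (simp add: T_def n_def add_pos_nonneg)
    then show "T z \<noteq> 0" by force
    show "t z ^ 2 \<noteq> n" using z unfolding t2 by (simp add: \<Omega>_def n_def)
  qed
  have ht: "t holomorphic_on \<Omega>"
  proof -
    have "\<Omega> \<subseteq> - \<real>\<^sub>\<le>\<^sub>0" by (auto simp: \<Omega>_def complex_nonpos_Reals_iff)
    then show ?thesis unfolding t_def [abs_def] by (intro holomorphic_intros) (auto simp: complex_nonpos_Reals_iff)
  qed
  have hct: "(\<lambda>z. csqrt (t z)) holomorphic_on \<Omega>"
  proof (rule holomorphic_on_compose_gen [OF ht, of csqrt "{z. 0 < Re z}", unfolded o_def])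
    show "csqrt holomorphic_on {z. 0 < Re z}" by (intro holomorphic_intros) (auto simp: complex_nonpos_Reals_iff)
  qed (use tR in \<open>auto simp: \<Omega>_def\<close>)
  have n1: "n - 1 \<noteq> 0" using d by (simp add: n_def)
  have sq1: "complex_of_real (sqrt (real d - 1)) \<noteq> 0" using d by simp
  have tl: "t (of_real l) = of_real (sqrt l)" if "0 < l" for l
    using that by (simp add: t_def csqrt_of_real_nonneg)
  have ctl: "csqrt (t (of_real l)) = of_real (sqrt (sqrt l))" if "0 < l" for l
    using that by (simp add: tl csqrt_of_real_nonneg)
  have "extends_holomorphically (S_infty d) {real d<..} \<Omega>"
  proof (rule S_infty_extends [where r = "\<lambda>z. 1 + (n - 1) / (1 + t z)^2" and w = "\<lambda>z. t z / (1 + t z)" and \<sigma> = "\<lambda>z. 1 / (1 + t z)"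
        and m = "\<lambda>z. -1" and p = "\<lambda>z. t z * (t z + n) / (1 + t z)" and lam = "\<lambda>z. - 2 * T z / (1 + t z)^3"
        and mu = "\<lambda>z. - 2 * of_real (sqrt (real d - 1)) * csqrt (t z) * (t z ^ 2 - n) / (t z * (1 + t z) * T z)"])
    have "open {z::complex. 0 < Re z}" by (rule open_halfspace_Re_gt)
    then show "open \<Omega>" unfolding \<Omega>_def by (intro open_Diff) auto
    show "of_real ` {real d<..} \<subseteq> \<Omega>" by (auto simp: \<Omega>_def complex_eq_iff intro: order.strict_trans1)
    show "0 < d" using d by simp
    show "(\<lambda>z. 1 + (n - 1) / (1 + t z)^2) holomorphic_on \<Omega>" "(\<lambda>z. t z / (1 + t z)) holomorphic_on \<Omega>"
      "(\<lambda>z. 1 / (1 + t z)) holomorphic_on \<Omega>" "(\<lambda>z. -1) holomorphic_on \<Omega>" "(\<lambda>z. t z * (t z + n) / (1 + t z)) holomorphic_on \<Omega>"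
      using nzs by (auto intro!: holomorphic_intros ht)
    have hT: "T holomorphic_on \<Omega>" unfolding T_def [abs_def] by (intro holomorphic_intros ht)
    show "(\<lambda>z. - 2 * T z / (1 + t z)^3) holomorphic_on \<Omega>" using nzs by (auto intro!: holomorphic_intros ht hT)
    show "(\<lambda>z. - 2 * of_real (sqrt (real d - 1)) * csqrt (t z) * (t z ^ 2 - n) / (t z * (1 + t z) * T z)) holomorphic_on \<Omega>"
      using nzs by (intro holomorphic_on_divide holomorphic_on_mult holomorphic_on_diff holomorphic_on_power holomorphic_on_add holomorphic_on_const ht hct hT) auto
  next
    fix z assume z: "z \<in> \<Omega>"
    note nz = nzs [OF z]
    show "z \<noteq> 0" by (rule nz)
    show "- 2 * T z / (1 + t z)^3 \<noteq> 0" using nz by simp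
    show "- 2 * of_real (sqrt (real d - 1)) * csqrt (t z) * (t z ^ 2 - n) / (t z * (1 + t z) * T z) \<noteq> 0"
      using nz sq1 by simp
    show "t z * (t z + n) / (1 + t z) \<noteq> - 1"
    proof
      assume "t z * (t z + n) / (1 + t z) = - 1"
      then have "t z * (t z + n) = - (1 + t z)" using nz by (simp add: field_simps)
      moreover have "T z = t z * (t z + n) + (1 + t z)" using t2 [of z] by (simp add: T_def power2_eq_square algebra_simps)
      ultimately have "T z = 0" by (simp only: add.left_inverse)
      with nz show False by simp
    qed
    note pt = plus_Delta_coeff [OF nz(1,2), of n "t z * (t z + n) / (1 + t z)", unfolded t2]
    show "Delta_coeff (-1) (t z * (t z + n) / (1 + t z)) (of_nat d) z (1 + (n - 1) / (1 + t z)^2) (t z / (1 + t z)) (1 / (1 + t z)) (-1) (t z * (t z + n) / (1 + t z)) 2 0 \<noteq> 0"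
      unfolding n_def [symmetric] pt using nz n1 by (simp add: t2)
    show "Delta_coeff 1 (- (-1)) (of_nat d) z (1 + (n - 1) / (1 + t z)^2) (t z / (1 + t z)) (1 / (1 + t z)) (-1) (t z * (t z + n) / (1 + t z)) 2 0 \<noteq> 0"
      unfolding n_def [symmetric] minus_minus pt using nz n1 by (simp add: t2)
  next
    fix l assume "l \<in> {real d<..}"
    then have l: "real d < l" "0 < l" by (auto intro: order.strict_trans1)
    note pd = plus_data [OF d l(1)]
    have T': "T (of_real l) = of_real (sqrt l ^ 2 + (real d + 1) * sqrt l + 1)" using l by (simp add: T_def tl n_def)
    show "1 + (n - 1) / (1 + t (of_real l))^2 = of_real (r_circ d l)"
      unfolding pd(1) tl [OF l(2)] n_def by simp
    show "t (of_real l) / (1 + t (of_real l)) = of_real (w2 d l (r_circ d l))"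
      unfolding pd(2) tl [OF l(2)] n_def by simp
    show "1 / (1 + t (of_real l)) = of_real (sigma2 d l (r_circ d l))"
      unfolding pd(3) tl [OF l(2)] n_def by simp
    show "-1 = of_real (cm d l)" unfolding pd(4) by simp
    show "t (of_real l) * (t (of_real l) + n) / (1 + t (of_real l)) = of_real (cp d l)"
      unfolding pd(5) tl [OF l(2)] n_def by simp
    show "- 2 * T (of_real l) / (1 + t (of_real l))^3 = of_real (lam_minus d l)"
      unfolding pd(6) T' tl [OF l(2)] by simp
    show "- 2 * of_real (sqrt (real d - 1)) * csqrt (t (of_real l)) * (t (of_real l) ^ 2 - n) / (t (of_real l) * (1 + t (of_real l)) * T (of_real l)) = of_real (mu_plus d l)"
    proof -
      have "csqrt (of_real (sqrt l)) = of_real (sqrt (sqrt l))" using l by (simp add: csqrt_of_real_nonneg)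
      then show ?thesis unfolding pd(7) T' tl [OF l(2)] n_def by simp
    qed
    show "lam_minus d l < 0" "mu_plus d l < 0" by (rule pd)+
  qed
  then show ?thesis by (simp add: \<Omega>_def)
qed

text \<open>At \<open>r\<^sup>*\<close> the discriminant \<open>J\<close> is a perfect square, so everything is rational in \<open>\<ell>\<close> and \<open>s = \<surd>d\<close>.
  The limit \<open>\<mu>\<^sub>+\<close> is the derivative of the vanishing factor in \<open>determinant_formula\<close>.\<close>

lemma star_data:
  fixes d :: nat and l :: real
  assumes d: "2 \<le> d" and l: "0 < l" "l < real d"
  defines "s \<equiv> sqrt (real d)"
  defines "q \<equiv> l + s" and "k \<equiv> l * (s + 1) + s^3 - s^2"
  shows "r_circ d l = (s^2 + l) / q" "w2 d l (r_circ d l) = l / q" "sigma2 d l (r_circ d l) = s / q"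
    "cm d l = - 2 * s * l / k" "cp d l = l" "lam_minus d l = - s * (k + 2 * s) / q^2" "mu_plus d l = - 4 * s^2 / (k + 2 * s)"
    "lam_minus d l < 0" "mu_plus d l < 0"
proof -
  have s2: "real d = s^2" by (simp add: s_def)
  have s1: "1 < s" unfolding s_def using d by simp
  have q0: "0 < q" "q \<noteq> 0" using l s1 by (auto simp: q_def)
  have k0: "0 < k"
  proof -
    have "s^2 < s^3" using s1 by (intro power_strict_increasing) auto
    moreover have "0 < l * (s + 1)" using l s1 by simp
    ultimately show ?thesis by (simp add: k_def)
  qed
  define r0 where "r0 = (s^2 + l) / q"
  have rs: "r_star d l = r0" unfolding r_star_def s_def [symmetric] r0_def q_def s2 using s1 by simp
  have rc: "r_circ d l = r0" using l rs by (simp add: r_circ_def)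
  then show "r_circ d l = (s^2 + l) / q" by (simp add: r0_def)
  have r1: "r0 - 1 = s * (s - 1) / q" using q0 unfolding r0_def by (simp add: q_def field_simps power2_eq_square)
  define S where "S = (s - 1) * (s^2 - l) / q"
  have S0: "0 < S" using l q0 s1 by (simp add: S_def s2)
  have JS: "J_disc d l r0 = S^2"
  proof -
    have "J_disc d l r0 = ((1 - l)^2 * (s * (s - 1))^2 - 2 * (s^2 - 1) * (l + 1) * (s * (s - 1)) * q + (s^2 - 1)^2 * q^2) / q^2"
      unfolding J_disc_def r1 s2 using q0(2) by (simp add: field_simps power2_eq_square)
    also have "(1 - l)^2 * (s * (s - 1))^2 - 2 * (s^2 - 1) * (l + 1) * (s * (s - 1)) * q + (s^2 - 1)^2 * q^2 = ((s - 1) * (s^2 - l))^2"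
      unfolding q_def by algebra
    finally show ?thesis by (simp add: S_def power_divide)
  qed
  have sqJ: "sqrt (J_disc d l r0) = S" unfolding JS using S0 by simp
  have w0: "w_minus d l r0 = l / q"
  proof -
    have "(s^2 - 1 + (l - 1) * (s * (s - 1) / q) - S) = 2 * (s^2 - 1) * (l / q)"
    proof -
      have "(s^2 - 1 + (l - 1) * (s * (s - 1) / q) - S) * q = (s^2 - 1) * q + (l - 1) * (s * (s - 1)) - (s - 1) * (s^2 - l)"
      proof -
        have "(X + Y * (Z / q) - W / q) * q = X * q + Y * Z - W" for X Y Z W using q0(2) by (simp add: field_simps)
        then show ?thesis unfolding S_def .
      qed
      also have "\<dots> = 2 * (s^2 - 1) * l" unfolding q_def by algebra
      finally show ?thesis using q0(2) by (simp only: eq_divide_eq times_divide_eq_right if_False if_True simp_thms)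
    qed
    moreover have "s^2 - 1 \<noteq> 0" using s1 by (simp add: power2_eq_1_iff)
    ultimately show ?thesis unfolding w_minus_def sqJ r1 s2 by simp
  qed
  then show "w2 d l (r_circ d l) = l / q" by (simp add: rc w2_def)
  have sg: "1 - l / q = s / q" using q0 by (simp add: q_def field_simps)
  then show "sigma2 d l (r_circ d l) = s / q" by (simp add: rc sigma2_def w0)
  have J0: "0 \<le> J_disc d l r0" by (simp add: JS)
  note df = determinant_formula [OF l(1) d J0, unfolded w0 sg sqJ s2]
  have g0: "r0 - l / q * (l + s^2) / l = 0" using l by (simp add: r0_def)
  have det: "c1 d l r0 * c4 d l r0 = c2 d l r0 * c3 d l r0" using df(1) unfolding g0 by simp
  have c4: "c4 d l r0 = - 2 * s^2 / q^2" using df(2) by (simp add: power_divide)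
  have c3: "c3 d l r0 = - 2 * l * s^2 / q^2"
  proof -
    have "c3 d l r0 = - 2 * (s^2 * (l / q) - l * (s * (s - 1) / q)) * (s / q)"
      using c_values(3) [OF l(1), of d r0] d unfolding w0 sg r1 s2 by simp
    also have "\<dots> = - 2 * l * s^2 / q^2" using q0(2) by (simp add: field_simps power2_eq_square)
    finally show ?thesis .
  qed
  have kk: "- 2 * l * s^2 / q^2 - s / q * S = - s * k / q^2"
  proof -
    have "- 2 * l * s^2 / q^2 - s / q * S = (- 2 * l * s^2 - s * ((s - 1) * (s^2 - l))) / q^2"
      using q0(2) by (simp add: S_def power2_eq_square diff_divide_distrib)
    also have "- 2 * l * s^2 - s * ((s - 1) * (s^2 - l)) = - s * k" unfolding k_def by algebra
    finally show ?thesis .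
  qed
  have c1: "c1 d l r0 = - s * k / q^2" using df(3) kk unfolding c3 by simp
  have c2: "c2 d l r0 = - s * k / (l * q^2)"
  proof -
    have "c2 d l r0 = (l * c2 d l r0) / l" using l by simp
    also have "l * c2 d l r0 = - s * k / q^2" using df(4) kk unfolding c4 by (simp add: mult_ac)
    finally show ?thesis by (simp add: mult.commute)
  qed
  have trv: "c1 d l r0 + c4 d l r0 = - s * (k + 2 * s) / q^2"
    unfolding c1 c4 by (simp add: add_divide_distrib [symmetric] algebra_simps power2_eq_square)
  have ks: "0 < k + 2 * s" using k0 s1 by simp
  have tr: "c1 d l r0 + c4 d l r0 < 0" unfolding trv using ks q0 s1 by (simp add: mult_neg_pos divide_neg_pos)
  have c2n: "c2 d l r0 < 0" unfolding c2 using k0 q0 s1 l by (simp add: divide_neg_pos)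
  note eig = eigen_data [OF det tr c2n]
  show "cm d l = - 2 * s * l / k" unfolding cm_def rc eig(2) c2 c4 using k0 q0 s1 l by (simp add: field_simps power2_eq_square)
  show "cp d l = l" unfolding cp_def rc eig(1) c1 c2 using k0 q0 s1 l by (simp add: field_simps power2_eq_square)
  show lamv: "lam_minus d l = - s * (k + 2 * s) / q^2" unfolding lam_minus_def rc eig(3) trv ..
  then show "lam_minus d l < 0" using tr trv by simp
  define J' where "J' = 2 * (1 - l)^2 * (r0 - 1) - 2 * (s^2 - 1) * (l + 1)"
  define w' where "w' = 1 / (2 * (s^2 - 1)) * ((l - 1) - inverse S / 2 * J')"
  define g where "g r = r - w_minus d l r * (l + s^2) / l" for r
  have "(J_disc d l has_real_derivative J') (at r0)"
    unfolding J_disc_def [abs_def] J'_def s2 by (auto intro!: derivative_eq_intros)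
  then have "((\<lambda>r. sqrt (J_disc d l r)) has_real_derivative inverse (sqrt (J_disc d l r0)) / 2 * J') (at r0)"
    using S0 by (intro DERIV_chain2 [OF DERIV_real_sqrt]) (simp_all add: JS)
  then have dS: "((\<lambda>r. sqrt (J_disc d l r)) has_real_derivative inverse S / 2 * J') (at r0)" unfolding sqJ .
  have dw: "(w_minus d l has_real_derivative w') (at r0)"
  proof -
    have "((\<lambda>r. s^2 - 1 + (l - 1) * (r - 1)) has_real_derivative l - 1) (at r0)" by (auto intro!: derivative_eq_intros)
    from DERIV_cmult [OF DERIV_diff [OF this dS], of "1 / (2 * (s^2 - 1))"]
    show ?thesis unfolding w_minus_def [abs_def] w'_def s2 .
  qed
  have dg: "(g has_real_derivative 1 - w' * (l + s^2) / l) (at r0)"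
    unfolding g_def [abs_def] using l by (auto intro!: derivative_eq_intros dw)
  have gr0: "g r0 = 0" unfolding g_def w0 by (rule g0)
  have "((\<lambda>r. (g r - g r0) / (r - r0)) \<longlongrightarrow> 1 - w' * (l + s^2) / l) (at r0)"
    using dg by (simp add: has_field_derivative_iff)
  then have "((\<lambda>r. (g r - g r0) / (r - r0)) \<longlongrightarrow> 1 - w' * (l + s^2) / l) (at_left r0)"
    by (rule filterlim_mono [OF _ order_refl at_le]) simp
  from tendsto_minus [OF this] have lg: "((\<lambda>r. g r / (r0 - r)) \<longlongrightarrow> - (1 - w' * (l + s^2) / l)) (at_left r0)"
    unfolding gr0 by (simp add: minus_divide_right)
  have Jc: "isCont (J_disc d l) r0" unfolding J_disc_def [abs_def] by (intro continuous_intros)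
  have "isCont (\<lambda>r. 2 * (1 - w_minus d l r)^2 * sqrt (J_disc d l r)) r0"
    by (intro continuous_intros continuous_c [OF l(1) d] Jc)
  then have "((\<lambda>r. 2 * (1 - w_minus d l r)^2 * sqrt (J_disc d l r)) \<longlongrightarrow> 2 * (s / q)^2 * S) (at_left r0)"
    unfolding isCont_def w0 sg sqJ by (rule filterlim_mono [OF _ order_refl at_le]) simp
  from tendsto_mult [OF this lg] have l1: "((\<lambda>r. 2 * (1 - w_minus d l r)^2 * sqrt (J_disc d l r) * (g r / (r0 - r))) \<longlongrightarrow>
      2 * (s / q)^2 * S * - (1 - w' * (l + s^2) / l)) (at_left r0)" .
  have "(J_disc d l \<longlongrightarrow> J_disc d l r0) (at_left r0)"
    using Jc unfolding isCont_def by (rule filterlim_mono [OF _ order_refl at_le]) simp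
  then have eJ: "\<forall>\<^sub>F r in at_left r0. 0 < J_disc d l r" by (rule order_tendstoD(1)) (use S0 in \<open>simp add: JS\<close>)
  have "\<forall>\<^sub>F r in at_left r0. 2 * (1 - w_minus d l r)^2 * sqrt (J_disc d l r) * (g r / (r0 - r)) =
      (c1 d l r * c4 d l r - c2 d l r * c3 d l r) / b_small d l r"
    using eJ
  proof eventually_elim
    case (elim r)
    have b: "b_small d l r = r0 - r" using l rs by (simp add: b_small_def)
    show ?case unfolding b determinant_formula(1) [OF l(1) d less_imp_le [OF elim]] g_def s2 by simp
  qed
  with l1 have lim: "((\<lambda>r. (c1 d l r * c4 d l r - c2 d l r * c3 d l r) / b_small d l r) \<longlongrightarrow>
      2 * (s / q)^2 * S * - (1 - w' * (l + s^2) / l)) (at_left r0)"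
    by (rule Lim_transform_eventually)
  have Sw: "S * w' = l * (s + 1) / q"
  proof -
    have "S * w' = 1 / (2 * (s^2 - 1)) * ((l - 1) * S - J' / 2)"
    proof -
      have "S * (1 / x * (y - inverse S / 2 * z)) = 1 / x * (y * S - z / 2)" for x y z
        using S0 by (simp add: right_diff_distrib mult_ac)
      then show ?thesis unfolding w'_def .
    qed
    also have "(l - 1) * S - J' / 2 = 2 * (s^2 - 1) * (l * (s + 1) / q)"
    proof -
      have "((l - 1) * S - J' / 2) * q = (l - 1) * ((s - 1) * (s^2 - l)) - ((1 - l)^2 * (s * (s - 1)) - (s^2 - 1) * (l + 1) * q)"
      proof -
        have "(x * (u / q) - (2 * y * (v / q) - 2 * z * u') / 2) * q = x * u - (y * v - z * u' * q)" for x y z u v u'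
          using q0(2) by (simp add: left_diff_distrib diff_divide_distrib)
        then show ?thesis unfolding S_def J'_def r1 .
      qed
      also have "\<dots> = 2 * (s^2 - 1) * (l * (s + 1))" unfolding q_def by algebra
      finally show ?thesis using q0(2) by (simp only: eq_divide_eq times_divide_eq_right if_False if_True simp_thms)
    qed
    also have "1 / (2 * (s^2 - 1)) * (2 * (s^2 - 1) * (l * (s + 1) / q)) = l * (s + 1) / q"
      using s1 by (simp add: power2_eq_1_iff)
    finally show ?thesis .
  qed
  have del: "2 * (s / q)^2 * S * - (1 - w' * (l + s^2) / l) = 4 * s^3 / q^2"
  proof -
    have "S * - (1 - w' * (l + s^2) / l) = (S * w') * (l + s^2) / l - S" by (simp add: algebra_simps)
    also have "\<dots> = ((s + 1) * (l + s^2) - (s - 1) * (s^2 - l)) / q"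
      unfolding Sw unfolding S_def using l by (simp add: diff_divide_distrib)
    also have "(s + 1) * (l + s^2) - (s - 1) * (s^2 - l) = 2 * s * q" unfolding q_def by algebra
    finally have "S * - (1 - w' * (l + s^2) / l) = 2 * s" using q0(2) by simp
    then have "2 * (s / q)^2 * (S * - (1 - w' * (l + s^2) / l)) = 2 * (s / q)^2 * (2 * s)" by simp
    then show ?thesis by (simp add: power_divide power2_eq_square power3_eq_cube mult_ac)
  qed
  have "mu_plus d l = 4 * s^3 / q^2 / (c1 d l r0 + c4 d l r0)"
    by (rule mu_plus_limit [OF l(1) d rc [symmetric] det tr c2n lim [unfolded del]])
  also have "\<dots> = - 4 * s^2 / (k + 2 * s)"
  proof -
    have "4 * s^3 / q^2 / (- s * K / q^2) = - 4 * s^2 / K" if "K \<noteq> 0" for K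
      using that q0(2) s1 by (simp add: field_simps power2_eq_square power3_eq_cube)
    from this [of "k + 2 * s"] ks show ?thesis unfolding trv by simp
  qed
  finally show muv: "mu_plus d l = - 4 * s^2 / (k + 2 * s)" .
  have "0 < s^2 / (k + 2 * s)" using ks s1 by simp
  then show "mu_plus d l < 0" unfolding muv by simp
qed

text \<open>The nontrivial factor of the numerator of the coefficient \<open>e\<^sub>2\<^sub>0\<close>, see \<open>star_Delta_coeff\<close>.\<close>

definition star_e :: "'a::field \<Rightarrow> 'a \<Rightarrow> 'a" where
  "star_e s l = (let k = l * (s + 1) + s^3 - s^2 in
     8 * s^3 * l * (l + s^2 - 1) + 4 * s * l * k * (l - s - s^2) - 2 * s * k^2 + 4 * s^3 * k^2 - k^3)"

lemma star_e_of_real: "star_e (of_real s) (of_real l) = (of_real (star_e s l) :: complex)"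
  unfolding star_e_def Let_def by simp

lemma star_Delta_coeff:
  fixes s l :: complex
  defines "q \<equiv> l + s" and "k \<equiv> l * (s + 1) + s^3 - s^2"
  assumes "q \<noteq> 0" "k \<noteq> 0" "l \<noteq> 0"
  shows "Delta_coeff (-1) l (s^2) l ((s^2 + l) / q) (l / q) (s / q) (- 2 * s * l / k) p 2 0
      = 4 * s^2 * l * (s - 1) * (l - s^2) * (l + s^2) / (k^2 * q)"
    and "Delta_coeff 1 (- (- 2 * s * l / k)) (s^2) l ((s^2 + l) / q) (l / q) (s / q) (- 2 * s * l / k) p 2 0
      = s * l * star_e s l / (k^3 * q)"
proof -
  define r w \<sigma> where "r = (s^2 + l) / q" and "w = l / q" and "\<sigma> = s / q"
  define h where "h = inverse k"
  have hk: "h * k = 1" using assms by (simp add: h_def)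
  have a1: "q * (3 * w - 1 - r) = l - s - s^2"
  proof -
    have "q * (3 * w - 1 - r) = 3 * l - q - (s^2 + l)"
      using assms(3) unfolding r_def w_def by (simp add: field_simps)
    then show ?thesis by (simp add: q_def)
  qed
  have a2: "q * \<sigma> = s" using assms by (simp add: \<sigma>_def)
  have a3: "q * (2 * (l + s^2 - 1) * w - (l + s^2 + l * r - r)) = - k"
  proof -
    have "q * (2 * (l + s^2 - 1) * w - (l + s^2 + l * r - r)) = 2 * (l + s^2 - 1) * l - ((l + s^2) * q + (l - 1) * (s^2 + l))"
      using assms(3) unfolding r_def w_def by (simp add: field_simps)
    also have "\<dots> = - k" unfolding q_def k_def by algebra
    finally show ?thesis .
  qed
  have a4: "q * (s^2 * w - l * (r - 1)) = l * s"
  proof -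
    have "q * (s^2 * w - l * (r - 1)) = s^2 * l - l * (s^2 + l - q)"
      using assms(3) unfolding r_def w_def by (simp add: field_simps)
    then show ?thesis by (simp add: q_def algebra_simps)
  qed
  have m: "- 2 * s * l / k = - 2 * s * l * h" by (simp add: h_def divide_inverse)
  have g: "q * Delta_coeff x (l * y) (s^2) l r w \<sigma> (- 2 * s * l * h) p 2 0 =
      (x * (l - s - s^2) + y * (s * (l + s^2 - 1))) * (4 * s^2 * l^2 * h^2)
      + (- 2 * x * s^3 - y * k) * (- 2 * s * l * h) - x * (l * s) - 3 * l * y * s" for x y
  proof -
    have "q * Delta_coeff x (l * y) (s^2) l r w \<sigma> (- 2 * s * l * h) p 2 0 =
      (x * (q * (3 * w - 1 - r)) + y * ((q * \<sigma>) * (l + s^2 - 1))) * (4 * s^2 * l^2 * h^2)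
      + (- 2 * x * s^2 * (q * \<sigma>) + y * (q * (2 * (l + s^2 - 1) * w - (l + s^2 + l * r - r)))) * (- 2 * s * l * h)
      - x * (q * (s^2 * w - l * (r - 1))) - 3 * l * y * (q * \<sigma>)"
    proof -
      have "l * y * (Z / l) = y * Z" for Z using assms(5) by simp
      then have Delta_coeff: "Delta_coeff x (l * y) (s^2) l r w \<sigma> (- 2 * s * l * h) p 2 0 =
        (x * (3 * w - 1 - r) + y * (\<sigma> * (l + s^2 - 1))) * (- 2 * s * l * h)^2
        + (x * (- 2 * s^2 * \<sigma>) + y * (2 * (l + s^2 - 1) * w - (l + s^2 + l * r - r))) * (- 2 * s * l * h)
        + (- x * (s^2 * w - l * (r - 1)) - l * y * 3 * \<sigma>)"
        unfolding Delta_coeff_def Let_def by simp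
      show ?thesis unfolding Delta_coeff by (simp add: algebra_simps power2_eq_square)
    qed
    also have "\<dots> = (x * (l - s - s^2) + y * (s * (l + s^2 - 1))) * (4 * s^2 * l^2 * h^2)
      + (- 2 * x * s^3 - y * k) * (- 2 * s * l * h) - x * (l * s) - 3 * l * y * s"
      unfolding a1 a2 a3 a4 by (simp add: algebra_simps power2_eq_square power3_eq_cube)
    finally show ?thesis .
  qed
  have "q * Delta_coeff (-1) l (s^2) l r w \<sigma> (- 2 * s * l * h) p 2 0 * k^2 = 4 * s^2 * l * (s - 1) * (l - s^2) * (l + s^2)"
  proof -
    have "q * Delta_coeff (-1) (l * 1) (s^2) l r w \<sigma> (- 2 * s * l * h) p 2 0 * k^2 =
       (- (l - s - s^2) + s * (l + s^2 - 1)) * (4 * s^2 * l^2 * (h * k)^2) + (2 * s^3 - k) * (- 2 * s * l * k * (h * k)) + l * s * k^2 - 3 * l * s * k^2"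
      unfolding g by (simp add: algebra_simps power2_eq_square)
    also have "\<dots> = 4 * s^2 * l * (s - 1) * (l - s^2) * (l + s^2)"
      unfolding hk power_one mult_1_right unfolding k_def by algebra
    finally show ?thesis by simp
  qed
  then show "Delta_coeff (-1) l (s^2) l ((s^2 + l) / q) (l / q) (s / q) (- 2 * s * l / k) p 2 0
      = 4 * s^2 * l * (s - 1) * (l - s^2) * (l + s^2) / (k^2 * q)"
    unfolding m r_def [symmetric] w_def [symmetric] \<sigma>_def [symmetric] using assms(3,4) by (simp add: eq_divide_eq mult_ac)
  have "q * Delta_coeff 1 (l * (2 * s * h)) (s^2) l r w \<sigma> (- 2 * s * l * h) p 2 0 * k^3 = s * l * star_e s l"
  proof -
    have "q * Delta_coeff 1 (l * (2 * s * h)) (s^2) l r w \<sigma> (- 2 * s * l * h) p 2 0 * k^3 =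
       (l - s - s^2) * (4 * s^2 * l^2 * k * (h * k)^2) + 2 * s * (s * (l + s^2 - 1)) * (4 * s^2 * l^2 * (h * k)^3)
       + (2 * s^3 * k^2 * (h * k) + 2 * s * k^2 * (h * k)^2) * (2 * s * l) - l * s * k^3 - 6 * l * s^2 * k^2 * (h * k)"
      unfolding g by (simp add: algebra_simps power2_eq_square power3_eq_cube)
    also have "\<dots> = s * l * star_e s l"
      unfolding hk star_e_def k_def [symmetric] Let_def by (simp add: algebra_simps power2_eq_square power3_eq_cube)
    finally show ?thesis .
  qed
  then show "Delta_coeff 1 (- (- 2 * s * l / k)) (s^2) l ((s^2 + l) / q) (l / q) (s / q) (- 2 * s * l / k) p 2 0
      = s * l * star_e s l / (k^3 * q)"
    unfolding m r_def [symmetric] w_def [symmetric] \<sigma>_def [symmetric] using assms(3,4) by (simp add: eq_divide_eq mult_ac)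
qed

text \<open>The term of third degree in \<open>k\<close> is absorbed by means of \<open>k < 2 s\<close>; what remains is a positive
  definite quadratic form.\<close>

lemma star_e_pos:
  fixes s l :: real
  assumes s: "2 \<le> s^2" "0 < s" and l: "0 < l" "l < s^2"
  shows "0 < star_e s l"
proof -
  \<comment> \<open>The scaling \<open>l = s\<^sup>2 u\<close> makes the positivity that of a quadratic form in \<open>k\<close>.\<close>
  define u where "u = l / s^2"
  have u: "0 < u" "u < 1" "l = s^2 * u" using s l by (auto simp: u_def)
  define k where "k = u * (s + 1) + s - 1"
  define b where "b = s + s^2 - s^2 * u"
  define c where "c = s^2 * u + s^2 - 1"
  have s1: "1 < s" using s by (smt (verit) one_power2 power_mono)
  have ss: "s \<le> s^2" using s1 by (simp add: power2_eq_square)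
  have k0: "0 < k"
  proof -
    have "0 < u * (s + 1)" using u s1 by simp
    then show ?thesis using s1 by (simp add: k_def)
  qed
  have k2: "k < 2 * s"
  proof -
    have "u * (s + 1) < 1 * (s + 1)" using u s1 by (intro mult_strict_right_mono) auto
    then show ?thesis by (simp add: k_def)
  qed
  have e: "star_e s l = s^5 * (8 * u * c - 4 * u * k * b - 2 * k^2 + 4 * s^2 * k^2 - s * k^3)"
    unfolding star_e_def u(3) k_def b_def c_def Let_def by algebra
  have k3: "s * k^3 \<le> 2 * s^2 * k^2"
  proof -
    have "s * k^3 = s * k^2 * k" by (simp add: power2_eq_square power3_eq_cube)
    also have "\<dots> \<le> s * k^2 * (2 * s)" using k2 k0 s by (intro mult_left_mono) auto
    finally show ?thesis by (simp add: power2_eq_square mult_ac)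
  qed
  have b0: "0 \<le> b" "b \<le> s^2 * (2 - u)"
  proof -
    have "s^2 * u \<le> s^2 * 1" using u by (intro mult_left_mono) auto
    then show "0 \<le> b" using s unfolding b_def by linarith
    show "b \<le> s^2 * (2 - u)" using ss by (simp add: b_def algebra_simps)
  qed
  \<comment> \<open>This says that the discriminant of that quadratic form is negative.\<close>
  have key: "u * b^2 < 4 * c * (s^2 - 1)"
  proof -
    have "u * b^2 \<le> u * (s^2 * (2 - u))^2" using b0 u by (intro mult_left_mono power_mono) auto
    also have "\<dots> = s^4 * (u * (2 - u)^2)" by (simp add: power_mult_distrib power2_eq_square power4_eq_xxxx)
    also have "\<dots> < s^4 * (2 * u + 1)"
    proof (intro mult_strict_left_mono)
      have "u^3 \<le> u^2" using u by (intro power_decreasing) auto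
      moreover have "0 \<le> (1 - 2 * u)^2" by simp
      moreover have "u^2 < 1" using u by (simp add: power_less_one_iff)
      moreover have "2 * u + 1 - u * (2 - u)^2 = (1 - u)^2 + 3 * u^2 - u^3"
        by (simp add: algebra_simps power2_eq_square power3_eq_cube)
      moreover have "0 < (1 - u)^2" using u by simp
      ultimately show "u * (2 - u)^2 < 2 * u + 1" by (smt (verit) zero_le_power2)
    qed (use s in auto)
    also have "\<dots> = 4 * (s^2 * u + s^2 / 2) * (s^2 / 2)" by (simp add: algebra_simps power2_eq_square power4_eq_xxxx)
    also have "\<dots> \<le> 4 * c * (s^2 - 1)"
    proof -
      have "0 \<le> s^2 * u" using u by simp
      with s show ?thesis unfolding c_def by (intro mult_mono mult_nonneg_nonneg) auto
    qed
    finally show ?thesis .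
  qed
  have s21: "0 < s^2 - 1" using s by simp
  have "0 < 2 * ((s^2 - 1) * k - u * b)^2 + 2 * u * (4 * c * (s^2 - 1) - u * b^2)"
    using key u by (intro add_nonneg_pos) auto
  also have "\<dots> = (s^2 - 1) * (2 * (s^2 - 1) * k^2 - 4 * u * k * b + 8 * u * c)"
    by (simp add: algebra_simps power2_eq_square)
  finally have "0 < 2 * (s^2 - 1) * k^2 - 4 * u * k * b + 8 * u * c" using s21 by (simp add: zero_less_mult_iff)
  also have "\<dots> \<le> 8 * u * c - 4 * u * k * b - 2 * k^2 + 4 * s^2 * k^2 - s * k^3"
    using k3 by (simp add: algebra_simps)
  finally show ?thesis unfolding e using s by simp
qed

text \<open>On \<open>(0, d)\<close> none of the denominators vanishes, so the explicit formulas hold in a neighbourhood; the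
  half-plane without the zeros of \<open>star_e\<close> and the point \<open>d\<close> is such a neighbourhood.\<close>

theorem star_extension:
  assumes d: "2 \<le> d"
  obtains \<Omega> where "of_real ` {0<..<real d} \<subseteq> \<Omega>" "extends_holomorphically (S_infty d) {0<..<real d} \<Omega>"
proof -
  define s where "s = complex_of_real (sqrt (real d))"
  define k where "k z = z * (s + 1) + s^3 - s^2" for z
  define \<Omega> where "\<Omega> = {z. 0 < Re z} \<inter> {z. z \<noteq> s^2} \<inter> {z. star_e s z \<noteq> 0}"
  have s2: "s^2 = of_nat d"
  proof -
    have "complex_of_real ((sqrt (real d))^2) = complex_of_real (real d)"
      by (rule arg_cong [of "(sqrt (real d))^2" "real d" complex_of_real]) simp
    then show ?thesis by (metis of_real_power of_real_of_nat_eq s_def)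
  qed
  have s1: "1 < sqrt (real d)" using d by simp
  have sr: "s + 1 = of_real (sqrt (real d) + 1)" "s^3 - s^2 = of_real (sqrt (real d)^3 - sqrt (real d)^2)"
    using s2 by (simp_all add: s_def)
  have s32: "0 < sqrt (real d)^3 - sqrt (real d)^2" using s1 power_strict_increasing [of 2 3 "sqrt (real d)"] by simp
  have kr: "k z = z * of_real (sqrt (real d) + 1) + of_real (sqrt (real d)^3 - sqrt (real d)^2)" for z
    unfolding k_def sr [symmetric] by simp
  have op: "open \<Omega>"
  proof -
    have "open {z. star_e s z \<noteq> 0}" unfolding star_e_def Let_def by (intro open_Collect_neq continuous_intros)
    moreover have "open {z. z \<noteq> s^2}" by (intro open_Collect_neq continuous_intros)
    moreover have "open {z::complex. 0 < Re z}" by (rule open_halfspace_Re_gt)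
    ultimately show ?thesis unfolding \<Omega>_def by (intro open_Int)
  qed
  have nz: "z \<noteq> 0" "z + s \<noteq> 0" "k z \<noteq> 0" "k z + 2 * s \<noteq> 0" "z \<noteq> s^2" "z + s^2 \<noteq> 0" "star_e s z \<noteq> 0" if z: "z \<in> \<Omega>" for z
  proof -
    have R: "0 < Re z" using z by (simp add: \<Omega>_def)
    have "0 < Re z + sqrt (real d)" using R s1 by linarith
    then have "0 < Re (z + s)" by (simp add: s_def)
    moreover have "0 < Re (z + s^2)" using R by (simp add: s2)
    ultimately have "0 < Re (z + s)" "0 < Re (z + s^2)" .
    then show "z + s \<noteq> 0" "z + s^2 \<noteq> 0" by force+
    have "0 < Re (k z)" unfolding kr using R s1 s32 by (simp add: add_pos_pos del: of_real_add of_real_diff)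
    moreover have "0 < Re (k z + 2 * s)"
    proof -
      have "0 < Re (k z) + 2 * sqrt (real d)" using \<open>0 < Re (k z)\<close> s1 by linarith
      then show ?thesis by (simp add: s_def)
    qed
    ultimately show "k z \<noteq> 0" "k z + 2 * s \<noteq> 0" by force+
    show "z \<noteq> 0" using R by auto
    show "z \<noteq> s^2" "star_e s z \<noteq> 0" using z by (simp_all add: \<Omega>_def)
  qed
  have s0: "s \<noteq> 0" "s - 1 \<noteq> 0" using s1 by (auto simp: s_def)
  have sub: "of_real ` {0<..<real d} \<subseteq> \<Omega>"
  proof
    fix z :: complex assume "z \<in> of_real ` {0<..<real d}"
    then obtain l where l: "z = of_real l" "0 < l" "l < real d" by auto
    have "star_e s z = of_real (star_e (sqrt (real d)) l)" unfolding l(1) s_def by (rule star_e_of_real)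
    moreover have "0 < star_e (sqrt (real d)) l" using l d by (intro star_e_pos) auto
    moreover have "z \<noteq> s^2"
    proof
      assume "z = s^2"
      then have "complex_of_real l = of_real (real d)" by (simp add: s2 l)
      then show False using l unfolding of_real_eq_iff by simp
    qed
    ultimately show "z \<in> \<Omega>" using l by (simp add: \<Omega>_def)
  qed
  have k_hol: "k holomorphic_on \<Omega>" unfolding k_def [abs_def] by (intro holomorphic_intros)
  have "extends_holomorphically (S_infty d) {0<..<real d} \<Omega>"
  proof (rule S_infty_extends [where r = "\<lambda>z. (s^2 + z) / (z + s)" and w = "\<lambda>z. z / (z + s)" and \<sigma> = "\<lambda>z. s / (z + s)"
        and m = "\<lambda>z. - 2 * s * z / k z" and p = "\<lambda>z. z" and lam = "\<lambda>z. - s * (k z + 2 * s) / (z + s)^2"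
        and mu = "\<lambda>z. - 4 * s^2 / (k z + 2 * s)"])
    show "open \<Omega>" "of_real ` {0<..<real d} \<subseteq> \<Omega>" by (rule op sub)+
    show "0 < d" using d by simp
    show "(\<lambda>z. (s^2 + z) / (z + s)) holomorphic_on \<Omega>" "(\<lambda>z. z / (z + s)) holomorphic_on \<Omega>" "(\<lambda>z. s / (z + s)) holomorphic_on \<Omega>"
      "(\<lambda>z. - 2 * s * z / k z) holomorphic_on \<Omega>" "(\<lambda>z. z) holomorphic_on \<Omega>" "(\<lambda>z. - s * (k z + 2 * s) / (z + s)^2) holomorphic_on \<Omega>"
      "(\<lambda>z. - 4 * s^2 / (k z + 2 * s)) holomorphic_on \<Omega>"
      using nz by (auto intro!: holomorphic_intros k_hol)
  next
    fix z assume "z \<in> \<Omega>"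
    note n = nz [OF this]
    show "z \<noteq> 0" "- s * (k z + 2 * s) / (z + s)^2 \<noteq> 0" "- 4 * s^2 / (k z + 2 * s) \<noteq> 0" using n s0 by simp_all
    show "z \<noteq> - 2 * s * z / k z"
    proof
      assume "z = - 2 * s * z / k z"
      from arg_cong [OF this, of "\<lambda>x. x * k z"] n have "z * k z = - 2 * s * z" by simp
      then have "z * (k z + 2 * s) = 0" by (simp add: algebra_simps)
      with n show False by simp
    qed
    note st = star_Delta_coeff [of z s z, folded k_def, OF n(2,3,1)]
    show "Delta_coeff (-1) z (of_nat d) z ((s^2 + z) / (z + s)) (z / (z + s)) (s / (z + s)) (- 2 * s * z / k z) z 2 0 \<noteq> 0"
      unfolding s2 [symmetric] st(1) using n s0 by simp
    show "Delta_coeff 1 (- (- 2 * s * z / k z)) (of_nat d) z ((s^2 + z) / (z + s)) (z / (z + s)) (s / (z + s)) (- 2 * s * z / k z) z 2 0 \<noteq> 0"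
      unfolding s2 [symmetric] st(2) using n s0 by simp
  next
    fix l assume "l \<in> {0<..<real d}"
    then have l: "0 < l" "l < real d" by auto
    note sd = star_data [OF d l]
    have sq: "complex_of_real (sqrt (real d)) ^ 2 = of_nat d" using s2 by (simp add: s_def)
    have kl: "k (of_real l) = of_real (l * (sqrt (real d) + 1) + sqrt (real d)^3 - sqrt (real d)^2)" by (simp add: k_def s_def sq)
    show "(s^2 + of_real l) / (of_real l + s) = of_real (r_circ d l)" unfolding sd(1) by (simp add: s_def sq)
    show "of_real l / (of_real l + s) = of_real (w2 d l (r_circ d l))" unfolding sd(2) by (simp add: s_def sq)
    show "s / (of_real l + s) = of_real (sigma2 d l (r_circ d l))" unfolding sd(3) by (simp add: s_def sq)
    show "- 2 * s * of_real l / k (of_real l) = of_real (cm d l)" unfolding sd(4) kl by (simp add: s_def sq)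
    show "of_real l = complex_of_real (cp d l)" unfolding sd(5) ..
    show "- s * (k (of_real l) + 2 * s) / (of_real l + s)^2 = of_real (lam_minus d l)" unfolding sd(6) kl by (simp add: s_def sq)
    show "- 4 * s^2 / (k (of_real l) + 2 * s) = of_real (mu_plus d l)" unfolding sd(7) kl by (simp add: s_def sq)
    show "lam_minus d l < 0" "mu_plus d l < 0" by (rule sd)+
  qed
  with sub show ?thesis by (rule that)
qed

lemma extends_holomorphically_subset:
  "extends_holomorphically f A \<Omega> \<Longrightarrow> B \<subseteq> A \<Longrightarrow> extends_holomorphically f B \<Omega>"
  unfolding extends_holomorphically_def by blast

theorem lemma1p4:
  fixes d :: nat
  assumes "d \<ge> 2"
  shows
    "(d \<ge> 4 \<longrightarrow>
        (\<exists>\<Omega>. extends_holomorphically (S_infty d) (O_star d) \<Omega>))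
     \<and> (d \<ge> 4 \<longrightarrow>
        (\<exists>\<Omega>. extends_holomorphically (S_infty d) {real d<..} \<Omega>))
     \<and> (d = 2 \<or> d = 3 \<longrightarrow>
        (\<exists>\<Omega>. of_real ` {0<..<real d} \<subseteq> \<Omega> \<and>
             extends_holomorphically (S_infty d) (O_star d) \<Omega>))
     \<and> (d = 2 \<or> d = 3 \<longrightarrow>
        (\<exists>\<Omega>. of_real ` ({0<..} - {real d}) \<subseteq> \<Omega> \<and>
             extends_holomorphically (S_infty d) {real d<..} \<Omega> \<and>
             (\<exists>C \<in> components \<Omega>. of_real ` {0<..<real d} \<subseteq> C \<and> of_real ` {real d<..} \<subseteq> C)))"
proof -
  obtain \<Omega>1 where \<Omega>1: "of_real ` {0<..<real d} \<subseteq> \<Omega>1" "extends_holomorphically (S_infty d) {0<..<real d} \<Omega>1"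
    using star_extension [OF assms] by metis
  have star: "extends_holomorphically (S_infty d) (O_star d) \<Omega>1"
    by (rule extends_holomorphically_subset [OF \<Omega>1(2)]) (auto simp: O_star_def)
  define \<Omega>2 where "\<Omega>2 = {z::complex. 0 < Re z} - {of_nat d}"
  have plus: "extends_holomorphically (S_infty d) {real d<..} \<Omega>2"
    unfolding \<Omega>2_def by (rule plus_extension [OF assms])
  have sub: "of_real ` ({0<..} - {real d}) \<subseteq> \<Omega>2" by (auto simp: \<Omega>2_def complex_eq_iff)
  have "connected \<Omega>2"
    unfolding \<Omega>2_def by (rule connected_open_delete) (auto simp: open_halfspace_Re_gt convex_halfspace_Re_gt convex_connected)
  moreover have "of_real 1 \<in> \<Omega>2" using assms by (auto simp: \<Omega>2_def complex_eq_iff)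
  ultimately have "components \<Omega>2 = {\<Omega>2}" by (subst components_eq_sing_iff) auto
  then have "\<Omega>2 \<in> components \<Omega>2" by simp
  moreover have "of_real ` {0<..<real d} \<subseteq> \<Omega>2" using sub by (force intro: order_trans [OF _ sub])
  moreover have "of_real ` {real d<..} \<subseteq> \<Omega>2" using plus by (simp add: extends_holomorphically_def)
  ultimately show ?thesis using \<Omega>1 star plus sub by blast
qed

end
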